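(* Let $0<p<q_0\le1$, let $E$ be a $p$-Banach space, let $M$ be a pointed $q_0$-metric space, and let $T\colon E\to\mathcal F_p(M)$ be bounded and linear. Then exactly one of the following alternatives holds: (i) $T$ is compact; (ii) $T$ fixes a copy of $\ell_p$.
   Context: All vector spaces are real. For $0<s\le 1$, an $s$-Banach space is a complete quasi-normed space $X$ with $\|x+y\|^s\le\|x\|^s+\|y\|^s$. An $s$-metric $d$ is a function such that $d^s$ is a metric; a $q$-metric is a $p$-metric if $p\le q$. Pointed spaces have a distinguished base point $0$; pointed maps send base point to base point (the base point of a vector space being $0$). For a pointed $p$-metric space $(M,d,0)$, the Lipschitz-free $p$-space $\mathcal F_p(M)$ is the (unique up to linear isometry) $p$-Banach space equipped with an isometric pointed map $\delta_M\colon M\to\mathcal F_p(M)$ whose linear span is dense, such that every pointed Lipschitz map $f\colon M\to Y$ into a $p$-Banach space $Y$ has a unique bounded linear extension $\widehat f\colon\mathcal F_p(M)\to Y$ with $\widehat f\,\delta_M=f$, and $\|\widehat f\|=\operatorname{Lip}(f)$. A bounded linear operator $T\colon E\to Y$ fixes a copy of $\ell_p$ if there is a closed subspace $E_0\subseteq E$, isomorphic to $\ell_p$, such that $T|_{E_0}$ is an isomorphic embedding; $T$ is compact if the image of the unit ball is relatively compact. *)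

theory Defs
  imports "HOL-Analysis.Analysis" "HOL-Library.Function_Algebras"
begin

section \<open>Pointwise real vector space structure on functions\<close>

instantiation "fun" :: (type, real_vector) real_vector
begin

definition scaleR_fun :: "real \<Rightarrow> ('a \<Rightarrow> 'b) \<Rightarrow> 'a \<Rightarrow> 'b"
  where "scaleR_fun c f = (\<lambda>x. c *\<^sub>R f x)"

instance
  by standard (auto simp: scaleR_fun_def plus_fun_def fun_eq_iff algebra_simps)

end

lemma scaleR_fun_apply [simp]: "(c *\<^sub>R f) x = c *\<^sub>R f x"
  by (simp add: scaleR_fun_def)


section \<open>Quasi-normed spaces and \<open>p\<close>-Banach spaces\<close>

text \<open>
  A space is a linear subspace \<open>X\<close> of some real vector space type together with a function \<open>n\<close>
  giving the quasi-norm; the values of \<open>n\<close> outside \<open>X\<close> are irrelevant.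
\<close>

definition quasi_norm_on :: "'a::real_vector set \<Rightarrow> ('a \<Rightarrow> real) \<Rightarrow> bool" where
  "quasi_norm_on X n \<longleftrightarrow>
     (\<forall>x\<in>X. 0 \<le> n x) \<and>
     (\<forall>x\<in>X. n x = 0 \<longleftrightarrow> x = 0) \<and>
     (\<forall>c. \<forall>x\<in>X. n (c *\<^sub>R x) = \<bar>c\<bar> * n x) \<and>
     (\<exists>K. \<forall>x\<in>X. \<forall>y\<in>X. n (x + y) \<le> K * (n x + n y))"

definition qnorm_topology :: "'a::real_vector set \<Rightarrow> ('a \<Rightarrow> real) \<Rightarrow> 'a topology" where
  "qnorm_topology X n =
     topology (\<lambda>U. U \<subseteq> X \<and> (\<forall>x\<in>U. \<exists>e>0. \<forall>y\<in>X. n (y - x) < e \<longrightarrow> y \<in> U))"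

lemma openin_qnorm_topology:
  "openin (qnorm_topology X n) U \<longleftrightarrow>
     U \<subseteq> X \<and> (\<forall>x\<in>U. \<exists>e>0. \<forall>y\<in>X. n (y - x) < e \<longrightarrow> y \<in> U)"
proof -
  have "istopology (\<lambda>U. U \<subseteq> X \<and> (\<forall>x\<in>U. \<exists>e>0. \<forall>y\<in>X. n (y - x) < e \<longrightarrow> y \<in> U))"
    unfolding istopology_def
  proof (intro conjI allI impI)
    fix S T assume S: "S \<subseteq> X \<and> (\<forall>x\<in>S. \<exists>e>0. \<forall>y\<in>X. n (y - x) < e \<longrightarrow> y \<in> S)"
      and T: "T \<subseteq> X \<and> (\<forall>x\<in>T. \<exists>e>0. \<forall>y\<in>X. n (y - x) < e \<longrightarrow> y \<in> T)"
    show "S \<inter> T \<subseteq> X" using S by blast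
    show "\<forall>x\<in>S \<inter> T. \<exists>e>0. \<forall>y\<in>X. n (y - x) < e \<longrightarrow> y \<in> S \<inter> T"
    proof
      fix x assume "x \<in> S \<inter> T"
      then obtain e1 e2 where "e1 > 0" "e2 > 0" "\<forall>y\<in>X. n (y - x) < e1 \<longrightarrow> y \<in> S"
          "\<forall>y\<in>X. n (y - x) < e2 \<longrightarrow> y \<in> T" using S T by blast
      then show "\<exists>e>0. \<forall>y\<in>X. n (y - x) < e \<longrightarrow> y \<in> S \<inter> T"
        by (intro exI[of _ "min e1 e2"]) auto
    qed
  next
    fix K assume K: "\<forall>U\<in>K. U \<subseteq> X \<and> (\<forall>x\<in>U. \<exists>e>0. \<forall>y\<in>X. n (y - x) < e \<longrightarrow> y \<in> U)"
    show "\<Union> K \<subseteq> X" using K by blast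
    show "\<forall>x\<in>\<Union> K. \<exists>e>0. \<forall>y\<in>X. n (y - x) < e \<longrightarrow> y \<in> \<Union> K"
      using K by (meson UnionE UnionI)
  qed
  then show ?thesis
    by (simp add: qnorm_topology_def)
qed

lemma topspace_qnorm_topology [simp]: "topspace (qnorm_topology X n) = X"
proof -
  have "openin (qnorm_topology X n) X"
    by (auto simp: openin_qnorm_topology intro: exI[of _ 1])
  then show ?thesis
    by (metis openin_qnorm_topology openin_subset openin_topspace subset_antisym)
qed

definition p_normed :: "real \<Rightarrow> 'a::real_vector set \<Rightarrow> ('a \<Rightarrow> real) \<Rightarrow> bool" where
  "p_normed p X n \<longleftrightarrow> subspace X \<and> quasi_norm_on X n \<and>
     (\<forall>x\<in>X. \<forall>y\<in>X. n (x + y) powr p \<le> n x powr p + n y powr p)"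

definition qnorm_complete :: "'a::real_vector set \<Rightarrow> ('a \<Rightarrow> real) \<Rightarrow> bool" where
  "qnorm_complete X n \<longleftrightarrow>
     (\<forall>\<sigma>::nat \<Rightarrow> 'a. range \<sigma> \<subseteq> X \<and> (\<forall>e>0. \<exists>N. \<forall>i\<ge>N. \<forall>j\<ge>N. n (\<sigma> i - \<sigma> j) < e) \<longrightarrow>
        (\<exists>x. limitin (qnorm_topology X n) \<sigma> x sequentially))"

definition p_banach :: "real \<Rightarrow> 'a::real_vector set \<Rightarrow> ('a \<Rightarrow> real) \<Rightarrow> bool" where
  "p_banach p X n \<longleftrightarrow> p_normed p X n \<and> qnorm_complete X n"

definition lp_space :: "real \<Rightarrow> (nat \<Rightarrow> real) set" where
  "lp_space p = {x. summable (\<lambda>i. \<bar>x i\<bar> powr p)}"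

definition lp_norm :: "real \<Rightarrow> (nat \<Rightarrow> real) \<Rightarrow> real" where
  "lp_norm p x = (\<Sum>i. \<bar>x i\<bar> powr p) powr (1 / p)"


section \<open>Operators\<close>

definition linear_map_on :: "'a::real_vector set \<Rightarrow> ('a \<Rightarrow> 'b::real_vector) \<Rightarrow> bool" where
  "linear_map_on X T \<longleftrightarrow>
     (\<forall>x\<in>X. \<forall>y\<in>X. T (x + y) = T x + T y) \<and> (\<forall>c. \<forall>x\<in>X. T (c *\<^sub>R x) = c *\<^sub>R T x)"

definition bounded_operator ::
  "'a::real_vector set \<Rightarrow> ('a \<Rightarrow> real) \<Rightarrow> 'b::real_vector set \<Rightarrow> ('b \<Rightarrow> real) \<Rightarrow> ('a \<Rightarrow> 'b) \<Rightarrow> bool"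
  where "bounded_operator X nX Y nY T \<longleftrightarrow>
     T \<in> X \<rightarrow> Y \<and> linear_map_on X T \<and> (\<exists>C. \<forall>x\<in>X. nY (T x) \<le> C * nX x)"

definition operator_norm ::
  "'a::real_vector set \<Rightarrow> ('a \<Rightarrow> real) \<Rightarrow> ('b::real_vector \<Rightarrow> real) \<Rightarrow> ('a \<Rightarrow> 'b) \<Rightarrow> real"
  where "operator_norm X nX nY T = (SUP x\<in>{x\<in>X. nX x \<le> 1}. nY (T x))"

definition isomorphism_on ::
  "'a::real_vector set \<Rightarrow> ('a \<Rightarrow> real) \<Rightarrow> 'b::real_vector set \<Rightarrow> ('b \<Rightarrow> real) \<Rightarrow> ('a \<Rightarrow> 'b) \<Rightarrow> bool"
  where "isomorphism_on X nX Y nY T \<longleftrightarrow>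
     bij_betw T X Y \<and> bounded_operator X nX Y nY T \<and>
     bounded_operator Y nY X nX (inv_into X T)"

definition compact_operator ::
  "'a::real_vector set \<Rightarrow> ('a \<Rightarrow> real) \<Rightarrow> 'b::real_vector set \<Rightarrow> ('b \<Rightarrow> real) \<Rightarrow> ('a \<Rightarrow> 'b) \<Rightarrow> bool"
  where "compact_operator X nX Y nY T \<longleftrightarrow>
     compactin (qnorm_topology Y nY)
       (qnorm_topology Y nY closure_of (T ` {x\<in>X. nX x \<le> 1}))"

definition fixes_copy_of_lp ::
  "real \<Rightarrow> 'a::real_vector set \<Rightarrow> ('a \<Rightarrow> real) \<Rightarrow> ('b::real_vector \<Rightarrow> real) \<Rightarrow> ('a \<Rightarrow> 'b) \<Rightarrow> bool"
  where "fixes_copy_of_lp p X nX nY T \<longleftrightarrow>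
     (\<exists>X0. X0 \<subseteq> X \<and> subspace X0 \<and> closedin (qnorm_topology X nX) X0 \<and>
        (\<exists>J. isomorphism_on (lp_space p) (lp_norm p) X0 nX J) \<and>
        isomorphism_on X0 nX (T ` X0) nY T)"


section \<open>\<open>s\<close>-metric spaces and Lipschitz maps\<close>

text \<open>
  Nonnegativity is stated separately because \<open>powr\<close> does not detect the sign of \<open>d\<close>. As usual
  with \<^locale>\<open>Metric_space\<close>, symmetry is also required off the carrier.
\<close>

definition s_metric :: "real \<Rightarrow> 'm set \<Rightarrow> ('m \<Rightarrow> 'm \<Rightarrow> real) \<Rightarrow> bool" where
  "s_metric s M d \<longleftrightarrow> (\<forall>x\<in>M. \<forall>y\<in>M. 0 \<le> d x y) \<and> Metric_space M (\<lambda>x y. d x y powr s)"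

definition lipschitz_bound ::
  "'m set \<Rightarrow> ('m \<Rightarrow> 'm \<Rightarrow> real) \<Rightarrow> ('b::real_vector \<Rightarrow> real) \<Rightarrow> ('m \<Rightarrow> 'b) \<Rightarrow> real \<Rightarrow> bool"
  where "lipschitz_bound M d nY f L \<longleftrightarrow>
     0 \<le> L \<and> (\<forall>x\<in>M. \<forall>y\<in>M. nY (f x - f y) \<le> L * d x y)"

definition lipschitz_const ::
  "'m set \<Rightarrow> ('m \<Rightarrow> 'm \<Rightarrow> real) \<Rightarrow> ('b::real_vector \<Rightarrow> real) \<Rightarrow> ('m \<Rightarrow> 'b) \<Rightarrow> real"
  where "lipschitz_const M d nY f = Inf {L. lipschitz_bound M d nY f L}"

definition pointed_lipschitz ::
  "'m set \<Rightarrow> ('m \<Rightarrow> 'm \<Rightarrow> real) \<Rightarrow> 'm \<Rightarrow> 'b::real_vector set \<Rightarrow> ('b \<Rightarrow> real) \<Rightarrow> ('m \<Rightarrow> 'b) \<Rightarrow> bool"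
  where "pointed_lipschitz M d z Y nY f \<longleftrightarrow>
     f \<in> M \<rightarrow> Y \<and> f z = 0 \<and> (\<exists>L. lipschitz_bound M d nY f L)"


section \<open>Lipschitz-free \<open>p\<close>-spaces\<close>

text \<open>
  Every pointed Lipschitz map from \<open>M\<close> into \<open>Y\<close> extends uniquely along \<open>\<delta>\<close> to a bounded linear
  operator on \<open>F\<close>, with norm the Lipschitz constant.
\<close>

definition lipschitz_extension_property ::
  "'m set \<Rightarrow> ('m \<Rightarrow> 'm \<Rightarrow> real) \<Rightarrow> 'm \<Rightarrow> 'f::real_vector set \<Rightarrow> ('f \<Rightarrow> real) \<Rightarrow> ('m \<Rightarrow> 'f) \<Rightarrow>
   'b::real_vector set \<Rightarrow> ('b \<Rightarrow> real) \<Rightarrow> bool"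
  where "lipschitz_extension_property M d z F nF \<delta> Y nY \<longleftrightarrow>
     (\<forall>f. pointed_lipschitz M d z Y nY f \<longrightarrow>
        (\<exists>T. bounded_operator F nF Y nY T \<and> (\<forall>x\<in>M. T (\<delta> x) = f x) \<and>
             operator_norm F nF nY T = lipschitz_const M d nY f \<and>
             (\<forall>T'. bounded_operator F nF Y nY T' \<and> (\<forall>x\<in>M. T' (\<delta> x) = f x) \<longrightarrow>
                   (\<forall>v\<in>F. T' v = T v))))"

text \<open>
  HOL cannot quantify over all types inside a definition, so the target spaces \<open>Y\<close> range over all
  \<open>p\<close>-Banach spaces carried by subspaces of one fixed vector space \<open>(nat \<Rightarrow> 'm \<Rightarrow> real) \<Rightarrow> real\<close>.
  This is no restriction: theorem \<open>lipschitz_free_space_universal\<close> below derives the extension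
  property for \<open>p\<close>-Banach spaces over every type. (The closed linear span of \<open>f ` M\<close> has at
  most as many elements as \<open>nat \<Rightarrow> 'm \<Rightarrow> real\<close> and so embeds linearly in the fixed space.)
\<close>

definition lipschitz_free_space ::
  "real \<Rightarrow> 'm set \<Rightarrow> ('m \<Rightarrow> 'm \<Rightarrow> real) \<Rightarrow> 'm \<Rightarrow> 'f::real_vector set \<Rightarrow> ('f \<Rightarrow> real) \<Rightarrow>
   ('m \<Rightarrow> 'f) \<Rightarrow> bool"
  where "lipschitz_free_space p M d z F nF \<delta> \<longleftrightarrow>
     p_banach p F nF \<and>
     \<delta> \<in> M \<rightarrow> F \<and> \<delta> z = 0 \<and>
     (\<forall>x\<in>M. \<forall>y\<in>M. nF (\<delta> x - \<delta> y) = d x y) \<and>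
     qnorm_topology F nF closure_of (span (\<delta> ` M)) = F \<and>
     (\<forall>(Y :: ((nat \<Rightarrow> 'm \<Rightarrow> real) \<Rightarrow> real) set) nY.
        p_banach p Y nY \<longrightarrow> lipschitz_extension_property M d z F nF \<delta> Y nY)"

subsection \<open>Independence of the choice of the fixed target space\<close>

lemma p_normedD:
  assumes "p_normed p X n"
  shows "subspace X" "\<And>x. x \<in> X \<Longrightarrow> 0 \<le> n x" "\<And>x. x \<in> X \<Longrightarrow> n x = 0 \<longleftrightarrow> x = 0"
    "\<And>c x. x \<in> X \<Longrightarrow> n (c *\<^sub>R x) = \<bar>c\<bar> * n x"
    "\<And>x y. x \<in> X \<Longrightarrow> y \<in> X \<Longrightarrow> n (x + y) powr p \<le> n x powr p + n y powr p"
  using assms by (auto simp: p_normed_def quasi_norm_on_def)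

lemma p_normed_minus:
  assumes "p_normed p X n" "x \<in> X" shows "n (- x) = n x"
  using p_normedD(4)[OF assms, of "-1"] by simp

lemma p_normed_diff_commute:
  assumes "p_normed p X n" "x \<in> X" "y \<in> X" shows "n (x - y) = n (y - x)"
  using p_normed_minus[OF assms(1), of "x - y"] assms
  by (simp add: subspace_diff p_normedD(1))

lemma p_normed_diff_triangle:
  assumes "p_normed p X n" "x \<in> X" "y \<in> X" "w \<in> X"
  shows "n (x - w) powr p \<le> n (x - y) powr p + n (y - w) powr p"
proof -
  have "x - y \<in> X" "y - w \<in> X"
    using assms by (simp_all add: subspace_diff p_normedD(1))
  from p_normedD(5)[OF assms(1) this] show ?thesis by simp
qed

lemma p_normed_less_if_powr:
  assumes "p_normed p X n" "0 < p" "x \<in> X" "y \<in> X" "w \<in> X" "0 < e"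
    and "n (x - y) powr p < e powr p / 2" "n (y - w) powr p < e powr p / 2"
  shows "n (x - w) < e"
proof -
  have "n (x - w) powr p < e powr p"
    using p_normed_diff_triangle[OF assms(1,3-5)] assms(7,8) by linarith
  then show ?thesis
    using assms(2,6) by (meson not_less powr_mono2 less_imp_le)
qed

lemma p_normed_half_radius:
  fixes e p :: real
  assumes "0 < p" "0 < e"
  obtains r where "0 < r" "\<And>t. 0 \<le> t \<Longrightarrow> t < r \<Longrightarrow> t powr p < e powr p / 2"
proof
  let ?r = "(e powr p / 2) powr (1 / p)"
  show "0 < ?r" using assms by simp
  fix t :: real assume "0 \<le> t" "t < ?r"
  then have "t powr p < ?r powr p" using assms by (intro powr_less_mono2) auto
  also have "\<dots> = e powr p / 2" using assms by (simp add: powr_powr)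
  finally show "t powr p < e powr p / 2" .
qed

lemma p_normed_nearby:
  assumes "p_normed p X n" "0 < p" "0 < e"
  obtains r where "0 < r"
    "\<And>x y w. x \<in> X \<Longrightarrow> y \<in> X \<Longrightarrow> w \<in> X \<Longrightarrow> n (x - y) < r \<Longrightarrow> n (y - w) < r \<Longrightarrow> n (x - w) < e"
proof -
  obtain r where r: "0 < r" "\<And>t. 0 \<le> t \<Longrightarrow> t < r \<Longrightarrow> t powr p < e powr p / 2"
    using p_normed_half_radius[OF assms(2,3)] by blast
  have "n (x - w) < e"
    if "x \<in> X" "y \<in> X" "w \<in> X" "n (x - y) < r" "n (y - w) < r" for x y w
  proof (rule p_normed_less_if_powr[OF assms(1,2) that(1-3) assms(3)])
    have "x - y \<in> X" "y - w \<in> X"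
      using that p_normedD(1)[OF assms(1)] by (simp_all add: subspace_diff)
    then have "0 \<le> n (x - y)" "0 \<le> n (y - w)" by (simp_all add: p_normedD(2)[OF assms(1)])
    then show "n (x - y) powr p < e powr p / 2" "n (y - w) powr p < e powr p / 2"
      using r(2) that(4,5) by blast+
  qed
  with r(1) that show ?thesis by blast
qed

lemma qnorm_ball_nhd:
  assumes X: "p_normed p X n" and p: "0 < p" and x: "x \<in> X" and e: "0 < e"
  shows "\<exists>U. openin (qnorm_topology X n) U \<and> x \<in> U \<and> (\<forall>y\<in>U. n (y - x) < e)"
proof (intro exI conjI ballI)
  let ?U = "{y\<in>X. n (y - x) powr p < e powr p}"
  have diff: "a - b \<in> X" if "a \<in> X" "b \<in> X" for a b
    using that X by (simp add: subspace_diff p_normedD(1))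
  show "openin (qnorm_topology X n) ?U"
    unfolding openin_qnorm_topology
  proof (intro conjI ballI)
    fix y assume "y \<in> ?U"
    then have y: "y \<in> X" "n (y - x) powr p < e powr p" by auto
    define r where "r = (e powr p - n (y - x) powr p) powr (1 / p)"
    have r: "0 < r" "r powr p = e powr p - n (y - x) powr p"
      using y p by (auto simp: r_def powr_powr)
    show "\<exists>e'>0. \<forall>w\<in>X. n (w - y) < e' \<longrightarrow> w \<in> ?U"
    proof (intro exI[of _ r] conjI ballI impI)
      fix w assume w: "w \<in> X" "n (w - y) < r"
      have "n (w - y) powr p < r powr p"
        using w y p p_normedD(2)[OF X diff[OF w(1) y(1)]] by (intro powr_less_mono2) auto
      then have "n (w - x) powr p < e powr p"
        using p_normed_diff_triangle[OF X w(1) y(1) x] r(2) by linarith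
      then show "w \<in> ?U" using w by simp
    qed (use r in simp)
  qed auto
  show "x \<in> ?U" using x e p p_normedD(3)[OF X, of 0] p_normedD(1)[OF X]
    by (simp add: subspace_0)
  fix y assume "y \<in> ?U"
  then show "n (y - x) < e"
    using e p by (metis (mono_tags, lifting) mem_Collect_eq not_less powr_mono2 less_imp_le)
qed

lemma limitin_qnorm_topology:
  assumes X: "p_normed p X n" and p: "0 < p" and \<sigma>: "range \<sigma> \<subseteq> X"
  shows "limitin (qnorm_topology X n) \<sigma> x sequentially \<longleftrightarrow>
     x \<in> X \<and> (\<forall>e>0. eventually (\<lambda>k. n (\<sigma> k - x) < e) sequentially)"
proof
  assume L: "limitin (qnorm_topology X n) \<sigma> x sequentially"
  then have x: "x \<in> X" by (simp add: limitin_def)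
  have "eventually (\<lambda>k. n (\<sigma> k - x) < e) sequentially" if "e > 0" for e
    using qnorm_ball_nhd[OF X p x that] L
    by (auto simp: limitin_def elim!: eventually_mono)
  with x show "x \<in> X \<and> (\<forall>e>0. eventually (\<lambda>k. n (\<sigma> k - x) < e) sequentially)" by blast
next
  assume R: "x \<in> X \<and> (\<forall>e>0. eventually (\<lambda>k. n (\<sigma> k - x) < e) sequentially)"
  show "limitin (qnorm_topology X n) \<sigma> x sequentially"
    unfolding limitin_def
  proof (intro conjI allI impI)
    fix U assume U: "openin (qnorm_topology X n) U \<and> x \<in> U"
    then obtain e where "e > 0" and e: "\<forall>y\<in>X. n (y - x) < e \<longrightarrow> y \<in> U"
      by (auto simp: openin_qnorm_topology)
    with R have "eventually (\<lambda>k. n (\<sigma> k - x) < e) sequentially" by blast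
    then show "eventually (\<lambda>k. \<sigma> k \<in> U) sequentially"
      using e \<sigma> by (auto elim!: eventually_mono)
  qed (use R in simp)
qed

lemma closure_of_qnorm_topologyD:
  assumes "p_normed p X n" "0 < p" "x \<in> qnorm_topology X n closure_of S" "0 < e"
  shows "\<exists>y\<in>S \<inter> X. n (y - x) < e"
proof -
  have x: "x \<in> X" using assms(3) by (auto simp: closure_of_def)
  obtain U where "openin (qnorm_topology X n) U" "x \<in> U" "\<forall>y\<in>U. n (y - x) < e"
    using qnorm_ball_nhd[OF assms(1,2) x assms(4)] by blast
  moreover from this obtain y where "y \<in> S" "y \<in> U"
    using assms(3) by (auto simp: in_closure_of)
  moreover have "U \<subseteq> X" using \<open>openin (qnorm_topology X n) U\<close> by (simp add: openin_qnorm_topology)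
  ultimately show ?thesis by blast
qed

text \<open>A subset approximated by combinations of at most \<open>'m\<close>-many vectors embeds linearly.\<close>

lemma linear_embedding_in_fixed_space:
  fixes f :: "'m \<Rightarrow> 'b::real_vector"
  assumes Y: "p_normed p Y n" "0 < p" and C: "C \<subseteq> Y" and fM: "f ` M \<subseteq> Y"
    and approx: "\<forall>y\<in>C. \<forall>e>0. \<exists>s\<in>span (f ` M). n (s - y) < e"
  obtains h :: "'b \<Rightarrow> (nat \<Rightarrow> 'm \<Rightarrow> real) \<Rightarrow> real" where "linear h" "inj_on h (span C)"
proof -
  define comb where "comb u = (\<Sum>w | u w \<noteq> 0. u w *\<^sub>R w)" for u :: "'b \<Rightarrow> real"
  have "\<exists>u. {w. u w \<noteq> 0} \<subseteq> f ` M \<and> comb u \<in> Y \<and> n (comb u - y) < e"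
    if y: "y \<in> C" "0 < e" for y e
  proof -
    obtain s where s: "s \<in> span (f ` M)" "n (s - y) < e" using approx y by blast
    then obtain u where u: "{w. u w \<noteq> 0} \<subseteq> f ` M" "s = comb u"
      unfolding span_alt comb_def by blast
    moreover have "s \<in> Y"
      using s fM p_normedD(1)[OF Y(1)] span_minimal by blast
    ultimately show ?thesis using s by blast
  qed
  then have "\<forall>y k. \<exists>u. y \<in> C \<longrightarrow> {w. u w \<noteq> 0} \<subseteq> f ` M \<and> comb u \<in> Y \<and>
      n (comb u - y) < 1 / real (Suc k)"
    by (metis of_nat_0_less_iff zero_less_Suc zero_less_divide_1_iff)
  then obtain U where U: "\<And>y k. y \<in> C \<Longrightarrow> {w. U y k w \<noteq> 0} \<subseteq> f ` M"
    "\<And>y k. y \<in> C \<Longrightarrow> comb (U y k) \<in> Y"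
    "\<And>y k. y \<in> C \<Longrightarrow> n (comb (U y k) - y) < 1 / real (Suc k)"
    by metis
  define g where "g y = (\<lambda>k x. U y k (f x))" for y
  have inj_g: "inj_on g C"
  proof (rule inj_onI)
    fix y y' assume y: "y \<in> C" and y': "y' \<in> C" and eq: "g y = g y'"
    have Ueq: "U y k = U y' k" for k
    proof
      fix w
      show "U y k w = U y' k w"
      proof (cases "w \<in> f ` M")
        case True
        then obtain x where "w = f x" by blast
        then show ?thesis using eq by (metis g_def)
      next
        case False
        then have "U y k w = 0" "U y' k w = 0" using U(1)[OF y, of k] U(1)[OF y', of k] by auto
        then show ?thesis by simp
      qed
    qed
    have yY: "y \<in> Y" "y' \<in> Y" using y y' C by auto
    have "n (y - y') < e" if e: "e > 0" for e
    proof -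
      obtain r where r: "0 < r" "\<And>x y w. x \<in> Y \<Longrightarrow> y \<in> Y \<Longrightarrow> w \<in> Y \<Longrightarrow> n (x - y) < r \<Longrightarrow>
          n (y - w) < r \<Longrightarrow> n (x - w) < e"
        using p_normed_nearby[OF Y e] by metis
      obtain k where k: "1 / real (Suc k) < r"
        using r(1) nat_approx_posE by blast
      show ?thesis
      proof (rule r(2)[OF yY(1) U(2)[OF y, of k] yY(2)])
        show "n (y - comb (U y k)) < r"
          using U(3)[OF y, of k] k p_normed_diff_commute[OF Y(1) yY(1) U(2)[OF y, of k]] by linarith
        show "n (comb (U y k) - y') < r"
          using U(3)[OF y', of k] k by (simp add: Ueq)
      qed
    qed
    moreover have "y - y' \<in> Y" using yY by (simp add: subspace_diff p_normedD(1)[OF Y(1)])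
    ultimately have "n (y - y') = 0"
      using p_normedD(2)[OF Y(1)] by (metis less_irrefl order_less_le)
    then show "y = y'" using p_normedD(3)[OF Y(1) \<open>y - y' \<in> Y\<close>] by simp
  qed
  obtain B where B: "B \<subseteq> C" "independent B" "C \<subseteq> span B"
    using maximal_independent_subset by blast
  obtain h :: "'b \<Rightarrow> (nat \<Rightarrow> 'm \<Rightarrow> real) \<Rightarrow> real" where
    h: "linear h" "\<And>b. b \<in> B \<Longrightarrow> h b = (\<lambda>c. if c = g b then 1 else 0)"
    using linear_independent_extend[OF B(2), of "\<lambda>b c. if c = g b then 1 else 0"] by blast
  have ker: "x = 0" if xB: "x \<in> span B" and "h x = 0" for x
  proof -
    obtain t r where t: "finite t" "t \<subseteq> B" and x: "x = (\<Sum>b\<in>t. r b *\<^sub>R b)"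
      using xB unfolding span_explicit by blast
    have sum_apply: "(\<Sum>b\<in>s. q b) c = (\<Sum>b\<in>s. q b c)"
      for s :: "'b set" and q :: "'b \<Rightarrow> (nat \<Rightarrow> 'm \<Rightarrow> real) \<Rightarrow> real" and c
      by (induction s rule: infinite_finite_induct) auto
    have "r b0 = 0" if b0: "b0 \<in> t" for b0
    proof -
      have "0 = h x (g b0)" using \<open>h x = 0\<close> by simp
      also have "\<dots> = (\<Sum>b\<in>t. r b * h b (g b0))"
        by (simp add: x linear_sum[OF h(1)] linear_scale[OF h(1)] sum_apply)
      also have "\<dots> = (\<Sum>b\<in>t. if b = b0 then r b else 0)"
      proof (rule sum.cong[OF refl])
        fix b assume "b \<in> t"
        then have "b \<in> B" "b0 \<in> B" using b0 t by auto
        then show "r b * h b (g b0) = (if b = b0 then r b else 0)"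
          using inj_onD[OF inj_g, of b0 b] B(1) by (auto simp: h(2))
      qed
      also have "\<dots> = r b0" using t b0 by simp
      finally show ?thesis by simp
    qed
    then show "x = 0" by (simp add: x)
  qed
  have "inj_on h (span B)"
    using ker linear_injective_on_subspace_0[OF h(1), of "span B"] by auto
  moreover have "span C \<subseteq> span B" using B(3) span_minimal subspace_span by blast
  ultimately show ?thesis using that h(1) inj_on_subset by blast
qed

lemma qnorm_completeD:
  assumes "qnorm_complete X n" "range \<sigma> \<subseteq> X"
    and "\<forall>e>0. \<exists>N. \<forall>i\<ge>N. \<forall>j\<ge>N. n (\<sigma> i - \<sigma> j) < e"
  obtains x where "limitin (qnorm_topology X n) \<sigma> x sequentially"
  using assms(1)[unfolded qnorm_complete_def, rule_format, OF conjI, OF assms(2,3)]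
  by blast

lemma p_normed_mono:
  assumes "p_normed p X n" "subspace C" "C \<subseteq> X"
  shows "p_normed p C n"
proof -
  obtain K where "\<forall>x\<in>X. \<forall>y\<in>X. n (x + y) \<le> K * (n x + n y)"
    using assms(1) unfolding p_normed_def quasi_norm_on_def by metis
  then have "\<forall>x\<in>C. \<forall>y\<in>C. n (x + y) \<le> K * (n x + n y)" using assms(3) by blast
  then show ?thesis
    using assms(2) p_normedD(2-5)[OF assms(1) subsetD[OF assms(3)]] assms(3)
    unfolding p_normed_def quasi_norm_on_def by auto
qed

lemma p_banach_closed_span:
  assumes Y: "p_banach p Y n" and p: "0 < p" and A: "A \<subseteq> Y"
  shows "p_banach p {y\<in>Y. \<forall>e>0. \<exists>s\<in>span A. n (s - y) < e} n" (is "p_banach p ?C n")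
proof -
  have Yn: "p_normed p Y n" and Yc: "qnorm_complete Y n" using Y by (auto simp: p_banach_def)
  note Ysub = p_normedD(1)[OF Yn]
  have span: "span A \<subseteq> Y" using A Ysub span_minimal by blast
  have sub: "subspace ?C"
  proof (rule subspaceI)
    have "n (0 - 0) < e" if "e > 0" for e
      using that p_normedD(3)[OF Yn, of 0] Ysub by (simp add: subspace_0)
    then show "0 \<in> ?C" using Ysub span_zero by (fastforce simp: subspace_0)
  next
    fix x y assume x: "x \<in> ?C" and y: "y \<in> ?C"
    have "\<exists>s\<in>span A. n (s - (x + y)) < e" if e: "e > 0" for e
    proof -
      obtain r where r: "0 < r" "\<And>x y w. x \<in> Y \<Longrightarrow> y \<in> Y \<Longrightarrow> w \<in> Y \<Longrightarrow> n (x - y) < r \<Longrightarrow>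
          n (y - w) < r \<Longrightarrow> n (x - w) < e"
        using p_normed_nearby[OF Yn p e] by metis
      obtain s t where s: "s \<in> span A" "n (s - x) < r" and t: "t \<in> span A" "n (t - y) < r"
        using x y r(1) by blast
      have "n (s + t - (x + y)) < e"
        by (rule r(2)[of _ "x + t"]) (use s t x y span Ysub in \<open>auto intro: subspace_add\<close>)
      then show ?thesis using s t span_add by blast
    qed
    then show "x + y \<in> ?C" using x y Ysub by (auto intro: subspace_add)
  next
    fix c x assume x: "x \<in> ?C"
    have "\<exists>s\<in>span A. n (s - c *\<^sub>R x) < e" if e: "e > 0" for e
    proof -
      have "0 < e / (\<bar>c\<bar> + 1)" using e by simp
      then obtain s where s: "s \<in> span A" "n (s - x) < e / (\<bar>c\<bar> + 1)" using x by blast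
      have sx: "s - x \<in> Y" using s x span Ysub by (auto intro: subspace_diff)
      have "n (c *\<^sub>R s - c *\<^sub>R x) = \<bar>c\<bar> * n (s - x)"
        using p_normedD(4)[OF Yn sx, of c] by (simp add: scaleR_diff_right)
      also have "\<dots> \<le> (\<bar>c\<bar> + 1) * n (s - x)"
        using p_normedD(2)[OF Yn sx] by (intro mult_right_mono) auto
      also have "\<dots> < e" using s(2) by (simp add: field_simps)
      finally show ?thesis using s span_scale by blast
    qed
    then show "c *\<^sub>R x \<in> ?C" using x Ysub by (auto intro: subspace_scale)
  qed
  have Cn: "p_normed p ?C n"
    by (rule p_normed_mono[OF Yn sub]) auto
  have "qnorm_complete ?C n"
    unfolding qnorm_complete_def
  proof (intro allI impI)
    fix \<sigma> :: "nat \<Rightarrow> 'a"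
    assume \<sigma>: "range \<sigma> \<subseteq> ?C \<and> (\<forall>e>0. \<exists>N. \<forall>i\<ge>N. \<forall>j\<ge>N. n (\<sigma> i - \<sigma> j) < e)"
    have \<sigma>Y: "range \<sigma> \<subseteq> Y" using \<sigma> by blast
    obtain x where "limitin (qnorm_topology Y n) \<sigma> x sequentially"
      using qnorm_completeD[OF Yc \<sigma>Y conjunct2[OF \<sigma>]] .
    then have x: "x \<in> Y" "\<And>e. e > 0 \<Longrightarrow> eventually (\<lambda>k. n (\<sigma> k - x) < e) sequentially"
      by (auto simp: limitin_qnorm_topology[OF Yn p \<sigma>Y])
    have "\<exists>s\<in>span A. n (s - x) < e" if e: "e > 0" for e
    proof -
      obtain r where r: "0 < r" "\<And>x y w. x \<in> Y \<Longrightarrow> y \<in> Y \<Longrightarrow> w \<in> Y \<Longrightarrow> n (x - y) < r \<Longrightarrow>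
          n (y - w) < r \<Longrightarrow> n (x - w) < e"
        using p_normed_nearby[OF Yn p e] by metis
      obtain k where k: "n (\<sigma> k - x) < r"
        using x(2)[OF r(1)] by (auto simp: eventually_sequentially)
      obtain s where s: "s \<in> span A" "n (s - \<sigma> k) < r" using \<sigma> r(1) by blast
      have "n (s - x) < e"
        by (rule r(2)[of _ "\<sigma> k"]) (use s k x \<sigma>Y span in auto)
      then show ?thesis using s by blast
    qed
    then have "x \<in> ?C" using x by blast
    then have "limitin (qnorm_topology ?C n) \<sigma> x sequentially"
      using limitin_qnorm_topology[OF Cn p conjunct1[OF \<sigma>], of x] x(2) by simp
    then show "\<exists>x. limitin (qnorm_topology ?C n) \<sigma> x sequentially" ..
  qed
  with Cn show ?thesis by (simp add: p_banach_def)
qed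

lemma p_banach_linear_image:
  fixes h :: "'a::real_vector \<Rightarrow> 'b::real_vector"
  assumes C: "p_banach p C n" and p: "0 < p" and h: "linear h" "inj_on h C"
  shows "p_banach p (h ` C) (\<lambda>v. n (inv_into C h v))"
proof -
  have Cn: "p_normed p C n" and Cc: "qnorm_complete C n" using C by (auto simp: p_banach_def)
  note Csub = p_normedD(1)[OF Cn]
  let ?i = "inv_into C h"
  have i: "?i (h x) = x" if "x \<in> C" for x using that h by simp
  have i_add: "?i (h x + h y) = x + y" if "x \<in> C" "y \<in> C" for x y
    using i[of "x + y"] that Csub by (simp add: linear_add[OF h(1)] subspace_add)
  have i_diff: "?i (h x - h y) = x - y" if "x \<in> C" "y \<in> C" for x y
    using i[of "x - y"] that Csub by (simp add: linear_diff[OF h(1)] subspace_diff)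
  have i_scale: "?i (c *\<^sub>R h x) = c *\<^sub>R x" if "x \<in> C" for x c
    using i[of "c *\<^sub>R x"] that Csub by (simp add: linear_scale[OF h(1)] subspace_scale)
  have h0: "h x = 0 \<longleftrightarrow> x = 0" if "x \<in> C" for x
    using that h Csub by (metis i linear_0 subspace_0)
  have sub: "subspace (h ` C)" using h(1) Csub by (simp add: linear_subspace_image)
  obtain K where "\<forall>x\<in>C. \<forall>y\<in>C. n (x + y) \<le> K * (n x + n y)"
    using Cn by (auto simp: p_normed_def quasi_norm_on_def)
  then have Vn: "p_normed p (h ` C) (\<lambda>v. n (?i v))"
    using sub p_normedD[OF Cn] by (auto simp: p_normed_def quasi_norm_on_def i i_add i_scale h0)
  have "qnorm_complete (h ` C) (\<lambda>v. n (?i v))"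
    unfolding qnorm_complete_def
  proof (intro allI impI)
    fix \<sigma> :: "nat \<Rightarrow> 'b" assume \<sigma>: "range \<sigma> \<subseteq> h ` C \<and>
      (\<forall>e>0. \<exists>N. \<forall>i\<ge>N. \<forall>j\<ge>N. n (?i (\<sigma> i - \<sigma> j)) < e)"
    define \<tau> where "\<tau> k = ?i (\<sigma> k)" for k :: nat
    have \<tau>C: "\<tau> k \<in> C" and \<sigma>\<tau>: "\<sigma> k = h (\<tau> k)" for k
      using \<sigma> unfolding \<tau>_def by (auto simp: inv_into_into f_inv_into_f image_subset_iff)
    have \<tau>r: "range \<tau> \<subseteq> C" using \<tau>C by blast
    have "\<forall>e>0. \<exists>N. \<forall>i\<ge>N. \<forall>j\<ge>N. n (\<tau> i - \<tau> j) < e"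
      using conjunct2[OF \<sigma>] unfolding \<sigma>\<tau> by (simp add: i_diff \<tau>C)
    then obtain x where "limitin (qnorm_topology C n) \<tau> x sequentially"
      using qnorm_completeD[OF Cc \<tau>r] by metis
    then have x: "x \<in> C" "\<forall>e>0. eventually (\<lambda>k. n (\<tau> k - x) < e) sequentially"
      by (auto simp: limitin_qnorm_topology[OF Cn p \<tau>r])
    have "limitin (qnorm_topology (h ` C) (\<lambda>v. n (?i v))) \<sigma> (h x) sequentially"
      using x \<sigma> by (subst limitin_qnorm_topology[OF Vn p]) (auto simp: \<sigma>\<tau> i_diff \<tau>C)
    then show "\<exists>v. limitin (qnorm_topology (h ` C) (\<lambda>v. n (?i v))) \<sigma> v sequentially" ..
  qed
  with Vn show ?thesis by (simp add: p_banach_def)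
qed

lemma linear_map_on_span_eq:
  assumes "linear_map_on X T" "linear_map_on X T'" "subspace X" "A \<subseteq> X"
    and "\<And>a. a \<in> A \<Longrightarrow> T a = T' a" and "x \<in> span A"
  shows "T x = T' x"
proof -
  have "subspace {x\<in>X. T x = T' x}"
  proof (rule subspaceI)
    have "T (0 *\<^sub>R 0) = 0 *\<^sub>R T 0" "T' (0 *\<^sub>R 0) = 0 *\<^sub>R T' 0"
      using assms(1-3) unfolding linear_map_on_def by (blast intro: subspace_0)+
    then show "0 \<in> {x\<in>X. T x = T' x}" using assms(3) by (simp add: subspace_0)
  qed (use assms(1-3) in \<open>auto simp: linear_map_on_def subspace_add subspace_scale\<close>)
  moreover have "A \<subseteq> {x\<in>X. T x = T' x}" using assms by auto
  ultimately have "span A \<subseteq> {x\<in>X. T x = T' x}" by (rule span_minimal[rotated])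
  then show ?thesis using assms(6) by blast
qed

lemma bounded_operator_eq_on_closure:
  assumes F: "p_normed p F nF" and Y: "p_normed p Y nY" and p: "0 < p"
    and A: "A \<subseteq> F" and dense: "qnorm_topology F nF closure_of (span A) = F"
    and T: "bounded_operator F nF Y nY T" and T': "bounded_operator F nF Y nY T'"
    and eq: "\<And>a. a \<in> A \<Longrightarrow> T a = T' a" and v: "v \<in> F"
  shows "T v = T' v"
proof -
  note Fsub = p_normedD(1)[OF F] and Ysub = p_normedD(1)[OF Y]
  have lin: "linear_map_on F T" "linear_map_on F T'" and maps: "T \<in> F \<rightarrow> Y" "T' \<in> F \<rightarrow> Y"
    using T T' by (auto simp: bounded_operator_def)
  obtain C C' where C: "\<forall>x\<in>F. nY (T x) \<le> C * nF x" and C': "\<forall>x\<in>F. nY (T' x) \<le> C' * nF x"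
    using T T' by (auto simp: bounded_operator_def)
  define D where "D = \<bar>C\<bar> + \<bar>C'\<bar> + 1"
  have D: "D > 0" "\<And>x. x \<in> F \<Longrightarrow> nY (T x) \<le> D * nF x" "\<And>x. x \<in> F \<Longrightarrow> nY (T' x) \<le> D * nF x"
  proof -
    show "D > 0" by (simp add: D_def)
    fix x assume x: "x \<in> F"
    have "C * nF x \<le> D * nF x" "C' * nF x \<le> D * nF x"
      using p_normedD(2)[OF F x] by (auto intro!: mult_right_mono simp: D_def)
    then show "nY (T x) \<le> D * nF x" "nY (T' x) \<le> D * nF x"
      using C C' x by (auto intro: order_trans)
  qed
  have diff: "S (a - b) = S a - S b" if S: "linear_map_on F S" and ab: "a \<in> F" "b \<in> F" for S a b
  proof -
    have "S (a - b + b) = S (a - b) + S b"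
      using S ab Fsub unfolding linear_map_on_def by (blast intro: subspace_diff)
    then show ?thesis by simp
  qed
  have TY: "T v \<in> Y" "T' v \<in> Y" using maps v by auto
  have "nY (T v - T' v) < e" if e: "e > 0" for e
  proof -
    obtain r where r: "0 < r" "\<And>x y w. x \<in> Y \<Longrightarrow> y \<in> Y \<Longrightarrow> w \<in> Y \<Longrightarrow> nY (x - y) < r \<Longrightarrow>
        nY (y - w) < r \<Longrightarrow> nY (x - w) < e"
      using p_normed_nearby[OF Y p e] by metis
    have "0 < r / D" using r D by simp
    then obtain s where s: "s \<in> span A" "s \<in> F" "nF (s - v) < r / D"
      using closure_of_qnorm_topologyD[OF F p] v dense by blast
    have Ts: "T s = T' s" using linear_map_on_span_eq[OF lin Fsub A eq s(1)] by blast
    have small: "D * nF (s - v) < r" using s(3) D by (simp add: field_simps)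
    have sv: "s - v \<in> F" "v - s \<in> F" using s v Fsub by (auto intro: subspace_diff)
    have "nY (T (v - s)) \<le> D * nF (v - s)" "nY (T' (s - v)) \<le> D * nF (s - v)"
      using D sv by auto
    then have "nY (T v - T s) < r" "nY (T s - T' v) < r"
      using small p_normed_diff_commute[OF F v s(2)] diff[OF lin(1) v s(2)] diff[OF lin(2) s(2) v]
      by (auto simp: Ts)
    then show ?thesis using r(2)[OF TY(1) _ TY(2), of "T s"] maps s by blast
  qed
  moreover have TT: "T v - T' v \<in> Y" using TY Ysub by (auto intro: subspace_diff)
  ultimately have "nY (T v - T' v) = 0"
    using p_normedD(2)[OF Y] by (metis less_irrefl order_less_le)
  then show ?thesis using p_normedD(3)[OF Y TT] by simp
qed

theorem lipschitz_free_space_universal: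
  fixes M :: "'m set" and Y :: "'b::real_vector set"
  assumes free: "lipschitz_free_space p M d z F nF \<delta>" and p: "0 < p" and Y: "p_banach p Y nY"
  shows "lipschitz_extension_property M d z F nF \<delta> Y nY"
  unfolding lipschitz_extension_property_def
proof (intro allI impI)
  fix f assume f: "pointed_lipschitz M d z Y nY f"
  have Yn: "p_normed p Y nY" using Y by (simp add: p_banach_def)
  have Fn: "p_normed p F nF" and \<delta>F: "\<delta> ` M \<subseteq> F"
    and dense: "qnorm_topology F nF closure_of (span (\<delta> ` M)) = F"
    using free by (auto simp: lipschitz_free_space_def p_banach_def)
  have fY: "f ` M \<subseteq> Y" using f by (auto simp: pointed_lipschitz_def)
  define C where "C = {y\<in>Y. \<forall>e>0. \<exists>s\<in>span (f ` M). nY (s - y) < e}"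
  have C: "p_banach p C nY" unfolding C_def by (rule p_banach_closed_span[OF Y p fY])
  then have Cn: "p_normed p C nY" by (simp add: p_banach_def)
  note Csub = p_normedD(1)[OF Cn]
  have CY: "C \<subseteq> Y" by (auto simp: C_def)
  have fC: "f x \<in> C" if "x \<in> M" for x
  proof -
    have "nY (f x - f x) = 0"
      using p_normedD(3)[OF Yn, of 0] p_normedD(1)[OF Yn] by (simp add: subspace_0)
    moreover have "f x \<in> span (f ` M)" "f x \<in> Y" using that fY by (auto intro: span_base)
    ultimately show ?thesis unfolding C_def
      by (intro CollectI conjI allI impI bexI[of _ "f x"]) simp_all
  qed
  have approx: "\<forall>y\<in>C. \<forall>e>0. \<exists>s\<in>span (f ` M). nY (s - y) < e"
    by (simp add: C_def)
  obtain h :: "'b \<Rightarrow> (nat \<Rightarrow> 'm \<Rightarrow> real) \<Rightarrow> real" where h: "linear h" "inj_on h (span C)"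
    using linear_embedding_in_fixed_space[OF Yn p CY fY approx] by metis
  have inj: "inj_on h C" using h(2) inj_on_subset span_superset by blast
  let ?i = "inv_into C h"
  let ?n = "\<lambda>v. nY (?i v)"
  have V: "p_banach p (h ` C) ?n" by (rule p_banach_linear_image[OF C p h(1) inj])
  have i: "?i (h x) = x" if "x \<in> C" for x using that inj by simp
  have i_add: "?i (h x + h y) = x + y" if "x \<in> C" "y \<in> C" for x y
    using i[of "x + y"] that Csub by (simp add: linear_add[OF h(1)] subspace_add)
  have i_diff: "?i (h x - h y) = x - y" if "x \<in> C" "y \<in> C" for x y
    using i[of "x - y"] that Csub by (simp add: linear_diff[OF h(1)] subspace_diff)
  have i_scale: "?i (c *\<^sub>R h x) = c *\<^sub>R x" if "x \<in> C" for x c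
    using i[of "c *\<^sub>R x"] that Csub by (simp add: linear_scale[OF h(1)] subspace_scale)
  have bound: "lipschitz_bound M d ?n (h \<circ> f) = lipschitz_bound M d nY f"
    by (auto simp: fun_eq_iff lipschitz_bound_def i_diff fC)
  have hf: "pointed_lipschitz M d z (h ` C) ?n (h \<circ> f)"
    using f fC by (auto simp: pointed_lipschitz_def bound linear_0[OF h(1)])
  have const: "lipschitz_const M d ?n (h \<circ> f) = lipschitz_const M d nY f"
    by (simp add: lipschitz_const_def bound)
  have "lipschitz_extension_property M d z F nF \<delta> (h ` C) ?n"
    using free V by (auto simp: lipschitz_free_space_def)
  then obtain S where S: "bounded_operator F nF (h ` C) ?n S" "\<And>x. x \<in> M \<Longrightarrow> S (\<delta> x) = h (f x)"
    "operator_norm F nF ?n S = lipschitz_const M d nY f"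
    using hf const unfolding lipschitz_extension_property_def by (metis comp_apply)
  define T where "T = ?i \<circ> S"
  have SC: "S v \<in> h ` C" if "v \<in> F" for v using S(1) that by (auto simp: bounded_operator_def)
  then have TC: "T v \<in> C" "S v = h (T v)" if "v \<in> F" for v
    using that by (auto simp: T_def inv_into_into f_inv_into_f)
  have S_lin: "linear_map_on F S" using S(1) by (simp add: bounded_operator_def)
  have lin: "linear_map_on F T"
    unfolding linear_map_on_def
  proof (intro conjI ballI allI)
    fix x y assume xy: "x \<in> F" "y \<in> F"
    then have "S (x + y) = h (T x) + h (T y)"
      using S_lin TC(2)[OF xy(1)] TC(2)[OF xy(2)] unfolding linear_map_on_def by metis
    then have "T (x + y) = ?i (h (T x) + h (T y))" by (simp add: T_def)
    then show "T (x + y) = T x + T y" using i_add[OF TC(1) TC(1)] xy by metis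
  next
    fix c x assume x: "x \<in> F"
    then have "S (c *\<^sub>R x) = c *\<^sub>R h (T x)"
      using S_lin TC(2)[OF x] unfolding linear_map_on_def by metis
    then have "T (c *\<^sub>R x) = ?i (c *\<^sub>R h (T x))" by (simp add: T_def)
    then show "T (c *\<^sub>R x) = c *\<^sub>R T x" using i_scale[OF TC(1)] x by metis
  qed
  have T: "bounded_operator F nF Y nY T"
    unfolding bounded_operator_def
  proof (intro conjI)
    show "T \<in> F \<rightarrow> Y" using TC(1) CY by blast
    show "\<exists>K. \<forall>v\<in>F. nY (T v) \<le> K * nF v"
      using S(1) unfolding bounded_operator_def T_def comp_apply by metis
  qed (fact lin)
  have ext: "T (\<delta> x) = f x" if "x \<in> M" for x using S(2) that fC by (simp add: T_def i)
  have norm: "operator_norm F nF nY T = lipschitz_const M d nY f"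
    using S(3) by (simp add: operator_norm_def T_def)
  have uniq: "T' v = T v"
    if "bounded_operator F nF Y nY T'" "\<forall>x\<in>M. T' (\<delta> x) = f x" "v \<in> F" for T' v
    by (rule bounded_operator_eq_on_closure[OF Fn Yn p \<delta>F dense that(1) T _ that(3)])
      (use that(2) ext in auto)
  show "\<exists>T. bounded_operator F nF Y nY T \<and> (\<forall>x\<in>M. T (\<delta> x) = f x) \<and>
             operator_norm F nF nY T = lipschitz_const M d nY f \<and>
             (\<forall>T'. bounded_operator F nF Y nY T' \<and> (\<forall>x\<in>M. T' (\<delta> x) = f x) \<longrightarrow>
                   (\<forall>v\<in>F. T' v = T v))"
    using T ext norm uniq by blast
qed

end

theory Submission
  imports Defs
begin

text \<open>The $p$-th power of the norm of $F_p(M)$ is an optimal transport cost in which an edge of length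
  $d$ carrying mass $b$ costs $|b|^p d^p$. Let $q = q_0$. Replacing $p$ by $q$ gives a weaker norm, and a
  combination that is small for the $q$-norm but bounded in the $p$-norm is asymptotically disjoint from
  every fixed finitely supported one, that is, the $p$-th powers of the $p$-norms almost add up. Hence
  a $p$-bounded sequence that tends to $0$ for the $q$-norm but not for the $p$-norm has a subsequence
  equivalent to the basis of $\ell_p$, and so has any sequence that the operator maps onto it.

  If the operator is not compact, it maps some bounded sequence to a separated one. From the latter one
  obtains a sequence that is small for the $q$-norm either by taking differences, when the parts of
  large mass per edge accumulate, or by taking $\ell_p$-normalised averages over long blocks, when
  these parts stay away from each other. Conversely, the unit vectors of $\ell_p$ are separated, so
  an operator fixing $\ell_p$ is not compact.\<close>

section \<open>Concave powers\<close>

text \<open>Upper bounds for transport costs come from exhibiting flows. Lower bounds are the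
  obstacle: for p < 1 linear functionals do not recover the norm, so a lower bound is won by taking
  an almost optimal flow and rebuilding it into flows for the pieces. Two exponents are compared
  throughout, 1 and \<alpha> = p/q < 1. Smallness for exponent 1 gives nothing for exponent \<alpha>
  in general. But the cost is concave in the mass on each edge, so pushing mass around cycles and
  bypassing vertices without mass leaves at most three edges per atom, and Jensen's inequality then
  controls exponent \<alpha> by exponent 1 and the number of atoms. Strictness of p < q is what lets
  very light edges disappear for exponent 1 while they keep their cost for exponent \<alpha>. Heavy
  parts may accumulate at points outside M, so M is replaced by its closure in the free space, which
  is complete. Finally, that transport cost is not merely an upper bound for the norm but equal to
  it follows from the universal property, applied to the completion of the measures under that very
  cost.\<close>

lemma powr_le_tangent:
  fixes x y r :: real
  assumes "0 < x" "0 \<le> y" "0 < r" "r \<le> 1"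
  shows "y powr r \<le> x powr r + r * x powr (r - 1) * (y - x)"
proof (cases "y = 0")
  case True
  have "x powr (r - 1) * x = x powr r"
    using assms by (simp add: powr_diff)
  then have "x powr r + r * x powr (r - 1) * (y - x) = (1 - r) * x powr r"
    using True by (simp add: algebra_simps)
  then show ?thesis using True assms by simp
next
  case False
  then have y: "0 < y" using assms by simp
  \<comment> \<open>Weighted AM-GM. Multiplied by \<open>x powr (r - 1)\<close> it becomes the
    tangent inequality at \<open>x\<close>.\<close>
  have "y powr r * x powr (1 - r) \<le> r * y + (1 - r) * x"
    using assms y by (intro Youngs_inequality_0) auto
  then have "y powr r * x powr (1 - r) * x powr (r - 1) \<le> (r * y + (1 - r) * x) * x powr (r - 1)"
    by (intro mult_right_mono) auto
  moreover have "x powr (1 - r) * x powr (r - 1) = 1"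
    using assms by (simp flip: powr_add)
  moreover have "x powr (r - 1) * x = x powr r"
    using assms by (simp add: powr_diff)
  then have "(r * y + (1 - r) * x) * x powr (r - 1) = x powr r + r * x powr (r - 1) * (y - x)"
    by (simp add: algebra_simps)
  ultimately show ?thesis by (simp add: mult.assoc)
qed

lemma powr_subadditive:
  fixes x y r :: real
  assumes "0 \<le> x" "0 \<le> y" "0 < r" "r \<le> 1"
  shows "(x + y) powr r \<le> x powr r + y powr r"
proof (cases "x + y = 0")
  case True
  then show ?thesis using assms by simp
next
  case False
  then have s: "0 < x + y" using assms by simp
  \<comment> \<open>\<open>(x + y) powr r\<close> is the sum of \<open>x\<close> and
    \<open>y\<close>, each times \<open>(x + y) powr (r - 1)\<close>. This exponent is at most 0, so
    replacing \<open>x + y\<close> by the summand in question only enlarges the factor.\<close>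
  have *: "t * (x + y) powr (r - 1) \<le> t powr r" if "0 \<le> t" "t \<le> x + y" for t
  proof (cases "t = 0")
    case f: False
    have "t * (x + y) powr (r - 1) \<le> t * t powr (r - 1)"
      using that f assms by (intro mult_left_mono powr_mono2') auto
    also have "\<dots> = t powr r" using that f by (simp add: powr_diff)
    finally show ?thesis .
  qed (use assms in auto)
  have "(x + y) powr r = (x + y) * (x + y) powr (r - 1)"
    using s by (simp add: powr_diff)
  also have "\<dots> \<le> x powr r + y powr r"
    using *[of x] *[of y] assms by (simp add: distrib_right)
  finally show ?thesis .
qed

section \<open>Flows and transport costs\<close>

lemma sum_fun_apply: "(\<Sum>i\<in>I. f i) x = (\<Sum>i\<in>I. (f i x :: real))"
  by (induction I rule: infinite_finite_induct) auto

text \<open>The atomic quasi-norm of a free space is an optimal transport cost that is concave in the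
  transported mass. Writing \<^term>\<open>D\<close> for the metric $d^q$, an edge carrying mass $b$ over distance $D$
  has weight $|b|^q D$. The costs with exponents $s = 1$ and $s = p/q$ are the $q$-th power
  of the $q$-norm and the $p$-th power of the $p$-norm.\<close>

definition dirac :: "'a \<Rightarrow> 'a \<Rightarrow> real" where "dirac x v = of_bool (v = x)"

definition single_flow :: "'a \<Rightarrow> 'a \<Rightarrow> real \<Rightarrow> 'a \<times> 'a \<Rightarrow> real" where
  "single_flow x y c = (\<lambda>e. if e = (x, y) then c else 0)"

definition restrict_flow :: "('a \<times> 'a \<Rightarrow> real) \<Rightarrow> ('a \<times> 'a) set \<Rightarrow> 'a \<times> 'a \<Rightarrow> real" where
  "restrict_flow b P = (\<lambda>e. if e \<in> P then b e else 0)"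

text \<open>A flow is a way of writing the measure \<open>bd b\<close> as a combination of
  differences of point masses: \<open>b e\<close> is the coefficient and its sign orients the edge.
  The sum runs over the support, so it is meaningful for finitely supported \<open>b\<close>
  only.\<close>

definition bd :: "('a \<times> 'a \<Rightarrow> real) \<Rightarrow> 'a \<Rightarrow> real" where
  "bd b v = (\<Sum>e | b e \<noteq> 0. b e * (dirac (fst e) v - dirac (snd e) v))"

lemma bd_eq_sum:
  assumes "finite P" "{e. b e \<noteq> 0} \<subseteq> P"
  shows "bd b v = (\<Sum>e\<in>P. b e * (dirac (fst e) v - dirac (snd e) v))"
  unfolding bd_def by (rule sum.mono_neutral_left) (use assms in auto)

locale flow_space = Metric_space M D for M :: "'a set" and D +
  fixes q :: real
  assumes q: "0 < q" "q \<le> 1"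
begin

definition flow :: "('a \<times> 'a \<Rightarrow> real) \<Rightarrow> bool" where
  "flow b \<longleftrightarrow> finite {e. b e \<noteq> 0} \<and> {e. b e \<noteq> 0} \<subseteq> M \<times> M"

definition weight :: "('a \<times> 'a \<Rightarrow> real) \<Rightarrow> 'a \<times> 'a \<Rightarrow> real" where
  "weight b e = \<bar>b e\<bar> powr q * D (fst e) (snd e)"

definition cost :: "real \<Rightarrow> ('a \<times> 'a \<Rightarrow> real) \<Rightarrow> real" where
  "cost s b = (\<Sum>e | b e \<noteq> 0. weight b e powr s)"

text \<open>The finitely supported functions on \<open>M\<close> with total mass zero. Taking them
  as boundaries of flows guarantees that the infimum in \<open>transport\<close> ranges over a
  nonempty set.\<close>

definition balanced :: "('a \<Rightarrow> real) set" where
  "balanced = {bd b |b. flow b}"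

definition transport :: "real \<Rightarrow> ('a \<Rightarrow> real) \<Rightarrow> real" where
  "transport s m = Inf {cost s b |b. flow b \<and> bd b = m}"

lemma weight_nonneg [simp]: "0 \<le> weight b e"
  by (simp add: weight_def)

lemma weight_powr: "weight b e powr s = \<bar>b e\<bar> powr (q * s) * D (fst e) (snd e) powr s"
  by (simp add: weight_def powr_mult powr_powr)

lemma cost_eq_sum:
  assumes "finite P" "{e. b e \<noteq> 0} \<subseteq> P"
  shows "cost s b = (\<Sum>e\<in>P. weight b e powr s)"
  unfolding cost_def by (rule sum.mono_neutral_left) (use assms in \<open>auto simp: weight_def\<close>)

lemma cost_nonneg [simp]: "0 \<le> cost s b"
  by (simp add: cost_def sum_nonneg)

lemma flow_finite: "flow b \<Longrightarrow> finite {e. b e \<noteq> 0}"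
  by (simp add: flow_def)

lemma flow_add: "flow b \<Longrightarrow> flow b' \<Longrightarrow> flow (b + b')"
  unfolding flow_def
  by (rule conjI; rule finite_subset[where B = "{e. b e \<noteq> 0} \<union> {e. b' e \<noteq> 0}"]
      order_trans[where y = "{e. b e \<noteq> 0} \<union> {e. b' e \<noteq> 0}"]) auto

lemma flow_scale: "flow b \<Longrightarrow> flow (c *\<^sub>R b)"
  unfolding flow_def
  by (rule conjI; rule finite_subset[where B = "{e. b e \<noteq> 0}"]
      order_trans[where y = "{e. b e \<noteq> 0}"]) auto

lemma flow_0 [simp]: "flow 0"
  by (simp add: flow_def)

lemma flow_single: "x \<in> M \<Longrightarrow> y \<in> M \<Longrightarrow> flow (single_flow x y c)"
  unfolding flow_def single_flow_def
  by (rule conjI; rule finite_subset[where B = "{(x, y)}"]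
      order_trans[where y = "{(x, y)}"]) auto

lemma flow_restrict: "flow b \<Longrightarrow> flow (restrict_flow b P)"
  unfolding flow_def restrict_flow_def
  by (rule conjI; rule finite_subset[where B = "{e. b e \<noteq> 0}"]
      order_trans[where y = "{e. b e \<noteq> 0}"]) auto

lemma bd_add: assumes "flow b" "flow b'" shows "bd (b + b') = bd b + bd b'"
proof
  fix v
  let ?P = "{e. b e \<noteq> 0} \<union> {e. b' e \<noteq> 0}"
  have P: "finite ?P" using assms by (simp add: flow_def)
  show "bd (b + b') v = (bd b + bd b') v"
    by (simp, subst (1 2 3) bd_eq_sum[OF P]) (auto simp: distrib_right sum.distrib)
qed

lemma bd_scale: assumes "flow b" shows "bd (c *\<^sub>R b) = c *\<^sub>R bd b"
proof
  fix v
  have P: "finite {e. b e \<noteq> 0}" using assms by (simp add: flow_def)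
  show "bd (c *\<^sub>R b) v = (c *\<^sub>R bd b) v"
    by (simp, subst (1 2) bd_eq_sum[OF P]) (auto simp: sum_distrib_left mult.assoc)
qed

lemma bd_0 [simp]: "bd 0 = 0"
  by (simp add: bd_def fun_eq_iff)

lemma bd_single: "bd (single_flow x y c) = c *\<^sub>R (dirac x - dirac y)"
  by (rule ext, subst bd_eq_sum[of "{(x, y)}"]) (auto simp: single_flow_def)

lemma restrict_flow_split: "restrict_flow b P + restrict_flow b (- P) = b"
  by (auto simp: restrict_flow_def fun_eq_iff)

lemma bd_restrict_split:
  "flow b \<Longrightarrow> bd (restrict_flow b P) + bd (restrict_flow b (- P)) = bd b"
  by (metis bd_add flow_restrict restrict_flow_split)

lemma cost_restrict:
  assumes "flow b"
  shows "cost s (restrict_flow b P) = (\<Sum>e | b e \<noteq> 0 \<and> e \<in> P. weight b e powr s)"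
proof -
  have "cost s (restrict_flow b P) = (\<Sum>e | b e \<noteq> 0. weight (restrict_flow b P) e powr s)"
    by (rule cost_eq_sum) (use assms in \<open>auto simp: flow_def restrict_flow_def\<close>)
  also have "\<dots> = (\<Sum>e | b e \<noteq> 0. if e \<in> P then weight b e powr s else 0)"
    by (rule sum.cong) (auto simp: restrict_flow_def weight_def)
  also have "\<dots> = (\<Sum>e | b e \<noteq> 0 \<and> e \<in> P. weight b e powr s)"
    using flow_finite[OF assms] by (simp add: sum.If_cases Int_def)
  finally show ?thesis .
qed

lemma cost_restrict_split:
  assumes "flow b"
  shows "cost s (restrict_flow b P) + cost s (restrict_flow b (- P)) = cost s b"
proof -
  have "cost s b = (\<Sum>e | b e \<noteq> 0. weight b e powr s)" by (simp add: cost_def)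
  also have "{e. b e \<noteq> 0} = {e. b e \<noteq> 0 \<and> e \<in> P} \<union> {e. b e \<noteq> 0 \<and> e \<in> - P}" by auto
  also have "(\<Sum>e\<in>\<dots>. weight b e powr s) = (\<Sum>e | b e \<noteq> 0 \<and> e \<in> P. weight b e powr s)
      + (\<Sum>e | b e \<noteq> 0 \<and> e \<in> - P. weight b e powr s)"
    by (rule sum.union_disjoint) (use flow_finite[OF assms] in auto)
  finally show ?thesis using assms by (simp add: cost_restrict)
qed

lemma cost_scale: 
  assumes "flow b"
  shows "cost s (c *\<^sub>R b) = \<bar>c\<bar> powr (q * s) * cost s b"
  using flow_finite[OF assms]
  by (subst (1 2) cost_eq_sum[of "{e. b e \<noteq> 0}"])
    (auto simp: weight_powr sum_distrib_left abs_mult powr_mult mult_ac)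

lemma cost_single: "cost s (single_flow x y c) = \<bar>c\<bar> powr (q * s) * D x y powr s"
  by (subst cost_eq_sum[of "{(x, y)}"]) (auto simp: single_flow_def weight_powr)

lemma D_powr_triangle:
  assumes "x \<in> M" "y \<in> M" "w \<in> M" "0 < s" "s \<le> 1"
  shows "D x w powr s \<le> D x y powr s + D y w powr s"
proof -
  have "D x w powr s \<le> (D x y + D y w) powr s"
    using assms triangle by (intro powr_mono2) auto
  also have "\<dots> \<le> D x y powr s + D y w powr s"
    using assms by (intro powr_subadditive) auto
  finally show ?thesis .
qed

lemma abs_powr_add_le: "0 < s \<Longrightarrow> s \<le> 1 \<Longrightarrow> \<bar>a + c\<bar> powr (q * s) \<le> \<bar>a\<bar> powr (q * s) + \<bar>c\<bar> powr (q * s)"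
proof -
  assume s: "0 < s" "s \<le> 1"
  have "q * s \<le> 1 * 1" using s q by (intro mult_mono) auto
  then have r: "0 < q * s" "q * s \<le> 1" using s q by auto
  have "\<bar>a + c\<bar> powr (q * s) \<le> (\<bar>a\<bar> + \<bar>c\<bar>) powr (q * s)"
    using r by (intro powr_mono2) auto
  also have "\<dots> \<le> \<bar>a\<bar> powr (q * s) + \<bar>c\<bar> powr (q * s)"
    using r by (intro powr_subadditive) auto
  finally show ?thesis .
qed

lemma cost_add_le:
  assumes "flow b" "flow b'" "0 < s" "s \<le> 1"
  shows "cost s (b + b') \<le> cost s b + cost s b'"
proof -
  let ?P = "{e. b e \<noteq> 0} \<union> {e. b' e \<noteq> 0}"
  have P: "finite ?P" using assms by (simp add: flow_def)
  have "weight (b + b') e powr s \<le> weight b e powr s + weight b' e powr s" for e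
    using mult_right_mono[OF abs_powr_add_le[OF assms(3,4), of "b e" "b' e"],
        of "D (fst e) (snd e) powr s"]
    by (simp add: weight_powr distrib_right)
  then show ?thesis
    by (subst (1 2 3) cost_eq_sum[OF P]) (auto simp: sum.distrib[symmetric] intro!: sum_mono)
qed

lemma balancedI: "flow b \<Longrightarrow> bd b \<in> balanced"
  by (auto simp: balanced_def)

lemma balancedE:
  assumes "m \<in> balanced" obtains b where "flow b" "bd b = m"
  using assms by (auto simp: balanced_def)

lemma subspace_balanced: "subspace balanced"
proof (rule subspaceI)
  show "0 \<in> balanced" using balancedI[OF flow_0] by simp
  show "x + y \<in> balanced" if "x \<in> balanced" "y \<in> balanced" for x y
    using that by (elim balancedE) (metis balancedI bd_add flow_add)
  show "c *\<^sub>R x \<in> balanced" if "x \<in> balanced" for x c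
    using that by (elim balancedE) (metis balancedI bd_scale flow_scale)
qed

lemmas balanced_0 = subspace_0[OF subspace_balanced]
lemmas balanced_add = subspace_add[OF subspace_balanced]
lemmas balanced_diff = subspace_diff[OF subspace_balanced]
lemmas balanced_scale = subspace_scale[OF subspace_balanced]
lemmas balanced_sum = subspace_sum[OF subspace_balanced]

lemma balanced_dirac_diff: "x \<in> M \<Longrightarrow> y \<in> M \<Longrightarrow> dirac x - dirac y \<in> balanced"
  using balancedI[OF flow_single, of x y 1] by (simp add: bd_single)

lemma bd_support: assumes "flow b"
  shows "{v. bd b v \<noteq> 0} \<subseteq> fst ` {e. b e \<noteq> 0} \<union> snd ` {e. b e \<noteq> 0}"
proof -
  have "bd b v = 0" if "v \<notin> fst ` {e. b e \<noteq> 0} \<union> snd ` {e. b e \<noteq> 0}" for v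
    unfolding bd_def using that by (intro sum.neutral) (force simp: dirac_def)
  then show ?thesis by blast
qed

lemma balanced_support:
  assumes "m \<in> balanced" shows "finite {v. m v \<noteq> 0}" "{v. m v \<noteq> 0} \<subseteq> M"
proof -
  obtain b where b: "flow b" "bd b = m" using assms by (rule balancedE)
  have "finite (fst ` {e. b e \<noteq> 0} \<union> snd ` {e. b e \<noteq> 0})" using b by (simp add: flow_def)
  then show "finite {v. m v \<noteq> 0}" using bd_support[OF b(1)] b(2) finite_subset by blast
  show "{v. m v \<noteq> 0} \<subseteq> M" using bd_support[OF b(1)] b unfolding flow_def by force
qed

lemma card_bd_support: assumes "flow b"
  shows "card {v. bd b v \<noteq> 0} \<le> 2 * card {e. b e \<noteq> 0}"
proof -
  let ?S = "{e. b e \<noteq> 0}"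
  have f: "finite ?S" using assms by (simp add: flow_def)
  have "card {v. bd b v \<noteq> 0} \<le> card (fst ` ?S \<union> snd ` ?S)"
    using f bd_support[OF assms] by (intro card_mono) auto
  also have "\<dots> \<le> card (fst ` ?S) + card (snd ` ?S)" by (rule card_Un_le)
  also have "\<dots> \<le> card ?S + card ?S" using f by (intro add_mono card_image_le)
  finally show ?thesis by simp
qed

lemma balanced_sum_zero:
  assumes "m \<in> balanced" "finite A" "{v. m v \<noteq> 0} \<subseteq> A" shows "(\<Sum>v\<in>A. m v) = 0"
proof -
  obtain b where b: "flow b" "bd b = m" using assms(1) by (rule balancedE)
  let ?S = "{e. b e \<noteq> 0}"
  let ?V = "A \<union> fst ` ?S \<union> snd ` ?S"
  have f: "finite ?S" using b by (simp add: flow_def)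
  have fV: "finite ?V" using f assms by simp
  have "(\<Sum>v\<in>A. m v) = (\<Sum>v\<in>?V. m v)"
    by (rule sum.mono_neutral_left) (use assms fV in auto)
  also have "\<dots> = (\<Sum>v\<in>?V. \<Sum>e\<in>?S. b e * (dirac (fst e) v - dirac (snd e) v))"
    by (simp flip: b(2) add: bd_def)
  also have "\<dots> = (\<Sum>e\<in>?S. \<Sum>v\<in>?V. b e * (dirac (fst e) v - dirac (snd e) v))"
    by (rule sum.swap)
  also have "\<dots> = (\<Sum>e\<in>?S. 0)"
  proof (rule sum.cong[OF refl])
    fix e assume e: "e \<in> ?S"
    have "(\<Sum>v\<in>?V. dirac x v) = 1" if "x \<in> ?V" for x :: 'a
      using that fV by (simp add: dirac_def)
    then have "(\<Sum>v\<in>?V. dirac (fst e) v) = 1" "(\<Sum>v\<in>?V. dirac (snd e) v) = 1"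
      using e by blast+
    then show "(\<Sum>v\<in>?V. b e * (dirac (fst e) v - dirac (snd e) v)) = 0"
      by (simp flip: sum_distrib_left add: sum_subtractf)
  qed
  finally show ?thesis by simp
qed

text \<open>The total mass is zero, so subtracting one and the same \<open>dirac a\<close> from
  every atom changes nothing. The point \<open>a\<close> acts as a hub and may lie outside the
  support.\<close>

lemma balanced_expand:
  assumes "m \<in> balanced" "finite A" "{v. m v \<noteq> 0} \<subseteq> A"
  shows "m = (\<Sum>v\<in>A. m v *\<^sub>R (dirac v - dirac a))"
proof
  fix x
  have "(\<Sum>v\<in>A. m v *\<^sub>R (dirac v - dirac a)) x = (\<Sum>v\<in>A. m v * dirac v x) - (\<Sum>v\<in>A. m v) * dirac a x"
    by (simp add: sum_fun_apply right_diff_distrib sum_subtractf sum_distrib_right)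
  also have "\<dots> = (\<Sum>v\<in>A. m v * dirac v x)" using balanced_sum_zero[OF assms] by simp
  also have "\<dots> = m x" proof -
    have "(\<Sum>v\<in>A. m v * dirac v x) = (\<Sum>v\<in>A. if v = x then m v else 0)"
      by (rule sum.cong) (auto simp: dirac_def)
    then show ?thesis using assms by auto
  qed
  finally show "m x = (\<Sum>v\<in>A. m v *\<^sub>R (dirac v - dirac a)) x" by simp
qed

lemma transport_bdd: "bdd_below {cost s b |b. flow b \<and> bd b = m}"
  by (rule bdd_belowI[of _ 0]) auto

lemma transport_le: "flow b \<Longrightarrow> bd b = m \<Longrightarrow> transport s m \<le> cost s b"
  unfolding transport_def by (rule cInf_lower[OF _ transport_bdd]) auto

lemma transport_approx:
  assumes "m \<in> balanced" "transport s m < t"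
  obtains b where "flow b" "bd b = m" "cost s b < t"
proof -
  have "{cost s b |b. flow b \<and> bd b = m} \<noteq> {}" using assms(1) by (auto elim: balancedE)
  then obtain y where "y \<in> {cost s b |b. flow b \<and> bd b = m}" "y < t"
    using assms(2) unfolding transport_def by (meson cInf_lessD)
  then show ?thesis using that by auto
qed

lemma transport_nonneg: "m \<in> balanced \<Longrightarrow> 0 \<le> transport s m"
  unfolding transport_def by (rule cInf_greatest) (auto elim: balancedE)

lemma transport_bd_le: "flow b \<Longrightarrow> transport s (bd b) \<le> cost s b"
  by (rule transport_le) auto

lemma transport_add_le:
  assumes "m \<in> balanced" "m' \<in> balanced" "0 < s" "s \<le> 1"
  shows "transport s (m + m') \<le> transport s m + transport s m'"
proof (rule field_le_epsilon)
  fix e :: real assume e: "e > 0"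
  obtain b where b: "flow b" "bd b = m" "cost s b < transport s m + e/2"
    using transport_approx[OF assms(1), of s "transport s m + e/2"] e by auto
  obtain b' where b': "flow b'" "bd b' = m'" "cost s b' < transport s m' + e/2"
    using transport_approx[OF assms(2), of s "transport s m' + e/2"] e by auto
  have "transport s (m + m') \<le> cost s (b + b')"
    using b b' by (intro transport_le) (auto simp: flow_add bd_add)
  also have "\<dots> \<le> cost s b + cost s b'" using b b' assms by (intro cost_add_le) auto
  finally show "transport s (m + m') \<le> transport s m + transport s m' + e"
    using b b' by simp
qed

lemma transport_scale_le:
  assumes "m \<in> balanced"
  shows "transport s (c *\<^sub>R m) \<le> \<bar>c\<bar> powr (q * s) * transport s m"
proof (rule field_le_epsilon)
  fix e :: real assume e: "e > 0"
  let ?k = "\<bar>c\<bar> powr (q * s)"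
  \<comment> \<open>The added 1 keeps the denominator positive when \<open>c = 0\<close>.\<close>
  have e': "0 < e / (?k + 1)" using e by (simp add: add_nonneg_pos)
  obtain b where b: "flow b" "bd b = m" "cost s b < transport s m + e / (?k + 1)"
    using transport_approx[OF assms(1), of s "transport s m + e / (?k + 1)"] e' by auto
  have "transport s (c *\<^sub>R m) \<le> cost s (c *\<^sub>R b)"
    using b by (intro transport_le) (auto simp: flow_scale bd_scale)
  also have "\<dots> = ?k * cost s b" using b by (simp add: cost_scale)
  also have "\<dots> \<le> ?k * (transport s m + e / (?k + 1))" using b by (intro mult_left_mono) auto
  also have "\<dots> = ?k * transport s m + e * (?k / (?k + 1))" by (simp add: distrib_left)
  also have "?k / (?k + 1) \<le> 1" by (simp add: divide_le_eq add_nonneg_pos)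
  then have "e * (?k / (?k + 1)) \<le> e" using e mult_left_le by fastforce
  finally show "transport s (c *\<^sub>R m) \<le> ?k * transport s m + e" by simp
qed

lemma transport_0 [simp]: "transport s 0 = 0"
  using transport_bd_le[OF flow_0, of s] transport_nonneg[OF balanced_0, of s]
  by (simp add: cost_def)

lemma transport_scale:
  assumes "m \<in> balanced"
  shows "transport s (c *\<^sub>R m) = \<bar>c\<bar> powr (q * s) * transport s m"
proof (cases "c = 0")
  case False
  \<comment> \<open>The reverse inequality is \<open>transport_scale_le\<close> for the inverse
    scalar.\<close>
  have "transport s m = transport s (inverse c *\<^sub>R (c *\<^sub>R m))" using False by simp
  also have "\<dots> \<le> \<bar>inverse c\<bar> powr (q * s) * transport s (c *\<^sub>R m)"
    using assms by (intro transport_scale_le balanced_scale)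
  finally have "\<bar>c\<bar> powr (q * s) * transport s m \<le>
      \<bar>c\<bar> powr (q * s) * (\<bar>inverse c\<bar> powr (q * s) * transport s (c *\<^sub>R m))"
    by (intro mult_left_mono) auto
  also have "\<dots> = (\<bar>c\<bar> * \<bar>inverse c\<bar>) powr (q * s) * transport s (c *\<^sub>R m)"
    by (simp add: powr_mult)
  also have "\<bar>c\<bar> * \<bar>inverse c\<bar> = 1" using False by (simp flip: abs_mult)
  finally have "\<bar>c\<bar> powr (q * s) * transport s m \<le> transport s (c *\<^sub>R m)"
    by (simp only: powr_one_eq_one mult_1)
  then show ?thesis using transport_scale_le[OF assms, of s c] by (rule antisym[rotated])
qed simp

lemma transport_minus: "m \<in> balanced \<Longrightarrow> transport s (- m) = transport s m"
  using transport_scale[of m s "-1"] by simp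

lemma transport_diff_le:
  assumes "m \<in> balanced" "m' \<in> balanced" "0 < s" "s \<le> 1"
  shows "transport s (m - m') \<le> transport s m + transport s m'"
  using transport_add_le[OF assms(1) _ assms(3,4), of "- m'"] assms
    transport_minus[OF assms(2)] balanced_scale[OF assms(2), of "-1"] by simp

lemma transport_sum_le:
  assumes "finite I" "\<And>i. i \<in> I \<Longrightarrow> m i \<in> balanced" "0 < s" "s \<le> 1"
  shows "transport s (\<Sum>i\<in>I. m i) \<le> (\<Sum>i\<in>I. transport s (m i))"
  using assms(1,2)
proof (induction I rule: finite_induct)
  case (insert i I)
  have "transport s (m i + (\<Sum>i\<in>I. m i)) \<le> transport s (m i) + transport s (\<Sum>i\<in>I. m i)"
    using insert assms by (intro transport_add_le balanced_sum) auto
  moreover have "transport s (\<Sum>i\<in>I. m i) \<le> (\<Sum>i\<in>I. transport s (m i))"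
    using insert by blast
  ultimately show ?case
    unfolding sum.insert[OF insert(1,2)] by linarith
qed (simp only: sum.empty transport_0)

lemma transport_dirac_le:
  assumes "x \<in> M" "y \<in> M"
  shows "transport s (c *\<^sub>R (dirac x - dirac y)) \<le> \<bar>c\<bar> powr (q * s) * D x y powr s"
  using transport_le[OF flow_single[OF assms, of c] bd_single, of s] by (simp add: cost_single)

end

section \<open>Flows with few edges\<close>

lemma sum_powr_le:
  fixes c :: "'b \<Rightarrow> real"
  assumes "finite P" "real (card P) \<le> n" "0 < n" "\<And>e. e \<in> P \<Longrightarrow> 0 \<le> c e" "sum c P \<le> t" "0 < t"
    and r: "0 < r" "r \<le> 1"
  shows "(\<Sum>e\<in>P. c e powr r) \<le> n * (t / n) powr r"
proof -
  \<comment> \<open>Jensen's inequality, with bounds \<open>n\<close> and \<open>t\<close> in place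
    of the exact number and sum of the terms. The tangent at the mean \<open>u\<close> works because
    its constant term \<open>(1 - r) * u powr r\<close> and its slope are both nonnegative, so
    raising count and sum to their bounds only increases the estimate.\<close>
  define u where "u = t / n"
  have u: "0 < u" using assms by (simp add: u_def)
  have "(\<Sum>e\<in>P. c e powr r) \<le> (\<Sum>e\<in>P. u powr r + r * u powr (r - 1) * (c e - u))"
    using assms u by (intro sum_mono powr_le_tangent) auto
  also have "\<dots> = card P * (u powr r - r * u powr (r - 1) * u) + r * u powr (r - 1) * sum c P"
    by (simp add: sum.distrib sum_subtractf right_diff_distrib flip: sum_distrib_left)
  also have "u powr (r - 1) * u = u powr r" using u by (simp add: powr_diff)
  then have "u powr r - r * u powr (r - 1) * u = (1 - r) * u powr r" by (simp add: algebra_simps)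
  also have "card P * ((1 - r) * u powr r) + r * u powr (r - 1) * sum c P
      \<le> n * ((1 - r) * u powr r) + r * u powr (r - 1) * t"
    using assms by (intro add_mono mult_right_mono mult_left_mono) auto
  also have "t = n * u" using assms by (simp add: u_def)
  also have "r * u powr (r - 1) * (n * u) = n * r * u powr r"
    using u by (simp add: powr_diff)
  also have "n * ((1 - r) * u powr r) + n * r * u powr r = n * u powr r"
    by (simp add: algebra_simps)
  finally show ?thesis by (simp add: u_def)
qed

text \<open>More edges than vertices force a cycle; this is a dimension count.\<close>

lemma exists_cycle:
  fixes P :: "('a \<times> 'a) set"
  assumes "finite P" "card (fst ` P \<union> snd ` P) < card P"
  obtains \<beta> where "\<beta> \<noteq> 0" "{e. \<beta> e \<noteq> 0} \<subseteq> P" "bd \<beta> = 0"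
proof -
  define \<phi> :: "'a \<times> 'a \<Rightarrow> 'a \<Rightarrow> real" where "\<phi> e = dirac (fst e) - dirac (snd e)" for e
  have bd: "bd \<beta> = (\<Sum>e\<in>P. \<beta> e *\<^sub>R \<phi> e)" if "{e. \<beta> e \<noteq> 0} \<subseteq> P" for \<beta>
    using bd_eq_sum[OF assms(1) that] by (auto simp: fun_eq_iff sum_fun_apply \<phi>_def)
  let ?V = "dirac ` (fst ` P \<union> snd ` P)"
  have fV: "finite ?V" using assms by simp
  have sub: "\<phi> ` P \<subseteq> span ?V" 
  proof
    fix y assume "y \<in> \<phi> ` P"
    then obtain e where "e \<in> P" "y = dirac (fst e) - dirac (snd e)" by (auto simp: \<phi>_def)
    then show "y \<in> span ?V" by (metis UnI1 UnI2 imageI span_base span_diff)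
  qed
  have "\<exists>\<beta>. \<beta> \<noteq> 0 \<and> {e. \<beta> e \<noteq> 0} \<subseteq> P \<and> (\<Sum>e\<in>P. \<beta> e *\<^sub>R \<phi> e) = 0"
  \<comment> \<open>Linear dependence of the image of \<open>\<phi>\<close> does not see repeated
    values. Two distinct edges with equal value give a cycle by their difference; otherwise the
    dimension count applies to the image.\<close>
  proof (cases "inj_on \<phi> P")
    case False
    then obtain e e' where e: "e \<in> P" "e' \<in> P" "e \<noteq> e'" "\<phi> e = \<phi> e'" by (auto simp: inj_on_def)
    define \<beta> :: "'a \<times> 'a \<Rightarrow> real" where "\<beta> x = of_bool (x = e) - of_bool (x = e')" for x
    have "(\<Sum>x\<in>P. \<beta> x *\<^sub>R \<phi> x) = (\<Sum>x\<in>{e, e'}. \<beta> x *\<^sub>R \<phi> x)"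
      by (rule sum.mono_neutral_right) (use e assms in \<open>auto simp: \<beta>_def\<close>)
    also have "\<dots> = 0" using e by (simp add: \<beta>_def)
    finally have "(\<Sum>x\<in>P. \<beta> x *\<^sub>R \<phi> x) = 0" .
    moreover have "\<beta> e = 1" using e by (simp add: \<beta>_def)
    then have "\<beta> \<noteq> 0" by auto
    moreover have "{x. \<beta> x \<noteq> 0} \<subseteq> P" using e by (auto simp: \<beta>_def split: if_splits)
    ultimately show ?thesis by blast
  next
    case True
    have "card ?V \<le> card (fst ` P \<union> snd ` P)" using assms by (intro card_image_le) simp
    then have "card ?V < card (\<phi> ` P)" using assms True by (simp add: card_image)
    then have "dependent (\<phi> ` P)" using independent_span_bound[OF fV _ sub] by linarith
    then obtain u where u: "\<exists>v\<in>\<phi> ` P. u v \<noteq> 0" "(\<Sum>v\<in>\<phi> ` P. u v *\<^sub>R v) = 0"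
      using dependent_finite[of "\<phi> ` P"] assms(1) by auto
    define \<beta> where "\<beta> x = (if x \<in> P then u (\<phi> x) else 0)" for x
    have "(\<Sum>x\<in>P. \<beta> x *\<^sub>R \<phi> x) = (\<Sum>v\<in>\<phi> ` P. u v *\<^sub>R v)"
      using True by (simp add: sum.reindex \<beta>_def)
    moreover have "\<beta> \<noteq> 0" using u(1) by (auto simp: \<beta>_def fun_eq_iff)
    ultimately show ?thesis using u(2) by (intro exI[of _ \<beta>]) (auto simp: \<beta>_def)
  qed
  then show ?thesis using that bd by metis
qed

context flow_space
begin

text \<open>A flow containing a cycle can be improved by pushing mass around the cycle in the direction
  of non-positive derivative until an edge vanishes, because the cost is concave.\<close>

lemma cancel_cycle:
  assumes b: "flow b" and s: "0 < s" "s \<le> 1"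
    and loop: "\<And>e. b e \<noteq> 0 \<Longrightarrow> fst e \<noteq> snd e"
    and \<beta>: "\<beta> \<noteq> 0" "{e. \<beta> e \<noteq> 0} \<subseteq> {e. b e \<noteq> 0}" "bd \<beta> = 0"
  obtains b' where "flow b'" "bd b' = bd b" "cost s b' \<le> cost s b"
    "card {e. b' e \<noteq> 0} < card {e. b e \<noteq> 0}"
proof -
  let ?P = "{e. b e \<noteq> 0}"
  define r where "r = q * s"
  have r: "0 < r" "r \<le> 1" using q s mult_mono[of q 1 s 1] by (auto simp: r_def)
  have P: "finite ?P" "?P \<subseteq> M \<times> M" using b by (auto simp: flow_def)
  define w where "w e = D (fst e) (snd e) powr s" for e
  have w: "w e > 0" if "e \<in> ?P" for e
    using that loop[of e] P(2) by (force simp: w_def)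
  \<comment> \<open>\<open>S \<gamma>\<close> is the derivative of the cost of
    \<open>b + t *\<^sub>R \<gamma>\<close> at \<open>t = 0\<close>. It is odd in
    \<open>\<gamma>\<close>, so it is at most 0 for one of the two directions around the
    cycle.\<close>
  define S where "S \<gamma> = (\<Sum>e\<in>?P. w e * (r * \<bar>b e\<bar> powr (r - 1) * (sgn (b e) * \<gamma> e)))" for \<gamma>
  have S_minus: "S (- \<gamma>) = - S \<gamma>" for \<gamma> by (simp add: S_def sum_negf)
  obtain \<gamma> where \<gamma>: "\<gamma> = \<beta> \<or> \<gamma> = - \<beta>" "S \<gamma> \<le> 0" using S_minus[of \<beta>] by (metis linear neg_le_0_iff_le)
  have f\<beta>: "flow \<beta>" using \<beta>(2) P finite_subset unfolding flow_def by blast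
  have \<gamma>': "\<gamma> \<noteq> 0" "{e. \<gamma> e \<noteq> 0} \<subseteq> ?P" "bd \<gamma> = 0" "flow \<gamma>"
    using \<gamma>(1) \<beta> f\<beta> bd_scale[OF f\<beta>, of "-1"] flow_scale[OF f\<beta>, of "-1"] by auto
  \<comment> \<open>If no edge lost mass, all summands of \<open>S \<gamma>\<close> would be
    nonnegative, hence zero, and \<open>\<gamma>\<close> would vanish.\<close>
  have "\<exists>e\<in>?P. b e * \<gamma> e < 0"
  proof (rule ccontr)
    assume "\<not> ?thesis"
    then have nn: "0 \<le> sgn (b e) * \<gamma> e" if "e \<in> ?P" for e
    proof -
      have "0 \<le> b e * \<gamma> e" using \<open>\<not> (\<exists>e\<in>?P. b e * \<gamma> e < 0)\<close> that by (metis not_less)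
      then show ?thesis using that by (cases "b e > 0") (auto simp: zero_le_mult_iff)
    qed
    have "0 \<le> w e * (r * \<bar>b e\<bar> powr (r - 1) * (sgn (b e) * \<gamma> e))" if "e \<in> ?P" for e
      using nn[OF that] w[OF that] r by simp
    then have zero: "w e * (r * \<bar>b e\<bar> powr (r - 1) * (sgn (b e) * \<gamma> e)) = 0" if "e \<in> ?P" for e
      using \<gamma>(2) sum_nonneg_eq_0_iff[OF P(1)] sum_nonneg[of ?P] that unfolding S_def
      by (metis (mono_tags, lifting) antisym)
    have "\<gamma> e = 0" if "e \<in> ?P" for e
      using zero[OF that] w[OF that] r that by (auto simp: sgn_zero_iff)
    then have "\<gamma> = 0" using \<gamma>'(2) by (auto simp: fun_eq_iff)
    then show False using \<gamma>'(1) by simp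
  qed
  then have T: "finite {e \<in> ?P. b e * \<gamma> e < 0}" "{e \<in> ?P. b e * \<gamma> e < 0} \<noteq> {}" using P by auto
  obtain e0 where e0: "e0 \<in> ?P" "b e0 * \<gamma> e0 < 0"
    and e0_min: "\<And>e. e \<in> ?P \<Longrightarrow> b e * \<gamma> e < 0 \<Longrightarrow> - b e0 / \<gamma> e0 \<le> - b e / \<gamma> e"
    using arg_min_if_finite[OF T, of "\<lambda>e. - b e / \<gamma> e"]
    by (smt (verit, ccfv_threshold) mem_Collect_eq)
  \<comment> \<open>The first time at which an edge of \<open>b + t *\<^sub>R \<gamma>\<close>
    becomes empty. Up to then no edge changes sign, so the modulus of the mass on each edge is
    affine in \<open>t\<close> and the tangent bound applies.\<close>
  define t where "t = - b e0 / \<gamma> e0"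
  have t: "t > 0" using e0 by (auto simp: t_def mult_less_0_iff divide_simps)
  define b' where "b' = b + t *\<^sub>R \<gamma>"
  have fb': "flow b'" using b \<gamma>'(4) by (simp add: b'_def flow_add flow_scale)
  have bd': "bd b' = bd b"
    using b \<gamma>' unfolding b'_def by (subst bd_add) (auto simp: flow_scale bd_scale)
  have "b' e0 = 0" using e0 by (auto simp: b'_def t_def)
  then have sub: "{e. b' e \<noteq> 0} \<subset> ?P" using e0 \<gamma>'(2) by (auto simp: b'_def)
  have abs': "\<bar>b' e\<bar> = \<bar>b e\<bar> + t * (sgn (b e) * \<gamma> e) \<and> 0 \<le> \<bar>b e\<bar> + t * (sgn (b e) * \<gamma> e)"
    if e: "e \<in> ?P" for e
  proof (cases "b e * \<gamma> e < 0")
    case True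
    have le: "t \<le> - b e / \<gamma> e" using e0_min[OF e True] by (simp add: t_def)
    show ?thesis
    proof (cases "b e > 0")
      case True
      then have "\<gamma> e < 0" using \<open>b e * \<gamma> e < 0\<close> by (simp add: mult_less_0_iff)
      then have "b e + t * \<gamma> e \<ge> 0" using le by (simp add: field_simps)
      then show ?thesis using True by (simp add: b'_def)
    next
      case False
      then have "b e < 0" using e by simp
      then have "\<gamma> e > 0" using \<open>b e * \<gamma> e < 0\<close> by (simp add: mult_less_0_iff)
      then have "b e + t * \<gamma> e \<le> 0" using le by (simp add: field_simps)
      then show ?thesis using \<open>b e < 0\<close> by (simp add: b'_def)
    qed
  next
    case False
    show ?thesis
    proof (cases "b e > 0")
      case True
      then have "\<gamma> e \<ge> 0" using False by (simp add: not_less zero_le_mult_iff)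
      then have "b e + t * \<gamma> e \<ge> 0" using True t by simp
      then show ?thesis using True by (simp add: b'_def)
    next
      case f: False
      then have "b e < 0" using e by simp
      then have "\<gamma> e \<le> 0" using False by (simp add: not_less zero_le_mult_iff)
      then have "t * \<gamma> e \<le> 0" using t by (simp add: mult_nonneg_nonpos)
      then have "b e + t * \<gamma> e \<le> 0" using \<open>b e < 0\<close> by simp
      then show ?thesis using \<open>b e < 0\<close> by (simp add: b'_def)
    qed
  qed
  have "cost s b' = (\<Sum>e\<in>?P. \<bar>b' e\<bar> powr r * w e)"
    using cost_eq_sum[OF P(1), of b' s] sub by (simp add: weight_powr r_def w_def psubset_imp_subset)
  also have "\<dots> \<le> (\<Sum>e\<in>?P. (\<bar>b e\<bar> powr r + r * \<bar>b e\<bar> powr (r - 1) * (t * (sgn (b e) * \<gamma> e))) * w e)"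
  proof (intro sum_mono mult_right_mono)
    fix e assume e: "e \<in> ?P"
    show "\<bar>b' e\<bar> powr r \<le> \<bar>b e\<bar> powr r + r * \<bar>b e\<bar> powr (r - 1) * (t * (sgn (b e) * \<gamma> e))"
      using powr_le_tangent[of "\<bar>b e\<bar>" "\<bar>b' e\<bar>" r] abs'[OF e] e r by simp
  qed (use w in \<open>auto intro: less_imp_le\<close>)
  also have "\<dots> = (\<Sum>e\<in>?P. \<bar>b e\<bar> powr r * w e) + t * S \<gamma>"
    unfolding S_def by (simp add: sum.distrib sum_distrib_left algebra_simps)
  also have "\<dots> \<le> (\<Sum>e\<in>?P. \<bar>b e\<bar> powr r * w e)" using t \<gamma>(2) by (simp add: mult_nonneg_nonpos)
  also have "\<dots> = cost s b" by (simp add: cost_def weight_powr r_def w_def)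
  finally have "cost s b' \<le> cost s b" .
  moreover have "card {e. b' e \<noteq> 0} < card ?P" using sub P(1) by (rule psubset_card_mono[rotated])
  ultimately show ?thesis using that fb' bd' by blast
qed

text \<open>A vertex of degree at most two carrying no mass can be bypassed, by the triangle inequality.\<close>

lemma bypass_vertex:
  assumes b: "flow b" and s: "0 < s" "s \<le> 1"
    and loop: "\<And>e. b e \<noteq> 0 \<Longrightarrow> fst e \<noteq> snd e"
    and x: "bd b x = 0"
    and E: "E = {e. b e \<noteq> 0 \<and> (fst e = x \<or> snd e = x)}" "E \<noteq> {}" "card E \<le> 2"
  obtains b' where "flow b'" "bd b' = bd b" "cost s b' \<le> cost s b"
    "card {e. b' e \<noteq> 0} < card {e. b e \<noteq> 0}"
proof -
  let ?P = "{e. b e \<noteq> 0}"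
  have P: "finite ?P" "?P \<subseteq> M \<times> M" using b by (auto simp: flow_def)
  have fE: "finite E" using P E by (auto intro: finite_subset)
  \<comment> \<open>All edges at \<open>x\<close> are read as leaving \<open>x\<close>:
    \<open>other e\<close> is the far end and \<open>\<sigma> e\<close> the sign that corrects the
    orientation.\<close>
  define other where "other e = (if fst e = x then snd e else fst e)" for e
  define \<sigma> :: "'a \<times> 'a \<Rightarrow> real" where "\<sigma> e = (if fst e = x then 1 else -1)" for e
  have orient: "dirac (fst e) - dirac (snd e) = \<sigma> e *\<^sub>R (dirac x - dirac (other e))"
    "D (fst e) (snd e) = D x (other e)" "other e \<in> M" "x \<in> M" "b e \<noteq> 0"
    "dirac (other e) x = 0" if "e \<in> E" for e
    using that P(2) loop[of e] unfolding E(1)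
    by (auto simp: other_def \<sigma>_def dirac_def commute fun_eq_iff)
  have \<sigma>: "\<bar>\<sigma> e\<bar> = 1" for e by (simp add: \<sigma>_def)
  have bdx: "(\<Sum>e\<in>E. \<sigma> e * b e) = 0"
  proof -
    have "bd b x = (\<Sum>e\<in>E. b e * (dirac (fst e) x - dirac (snd e) x))"
      unfolding bd_def by (rule sum.mono_neutral_right) (use P E in \<open>auto simp: dirac_def\<close>)
    also have "\<dots> = (\<Sum>e\<in>E. \<sigma> e * b e)"
    proof (rule sum.cong[OF refl])
      fix e assume e: "e \<in> E"
      have "dirac (fst e) x - dirac (snd e) x = \<sigma> e * (dirac x x - dirac (other e) x)"
        using fun_cong[OF orient(1)[OF e], of x] by simp
      then show "b e * (dirac (fst e) x - dirac (snd e) x) = \<sigma> e * b e"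
        using orient(6)[OF e] by (simp add: dirac_def)
    qed
    finally show ?thesis using x by simp
  qed
  obtain e where e: "e \<in> E" using E(2) by blast
  \<comment> \<open>A single edge at \<open>x\<close> would leave its nonzero mass there. So
    \<open>x\<close> has exactly two edges, and what comes in through one goes out through the
    other.\<close>
  have "E \<noteq> {e}" using bdx orient(5)[OF e] \<sigma>[of e] by auto
  then obtain e' where e': "e' \<in> E" "e' \<noteq> e" using e by blast
  have "card {e, e'} = card E"
    using E(3) e e' fE card_mono[of E "{e, e'}"] by (simp add: card_insert_if)
  then have Eee: "E = {e, e'}" using card_subset_eq[OF fE, of "{e, e'}"] e e' by simp
  have eq: "\<sigma> e' * b e' = - (\<sigma> e * b e)" using bdx e'(2) by (simp add: Eee)
  then have abs_eq: "\<bar>b e'\<bar> = \<bar>b e\<bar>" by (metis \<sigma> abs_minus_cancel abs_mult mult_1)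
  define y z where "y = other e" and "z = other e'"
  define c where "c = \<sigma> e * b e"
  have yz: "y \<in> M" "z \<in> M" "x \<in> M" using orient e e' by (auto simp: y_def z_def)
  \<comment> \<open>The path through \<open>x\<close> is replaced by a direct edge between its ends.
    If that edge is already present the masses add, which \<open>cost_add_le\<close> tolerates;
    \<open>y = z\<close> gives a loop of length 0.\<close>
  define b' where "b' = restrict_flow b (- E) + single_flow z y c"
  have fb': "flow b'" unfolding b'_def using b yz by (intro flow_add flow_restrict flow_single)
  have supE: "{e. restrict_flow b E e \<noteq> 0} \<subseteq> E" by (auto simp: restrict_flow_def)
  have "bd (restrict_flow b E) = c *\<^sub>R (dirac z - dirac y)"
  proof
    fix v
    have "bd (restrict_flow b E) v = (\<Sum>e\<in>E. b e * (dirac (fst e) v - dirac (snd e) v))"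
      by (subst bd_eq_sum[OF fE supE]) (simp add: restrict_flow_def)
    also have "\<dots> = (\<Sum>e\<in>E. \<sigma> e * b e * (dirac x v - dirac (other e) v))"
    proof (rule sum.cong[OF refl])
      fix e assume e: "e \<in> E"
      have "dirac (fst e) v - dirac (snd e) v = \<sigma> e * (dirac x v - dirac (other e) v)"
        using fun_cong[OF orient(1)[OF e], of v] by simp
      then show "b e * (dirac (fst e) v - dirac (snd e) v)
          = \<sigma> e * b e * (dirac x v - dirac (other e) v)" by simp
    qed
    also have "\<dots> = c * (dirac z v - dirac y v)"
    proof -
      have "(\<Sum>e\<in>E. \<sigma> e * b e * (dirac x v - dirac (other e) v)) =
          \<sigma> e * b e * (dirac x v - dirac y v) + \<sigma> e' * b e' * (dirac x v - dirac z v)"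
        using e'(2) by (simp add: Eee y_def z_def)
      also have "\<dots> = c * (dirac z v - dirac y v)"
        unfolding eq c_def by (simp add: algebra_simps)
      finally show ?thesis .
    qed
    finally show "bd (restrict_flow b E) v = (c *\<^sub>R (dirac z - dirac y)) v" by simp
  qed
  then have bd': "bd b' = bd b"
    unfolding b'_def using bd_restrict_split[OF b, of E] b yz
    by (subst bd_add) (auto simp: flow_restrict flow_single bd_single add.commute)
  have costE: "cost s (restrict_flow b E) = (\<Sum>e\<in>E. weight b e powr s)"
    by (subst cost_restrict[OF b]) (auto simp: E(1) intro: sum.cong)
  have "\<bar>c\<bar> = \<bar>b e\<bar>" by (simp add: c_def abs_mult \<sigma>)
  then have "cost s (single_flow z y c) \<le> cost s (restrict_flow b E)"
    using e'(2) mult_left_mono[OF D_powr_triangle[OF yz(2,3,1) s], of "\<bar>b e\<bar> powr (q * s)"]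
      orient(2)[OF e] orient(2)[OF e'(1)]
    unfolding costE by (simp add: Eee cost_single weight_powr abs_eq y_def z_def
        algebra_simps commute[of "other e'" x])
  then have "cost s b' \<le> cost s b"
    using cost_add_le[OF flow_restrict[OF b] flow_single[OF yz(2,1)] s, of "- E" c]
      cost_restrict_split[OF b, of s E] unfolding b'_def by linarith
  moreover have "card {e. b' e \<noteq> 0} < card ?P"
  proof -
    have EP: "E \<subseteq> ?P" by (auto simp: E)
    have "{e. b' e \<noteq> 0} \<subseteq> insert (z, y) (?P - E)"
      by (auto simp: b'_def restrict_flow_def single_flow_def split: if_splits)
    then have "card {e. b' e \<noteq> 0} \<le> card (insert (z, y) (?P - E))"
      using P by (intro card_mono) auto
    also have "\<dots> \<le> Suc (card (?P - E))" using P by (simp add: card_insert_if)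
    also have "card (?P - E) = card ?P - 2"
      using EP fE e'(2) by (simp add: card_Diff_subset Eee)
    also have "2 \<le> card ?P" using card_mono[OF P(1) EP] e'(2) by (simp add: Eee)
    then have "Suc (card ?P - 2) < card ?P" by simp
    finally show ?thesis .
  qed
  ultimately show ?thesis using that fb' bd' by blast
qed

text \<open>A flow with the fewest edges, among those with this boundary and no larger cost, has no
  loops, at most as many edges as vertices (else a cycle could be cancelled) and degree at least 3
  at each vertex without mass (else it could be bypassed). With \<open>P\<close> edges,
  \<open>V\<close> vertices and \<open>X\<close> atoms, \<open>P \<le> V\<close> and
  \<open>3 * (V - X) \<le> 2 * P\<close>, hence \<open>P \<le> 3 * X\<close>.\<close>

lemma sparse_flow:
  assumes b: "flow b" and s: "0 < s" "s \<le> 1"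
  obtains b' where "flow b'" "bd b' = bd b" "cost s b' \<le> cost s b"
    "card {e. b' e \<noteq> 0} \<le> 3 * card {v. bd b v \<noteq> 0}"
proof -
  let ?Q = "\<lambda>b'. flow b' \<and> bd b' = bd b \<and> cost s b' \<le> cost s b"
  \<comment> \<open>The number of edges is minimised and not the cost, because a cost minimiser need
    not exist.\<close>
  obtain b' where b': "?Q b'"
    and least: "\<And>b''. ?Q b'' \<Longrightarrow> card {e. b' e \<noteq> 0} \<le> card {e. b'' e \<noteq> 0}"
    using ex_has_least_nat[of ?Q b "\<lambda>b. card {e. b e \<noteq> 0}"] b by blast
  have fb': "flow b'" using b' by simp
  let ?P = "{e. b' e \<noteq> 0}"
  have P: "finite ?P" "?P \<subseteq> M \<times> M" using b' by (auto simp: flow_def)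
  have minimal: False if "flow b''" "bd b'' = bd b'" "cost s b'' \<le> cost s b'"
    "card {e. b'' e \<noteq> 0} < card ?P" for b''
    using least[of b''] that b' by auto
  have loop: "fst e \<noteq> snd e" if e: "b' e \<noteq> 0" for e
  proof
    assume eq: "fst e = snd e"
    let ?b = "restrict_flow b' (- {e})"
    have sup: "{x. restrict_flow b' {e} x \<noteq> 0} \<subseteq> {e}" by (auto simp: restrict_flow_def)
    have "bd (restrict_flow b' {e}) = 0"
      by (rule ext, subst bd_eq_sum[OF _ sup]) (auto simp: eq)
    then have "bd ?b = bd b'" using bd_restrict_split[OF fb', of "{e}"] by simp
    moreover have "cost s ?b \<le> cost s b'"
      using cost_restrict_split[OF fb', of s "{e}"] cost_nonneg[of s "restrict_flow b' {e}"] by linarith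
    moreover have "{x. ?b x \<noteq> 0} \<subset> ?P" using e by (auto simp: restrict_flow_def)
    then have "card {x. ?b x \<noteq> 0} < card ?P" using P(1) psubset_card_mono by blast
    ultimately show False using minimal[of ?b] flow_restrict[OF fb'] by blast
  qed
  let ?V = "fst ` ?P \<union> snd ` ?P"
  have fV: "finite ?V" using P by simp
  have PV: "card ?P \<le> card ?V"
  proof (rule ccontr)
    assume "\<not> ?thesis"
    then obtain \<beta> where "\<beta> \<noteq> 0" "{e. \<beta> e \<noteq> 0} \<subseteq> ?P" "bd \<beta> = 0"
      using exists_cycle[OF P(1)] by (metis not_le)
    then show False using cancel_cycle[OF fb' s loop] minimal by metis
  qed
  let ?X = "{v. bd b v \<noteq> 0}"
  have X: "?X \<subseteq> ?V" using bd_support[OF fb'] b' by simp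
  have deg: "3 \<le> card {e \<in> ?P. fst e = x \<or> snd e = x}" if x: "x \<in> ?V - ?X" for x
  proof (rule ccontr)
    assume *: "\<not> ?thesis"
    have "bd b' x = 0" using x b' by simp
    moreover obtain e where "e \<in> ?P" "fst e = x \<or> snd e = x" using x by blast
    then have "{e \<in> ?P. fst e = x \<or> snd e = x} \<noteq> {}" by blast
    ultimately show False
      using bypass_vertex[OF fb' s loop, of x "{e \<in> ?P. fst e = x \<or> snd e = x}"] * minimal
      by (auto simp: not_le)
  qed
  have "3 * card (?V - ?X) \<le> (\<Sum>x\<in>?V - ?X. card {e \<in> ?P. fst e = x \<or> snd e = x})"
    using sum_bounded_below[of "?V - ?X" 3, OF deg] by (simp add: mult.commute)
  also have "\<dots> \<le> (\<Sum>x\<in>?V. card {e \<in> ?P. fst e = x \<or> snd e = x})"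
    using fV by (intro sum_mono2) auto
  also have "\<dots> = (\<Sum>x\<in>?V. \<Sum>e\<in>?P. if fst e = x \<or> snd e = x then 1 else 0)"
    using P by (intro sum.cong refl) (simp add: sum.If_cases Int_def)
  also have "\<dots> = (\<Sum>e\<in>?P. \<Sum>x\<in>?V. if fst e = x \<or> snd e = x then 1 else 0)" by (rule sum.swap)
  also have "\<dots> \<le> (\<Sum>e\<in>?P. 2)"
  proof (intro sum_mono)
    fix e
    have "(\<Sum>x\<in>?V. if fst e = x \<or> snd e = x then 1 else 0) = card {x \<in> ?V. fst e = x \<or> snd e = x}"
      using fV by (simp add: sum.If_cases Int_def)
    also have "\<dots> \<le> card {fst e, snd e}" by (intro card_mono) auto
    also have "\<dots> \<le> 2" by (simp add: card_insert_if)
    finally show "(\<Sum>x\<in>?V. if fst e = x \<or> snd e = x then 1 else 0) \<le> (2::nat)" .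
  qed
  finally have "3 * card (?V - ?X) \<le> 2 * card ?P" by simp
  moreover have "card (?V - ?X) = card ?V - card ?X"
    using X fV by (intro card_Diff_subset) (auto intro: finite_subset)
  ultimately have "card ?P \<le> 3 * card ?X" using PV by linarith
  then show ?thesis using that b' by blast
qed

text \<open>For measures with few atoms smallness passes from exponent 1 to \<open>\<alpha>\<close>:
  a nearly optimal flow for exponent 1 may be taken with at most \<open>3 * n\<close> edges, and the
  worst case is then an even spread of the cost over them.\<close>

lemma transport_le_of_transport_1:
  assumes "m \<in> balanced" "real (card {v. m v \<noteq> 0}) \<le> n" "0 < n" "transport 1 m < t"
    and \<alpha>: "0 < \<alpha>" "\<alpha> \<le> 1"
  shows "transport \<alpha> m \<le> 3 * n * (t / (3 * n)) powr \<alpha>"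
proof -
  obtain b where b: "flow b" "bd b = m" "cost 1 b < t" using transport_approx[OF assms(1,4)] .
  obtain b' where b': "flow b'" "bd b' = m" "cost 1 b' \<le> cost 1 b"
    "card {e. b' e \<noteq> 0} \<le> 3 * card {v. m v \<noteq> 0}"
    using sparse_flow[OF b(1), of 1] b(2) by auto
  have t: "0 < t" using b(3) cost_nonneg[of 1 b] by linarith
  have "real (card {e. b' e \<noteq> 0}) \<le> 3 * n" using b'(4) assms(2) by linarith
  moreover have "sum (weight b') {e. b' e \<noteq> 0} \<le> t" using b'(3) b(3) by (simp add: cost_def)
  ultimately have "cost \<alpha> b' \<le> 3 * n * (t / (3 * n)) powr \<alpha>"
    unfolding cost_def using flow_finite[OF b'(1)] assms t by (intro sum_powr_le) auto
  then show ?thesis using transport_le[OF b'(1,2), of \<alpha>] by linarith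
qed

text \<open>Markov's inequality.\<close>

lemma card_heavy_edges:
  assumes b: "flow b" and \<tau>: "0 < \<tau>" and \<alpha>: "0 < \<alpha>"
  shows "real (card {e. restrict_flow b {e. \<tau> \<le> weight b e} e \<noteq> 0}) * \<tau> powr \<alpha> \<le> cost \<alpha> b"
proof -
  let ?H = "{e. b e \<noteq> 0 \<and> \<tau> \<le> weight b e}"
  have "real (card ?H) * \<tau> powr \<alpha> = (\<Sum>e\<in>?H. \<tau> powr \<alpha>)" by simp
  also have "\<dots> \<le> (\<Sum>e\<in>?H. weight b e powr \<alpha>)"
    using \<tau> \<alpha> by (intro sum_mono powr_mono2) auto
  also have "\<dots> \<le> cost \<alpha> b" unfolding cost_def
    using flow_finite[OF b] by (intro sum_mono2) auto
  also have "?H = {e. restrict_flow b {e. \<tau> \<le> weight b e} e \<noteq> 0}"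
    by (auto simp: restrict_flow_def)
  finally show ?thesis .
qed

text \<open>A weight w at most \<open>\<tau>\<close> is the product of its powers with exponents
  \<open>1 - \<alpha>\<close> and \<open>\<alpha>\<close>, and the first is at most
  \<open>\<tau> powr (1 - \<alpha>)\<close>. This factor tends to 0 with \<open>\<tau>\<close>
  because \<open>\<alpha> < 1\<close>.\<close>

lemma cost_1_light_edges:
  assumes b: "flow b" and \<alpha>: "\<alpha> < 1" and Q: "\<And>e. e \<in> Q \<Longrightarrow> weight b e \<le> \<tau>"
  shows "cost 1 (restrict_flow b Q) \<le> \<tau> powr (1 - \<alpha>) * cost \<alpha> (restrict_flow b Q)"
proof -
  have "weight b e powr 1 \<le> \<tau> powr (1 - \<alpha>) * weight b e powr \<alpha>" if "e \<in> Q" for e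
  proof (cases "weight b e = 0")
    case False
    then have w: "0 < weight b e" using weight_nonneg[of b e] by linarith
    have "weight b e powr 1 = weight b e powr (1 - \<alpha>) * weight b e powr \<alpha>"
      by (simp flip: powr_add)
    also have "\<dots> \<le> \<tau> powr (1 - \<alpha>) * weight b e powr \<alpha>"
      using Q[OF that] \<alpha> w by (intro mult_right_mono powr_mono2) auto
    finally show ?thesis .
  qed simp
  then show ?thesis
    unfolding cost_restrict[OF b] sum_distrib_left by (intro sum_mono) auto
qed

section \<open>Almost additivity of the transport cost\<close>

lemma cost_restrict_le: "flow b \<Longrightarrow> cost s (restrict_flow b Q) \<le> cost s b"
  using cost_restrict_split[of b s Q] cost_nonneg[of s "restrict_flow b (- Q)"] by linarith

lemma cost_restrict_disjoint_Un:
  assumes "flow b" "P \<inter> Q = {}"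
  shows "cost s (restrict_flow b (P \<union> Q)) = cost s (restrict_flow b P) + cost s (restrict_flow b Q)"
proof -
  have "{e. b e \<noteq> 0 \<and> e \<in> P \<union> Q} = {e. b e \<noteq> 0 \<and> e \<in> P} \<union> {e. b e \<noteq> 0 \<and> e \<in> Q}" by auto
  then show ?thesis unfolding cost_restrict[OF assms(1)]
    using flow_finite[OF assms(1)] assms(2) by (simp only:) (rule sum.union_disjoint, auto)
qed

text \<open>Split a near-optimal flow for \<^term>\<open>u + v\<close> into heavy and light edges at a weight scale around
  which there is almost no cost. The heavy part then transports \<^term>\<open>u\<close> up to an error that is
  small for exponent 1 and has few atoms, hence is also small for exponent \<^term>\<open>\<alpha>\<close>.\<close>

lemma transport_almost_additive:
  fixes C \<eta> :: real and n :: nat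
  assumes \<alpha>: "0 < \<alpha>" "\<alpha> < 1" and \<eta>: "0 < \<eta>"
  obtains \<kappa> where "0 < \<kappa>"
    "\<And>u v. u \<in> balanced \<Longrightarrow> v \<in> balanced \<Longrightarrow> card {x. u x \<noteq> 0} \<le> n \<Longrightarrow>
      transport \<alpha> u \<le> C \<Longrightarrow> transport \<alpha> v \<le> C \<Longrightarrow> transport 1 v \<le> \<kappa> \<Longrightarrow>
      transport \<alpha> u + transport \<alpha> v \<le> transport \<alpha> (u + v) + \<eta>"
proof -
  \<comment> \<open>Bounds the cost of a flow for \<open>u + v\<close> that is optimal up to
    \<open>\<eta> / 2\<close>.\<close>
  define C1 where "C1 = 2 * \<bar>C\<bar> + \<eta> + 1"
  have C1: "C1 \<ge> 1" "2 * C + \<eta> / 2 \<le> C1" using \<eta> by (auto simp: C1_def)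
  \<comment> \<open>The final error estimate is \<open>A * (4 * C1 / K) powr \<alpha>\<close>. The
    number \<open>x0\<close> is the argument for which this equals \<open>\<eta> / 4\<close>, and
    the number \<open>K\<close> of bands is taken large enough to get below it.\<close>
  define A where "A = (3 * (2 * C1 + 1)) powr (1 - \<alpha>)"
  have A: "0 < A" using C1 by (simp add: A_def)
  define x0 where "x0 = (\<eta> / 4 / A) powr (1 / \<alpha>)"
  have x0: "0 < x0" using \<eta> A by (simp add: x0_def)
  obtain K0 :: nat where K0: "4 * C1 / x0 < K0" using reals_Archimedean2 by blast
  define K where "K = max 1 K0"
  have K: "K > 0" "4 * C1 / K \<le> x0" "1 \<le> real K"
  proof -
    show "K > 0" by (simp add: K_def)
    have "4 * C1 / x0 < K" using K0 by (simp add: K_def)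
    then show "4 * C1 / K \<le> x0" using x0 \<open>K > 0\<close> by (simp add: field_simps)
    show "1 \<le> real K" using \<open>K > 0\<close> by simp
  qed
  \<comment> \<open>Ratio of consecutive thresholds. With
    \<open>\<omega> powr (1 - \<alpha>) = 1 / K\<close>, all edges below a band together satisfy the
    same bound for exponent 1 as a band whose cost is only \<open>C1 / K\<close>.\<close>
  define \<omega> where "\<omega> = (1 / real K) powr (1 / (1 - \<alpha>))"
  have \<omega>: "0 < \<omega>" "\<omega> \<le> 1" "\<omega> powr (1 - \<alpha>) = 1 / K"
  proof -
    show "0 < \<omega>" using K by (simp add: \<omega>_def)
    show "\<omega> \<le> 1" using K \<alpha> by (simp add: \<omega>_def powr_le1)
    show "\<omega> powr (1 - \<alpha>) = 1 / K" using \<alpha> K by (simp add: \<omega>_def powr_powr)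
  qed
  \<comment> \<open>The thresholds start so low that
    \<open>n * \<tau> j powr \<alpha> \<le> 1\<close>: the atoms of \<open>u\<close> then contribute
    only 1 to the bound for the number of atoms of the error.\<close>
  define \<tau>0 where "\<tau>0 = (1 / (real n + 1)) powr (1 / \<alpha>)"
  define \<tau> where "\<tau> j = \<tau>0 * \<omega> ^ j" for j
  have \<tau>0: "0 < \<tau>0" "\<tau>0 powr \<alpha> = 1 / (real n + 1)"
    using \<alpha> by (auto simp: \<tau>0_def powr_powr)
  have \<tau>: "0 < \<tau> j" "\<tau> (Suc j) = \<tau> j * \<omega>" for j using \<tau>0 \<omega> by (auto simp: \<tau>_def)
  have \<tau>_mono: "\<tau> j \<le> \<tau> i" if "i \<le> j" for i j
    using that \<omega> \<tau>0 by (auto simp: \<tau>_def intro!: mult_left_mono power_decreasing)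
  have \<tau>_Suc: "\<tau> (Suc j) powr (1 - \<alpha>) = \<tau> j powr (1 - \<alpha>) / K" for j
    using \<tau> \<omega> by (simp add: \<tau>(2) powr_mult)
  have \<tau>n: "real n * \<tau> j powr \<alpha> \<le> 1" for j
  proof -
    have "\<tau> j powr \<alpha> \<le> \<tau>0 powr \<alpha>"
      using \<tau>_mono[of 0 j] \<tau>(1)[of j] \<alpha> by (intro powr_mono2) (auto simp: \<tau>_def)
    then have "real n * \<tau> j powr \<alpha> \<le> real n * (1 / (real n + 1))"
      unfolding \<tau>0(2) by (intro mult_left_mono) auto
    also have "\<dots> \<le> 1" by simp
    finally show ?thesis .
  qed
  \<comment> \<open>Taken at the smallest threshold, because the band that turns out cheap depends
    on \<open>u\<close> and \<open>v\<close> while \<open>\<kappa>\<close> must not.\<close>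
  define \<kappa> where "\<kappa> = \<tau> K powr (1 - \<alpha>) * C1 / K"
  show ?thesis
  proof (rule that[of \<kappa>])
    show "0 < \<kappa>" using \<tau>(1)[of K] C1 K by (simp add: \<kappa>_def)
    fix u v
    assume u: "u \<in> balanced" and v: "v \<in> balanced" and n: "card {x. u x \<noteq> 0} \<le> n"
      and Cu: "transport \<alpha> u \<le> C" and Cv: "transport \<alpha> v \<le> C" and \<kappa>v: "transport 1 v \<le> \<kappa>"
    obtain b where b: "flow b" "bd b = u + v" "cost \<alpha> b < transport \<alpha> (u + v) + \<eta> / 2"
      using transport_approx[OF balanced_add[OF u v], of \<alpha> "transport \<alpha> (u + v) + \<eta> / 2"] \<eta> by auto
    have "transport \<alpha> (u + v) \<le> transport \<alpha> u + transport \<alpha> v"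
      using u v \<alpha> by (intro transport_add_le) auto
    then have bC: "cost \<alpha> b \<le> C1" using b(3) Cu Cv C1 by linarith
    define band where "band j = {e. \<tau> (Suc j) \<le> weight b e \<and> weight b e < \<tau> j}" for j
    have bands: "(\<Sum>j<K. cost \<alpha> (restrict_flow b (band j))) \<le> cost \<alpha> b"
    proof -
      have "(\<Sum>j<K. cost \<alpha> (restrict_flow b (band j)))
          = (\<Sum>j<K. \<Sum>e | b e \<noteq> 0. weight b e powr \<alpha> * of_bool (e \<in> band j))"
      proof (rule sum.cong[OF refl])
        fix j
        have "(\<Sum>e | b e \<noteq> 0. weight b e powr \<alpha> * of_bool (e \<in> band j))
            = (\<Sum>e | b e \<noteq> 0. if e \<in> band j then weight b e powr \<alpha> else 0)"
          by (rule sum.cong) auto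
        also have "\<dots> = cost \<alpha> (restrict_flow b (band j))"
          unfolding cost_restrict[OF b(1)] using flow_finite[OF b(1)]
          by (simp add: sum.If_cases Int_def)
        finally show "cost \<alpha> (restrict_flow b (band j))
            = (\<Sum>e | b e \<noteq> 0. weight b e powr \<alpha> * of_bool (e \<in> band j))" by simp
      qed
      also have "\<dots> = (\<Sum>e | b e \<noteq> 0. weight b e powr \<alpha> * (\<Sum>j<K. of_bool (e \<in> band j)))"
        by (subst sum.swap) (simp add: sum_distrib_left mult.commute)
      also have "\<dots> \<le> (\<Sum>e | b e \<noteq> 0. weight b e powr \<alpha> * 1)"
      proof (intro sum_mono mult_left_mono)
        fix e
        have "of_bool (e \<in> band j) = (of_bool (\<tau> (Suc j) \<le> weight b e) :: real) - of_bool (\<tau> j \<le> weight b e)"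
          for j using \<tau>_mono[of j "Suc j"] by (auto simp: band_def)
        then have "(\<Sum>j<K. of_bool (e \<in> band j)) =
            (of_bool (\<tau> K \<le> weight b e) :: real) - of_bool (\<tau> 0 \<le> weight b e)"
          by (simp add: sum_lessThan_telescope[of "\<lambda>j. of_bool (\<tau> j \<le> weight b e)"])
        also have "\<dots> \<le> 1" by simp
        finally show "(\<Sum>j<K. of_bool (e \<in> band j)) \<le> (1::real)" .
      qed simp
      finally show ?thesis by (simp add: cost_def)
    qed
    \<comment> \<open>The \<open>K\<close> bands are disjoint and share a cost of at most
      \<open>C1\<close>, so one of them is cheap.\<close>
    have "\<exists>j<K. cost \<alpha> (restrict_flow b (band j)) \<le> C1 / K"
    proof (rule ccontr)
      assume nex: "\<not> ?thesis"
      then have "C1 / K < cost \<alpha> (restrict_flow b (band j))" if "j < K" for j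
        using that nex by (meson not_le)
      then have "(\<Sum>j<K. C1 / K) < (\<Sum>j<K. cost \<alpha> (restrict_flow b (band j)))"
        using K(1) by (intro sum_strict_mono) (auto simp: lessThan_empty_iff)
      then show False using bands bC K by simp
    qed
    then obtain j where j: "j < K" "cost \<alpha> (restrict_flow b (band j)) \<le> C1 / K" by blast
    let ?t = "\<tau> j" and ?H = "{e. \<tau> j \<le> weight b e}" and ?S = "{e. weight b e < \<tau> (Suc j)}"
    define B where "B = restrict_flow b ?H"
    define R where "R = restrict_flow b (- ?H)"
    have fB: "flow B" and fR: "flow R" by (simp_all add: B_def R_def flow_restrict b)
    have BR: "bd B + bd R = u + v" using bd_restrict_split[OF b(1)] b(2) by (simp add: B_def R_def)
    have cBR: "cost \<alpha> B + cost \<alpha> R = cost \<alpha> b"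
      using cost_restrict_split[OF b(1)] by (simp add: B_def R_def)
    have eqR: "- ?H = band j \<union> ?S" "band j \<inter> ?S = {}"
      using \<tau>_mono[of j "Suc j"] by (auto simp: band_def)
    have "cost 1 R = cost 1 (restrict_flow b (band j)) + cost 1 (restrict_flow b ?S)"
      unfolding R_def eqR(1) by (rule cost_restrict_disjoint_Un[OF b(1) eqR(2)])
    also have "cost 1 (restrict_flow b (band j)) \<le> ?t powr (1 - \<alpha>) * (C1 / K)"
      using cost_1_light_edges[OF b(1) \<alpha>(2), of "band j" ?t] j(2)
        mult_left_mono[OF j(2), of "?t powr (1 - \<alpha>)"] by (auto simp: band_def)
    also have "cost 1 (restrict_flow b ?S) \<le> \<tau> (Suc j) powr (1 - \<alpha>) * C1"
      using cost_1_light_edges[OF b(1) \<alpha>(2), of ?S "\<tau> (Suc j)"]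
        mult_left_mono[OF order_trans[OF cost_restrict_le[OF b(1), of \<alpha> ?S] bC],
          of "\<tau> (Suc j) powr (1 - \<alpha>)"] by auto
    also have "\<tau> (Suc j) powr (1 - \<alpha>) * C1 = ?t powr (1 - \<alpha>) * (C1 / K)" by (simp add: \<tau>_Suc)
    finally have R1: "cost 1 R \<le> 2 * (?t powr (1 - \<alpha>) * (C1 / K))" by (simp add: mult_ac)
    have "\<kappa> \<le> ?t powr (1 - \<alpha>) * (C1 / K)"
    proof -
      have "\<tau> K powr (1 - \<alpha>) \<le> ?t powr (1 - \<alpha>)"
        using \<tau>_mono[of j K] j(1) \<tau>(1)[of K] \<alpha> by (intro powr_mono2) auto
      then have "\<tau> K powr (1 - \<alpha>) * (C1 / K) \<le> ?t powr (1 - \<alpha>) * (C1 / K)"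
        using C1 K by (intro mult_right_mono) auto
      then show ?thesis by (simp add: \<kappa>_def)
    qed
    \<comment> \<open>The mismatch between the heavy part and \<open>u\<close>. As
      \<open>v - bd R\<close> it is small for exponent 1, as \<open>bd B - u\<close> it has few
      atoms; \<open>transport_le_of_transport_1\<close> combines the two.\<close>
    define g where "g = v - bd R"
    have g: "g \<in> balanced" using v fR by (simp add: g_def balanced_diff balancedI)
    have gB: "g = bd B - u" using BR by (simp add: g_def algebra_simps)
    have "transport 1 g \<le> transport 1 v + transport 1 (bd R)"
      unfolding g_def using v fR by (intro transport_diff_le balancedI) auto
    also have "\<dots> \<le> ?t powr (1 - \<alpha>) * (C1 / K) + 2 * (?t powr (1 - \<alpha>) * (C1 / K))"
      by (intro add_mono order_trans[OF \<kappa>v \<open>\<kappa> \<le> _\<close>] order_trans[OF transport_bd_le[OF fR] R1])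
    also have "\<dots> = 3 * (?t powr (1 - \<alpha>) * (C1 / K))" by simp
    also have "\<dots> < 4 * (?t powr (1 - \<alpha>) * (C1 / K))"
      using \<tau>(1)[of j] C1 K by (intro mult_strict_right_mono) auto
    finally have g1: "transport 1 g < 4 * (?t powr (1 - \<alpha>) * (C1 / K))" .
    define \<nu> where "\<nu> = (2 * C1 + 1) * ?t powr (- \<alpha>)"
    have "card {x. g x \<noteq> 0} \<le> card ({x. bd B x \<noteq> 0} \<union> {x. u x \<noteq> 0})"
      using balanced_support(1)[OF u] balanced_support(1)[OF balancedI[OF fB]]
      by (intro card_mono) (auto simp: gB)
    also have "\<dots> \<le> card {x. bd B x \<noteq> 0} + card {x. u x \<noteq> 0}" by (rule card_Un_le)
    also have "\<dots> \<le> 2 * card {e. B e \<noteq> 0} + n" using card_bd_support[OF fB] n by simp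
    finally have "real (card {x. g x \<noteq> 0}) * ?t powr \<alpha> \<le> (2 * real (card {e. B e \<noteq> 0}) + n) * ?t powr \<alpha>"
      by (intro mult_right_mono) auto
    also have "\<dots> \<le> 2 * C1 + 1"
      using card_heavy_edges[OF b(1) \<tau>(1)[of j] \<alpha>(1)] bC \<tau>n[of j]
      by (simp add: B_def distrib_right)
    finally have "real (card {x. g x \<noteq> 0}) \<le> \<nu>"
      using \<tau>(1)[of j] by (simp add: \<nu>_def powr_minus field_simps)
    moreover have "0 < \<nu>" using \<tau>(1)[of j] C1 by (simp add: \<nu>_def)
    ultimately have "transport \<alpha> g \<le> 3 * \<nu> * (4 * (?t powr (1 - \<alpha>) * (C1 / K)) / (3 * \<nu>)) powr \<alpha>"
      using transport_le_of_transport_1[OF g _ _ g1] \<alpha> by auto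
    also have "\<dots> = (3 * \<nu>) powr (1 - \<alpha>) * (4 * (?t powr (1 - \<alpha>) * (C1 / K))) powr \<alpha>"
    proof -
      have "N * (Y / N) powr \<alpha> = N powr (1 - \<alpha>) * Y powr \<alpha>" if "0 < N" "0 \<le> Y" for N Y :: real
        using that by (simp add: powr_diff powr_divide)
      from this[of "3 * \<nu>" "4 * (?t powr (1 - \<alpha>) * (C1 / K))"] show ?thesis
        using \<open>0 < \<nu>\<close> C1 by simp
    qed
    \<comment> \<open>The bound \<open>\<nu>\<close> for the number of atoms is proportional to
      \<open>\<tau> j powr (- \<alpha>)\<close>, so its power with exponent
      \<open>1 - \<alpha>\<close> cancels \<open>\<tau> j powr ((1 - \<alpha>) * \<alpha>)\<close>:
      the estimate does not depend on the scale of the band.\<close>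
    also have "\<dots> = A * (4 * C1 / K) powr \<alpha>"
    proof -
      have "(3 * \<nu>) powr (1 - \<alpha>) = A * ?t powr (- \<alpha> * (1 - \<alpha>))"
        using C1 \<tau>(1)[of j] by (simp add: \<nu>_def A_def powr_mult powr_powr flip: mult.assoc)
      moreover have "(4 * (?t powr (1 - \<alpha>) * (C1 / K))) powr \<alpha> = ?t powr ((1 - \<alpha>) * \<alpha>) * (4 * C1 / K) powr \<alpha>"
        using C1 K \<tau>(1)[of j] by (simp add: powr_mult powr_powr powr_divide)
      moreover have "?t powr (- \<alpha> * (1 - \<alpha>)) * ?t powr ((1 - \<alpha>) * \<alpha>) = 1"
        using \<tau>(1)[of j] by (simp flip: powr_add)
      ultimately show ?thesis by simp
    qed
    also have "\<dots> \<le> A * x0 powr \<alpha>"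
      using K C1 \<alpha> A by (intro mult_left_mono powr_mono2) auto
    also have "x0 powr \<alpha> = \<eta> / 4 / A" using \<alpha> \<eta> A by (simp add: x0_def powr_powr)
    finally have g\<alpha>: "transport \<alpha> g \<le> \<eta> / 4" using A by simp
    have u': "u = bd B - g" by (simp add: gB)
    have v': "v = g + bd R" by (simp add: g_def)
    have "transport \<alpha> u \<le> cost \<alpha> B + transport \<alpha> g"
      using transport_diff_le[OF balancedI[OF fB] g, of \<alpha>] \<alpha> transport_bd_le[OF fB, of \<alpha>] u' by auto
    moreover have "transport \<alpha> v \<le> transport \<alpha> g + cost \<alpha> R"
      using transport_add_le[OF g balancedI[OF fR], of \<alpha>] \<alpha> transport_bd_le[OF fR, of \<alpha>] v' by auto
    ultimately show "transport \<alpha> u + transport \<alpha> v \<le> transport \<alpha> (u + v) + \<eta>"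
      using g\<alpha> cBR b(3) by linarith
  qed
qed

text \<open>The cost on edges of weight at least \<open>\<tau>\<close> grows as
  \<open>\<tau>\<close> decreases but stays below \<open>C\<close>. Some threshold and subsequence
  therefore nearly exhaust what is attained infinitely often, and lower thresholds can eventually
  gain at most \<open>\<eta>\<close>. The subsequence is fixed before \<open>\<tau>\<close>; only
  the starting index depends on it.\<close>

lemma level_splitting:
  fixes C \<eta> :: real
  assumes b: "\<And>k::nat. flow (b k)" "\<And>k. cost \<alpha> (b k) \<le> C" and \<eta>: "0 < \<eta>"
  obtains \<tau>0 and K :: "nat set" where "0 < \<tau>0" "infinite K"
    "\<And>\<tau>. 0 < \<tau> \<Longrightarrow> \<exists>k0. \<forall>k\<in>K. k0 \<le> k \<longrightarrow>
      cost \<alpha> (restrict_flow (b k) {e. \<tau> \<le> weight (b k) e \<and> weight (b k) e < \<tau>0}) \<le> \<eta>"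
proof -
  define F where "F k \<tau> = cost \<alpha> (restrict_flow (b k) {e. \<tau> \<le> weight (b k) e})" for k \<tau>
  have FC: "F k \<tau> \<le> C" for k \<tau>
    using cost_restrict_le[OF b(1)[of k], of \<alpha>] b(2)[of k] unfolding F_def by (rule order_trans)
  \<comment> \<open>\<open>Sup X\<close> is the supremum over \<open>\<tau>\<close> of the limes
    superior of \<open>F k \<tau>\<close>. The threshold \<open>\<tau>0\<close> comes within
    \<open>\<eta> / 2\<close> of it for infinitely many \<open>k\<close>, and each
    \<open>\<tau>\<close> exceeds it by more than \<open>\<eta> / 2\<close> only finitely
    often.\<close>
  define X where "X = {x. \<exists>\<tau>>0. infinite {k. x < F k \<tau>}}"
  have "- 1 \<in> X"
  proof -
    have "{k. - 1 < F k 1} = UNIV" unfolding F_def by (auto intro: less_le_trans[OF _ cost_nonneg])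
    then show ?thesis unfolding X_def by (auto intro!: exI[of _ 1])
  qed
  moreover have "x \<le> C" if x: "x \<in> X" for x
  proof -
    obtain \<tau> where "infinite {k. x < F k \<tau>}" using x by (auto simp: X_def)
    then obtain k where "x < F k \<tau>" using not_finite_existsD by blast
    then show ?thesis using FC[of k \<tau>] by linarith
  qed
  ultimately have X: "X \<noteq> {}" "bdd_above X" using bdd_aboveI[of X C] by auto
  obtain x where x: "x \<in> X" "Sup X - \<eta> / 2 < x"
    using less_cSupD[OF X(1), of "Sup X - \<eta> / 2"] \<eta> by auto
  obtain \<tau>0 where \<tau>0: "0 < \<tau>0" "infinite {k. x < F k \<tau>0}" using x(1) by (auto simp: X_def)
  show ?thesis
  proof (rule that[OF \<tau>0])
    fix \<tau> :: real assume \<tau>: "0 < \<tau>"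
    have "Sup X + \<eta> / 2 \<notin> X" using cSup_upper[OF _ X(2), of "Sup X + \<eta> / 2"] \<eta> by auto
    then have "finite {k. Sup X + \<eta> / 2 < F k \<tau>}" using \<tau> by (auto simp: X_def)
    then obtain k0 where k0: "\<And>k. Sup X + \<eta> / 2 < F k \<tau> \<Longrightarrow> k < k0"
      using finite_nat_set_iff_bounded by auto
    show "\<exists>k0. \<forall>k\<in>{k. x < F k \<tau>0}. k0 \<le> k \<longrightarrow>
      cost \<alpha> (restrict_flow (b k) {e. \<tau> \<le> weight (b k) e \<and> weight (b k) e < \<tau>0}) \<le> \<eta>"
    proof (intro exI[of _ k0] ballI impI)
      fix k assume k: "k \<in> {k. x < F k \<tau>0}" "k0 \<le> k"
      let ?band = "{e. \<tau> \<le> weight (b k) e \<and> weight (b k) e < \<tau>0}"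
      show "cost \<alpha> (restrict_flow (b k) ?band) \<le> \<eta>"
      proof (cases "\<tau> \<le> \<tau>0")
        case True
        have "{e. \<tau> \<le> weight (b k) e} = ?band \<union> {e. \<tau>0 \<le> weight (b k) e}" using True by auto
        then have "F k \<tau> = cost \<alpha> (restrict_flow (b k) ?band) + F k \<tau>0"
          unfolding F_def by (simp only:) (rule cost_restrict_disjoint_Un[OF b(1)], auto)
        then show ?thesis using k k0[of k] x(2) by fastforce
      next
        case False
        have "?band = {}" using False by auto
        show ?thesis unfolding cost_restrict[OF b(1)]
          using \<eta> \<open>?band = {}\<close> by (subst sum.neutral) auto
      qed
    qed
  qed
qed

end

text \<open>Expectation over a uniformly random radius between \<open>a\<close> and
  \<open>b\<close>: an inequality valid for every radius is integrated, and the summand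
  \<open>j\<close> is active on a set of length at most
  \<open>min (b - a) (t j - s j)\<close>.\<close>

lemma average_indicators:
  fixes s t c :: "'b \<Rightarrow> real"
  assumes "finite P" "a < b" "\<And>j. j \<in> P \<Longrightarrow> 0 \<le> c j" "\<And>j. j \<in> P \<Longrightarrow> s j \<le> t j"
    and le: "\<And>\<theta>. a \<le> \<theta> \<Longrightarrow> \<theta> \<le> b \<Longrightarrow> \<kappa> \<le> (\<Sum>j\<in>P. c j * indicator {s j<..t j} \<theta>)"
  shows "\<kappa> * (b - a) \<le> (\<Sum>j\<in>P. c j * min (b - a) (t j - s j))"
proof -
  let ?f = "\<lambda>\<theta>. \<Sum>j\<in>P. c j * indicator ({s j<..t j} \<inter> {a..b}) \<theta>"
  have int: "integrable lborel (indicator ({s j<..t j} \<inter> {a..b}) :: real \<Rightarrow> real)" for j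
  proof (rule integrable_real_indicator)
    have "emeasure lborel ({s j<..t j} \<inter> {a..b}) \<le> emeasure lborel {a..b}"
      by (intro emeasure_mono) auto
    also have "\<dots> < \<infinity>" using assms(2) by simp
    finally show "emeasure lborel ({s j<..t j} \<inter> {a..b}) < \<infinity>" .
  qed simp
  have "\<kappa> * (b - a) = (\<integral>\<theta>. \<kappa> * indicator {a..b} \<theta> \<partial>lborel)" using assms(2) by simp
  also have "\<dots> \<le> (\<integral>\<theta>. ?f \<theta> \<partial>lborel)"
  proof (rule integral_mono)
    show "integrable lborel (\<lambda>\<theta>. \<kappa> * indicator {a..b} \<theta>)" using assms(2) by simp
    show "integrable lborel ?f" using int by simp
    fix \<theta> :: real
    show "\<kappa> * indicator {a..b} \<theta> \<le> ?f \<theta>"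
      using le[of \<theta>] by (auto simp: indicator_def of_bool_def cong: if_cong)
  qed
  also have "\<dots> = (\<Sum>j\<in>P. c j * measure lborel ({s j<..t j} \<inter> {a..b}))"
    using int by (subst Bochner_Integration.integral_sum) auto
  also have "\<dots> \<le> (\<Sum>j\<in>P. c j * min (b - a) (t j - s j))"
  proof (intro sum_mono mult_left_mono)
    fix j assume j: "j \<in> P"
    have "measure lborel ({s j<..t j} \<inter> {a..b}) \<le> measure lborel {a..b}"
      by (rule measure_mono_fmeasurable) (use assms(2) in \<open>auto simp: fmeasurable_def\<close>)
    moreover have "measure lborel ({s j<..t j} \<inter> {a..b}) \<le> measure lborel {s j<..t j}"
      by (rule measure_mono_fmeasurable) (use assms(4)[OF j] in \<open>auto simp: fmeasurable_def\<close>)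
    ultimately show "measure lborel ({s j<..t j} \<inter> {a..b}) \<le> min (b - a) (t j - s j)"
      using assms(2) assms(4)[OF j] by simp
  qed (use assms in auto)
  finally show ?thesis .
qed

text \<open>Interpolates between the two bounds for the measure of the radii that cut an edge, so
  that a length turns into its power \<open>\<alpha>\<close>, the form in which edges are paid
  for.\<close>

lemma min_le_powr:
  fixes u v \<alpha> :: real
  assumes "0 < u" "0 \<le> v" "0 < \<alpha>" "\<alpha> \<le> 1"
  shows "min u v \<le> u powr (1 - \<alpha>) * v powr \<alpha>"
proof (cases "v = 0")
  case False
  have "min u v = min u v powr (1 - \<alpha>) * min u v powr \<alpha>"
    using False assms by (simp flip: powr_add)
  also have "\<dots> \<le> u powr (1 - \<alpha>) * v powr \<alpha>"
    using False assms by (intro mult_mono powr_mono2) auto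
  finally show ?thesis .
qed (use assms in auto)

section \<open>Escape from finite sets, and separated supports\<close>

context flow_space
begin

definition dist_to :: "'a set \<Rightarrow> 'a \<Rightarrow> real" where "dist_to A x = Min (D x ` A)"

lemma dist_to_attained:
  assumes "finite A" "A \<noteq> {}" shows "\<exists>a\<in>A. D x a = dist_to A x"
proof -
  have "Min (D x ` A) \<in> D x ` A" using assms by (intro Min_in) auto
  then show ?thesis unfolding dist_to_def by force
qed

lemma dist_to_le: "finite A \<Longrightarrow> a \<in> A \<Longrightarrow> dist_to A x \<le> D x a"
  unfolding dist_to_def by (rule Min_le) auto

lemma dist_to_nonneg: "finite A \<Longrightarrow> A \<noteq> {} \<Longrightarrow> 0 \<le> dist_to A x"
  using dist_to_attained[of A x] nonneg by (metis)

lemma dist_to_pos: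
  assumes "finite A" "A \<noteq> {}" "A \<subseteq> M" "x \<in> M" "x \<notin> A" shows "0 < dist_to A x"
proof -
  obtain a where a: "a \<in> A" "D x a = dist_to A x" using dist_to_attained[OF assms(1,2)] by blast
  then have "0 < D x a" using assms by (metis mdist_pos_eq subsetD)
  then show ?thesis using a by simp
qed

lemma dist_to_triangle:
  assumes "finite A" "A \<noteq> {}" "A \<subseteq> M" "x \<in> M" "y \<in> M"
  shows "dist_to A x \<le> D x y + dist_to A y"
proof -
  obtain a where a: "a \<in> A" "D y a = dist_to A y" using dist_to_attained[OF assms(1,2)] by blast
  have "dist_to A x \<le> D x a" using a assms by (intro dist_to_le) auto
  also have "\<dots> \<le> D x y + D y a" using a assms by (intro triangle) auto
  finally show ?thesis using a by simp
qed

lemma dist_to_mono: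
  assumes "finite B" "A \<subseteq> B" "A \<noteq> {}" shows "dist_to B x \<le> dist_to A x"
  unfolding dist_to_def using assms by (intro Min_antimono) auto

lemma dist_to_singleton [simp]: "dist_to {a} x = D x a"
  by (simp add: dist_to_def)

text \<open>If the claim fails for every candidate, points that are ever closer to the sequence can be
  added to \<^term>\<open>A\<close>; this produces a Cauchy subsequence, whose limit is a valid choice after all.\<close>

lemma escape_point:
  fixes I :: "nat set"
  assumes complete: mcomplete and x: "\<And>l. l \<in> I \<Longrightarrow> x l \<in> M" and I: "infinite I" and z: "z \<in> M"
  obtains A I' where "finite A" "A \<noteq> {}" "A \<subseteq> M" "I' \<subseteq> I" "infinite I'"
    "\<And>y. y \<in> M \<Longrightarrow> \<exists>l0. \<forall>l\<in>I'. l0 \<le> l \<longrightarrow> dist_to A (x l) \<le> 4 * D (x l) y"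
proof (rule ccontr)
  note intro = that
  assume nex: "\<not> thesis"
  have step: "\<exists>y\<in>M. infinite {l \<in> J. 4 * D (x l) y < dist_to A (x l)}"
    if AJ: "finite A" "A \<noteq> {}" "A \<subseteq> M" "J \<subseteq> I" "infinite J" for A J
  proof (rule ccontr)
    assume "\<not> ?thesis"
    then have fin: "finite {l \<in> J. 4 * D (x l) y < dist_to A (x l)}" if "y \<in> M" for y
      using that by blast
    have all: "\<exists>l0. \<forall>l\<in>J. l0 \<le> l \<longrightarrow> dist_to A (x l) \<le> 4 * D (x l) y" if y: "y \<in> M" for y
    proof -
      obtain l0 where "\<forall>l\<in>{l \<in> J. 4 * D (x l) y < dist_to A (x l)}. l < l0"
        using fin[OF y] finite_nat_set_iff_bounded by auto
      then show ?thesis by (intro exI[of _ l0]) (force simp: not_le)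
    qed
    have thesis by (rule intro[OF AJ]) (rule all)
    with nex show False by (rule notE)
  qed
  \<comment> \<open>A stage consists of the current finite set, the current index set and the point
    added last. The invariant \<open>z \<in> A\<close> anchors all distances at a fixed
    point.\<close>
  define P where "P = (\<lambda>(n::nat) (A, J, y::'a). finite A \<and> A \<noteq> {} \<and> A \<subseteq> M \<and> J \<subseteq> I \<and> infinite J \<and> z \<in> A)"
  define Q where "Q = (\<lambda>(n::nat) (A, J, y::'a) (A', J', y'). y' \<in> M \<and> A' = insert y' A \<and> J' \<subseteq> J \<and>
    (\<forall>l\<in>J'. 4 * D (x l) y' \<le> dist_to A (x l)))"
  have "\<exists>f. \<forall>n. P n (f n) \<and> Q n (f n) (f (Suc n))"
  proof (rule dependent_nat_choice)
    show "\<exists>s. P 0 s" using z I by (intro exI[of _ "({z}, I, z)"]) (auto simp: P_def)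
    fix s n assume s: "P n s"
    obtain A J y where sAJ: "s = (A, J, y)" by (cases s)
    obtain y' where y': "y' \<in> M" "infinite {l \<in> J. 4 * D (x l) y' < dist_to A (x l)}"
      using step[of A J] s by (auto simp: P_def sAJ)
    show "\<exists>s'. P (Suc n) s' \<and> Q n s s'"
      using s y' by (intro exI[of _ "(insert y' A, {l \<in> J. 4 * D (x l) y' < dist_to A (x l)}, y')"])
        (auto simp: P_def Q_def sAJ)
  qed
  then obtain f where f: "\<And>n. P n (f n)" "\<And>n. Q n (f n) (f (Suc n))" by blast
  define A J y where "A n = fst (f n)" and "J n = fst (snd (f n))" and "y n = snd (snd (f n))" for n
  have fe: "f n = (A n, J n, y n)" for n by (simp add: A_def J_def y_def)
  have A: "finite (A n)" "A n \<noteq> {}" "A n \<subseteq> M" "z \<in> A n" and J: "J n \<subseteq> I" "infinite (J n)" for n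
    using f(1)[of n] by (auto simp: P_def fe)
  have y: "y (Suc n) \<in> M" "A (Suc n) = insert (y (Suc n)) (A n)" "J (Suc n) \<subseteq> J n" for n
    using f(2)[of n] by (auto simp: Q_def fe)
  have close: "4 * D (x l) (y (Suc n)) \<le> dist_to (A n) (x l)" if "l \<in> J (Suc n)" for n l
    using f(2)[of n] that by (auto simp: Q_def fe)
  have J_mono: "J n \<subseteq> J m" if "m \<le> n" for m n
    using y(3) that by (rule lift_Suc_antimono_le)
  have xM: "x l \<in> M" if "l \<in> J n" for n l using that J x by blast
  \<comment> \<open>The first added point is at least four times closer to \<open>x l\<close> than
    \<open>z\<close> is. Hence \<open>D (x l) z\<close> is at most 4/3 of
    \<open>D (y 1) z\<close>.\<close>
  define R where "R = 2 * D (y 1) z"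
  have R: "dist_to (A 0) (x l) \<le> R" if l: "l \<in> J 1" for l
  proof -
    have d: "dist_to (A 0) (x l) \<le> D (x l) z" using A by (intro dist_to_le) auto
    have "4 * D (x l) (y 1) \<le> D (x l) z" using close[of l 0] l d by simp
    moreover have "D (x l) z \<le> D (x l) (y 1) + D (y 1) z"
      using triangle[of "x l" "y 1" z] xM[OF l] y(1)[of 0] z by simp
    ultimately show ?thesis using d nonneg[of "y 1" z] unfolding R_def by linarith
  qed
  \<comment> \<open>Each added point brings the set four times closer to the remaining members of
    the sequence.\<close>
  have shrink: "dist_to (A n) (x l) \<le> R * (1/4) ^ n" if "l \<in> J (Suc n)" for n l
    using that
  proof (induction n)
    case (Suc n)
    then have l: "l \<in> J (Suc n)" using J_mono[of "Suc n" "Suc (Suc n)"] by auto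
    have "dist_to (A (Suc n)) (x l) \<le> D (x l) (y (Suc n))"
      using A[of "Suc n"] y(2)[of n] by (intro dist_to_le) auto
    then show ?case using close[OF l] Suc.IH[OF l] by simp
  qed (use R in simp)
  have near: "D (x l) (y (Suc n)) \<le> R * (1/4) ^ n" if l: "l \<in> J (Suc n)" for n l
    using close[OF l] shrink[OF l] nonneg[of "x l" "y (Suc n)"] by linarith
  \<comment> \<open>Diagonal subsequence through the nested index sets.\<close>
  have "\<exists>r. \<forall>n. r n \<in> J (Suc n) \<and> r n < r (Suc n)"
  proof (rule dependent_nat_choice)
    show "\<exists>l. l \<in> J (Suc 0)" using J(2)[of 1] by (metis One_nat_def finite.emptyI ex_in_conv)
    fix l n
    show "\<exists>l'. l' \<in> J (Suc (Suc n)) \<and> l < l'"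
      using J(2)[of "Suc (Suc n)"] infinite_nat_iff_unbounded by blast
  qed
  then obtain r where r: "\<And>n. r n \<in> J (Suc n)" "strict_mono r" by (auto simp: strict_mono_Suc_iff)
  have R0: "0 \<le> R" using nonneg by (simp add: R_def)
  have "MCauchy (x \<circ> r)"
    unfolding MCauchy_def
  proof (intro conjI allI impI)
    show "range (x \<circ> r) \<subseteq> M" using r xM by auto
    fix e :: real assume e: "e > 0"
    have "(\<lambda>n. R * (1/4) ^ n) \<longlonglongrightarrow> R * 0" by (intro tendsto_mult LIMSEQ_power_zero) auto
    then obtain N where N: "R * (1/4) ^ N < e / 2"
      using order_tendstoD(2)[of _ "R * 0" sequentially "e / 2"] e
      by (auto simp: eventually_sequentially)
    show "\<exists>N. \<forall>n n'. N \<le> n \<longrightarrow> N \<le> n' \<longrightarrow> D ((x \<circ> r) n) ((x \<circ> r) n') < e"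
    proof (intro exI[of _ N] allI impI)
      fix n n' assume n: "N \<le> n" "N \<le> n'"
      have rJ: "r n \<in> J (Suc N)" "r n' \<in> J (Suc N)" using r(1) J_mono n by blast+
      have "D (x (r n)) (x (r n')) \<le> D (x (r n)) (y (Suc N)) + D (y (Suc N)) (x (r n'))"
        using xM rJ y(1) by (intro triangle) auto
      also have "\<dots> < e" using near[OF rJ(1)] near[OF rJ(2)] N by (simp add: commute)
      finally show "D ((x \<circ> r) n) ((x \<circ> r) n') < e" by simp
    qed
  qed
  then obtain \<xi> where \<xi>: "limitin mtopology (x \<circ> r) \<xi> sequentially"
    using complete unfolding mcomplete_def by blast
  then have \<xi>M: "\<xi> \<in> M" and lim: "\<And>e. e > 0 \<Longrightarrow> \<exists>N. \<forall>n\<ge>N. D (x (r n)) \<xi> < e"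
    unfolding limit_metric_sequentially comp_def by (blast, metis)
  \<comment> \<open>The limit alone is a valid finite set: the distance to \<open>\<xi>\<close>
    tends to 0 while the distance to any other \<open>w\<close> stays bounded below. For
    \<open>w = \<xi>\<close> the inequality is trivial.\<close>
  have "\<exists>l0. \<forall>l\<in>range r. l0 \<le> l \<longrightarrow> dist_to {\<xi>} (x l) \<le> 4 * D (x l) w" if w: "w \<in> M" for w
  proof (cases "w = \<xi>")
    case False
    then have pos: "0 < D \<xi> w" using w \<xi>M by simp
    then obtain N where N: "\<And>n. n \<ge> N \<Longrightarrow> D (x (r n)) \<xi> < D \<xi> w / 2" using lim[of "D \<xi> w / 2"] by auto
    show ?thesis
    proof (intro exI[of _ "r N"] ballI impI)
      fix l assume "l \<in> range r" "r N \<le> l"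
      then obtain n where n: "l = r n" "N \<le> n" using r(2) by (auto simp: strict_mono_less_eq)
      have "x l \<in> M" using xM r(1) n by blast
      then have "D \<xi> w \<le> D \<xi> (x l) + D (x l) w" using w \<xi>M by (intro triangle) auto
      then show "dist_to {\<xi>} (x l) \<le> 4 * D (x l) w"
        using N[OF n(2)] nonneg[of "x l" w] commute[of \<xi> "x l"]
        unfolding n(1) dist_to_singleton by linarith
    qed
  qed (auto intro: nonneg)
  moreover have "infinite (range r)" using r(2) by (simp add: strict_mono_imp_inj_on range_inj_infinite)
  moreover have "range r \<subseteq> I" using r(1) J by blast
  ultimately show False using intro[of "{\<xi>}" "range r"] \<xi>M nex by blast
qed

text \<open>Induction on the number of points: \<open>escape_point\<close> handles one chosen point
  of each set, the induction hypothesis the others along the resulting subsequence. Uniting the two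
  finite sets is harmless because \<open>dist_to\<close> decreases as the set grows.\<close>

lemma escape_sets:
  fixes I :: "nat set"
  assumes complete: mcomplete and z: "z \<in> M" and I: "infinite I"
    and X: "\<And>l. l \<in> I \<Longrightarrow> finite (X l) \<and> X l \<subseteq> M \<and> card (X l) \<le> n"
  obtains A I' where "finite A" "A \<noteq> {}" "A \<subseteq> M" "I' \<subseteq> I" "infinite I'"
    "\<And>y. y \<in> M \<Longrightarrow> \<exists>l0. \<forall>l\<in>I'. l0 \<le> l \<longrightarrow> (\<forall>a\<in>X l. dist_to A a \<le> 4 * D a y)"
proof -
  have "\<exists>A I'. finite A \<and> A \<noteq> {} \<and> A \<subseteq> M \<and> I' \<subseteq> I \<and> infinite I' \<and>
    (\<forall>y\<in>M. \<exists>l0. \<forall>l\<in>I'. l0 \<le> l \<longrightarrow> (\<forall>a\<in>X l. dist_to A a \<le> 4 * D a y))"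
    using I X
  proof (induction n arbitrary: I X)
    case 0
    then have "X l = {}" if "l \<in> I" for l using that by fastforce
    then show ?case using 0 z by (intro exI[of _ "{z}"] exI[of _ I]) auto
  next
    case (Suc n)
    \<comment> \<open>For empty sets \<open>z\<close> is a placeholder that keeps \<open>x\<close>
      in \<open>M\<close>.\<close>
    define x where "x l = (if X l = {} then z else SOME a. a \<in> X l)" for l
    have x: "X l \<noteq> {} \<Longrightarrow> x l \<in> X l" for l by (auto simp: x_def some_in_eq)
    have xM: "x l \<in> M" if "l \<in> I" for l
      using x[of l] Suc.prems(2)[OF that] z by (cases "X l = {}") (auto simp: x_def)
    obtain A1 I1 where 1: "finite A1" "A1 \<noteq> {}" "A1 \<subseteq> M" "I1 \<subseteq> I" "infinite I1"
      "\<And>y. y \<in> M \<Longrightarrow> \<exists>l0. \<forall>l\<in>I1. l0 \<le> l \<longrightarrow> dist_to A1 (x l) \<le> 4 * D (x l) y"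
      using escape_point[of I x z, OF complete xM Suc.prems(1) z] by metis
    have "finite (X l - {x l}) \<and> X l - {x l} \<subseteq> M \<and> card (X l - {x l}) \<le> n" if "l \<in> I1" for l
    proof -
      have l: "l \<in> I" using that 1 by blast
      then show ?thesis using Suc.prems(2)[OF l] x[of l] by (cases "X l = {}") auto
    qed
    with Suc.IH[of I1 "\<lambda>l. X l - {x l}", OF 1(5)] obtain A2 I2 where
      2: "finite A2" "A2 \<noteq> {}" "A2 \<subseteq> M" "I2 \<subseteq> I1" "infinite I2"
      "\<forall>y\<in>M. \<exists>l0. \<forall>l\<in>I2. l0 \<le> l \<longrightarrow> (\<forall>a\<in>X l - {x l}. dist_to A2 a \<le> 4 * D a y)"
      by metis
    have "\<exists>l0. \<forall>l\<in>I2. l0 \<le> l \<longrightarrow> (\<forall>a\<in>X l. dist_to (A1 \<union> A2) a \<le> 4 * D a y)" if y: "y \<in> M" for y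
    proof -
      obtain k1 where k1: "\<forall>l\<in>I1. k1 \<le> l \<longrightarrow> dist_to A1 (x l) \<le> 4 * D (x l) y" using 1(6)[OF y] by blast
      obtain k2 where k2: "\<forall>l\<in>I2. k2 \<le> l \<longrightarrow> (\<forall>a\<in>X l - {x l}. dist_to A2 a \<le> 4 * D a y)"
        using 2(6) y by blast
      have m: "dist_to (A1 \<union> A2) a \<le> dist_to A1 a" "dist_to (A1 \<union> A2) a \<le> dist_to A2 a" for a
        using 1 2 by (auto intro!: dist_to_mono)
      show ?thesis
      proof (intro exI[of _ "max k1 k2"] ballI impI)
        fix l a assume l: "l \<in> I2" "max k1 k2 \<le> l" and a: "a \<in> X l"
        show "dist_to (A1 \<union> A2) a \<le> 4 * D a y"
        proof (cases "a = x l")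
          case True
          have "dist_to A1 (x l) \<le> 4 * D (x l) y" using k1 l 2(4) by auto
          then show ?thesis using m(1)[of a] True by simp
        next
          case False
          then have "dist_to A2 a \<le> 4 * D a y" using k2 l a by simp
          then show ?thesis using m(2)[of a] by linarith
        qed
      qed
    qed
    then show ?case using 1 2 by (intro exI[of _ "A1 \<union> A2"] exI[of _ I2]) auto
  qed
  then show ?thesis using that by metis
qed

text \<open>Indices are chosen one by one, each beyond the finitely many bounds \<open>l0\<close>
  that belong to the points already used. For a new point \<open>a\<close> and an old point
  \<open>y\<close> the hypothesis controls \<open>dist_to A a\<close> only; the triangle inequality
  gives \<open>dist_to A y \<le> D y a + dist_to A a \<le> 5 * D y a\<close>, hence the constant
  5.\<close>

lemma choose_separated:
  fixes I :: "nat set"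
  assumes I: "infinite I" and A: "finite A" "A \<noteq> {}" "A \<subseteq> M"
    and X: "\<And>l. l \<in> I \<Longrightarrow> finite (X l) \<and> X l \<subseteq> M"
    and esc: "\<And>y. y \<in> M \<Longrightarrow> \<exists>l0. \<forall>l\<in>I. l0 \<le> l \<longrightarrow> (\<forall>a\<in>X l. dist_to A a \<le> 4 * D a y)"
  obtains S where "finite S" "S \<subseteq> I" "card S = s"
    "\<And>i l a b. i \<in> S \<Longrightarrow> l \<in> S \<Longrightarrow> i \<noteq> l \<Longrightarrow> a \<in> X i \<Longrightarrow> b \<in> X l \<Longrightarrow> dist_to A a \<le> 5 * D a b"
proof -
  have "\<exists>S. finite S \<and> S \<subseteq> I \<and> card S = s \<and>
    (\<forall>i\<in>S. \<forall>l\<in>S. i \<noteq> l \<longrightarrow> (\<forall>a\<in>X i. \<forall>b\<in>X l. dist_to A a \<le> 5 * D a b))"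
  proof (induction s)
    case 0
    show ?case by (intro exI[of _ "{}"]) auto
  next
    case (Suc s)
    then obtain S where S: "finite S" "S \<subseteq> I" "card S = s"
      "\<forall>i\<in>S. \<forall>l\<in>S. i \<noteq> l \<longrightarrow> (\<forall>a\<in>X i. \<forall>b\<in>X l. dist_to A a \<le> 5 * D a b)" by blast
    let ?Y = "\<Union>i\<in>S. X i"
    have Y: "finite ?Y" "?Y \<subseteq> M" using S X by blast+
    have "\<exists>L. \<forall>y\<in>?Y. \<forall>l\<in>I. L y \<le> l \<longrightarrow> (\<forall>a\<in>X l. dist_to A a \<le> 4 * D a y)"
      using esc Y(2) by (intro bchoice) blast
    then obtain L where L: "\<forall>y\<in>?Y. \<forall>l\<in>I. L y \<le> l \<longrightarrow> (\<forall>a\<in>X l. dist_to A a \<le> 4 * D a y)" by blast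
    have "finite (S \<union> (\<Union>y\<in>?Y. {..L y}))" using S Y by blast
    then obtain l where l: "l \<in> I" "l \<notin> S \<union> (\<Union>y\<in>?Y. {..L y})"
      using I by (meson finite_subset subsetI)
    have far: "dist_to A a \<le> 4 * D a y" if "y \<in> ?Y" "a \<in> X l" for a y
    proof -
      have "l \<notin> {..L y}" using l(2) that(1) by blast
      then have "L y \<le> l" by simp
      then show ?thesis using L l(1) that by blast
    qed
    have sym: "dist_to A y \<le> 5 * D y a" if y: "y \<in> ?Y" and a: "a \<in> X l" for a y
    proof -
      have "a \<in> M" "y \<in> M" using X[OF l(1)] Y y a by auto
      then show ?thesis
        using dist_to_triangle[OF A, of y a] far[OF y a] by (simp add: commute)
    qed
    have far5: "dist_to A a \<le> 5 * D a y" if "y \<in> ?Y" "a \<in> X l" for a y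
      using far[OF that] nonneg[of a y] by linarith
    show ?case
    proof (intro exI[of _ "insert l S"] conjI ballI impI)
      show "card (insert l S) = Suc s" using S l by simp
      fix i j a b assume *: "i \<in> insert l S" "j \<in> insert l S" "i \<noteq> j" "a \<in> X i" "b \<in> X j"
      then consider "i \<in> S" "j \<in> S" | "i = l" "j \<in> S" | "i \<in> S" "j = l" by blast
      then show "dist_to A a \<le> 5 * D a b"
      proof cases
        case 1
        then show ?thesis using S(4) * by blast
      next
        case 2
        then show ?thesis using far5[of b a] * by blast
      next
        case 3
        then show ?thesis using sym[of a b] * by blast
      qed
    qed (use S l in auto)
  qed
  then show ?thesis using that by metis
qed

text \<open>Cut out of a flow for the sum the random neighbourhoods \<^term>\<open>W i \<theta>\<close> of the supports, whose
  radii are proportional to the distance to \<^term>\<open>A\<close>, and reroute the cut edges to \<^term>\<open>A\<close>. An edge is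
  cut with probability proportional to its length, so the expected cost is controlled.\<close>

lemma transport_sum_separated:
  fixes C :: "'i \<Rightarrow> 'a \<Rightarrow> real"
  assumes \<alpha>: "0 < \<alpha>" "\<alpha> \<le> 1" and A: "finite A" "A \<noteq> {}" "A \<subseteq> M" and S: "finite S"
    and C: "\<And>i. i \<in> S \<Longrightarrow> C i \<in> balanced"
    and sep: "\<And>i l a b. i \<in> S \<Longrightarrow> l \<in> S \<Longrightarrow> i \<noteq> l \<Longrightarrow> C i a \<noteq> 0 \<Longrightarrow> C l b \<noteq> 0 \<Longrightarrow> dist_to A a \<le> 5 * D a b"
    and low: "\<And>i w. i \<in> S \<Longrightarrow> w \<in> balanced \<Longrightarrow> {v. w v \<noteq> 0} \<subseteq> A \<Longrightarrow> \<kappa> \<le> transport \<alpha> (C i - w)"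
  shows "\<kappa> * card S \<le> 81 * transport \<alpha> (\<Sum>i\<in>S. C i)"
proof -
  define r where "r = q * \<alpha>"
  define W where "W i \<theta> = {x \<in> M. \<exists>a. C i a \<noteq> 0 \<and> a \<notin> A \<and> D x a < \<theta> * dist_to A a}" for i \<theta>
  have supp: "a \<in> M" if "i \<in> S" "C i a \<noteq> 0" for i a
    using balanced_support(2)[OF C[OF that(1)]] that(2) by blast
  have pos: "0 < dist_to A a" if "i \<in> S" "C i a \<noteq> 0" "a \<notin> A" for i a
    using dist_to_pos[OF A supp[OF that(1,2)] that(3)] .
  have W_mono: "W i \<theta> \<subseteq> W i \<theta>'" if "i \<in> S" "\<theta> \<le> \<theta>'" for i \<theta> \<theta>'
    using that pos unfolding W_def by (force intro: less_le_trans mult_right_mono less_imp_le)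
  \<comment> \<open>For \<open>\<theta> \<le> 1/10\<close> the separation constant 5 makes the radii
    at atoms \<open>a\<close> and \<open>b\<close> of different summands at most
    \<open>D a b / 2\<close> each; as the balls are open, they are disjoint.\<close>
  have W_disj: "i = l" if h: "i \<in> S" "l \<in> S" "x \<in> W i \<theta>" "x \<in> W l \<theta>" "0 \<le> \<theta>" "\<theta> \<le> 1/10" for i l x \<theta>
  proof (rule ccontr)
    assume ne: "i \<noteq> l"
    obtain a where a: "C i a \<noteq> 0" "a \<notin> A" "D x a < \<theta> * dist_to A a" using h by (auto simp: W_def)
    obtain b where b: "C l b \<noteq> 0" "b \<notin> A" "D x b < \<theta> * dist_to A b" using h by (auto simp: W_def)
    have "x \<in> M" "a \<in> M" "b \<in> M" using h a b supp by (auto simp: W_def)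
    then have "D a b \<le> D x a + D x b" using triangle[of a x b] by (simp add: commute)
    moreover have "\<theta> * dist_to A a \<le> 1/10 * (5 * D a b)" "\<theta> * dist_to A b \<le> 1/10 * (5 * D b a)"
      using sep[OF h(1,2) ne a(1) b(1)] sep[OF h(2,1) ne[symmetric] b(1) a(1)]
        pos[OF h(1) a(1,2)] pos[OF h(2) b(1,2)] h by (intro mult_mono; simp)+
    ultimately show False using a b commute[of a b] by simp
  qed
  have W_other: "b \<notin> W i \<theta>" if "i \<in> S" "l \<in> S" "i \<noteq> l" "C l b \<noteq> 0" "0 \<le> \<theta>" "\<theta> \<le> 1/10" for i l b \<theta>
  proof
    assume "b \<in> W i \<theta>"
    then obtain a where a: "C i a \<noteq> 0" "a \<notin> A" "D b a < \<theta> * dist_to A a" by (auto simp: W_def)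
    have "\<theta> * dist_to A a \<le> 1/10 * (5 * D a b)"
      using sep[OF that(1-3) a(1) that(4)] pos[OF that(1) a(1,2)] that by (intro mult_mono) auto
    moreover have "0 \<le> D a b" by simp
    ultimately show False using a(3) commute[of a b] by linarith
  qed
  have W_own: "v \<in> W i \<theta>" if "i \<in> S" "C i v \<noteq> 0" "v \<notin> A" "0 < \<theta>" for i v \<theta>
    using that supp pos[OF that(1-3)] by (auto simp: W_def intro!: exI[of _ v])
  \<comment> \<open>The radii \<open>\<theta>\<close> that cut the edge from \<open>x\<close> to
    \<open>y\<close> with \<open>x\<close> inside lie in an interval that starts at \<open>s\<close>
    and has length \<open>D x y / \<rho>\<close>. The last conjunct bounds the price of rerouting
    from \<open>x\<close> to \<open>A\<close> by the same \<open>\<rho>\<close>, so that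
    \<open>\<rho>\<close> cancels after averaging.\<close>
  define G where "G x y s \<rho> \<longleftrightarrow> 0 < \<rho> \<and> (\<forall>\<theta> i. 1/20 \<le> \<theta> \<longrightarrow> \<theta> \<le> 1/10 \<longrightarrow> i \<in> S \<longrightarrow> x \<in> W i \<theta> \<longrightarrow> y \<notin> W i \<theta> \<longrightarrow>
    s < \<theta> \<and> \<theta> \<le> s + D x y / \<rho> \<and> dist_to A x \<le> 2 * \<rho>)" for x y s \<rho>
  have "\<exists>s \<rho>. G x y s \<rho>" if x: "x \<in> M" and y: "y \<in> M" for x y
  proof (cases "\<exists>i\<in>S. x \<in> W i (1/10)")
    case False
    then have "x \<notin> W i \<theta>" if "\<theta> \<le> 1/10" "i \<in> S" for \<theta> i using W_mono[OF that(2,1)] that(2) by blast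
    then show ?thesis by (intro exI[of _ 0] exI[of _ 1]) (auto simp: G_def)
  next
    case True
    then obtain i where i: "i \<in> S" "x \<in> W i (1/10)" by blast
    define Y where "Y = {a. C i a \<noteq> 0 \<and> a \<notin> A}"
    have Y: "finite Y" "Y \<noteq> {}"
      using balanced_support(1)[OF C[OF i(1)]] i(2) by (auto simp: Y_def W_def)
    \<comment> \<open>The ball around \<open>a\<close> contains \<open>x\<close> once
      \<open>\<theta>\<close> exceeds \<open>?h a\<close>. The atom that captures \<open>x\<close>
      first supplies both \<open>s\<close> and \<open>\<rho>\<close>.\<close>
    let ?h = "\<lambda>a. D x a / dist_to A a"
    have "Min (?h ` Y) \<in> ?h ` Y" using Y by (intro Min_in) auto
    then obtain a where a: "a \<in> Y" "?h a = Min (?h ` Y)" by force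
    then have amin: "?h a \<le> ?h a'" if "a' \<in> Y" for a' using Y(1) that by simp
    have aC: "C i a \<noteq> 0" "a \<notin> A" using a by (auto simp: Y_def)
    define \<rho> where "\<rho> = dist_to A a"
    have \<rho>: "0 < \<rho>" using pos[OF i(1) aC] by (simp add: \<rho>_def)
    have aM: "a \<in> M" using supp[OF i(1) aC(1)] .
    have "G x y (?h a) \<rho>"
      unfolding G_def
    proof (intro conjI allI impI)
      fix \<theta> j assume \<theta>: "1/20 \<le> \<theta>" "\<theta> \<le> 1/10" and j: "j \<in> S" and in_W: "x \<in> W j \<theta>" "y \<notin> W j \<theta>"
      have "x \<in> W j (1/10)" using W_mono[OF j \<theta>(2)] in_W(1) by blast
      then have ji: "j = i" using W_disj[OF j i(1) _ i(2)] by simp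
      obtain a' where a': "a' \<in> Y" "D x a' < \<theta> * dist_to A a'"
        using in_W(1) by (auto simp: W_def Y_def ji)
      then have "?h a' < \<theta>" using pos[OF i(1), of a'] by (simp add: Y_def divide_less_eq)
      then show lt: "?h a < \<theta>" using amin[OF a'(1)] by simp
      have "\<theta> * \<rho> \<le> D y a" using in_W(2) y aC by (auto simp: W_def ji \<rho>_def not_less)
      also have "D y a \<le> D x y + D x a" using triangle[OF y x aM] by (simp add: commute)
      finally have "\<theta> \<le> (D x y + D x a) / \<rho>" using \<rho> by (simp add: le_divide_eq)
      then show "\<theta> \<le> ?h a + D x y / \<rho>" by (simp add: add_divide_distrib \<rho>_def)
      have "D x a < \<theta> * \<rho>" using lt \<rho> by (simp add: divide_less_eq \<rho>_def)
      also have "\<dots> \<le> 1 * \<rho>" using \<theta> \<rho> by (intro mult_right_mono) auto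
      finally show "dist_to A x \<le> 2 * \<rho>"
        using dist_to_triangle[OF A x aM] by (simp add: \<rho>_def)
    qed (use \<rho> in simp)
    then show ?thesis by blast
  qed
  then obtain s \<rho> where G: "\<And>x y. x \<in> M \<Longrightarrow> y \<in> M \<Longrightarrow> G x y (s x y) (\<rho> x y)" by metis
  have "\<forall>x. \<exists>a. a \<in> A \<and> D x a = dist_to A x" using dist_to_attained[OF A(1,2)] by blast
  then obtain near where near: "\<And>x. near x \<in> A" "\<And>x. D x (near x) = dist_to A x" by metis
  have main: "\<kappa> * card S \<le> 81 * cost \<alpha> b" if b: "flow b" "bd b = (\<Sum>i\<in>S. C i)" for b
  proof -
    let ?P = "{e. b e \<noteq> 0}"
    have P: "finite ?P" "\<And>e. e \<in> ?P \<Longrightarrow> fst e \<in> M \<and> snd e \<in> M" using b(1) by (auto simp: flow_def)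
    let ?c = "\<lambda>e. \<bar>b e\<bar> powr r"
    let ?m = "\<lambda>x y (\<theta>::real). (2 * \<rho> x y) powr \<alpha> * indicator {s x y<..s x y + D x y / \<rho> x y} \<theta>"
    have theta: "\<kappa> * card S \<le> cost \<alpha> b + (\<Sum>e\<in>?P. ?c e * ?m (fst e) (snd e) \<theta> + ?c e * ?m (snd e) (fst e) \<theta>)"
      if \<theta>: "1/20 \<le> \<theta>" "\<theta> \<le> 1/10" for \<theta>
    proof -
      \<comment> \<open>The piece of an edge that serves summand \<open>i\<close>: kept inside
        \<open>W i \<theta>\<close>, redirected to the nearest point of \<open>A\<close> when cut,
        dropped when both ends are outside.\<close>
      define t where "t i e = (if fst e \<in> W i \<theta>
          then if snd e \<in> W i \<theta> then b e *\<^sub>R (dirac (fst e) - dirac (snd e))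
               else b e *\<^sub>R (dirac (fst e) - dirac (near (fst e)))
          else if snd e \<in> W i \<theta> then b e *\<^sub>R (dirac (near (snd e)) - dirac (snd e)) else 0)" for i e
      define \<omega> where "\<omega> i x y = (of_bool (x \<in> W i \<theta> \<and> y \<notin> W i \<theta>) :: real)" for i x y
      have nearM: "near x \<in> M" for x using near(1) A by blast
      have tb: "t i e \<in> balanced" if "e \<in> ?P" for i e
        using P(2)[OF that] nearM unfolding t_def
        by (auto intro!: balanced_scale balanced_dirac_diff balanced_0)
      have lower: "\<kappa> \<le> transport \<alpha> (\<Sum>e\<in>?P. t i e)" if i: "i \<in> S" for i
      proof -
        let ?u = "\<Sum>e\<in>?P. t i e"
        have ub: "?u \<in> balanced" by (rule balanced_sum) (rule tb)
        have "C i v = ?u v" if v: "v \<notin> A" for v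
        proof -
          have nv: "near x \<noteq> v" "v \<noteq> near x" for x using v near(1)[of x] by auto
          have tv: "t i e v = of_bool (v \<in> W i \<theta>) * (b e * (dirac (fst e) v - dirac (snd e) v))" for e
            by (auto simp: t_def dirac_def nv)
          have "?u v = of_bool (v \<in> W i \<theta>) * bd b v"
            unfolding sum_fun_apply bd_def tv by (simp add: sum_distrib_left)
          also have "\<dots> = of_bool (v \<in> W i \<theta>) * (\<Sum>l\<in>S. C l v)" by (simp add: b(2) sum_fun_apply)
          also have "\<dots> = C i v"
          proof (cases "v \<in> W i \<theta>")
            case True
            have "(\<Sum>l\<in>S. C l v) = (\<Sum>l\<in>{i}. C l v)"
              using S i W_other[OF i _ _ _ _ \<theta>(2)] True \<theta> by (intro sum.mono_neutral_right) auto
            then show ?thesis using True by simp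
          next
            case False
            then show ?thesis using W_own[OF i _ v, of \<theta>] \<theta> by auto
          qed
          finally show ?thesis by simp
        qed
        \<comment> \<open>No other summand has an atom in \<open>W i \<theta>\<close>, and rerouting
          affects only the mass on \<open>A\<close>. So the pieces transport \<open>C i\<close> up
          to a measure on \<open>A\<close>, and by \<open>low\<close> this cannot be cheap.\<close>
        then have "{v. (C i - ?u) v \<noteq> 0} \<subseteq> A" by auto
        then have "\<kappa> \<le> transport \<alpha> (C i - (C i - ?u))"
          using low[OF i balanced_diff[OF C[OF i] ub]] by blast
        then show ?thesis by simp
      qed
      have t_le: "transport \<alpha> (t i e) \<le> ?c e * (of_bool (fst e \<in> W i \<theta> \<and> snd e \<in> W i \<theta>) * D (fst e) (snd e) powr \<alpha>
          + \<omega> i (fst e) (snd e) * dist_to A (fst e) powr \<alpha> + \<omega> i (snd e) (fst e) * dist_to A (snd e) powr \<alpha>)"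
        if "e \<in> ?P" for i e
        using transport_dirac_le[of "fst e" "snd e" \<alpha> "b e"] P(2)[OF that] nearM
          transport_dirac_le[of "fst e" "near (fst e)" \<alpha> "b e"]
          transport_dirac_le[of "near (snd e)" "snd e" \<alpha> "b e"] near(2)
          commute[of "near (snd e)" "snd e"]
        unfolding t_def \<omega>_def r_def by auto
      have one: "(\<Sum>i\<in>S. of_bool (Q i)) \<le> (1::real)" if "\<And>i l. i \<in> S \<Longrightarrow> l \<in> S \<Longrightarrow> Q i \<Longrightarrow> Q l \<Longrightarrow> i = l" for Q
      proof -
        have "(\<Sum>i\<in>S. of_bool (Q i)) = real (card {i \<in> S. Q i})" using S by (simp add: Int_def)
        also have "card {i \<in> S. Q i} \<le> Suc 0"
          using that S by (subst card_le_Suc0_iff_eq) auto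
        finally show ?thesis by simp
      qed
      have both: "(\<Sum>i\<in>S. of_bool (x \<in> W i \<theta> \<and> y \<in> W i \<theta>)) \<le> (1::real)" for x y
        using W_disj[of _ _ x \<theta>] \<theta> by (intro one) auto
      have exit: "(\<Sum>i\<in>S. \<omega> i x y) * dist_to A x powr \<alpha> \<le> ?m x y \<theta>" if x: "x \<in> M" and y: "y \<in> M" for x y
      proof (cases "\<exists>i\<in>S. x \<in> W i \<theta> \<and> y \<notin> W i \<theta>")
        case True
        then obtain i where i: "i \<in> S" "x \<in> W i \<theta>" "y \<notin> W i \<theta>" by blast
        have g: "s x y < \<theta>" "\<theta> \<le> s x y + D x y / \<rho> x y" "dist_to A x \<le> 2 * \<rho> x y"
          using G[OF x y] \<theta> i unfolding G_def by blast+
        have "(\<Sum>i\<in>S. \<omega> i x y) \<le> 1" unfolding \<omega>_def using W_disj[of _ _ x \<theta>] \<theta> by (intro one) auto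
        then have "(\<Sum>i\<in>S. \<omega> i x y) * dist_to A x powr \<alpha> \<le> 1 * dist_to A x powr \<alpha>"
          by (intro mult_right_mono) auto
        also have "\<dots> \<le> (2 * \<rho> x y) powr \<alpha>"
          using g(3) \<alpha> dist_to_nonneg[OF A(1,2)] by (simp add: powr_mono2)
        finally show ?thesis using g by simp
      next
        case False
        then have "(\<Sum>i\<in>S. \<omega> i x y) = 0" unfolding \<omega>_def by (intro sum.neutral) auto
        then show ?thesis by simp
      qed
      have "\<kappa> * card S = (\<Sum>i\<in>S. \<kappa>)" by simp
      also have "\<dots> \<le> (\<Sum>i\<in>S. \<Sum>e\<in>?P. transport \<alpha> (t i e))"
      proof (intro sum_mono)
        fix i assume i: "i \<in> S"
        have "transport \<alpha> (\<Sum>e\<in>?P. t i e) \<le> (\<Sum>e\<in>?P. transport \<alpha> (t i e))"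
          by (rule transport_sum_le) (use P(1) tb \<alpha> in auto)
        then show "\<kappa> \<le> (\<Sum>e\<in>?P. transport \<alpha> (t i e))" using lower[OF i] by linarith
      qed
      also have "\<dots> = (\<Sum>e\<in>?P. \<Sum>i\<in>S. transport \<alpha> (t i e))" by (rule sum.swap)
      also have "\<dots> \<le> (\<Sum>e\<in>?P. weight b e powr \<alpha> + (?c e * ?m (fst e) (snd e) \<theta> + ?c e * ?m (snd e) (fst e) \<theta>))"
      proof (intro sum_mono)
        fix e assume e: "e \<in> ?P"
        let ?x = "fst e" and ?y = "snd e"
        have "(\<Sum>i\<in>S. transport \<alpha> (t i e)) \<le> (\<Sum>i\<in>S. ?c e * (of_bool (?x \<in> W i \<theta> \<and> ?y \<in> W i \<theta>) * D ?x ?y powr \<alpha>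
          + \<omega> i ?x ?y * dist_to A ?x powr \<alpha> + \<omega> i ?y ?x * dist_to A ?y powr \<alpha>))"
          by (intro sum_mono t_le[OF e])
        also have "\<dots> = ?c e * ((\<Sum>i\<in>S. of_bool (?x \<in> W i \<theta> \<and> ?y \<in> W i \<theta>)) * D ?x ?y powr \<alpha>
          + (\<Sum>i\<in>S. \<omega> i ?x ?y) * dist_to A ?x powr \<alpha> + (\<Sum>i\<in>S. \<omega> i ?y ?x) * dist_to A ?y powr \<alpha>)"
          by (simp only: sum_distrib_left sum_distrib_right sum.distrib distrib_left)
        also have "\<dots> \<le> ?c e * (1 * D ?x ?y powr \<alpha> + ?m ?x ?y \<theta> + ?m ?y ?x \<theta>)"
          using P(2)[OF e] both by (intro mult_left_mono add_mono mult_right_mono exit) auto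
        finally show "(\<Sum>i\<in>S. transport \<alpha> (t i e)) \<le>
            weight b e powr \<alpha> + (?c e * ?m ?x ?y \<theta> + ?c e * ?m ?y ?x \<theta>)"
          by (simp add: weight_powr r_def distrib_left)
      qed
      finally show ?thesis by (simp add: sum.distrib cost_def)
    qed
    \<comment> \<open>Each edge is counted once per orientation, since either end may be the one
      inside a neighbourhood.\<close>
    define src where "src j = (if snd j then fst (fst j) else snd (fst j))" for j :: "('a \<times> 'a) \<times> bool"
    define tgt where "tgt j = (if snd j then snd (fst j) else fst (fst j))" for j :: "('a \<times> 'a) \<times> bool"
    let ?J = "?P \<times> (UNIV :: bool set)"
    have sum_J: "(\<Sum>j\<in>?J. f j) = (\<Sum>e\<in>?P. f (e, True) + f (e, False))" for f :: "_ \<Rightarrow> real"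
    proof -
      have "(\<Sum>j\<in>?J. f j) = (\<Sum>e\<in>?P. \<Sum>\<beta>\<in>UNIV. f (e, \<beta>))"
        by (simp add: sum.cartesian_product)
      then show ?thesis by (simp add: UNIV_bool add.commute)
    qed
    have J: "src j \<in> M" "tgt j \<in> M" "0 < \<rho> (src j) (tgt j)" if "j \<in> ?J" for j
      using that P(2)[of "fst j"] G[of "src j" "tgt j"] by (auto simp: src_def tgt_def G_def)
    have "(\<kappa> * card S - cost \<alpha> b) * (1/10 - 1/20) \<le>
        (\<Sum>j\<in>?J. ?c (fst j) * (2 * \<rho> (src j) (tgt j)) powr \<alpha> *
          min (1/10 - 1/20) (s (src j) (tgt j) + D (src j) (tgt j) / \<rho> (src j) (tgt j) - s (src j) (tgt j)))"
    proof (rule average_indicators)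
      show "finite ?J" using P by simp
      show "s (src j) (tgt j) \<le> s (src j) (tgt j) + D (src j) (tgt j) / \<rho> (src j) (tgt j)"
        if "j \<in> ?J" for j using J[OF that] by simp
      fix \<theta> :: real assume \<theta>: "1/20 \<le> \<theta>" "\<theta> \<le> 1/10"
      show "\<kappa> * card S - cost \<alpha> b \<le> (\<Sum>j\<in>?J. ?c (fst j) * (2 * \<rho> (src j) (tgt j)) powr \<alpha> *
        indicator {s (src j) (tgt j)<..s (src j) (tgt j) + D (src j) (tgt j) / \<rho> (src j) (tgt j)} \<theta>)"
        using theta[OF \<theta>] unfolding sum_J by (simp add: src_def tgt_def mult.assoc)
    qed auto
    \<comment> \<open>Rerouting costs \<open>(2 * \<rho>) powr \<alpha>\<close> and happens on a set
      of radii of measure at most \<open>(D / \<rho>) powr \<alpha>\<close>. The product is at most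
      twice the price of the edge.\<close>
    also have "\<dots> \<le> (\<Sum>j\<in>?J. 2 * (?c (fst j) * D (src j) (tgt j) powr \<alpha>))"
    proof (intro sum_mono)
      fix j assume j: "j \<in> ?J"
      let ?D = "D (src j) (tgt j)" and ?\<rho> = "\<rho> (src j) (tgt j)" and ?s = "s (src j) (tgt j)"
      have "min (1/10 - 1/20) (?s + ?D / ?\<rho> - ?s) = min (1/20) (?D / ?\<rho>)" by simp
      also have "\<dots> \<le> (1/20) powr (1 - \<alpha>) * (?D / ?\<rho>) powr \<alpha>"
        using J[OF j] \<alpha> by (intro min_le_powr) auto
      also have "\<dots> \<le> 1 * (?D / ?\<rho>) powr \<alpha>"
        using \<alpha> by (intro mult_right_mono powr_le1) auto
      finally have "?c (fst j) * (2 * ?\<rho>) powr \<alpha> * min (1/10 - 1/20) (?s + ?D / ?\<rho> - ?s)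
          \<le> ?c (fst j) * (2 * ?\<rho>) powr \<alpha> * (?D / ?\<rho>) powr \<alpha>"
        by (intro mult_left_mono) auto
      also have "\<dots> = 2 powr \<alpha> * (?c (fst j) * ?D powr \<alpha>)"
        using J[OF j] by (simp add: powr_mult powr_divide)
      also have "2 powr \<alpha> \<le> (2 powr 1 :: real)" using \<alpha> by (intro powr_mono) auto
      finally show "?c (fst j) * (2 * ?\<rho>) powr \<alpha> * min (1/10 - 1/20) (?s + ?D / ?\<rho> - ?s)
          \<le> 2 * (?c (fst j) * ?D powr \<alpha>)" by (simp add: mult_right_mono)
    qed
    \<comment> \<open>Two orientations, each with factor 2. The radius ranges over an interval of
      length 1/20, so the outcome is
      \<open>\<kappa> * card S \<le> (1 + 20 * 4) * cost \<alpha> b\<close>; this is the constant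
      81.\<close>
    also have "\<dots> = 4 * cost \<alpha> b"
      unfolding sum_J by (simp add: src_def tgt_def commute[of "snd _" "fst _"] cost_def weight_powr r_def
          sum_distrib_left)
    finally show ?thesis by simp
  qed
  show ?thesis
  proof (rule field_le_epsilon)
    fix e :: real assume "e > 0"
    then obtain b where b: "flow b" "bd b = (\<Sum>i\<in>S. C i)" "cost \<alpha> b < transport \<alpha> (\<Sum>i\<in>S. C i) + e / 81"
      using transport_approx[OF balanced_sum[of S C], of \<alpha> "transport \<alpha> (\<Sum>i\<in>S. C i) + e / 81"] C by auto
    show "\<kappa> * card S \<le> 81 * transport \<alpha> (\<Sum>i\<in>S. C i) + e"
      using main[OF b(1,2)] b(3) by simp
  qed
qed

section \<open>Measures supported on a fixed finite set\<close>

lemma abs_sum_powr_le: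
  assumes "finite P" "0 < s" "s \<le> 1"
  shows "\<bar>\<Sum>e\<in>P. f e\<bar> powr (q * s) \<le> (\<Sum>e\<in>P. \<bar>f e\<bar> powr (q * s))"
  using assms(1)
proof (induction P rule: finite_induct)
  case (insert e P)
  then show ?case using abs_powr_add_le[OF assms(2,3), of "f e" "sum f P"] by simp
qed simp

text \<open>The mass at a point is seen through the boundary of a ball of random radius.\<close>

lemma coefficient_bound:
  assumes \<alpha>: "0 < \<alpha>" "\<alpha> \<le> 1" and A: "finite A" "A \<subseteq> M" "a \<in> A"
  obtains c where "0 < c"
    "\<And>w. w \<in> balanced \<Longrightarrow> {v. w v \<noteq> 0} \<subseteq> A \<Longrightarrow> c * \<bar>w a\<bar> powr (q * \<alpha>) \<le> transport \<alpha> w"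
proof (cases "A = {a}")
  case True
  \<comment> \<open>A balanced measure carried by one point is zero, so any constant serves.\<close>
  have "1 * \<bar>w a\<bar> powr (q * \<alpha>) \<le> transport \<alpha> w" if "w \<in> balanced" "{v. w v \<noteq> 0} \<subseteq> A" for w
    using balanced_sum_zero[OF that(1) A(1) that(2)] transport_nonneg[OF that(1)] True by simp
  then show ?thesis using that[of 1] by simp
next
  case False
  define r where "r = q * \<alpha>"
  define \<rho> where "\<rho> = dist_to (A - {a}) a"
  have A': "finite (A - {a})" "A - {a} \<noteq> {}" "A - {a} \<subseteq> M" "a \<in> M" using A False by auto
  have \<rho>: "0 < \<rho>" unfolding \<rho>_def by (rule dist_to_pos[OF A']) simp
  have main: "(\<rho> / 2) powr \<alpha> * \<bar>w a\<bar> powr r \<le> cost \<alpha> b"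
    if w: "{v. w v \<noteq> 0} \<subseteq> A" and b: "flow b" "bd b = w" for w b
  proof -
    let ?P = "{e. b e \<noteq> 0}"
    have P: "finite ?P" "\<And>e. e \<in> ?P \<Longrightarrow> fst e \<in> M \<and> snd e \<in> M" using b(1) by (auto simp: flow_def)
    let ?lo = "\<lambda>e. min (D a (fst e)) (D a (snd e))" and ?hi = "\<lambda>e. max (D a (fst e)) (D a (snd e))"
    have "\<bar>w a\<bar> powr r * (\<rho> - \<rho> / 2) \<le> (\<Sum>e\<in>?P. \<bar>b e\<bar> powr r * min (\<rho> - \<rho> / 2) (?hi e - ?lo e))"
    proof (rule average_indicators)
      fix \<theta> assume \<theta>: "\<rho> / 2 \<le> \<theta>" "\<theta> \<le> \<rho>"
      \<comment> \<open>Indicator of the ball of radius \<open>\<theta>\<close> around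
        \<open>a\<close>. The other points of \<open>A\<close> are at distance at least
        \<open>\<rho> \<ge> \<theta>\<close>, so pairing \<open>w\<close> with \<open>g\<close>
        leaves \<open>w a\<close>, while on the side of the flow only edges crossing the sphere
        survive. The strict inequality matches the half-open intervals of
        \<open>average_indicators\<close>.\<close>
      define g where "g v = (of_bool (D a v < \<theta>) :: real)" for v
      let ?V = "A \<union> fst ` ?P \<union> snd ` ?P"
      have V: "finite ?V" using A P by simp
      have far: "\<theta> \<le> D a v" if "v \<in> A" "v \<noteq> a" for v
      proof -
        have "\<rho> \<le> D a v" unfolding \<rho>_def using A' that by (intro dist_to_le) auto
        then show ?thesis using \<theta> by simp
      qed
      have gw: "g v * w v = (if v = a then w a else 0)" for v
      proof (cases "v = a")
        case True
        then show ?thesis using \<theta> \<rho> A' by (simp add: g_def)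
      next
        case f: False
        show ?thesis
        proof (cases "v \<in> A")
          case True
          then show ?thesis using far[OF True f] f by (simp add: g_def)
        next
          case False
          then have "w v = 0" using w by blast
          then show ?thesis using f by simp
        qed
      qed
      have "w a = (\<Sum>v\<in>?V. g v * w v)" using V A(3) by (simp add: gw)
      also have "\<dots> = (\<Sum>v\<in>?V. \<Sum>e\<in>?P. g v * (b e * (dirac (fst e) v - dirac (snd e) v)))"
        unfolding b(2)[symmetric] bd_def sum_distrib_left ..
      also have "\<dots> = (\<Sum>e\<in>?P. \<Sum>v\<in>?V. g v * (b e * (dirac (fst e) v - dirac (snd e) v)))"
        by (rule sum.swap)
      also have "\<dots> = (\<Sum>e\<in>?P. b e * (g (fst e) - g (snd e)))"
      proof (rule sum.cong[OF refl])
        fix e assume e: "e \<in> ?P"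
        have d: "(\<Sum>v\<in>?V. g v * dirac x v) = g x" if "x \<in> ?V" for x
        proof -
          have "(\<Sum>v\<in>?V. g v * dirac x v) = (\<Sum>v\<in>?V. if v = x then g v else 0)"
            by (rule sum.cong) (auto simp: dirac_def)
          then show ?thesis using that V by simp
        qed
        have "(\<Sum>v\<in>?V. g v * (b e * (dirac (fst e) v - dirac (snd e) v)))
            = b e * ((\<Sum>v\<in>?V. g v * dirac (fst e) v) - (\<Sum>v\<in>?V. g v * dirac (snd e) v))"
          by (simp only: sum_distrib_left sum_subtractf[symmetric]) (simp add: algebra_simps)
        also have "\<dots> = b e * (g (fst e) - g (snd e))"
          using d[of "fst e"] d[of "snd e"] e by auto
        finally show "(\<Sum>v\<in>?V. g v * (b e * (dirac (fst e) v - dirac (snd e) v)))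
            = b e * (g (fst e) - g (snd e))" .
      qed
      finally have "\<bar>w a\<bar> powr r \<le> (\<Sum>e\<in>?P. \<bar>b e * (g (fst e) - g (snd e))\<bar> powr r)"
        using abs_sum_powr_le[OF P(1) \<alpha>] by (simp add: r_def)
      also have "\<dots> \<le> (\<Sum>e\<in>?P. \<bar>b e\<bar> powr r * indicator {?lo e<..?hi e} \<theta>)"
        by (intro sum_mono) (auto simp: g_def abs_mult powr_mult)
      finally show "\<bar>w a\<bar> powr r \<le> (\<Sum>e\<in>?P. \<bar>b e\<bar> powr r * indicator {?lo e<..?hi e} \<theta>)" .
    qed (use P \<rho> in auto)
    also have "\<dots> \<le> (\<Sum>e\<in>?P. \<bar>b e\<bar> powr r * ((\<rho> / 2) powr (1 - \<alpha>) * D (fst e) (snd e) powr \<alpha>))"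
    proof (intro sum_mono mult_left_mono)
      fix e assume e: "e \<in> ?P"
      have "?hi e - ?lo e \<le> D (fst e) (snd e)"
        using triangle[of a "fst e" "snd e"] triangle[of a "snd e" "fst e"] P(2)[OF e] A'
          commute[of "fst e" "snd e"] by (auto simp: max_def min_def)
      then have "min (\<rho> - \<rho> / 2) (?hi e - ?lo e) \<le> min (\<rho> / 2) (D (fst e) (snd e))"
        by (intro min.mono) auto
      also have "\<dots> \<le> (\<rho> / 2) powr (1 - \<alpha>) * D (fst e) (snd e) powr \<alpha>"
        using \<rho> \<alpha> by (intro min_le_powr) auto
      finally show "min (\<rho> - \<rho> / 2) (?hi e - ?lo e) \<le> (\<rho> / 2) powr (1 - \<alpha>) * D (fst e) (snd e) powr \<alpha>" .
    qed auto
    also have "\<dots> = (\<rho> / 2) powr (1 - \<alpha>) * cost \<alpha> b"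
      by (simp add: cost_def weight_powr r_def sum_distrib_left mult_ac)
    finally have "(\<rho> / 2) powr (1 - \<alpha>) * ((\<rho> / 2) powr \<alpha> * \<bar>w a\<bar> powr r) \<le> (\<rho> / 2) powr (1 - \<alpha>) * cost \<alpha> b"
      using \<rho> by (simp add: powr_diff mult.commute)
    then show ?thesis using \<rho> by simp
  qed
  have "(\<rho> / 2) powr \<alpha> * \<bar>w a\<bar> powr (q * \<alpha>) \<le> transport \<alpha> w"
    if w: "w \<in> balanced" "{v. w v \<noteq> 0} \<subseteq> A" for w
  proof (rule field_le_epsilon)
    fix e :: real assume "e > 0"
    then obtain b where b: "flow b" "bd b = w" "cost \<alpha> b < transport \<alpha> w + e"
      using transport_approx[OF w(1), of \<alpha> "transport \<alpha> w + e"] by auto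
    then show "(\<rho> / 2) powr \<alpha> * \<bar>w a\<bar> powr (q * \<alpha>) \<le> transport \<alpha> w + e"
      using main[OF w(2) b(1,2)] by (simp add: r_def)
  qed
  then show ?thesis using that[of "(\<rho> / 2) powr \<alpha>"] \<rho> by simp
qed

text \<open>Cost of the star-shaped flow that sends every atom to the hub \<open>a\<close>.\<close>

lemma transport_le_coefficients:
  assumes "m \<in> balanced" "finite A" "{v. m v \<noteq> 0} \<subseteq> A" "A \<subseteq> M" "a \<in> M" "0 < \<alpha>" "\<alpha> \<le> 1"
  shows "transport \<alpha> m \<le> (\<Sum>v\<in>A. \<bar>m v\<bar> powr (q * \<alpha>) * D v a powr \<alpha>)"
proof -
  have "transport \<alpha> m = transport \<alpha> (\<Sum>v\<in>A. m v *\<^sub>R (dirac v - dirac a))"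
    using balanced_expand[OF assms(1-3)] by simp
  also have "\<dots> \<le> (\<Sum>v\<in>A. transport \<alpha> (m v *\<^sub>R (dirac v - dirac a)))"
    by (rule transport_sum_le) (use assms in \<open>auto intro: balanced_scale balanced_dirac_diff\<close>)
  also have "\<dots> \<le> (\<Sum>v\<in>A. \<bar>m v\<bar> powr (q * \<alpha>) * D v a powr \<alpha>)"
    using assms by (intro sum_mono transport_dirac_le) auto
  finally show ?thesis .
qed

text \<open>Measures on a fixed finite set form a finite-dimensional space, where bounded sets are
  totally bounded. \<open>coefficient_bound\<close> bounds the coefficients, so infinitely many of
  the measures share a cell of a grid of mesh \<open>h\<close>.\<close>

lemma finite_support_close:
  fixes K :: "nat set"
  assumes \<alpha>: "0 < \<alpha>" "\<alpha> \<le> 1" and A: "finite A" "A \<noteq> {}" "A \<subseteq> M" and K: "infinite K"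
    and w: "\<And>k. k \<in> K \<Longrightarrow> w k \<in> balanced \<and> {v. w k v \<noteq> 0} \<subseteq> A \<and> transport \<alpha> (w k) \<le> C"
    and \<delta>: "0 < \<delta>"
  obtains k l where "k \<in> K" "l \<in> K" "k \<noteq> l" "transport \<alpha> (w k - w l) \<le> \<delta>"
proof -
  define r where "r = q * \<alpha>"
  have r: "0 < r" using q \<alpha> by (simp add: r_def)
  have "\<forall>a\<in>A. \<exists>c>0. \<forall>w. w \<in> balanced \<longrightarrow> {v. w v \<noteq> 0} \<subseteq> A \<longrightarrow> c * \<bar>w a\<bar> powr r \<le> transport \<alpha> w"
    using coefficient_bound[OF \<alpha> A(1,3)] unfolding r_def by metis
  then obtain c where c: "\<And>a. a \<in> A \<Longrightarrow> 0 < c a"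
    "\<And>a w. a \<in> A \<Longrightarrow> w \<in> balanced \<Longrightarrow> {v. w v \<noteq> 0} \<subseteq> A \<Longrightarrow> c a * \<bar>w a\<bar> powr r \<le> transport \<alpha> w"
    by metis
  obtain a0 where a0: "a0 \<in> A" using A by blast
  define B where "B a = (C / c a) powr (1 / r)" for a
  have B: "\<bar>w k a\<bar> \<le> B a" if k: "k \<in> K" and a: "a \<in> A" for k a
  proof -
    have "c a * \<bar>w k a\<bar> powr r \<le> C" using c(2)[OF a, of "w k"] w[OF k] by linarith
    then have "\<bar>w k a\<bar> powr r \<le> C / c a" using c(1)[OF a] by (simp add: field_simps)
    then have "(\<bar>w k a\<bar> powr r) powr (1 / r) \<le> B a" unfolding B_def using r by (intro powr_mono2) auto
    then show ?thesis using r by (simp add: powr_powr)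
  qed
  define Q where "Q = (\<Sum>a\<in>A. D a a0 powr \<alpha>)"
  have Q: "0 \<le> Q" by (simp add: Q_def sum_nonneg)
  \<comment> \<open>Two measures whose coefficients differ by at most \<open>h\<close> are at cost
    at most \<open>h powr r * Q\<close>, which is below \<open>\<delta>\<close>.\<close>
  define h where "h = (\<delta> / (Q + 1)) powr (1 / r)"
  have h: "0 < h" "h powr r = \<delta> / (Q + 1)" using \<delta> Q r by (auto simp: h_def powr_powr)
  define \<phi> where "\<phi> k = (\<lambda>a\<in>A. \<lfloor>w k a / h\<rfloor>)" for k
  have "\<phi> ` K \<subseteq> PiE A (\<lambda>a. {\<lfloor>- B a / h\<rfloor>..\<lfloor>B a / h\<rfloor>})"
  proof
    fix f assume "f \<in> \<phi> ` K"
    then obtain k where k: "k \<in> K" "f = \<phi> k" by blast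
    have "\<lfloor>- B a / h\<rfloor> \<le> \<lfloor>w k a / h\<rfloor> \<and> \<lfloor>w k a / h\<rfloor> \<le> \<lfloor>B a / h\<rfloor>" if "a \<in> A" for a
      using B[OF k(1) that] h unfolding abs_le_iff
      by (intro conjI floor_mono divide_right_mono) linarith+
    then show "f \<in> PiE A (\<lambda>a. {\<lfloor>- B a / h\<rfloor>..\<lfloor>B a / h\<rfloor>})" by (auto simp: k \<phi>_def)
  qed
  then have "finite (\<phi> ` K)" by (rule finite_subset) (intro finite_PiE A finite_atLeastAtMost_int)
  then obtain k where k: "k \<in> K" "infinite {l \<in> K. \<phi> l = \<phi> k}" using pigeonhole_infinite[OF K] by blast
  then have "infinite ({l \<in> K. \<phi> l = \<phi> k} - {k})" by simp
  then have "{l \<in> K. \<phi> l = \<phi> k} - {k} \<noteq> {}" by (metis finite.emptyI)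
  then obtain l where l: "l \<in> K" "l \<noteq> k" "\<phi> l = \<phi> k" by blast
  have close: "\<bar>(w k - w l) a\<bar> \<le> h" if a: "a \<in> A" for a
  proof -
    have "\<lfloor>w k a / h\<rfloor> = \<lfloor>w l a / h\<rfloor>" using fun_cong[OF l(3), of a] a by (simp add: \<phi>_def)
    then have "\<bar>w k a / h - w l a / h\<bar> \<le> 1" by linarith
    then show ?thesis using h by (simp add: abs_le_iff field_simps flip: diff_divide_distrib)
  qed
  have "w k v = 0" "w l v = 0" if "v \<notin> A" for v using w[OF k(1)] w[OF l(1)] that by blast+
  then have "(w k - w l) v = 0" if "v \<notin> A" for v using that by simp
  then have supp: "{v. (w k - w l) v \<noteq> 0} \<subseteq> A" by blast
  have "transport \<alpha> (w k - w l) \<le> (\<Sum>a\<in>A. \<bar>(w k - w l) a\<bar> powr r * D a a0 powr \<alpha>)"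
    unfolding r_def using w[OF k(1)] w[OF l(1)] A a0 \<alpha>
    by (intro transport_le_coefficients[OF _ _ supp] balanced_diff) auto
  also have "\<dots> \<le> (\<Sum>a\<in>A. h powr r * D a a0 powr \<alpha>)"
    using close r by (intro sum_mono mult_right_mono powr_mono2) auto
  also have "\<dots> = \<delta> * (Q / (Q + 1))"
    unfolding h(2) sum_distrib_left[symmetric] Q_def[symmetric] by simp
  also have "\<dots> \<le> \<delta> * 1" using Q \<delta> by (intro mult_left_mono) auto
  finally show ?thesis using that k l by auto
qed

text \<open>The embedding of l_\<alpha> into l_1: no weight exceeds
  \<open>cost \<alpha> b powr (1 / \<alpha>)\<close>, and with this threshold every edge is
  light.\<close>

lemma cost_1_le_cost:
  assumes b: "flow b" and \<alpha>: "0 < \<alpha>" "\<alpha> < 1"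
  shows "cost 1 b \<le> cost \<alpha> b powr (1 / \<alpha>)"
proof (cases "cost \<alpha> b = 0")
  case True
  then have "\<forall>e\<in>{e. b e \<noteq> 0}. weight b e powr \<alpha> = 0"
    unfolding cost_def using flow_finite[OF b] by (subst sum_nonneg_eq_0_iff[symmetric]) auto
  then have "cost 1 b = 0" unfolding cost_def by (intro sum.neutral) auto
  then show ?thesis using True by simp
next
  case False
  then have pos: "0 < cost \<alpha> b" using cost_nonneg[of \<alpha> b] by linarith
  define \<mu> where "\<mu> = cost \<alpha> b powr (1 / \<alpha>)"
  have \<mu>: "0 < \<mu>" "\<mu> powr \<alpha> = cost \<alpha> b" using pos \<alpha> by (auto simp: \<mu>_def powr_powr)
  have "weight b e \<le> \<mu>" if "b e \<noteq> 0" for e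
  proof -
    have "weight b e powr \<alpha> \<le> cost \<alpha> b"
      unfolding cost_def using flow_finite[OF b] that by (intro member_le_sum) auto
    then have "(weight b e powr \<alpha>) powr (1 / \<alpha>) \<le> \<mu>" unfolding \<mu>_def using \<alpha> by (intro powr_mono2) auto
    then show ?thesis using \<alpha> by (simp add: powr_powr)
  qed
  moreover have "restrict_flow b {e. b e \<noteq> 0} = b" by (auto simp: restrict_flow_def)
  ultimately have "cost 1 b \<le> \<mu> powr (1 - \<alpha>) * cost \<alpha> b"
    using cost_1_light_edges[OF b \<alpha>(2), of "{e. b e \<noteq> 0}" \<mu>] by simp
  also have "\<dots> = \<mu>" using \<mu> by (simp flip: \<mu>(2) powr_add)
  finally show ?thesis by (simp add: \<mu>_def)
qed

section \<open>Combinations that are small for exponent 1\<close>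

lemma exists_small_scale:
  fixes B \<kappa> :: real
  assumes "\<alpha> < 1" "0 < \<kappa>" "0 \<le> B" "0 < \<tau>0"
  obtains \<tau> where "0 < \<tau>" "\<tau> \<le> \<tau>0" "\<tau> powr (1 - \<alpha>) * B \<le> \<kappa>"
proof -
  define \<tau> where "\<tau> = min \<tau>0 ((\<kappa> / (B + 1)) powr (1 / (1 - \<alpha>)))"
  have \<tau>: "0 < \<tau>" using assms by (simp add: \<tau>_def)
  have "\<tau> powr (1 - \<alpha>) \<le> ((\<kappa> / (B + 1)) powr (1 / (1 - \<alpha>))) powr (1 - \<alpha>)"
    using \<tau> assms by (intro powr_mono2) (auto simp: \<tau>_def)
  also have "\<dots> = \<kappa> / (B + 1)" using assms by (simp add: powr_powr)
  finally have "\<tau> powr (1 - \<alpha>) * B \<le> \<kappa> / (B + 1) * B" using assms by (intro mult_right_mono) auto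
  also have "\<dots> = \<kappa> * (B / (B + 1))" by simp
  also have "\<dots> \<le> \<kappa> * 1" using assms by (intro mult_left_mono) auto
  finally show ?thesis using that[OF \<tau>] by (simp add: \<tau>_def)
qed

text \<open>Split each \<^term>\<open>m k\<close> into heavy, intermediate and light parts, the intermediate part having small
  cost. If the heavy parts come close to each other, differences of light parts work. Otherwise a
  subsequence of the heavy parts is separated relative to a finite set, and averages
  over long blocks work.\<close>

lemma diffuse_combination:
  fixes m :: "nat \<Rightarrow> 'a \<Rightarrow> real"
  assumes \<alpha>: "0 < \<alpha>" "\<alpha> < 1" and complete: mcomplete and z: "z \<in> M"
    and m: "\<And>k. m k \<in> balanced" "\<And>k. transport \<alpha> (m k) \<le> C"
    and \<epsilon>: "0 < \<epsilon>" and sep: "\<And>k l. k \<noteq> l \<Longrightarrow> \<epsilon> \<le> transport \<alpha> (m k - m l)"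
  obtains c where "\<epsilon> / 10000 \<le> c"
    "\<And>\<kappa>. 0 < \<kappa> \<Longrightarrow> \<exists>S lam v. finite S \<and> (\<Sum>k\<in>S. \<bar>lam k\<bar> powr (q * \<alpha>)) \<le> 2 \<and> v \<in> balanced \<and>
      transport \<alpha> ((\<Sum>k\<in>S. lam k *\<^sub>R m k) - v) \<le> c / 4 \<and> c \<le> transport \<alpha> v \<and> transport 1 v \<le> \<kappa>"
proof -
  have \<alpha>1: "\<alpha> \<le> 1" using \<alpha> by simp
  define C1 where "C1 = C + 1"
  have C0: "0 \<le> C" using m transport_nonneg order_trans by blast
  then have C1: "1 \<le> C1" by (simp add: C1_def)
  have "\<exists>b. flow b \<and> bd b = m k \<and> cost \<alpha> b \<le> C1" for k
    using transport_approx[OF m(1), of \<alpha> k C1] m(2)[of k] unfolding C1_def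
    by (metis less_add_one less_le order_le_less_trans)
  then obtain b where b: "\<And>k. flow (b k)" "\<And>k. bd (b k) = m k" "\<And>k. cost \<alpha> (b k) \<le> C1" by metis
  \<comment> \<open>Small against the gain \<open>\<epsilon> / 5184\<close> per index in the
    averaging case, of which \<open>2 * \<eta>\<close> is lost.\<close>
  define \<eta> where "\<eta> = \<epsilon> / 100000"
  have \<eta>: "0 < \<eta>" using \<epsilon> by (simp add: \<eta>_def)
  obtain \<tau>0 K where \<tau>0: "0 < \<tau>0" and K: "infinite K"
    and band: "\<And>\<tau>. 0 < \<tau> \<Longrightarrow> \<exists>k0. \<forall>k\<in>K. k0 \<le> k \<longrightarrow>
      cost \<alpha> (restrict_flow (b k) {e. \<tau> \<le> weight (b k) e \<and> weight (b k) e < \<tau>0}) \<le> \<eta>"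
  proof (rule level_splitting[where b = b, OF b(1) b(3) \<eta>])
    fix \<tau>0 and K :: "nat set"
    assume *: "0 < \<tau>0" "infinite K" and "\<And>\<tau>. 0 < \<tau> \<Longrightarrow> \<exists>k0. \<forall>k\<in>K. k0 \<le> k \<longrightarrow>
      cost \<alpha> (restrict_flow (b k) {e. \<tau> \<le> weight (b k) e \<and> weight (b k) e < \<tau>0}) \<le> \<eta>"
    from * this(3) show thesis by (rule that)
  qed
  define H where "H k = bd (restrict_flow (b k) {e. \<tau>0 \<le> weight (b k) e})" for k
  define R where "R \<tau> k = bd (restrict_flow (b k) {e. \<tau> \<le> weight (b k) e \<and> weight (b k) e < \<tau>0})" for \<tau> k
  define L where "L \<tau> k = bd (restrict_flow (b k) {e. weight (b k) e < \<tau>})" for \<tau> k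
  have HB: "H k \<in> balanced" and RB: "R \<tau> k \<in> balanced" and LB: "L \<tau> k \<in> balanced" for k \<tau>
    by (simp_all add: H_def R_def L_def balancedI flow_restrict b)
  have split: "m k = H k + R \<tau> k + L \<tau> k" if "\<tau> \<le> \<tau>0" for k \<tau>
  proof -
    let ?H = "restrict_flow (b k) {e. \<tau>0 \<le> weight (b k) e}"
    let ?R = "restrict_flow (b k) {e. \<tau> \<le> weight (b k) e \<and> weight (b k) e < \<tau>0}"
    let ?L = "restrict_flow (b k) {e. weight (b k) e < \<tau>}"
    have fl: "flow ?H" "flow ?R" "flow ?L" by (intro flow_restrict b)+
    have "?H + ?R + ?L = b k"
      using that by (auto simp: restrict_flow_def fun_eq_iff)
    then have "m k = bd (?H + ?R + ?L)" by (simp only: b(2))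
    also have "\<dots> = bd (?H + ?R) + bd ?L" by (rule bd_add[OF flow_add[OF fl(1,2)] fl(3)])
    also have "bd (?H + ?R) = bd ?H + bd ?R" by (rule bd_add[OF fl(1,2)])
    finally show ?thesis by (simp only: H_def R_def L_def)
  qed
  have HC: "transport \<alpha> (H k) \<le> C1" for k
    unfolding H_def by (intro order_trans[OF transport_bd_le] order_trans[OF cost_restrict_le] flow_restrict b)
  have LC: "transport \<alpha> (L \<tau> k) \<le> C1" for \<tau> k
    unfolding L_def by (intro order_trans[OF transport_bd_le] order_trans[OF cost_restrict_le] flow_restrict b)
  have L1: "transport 1 (L \<tau> k) \<le> \<tau> powr (1 - \<alpha>) * C1" for \<tau> k
  proof -
    have "transport 1 (L \<tau> k) \<le> cost 1 (restrict_flow (b k) {e. weight (b k) e < \<tau>})"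
      unfolding L_def by (intro transport_bd_le flow_restrict b)
    also have "\<dots> \<le> \<tau> powr (1 - \<alpha>) * cost \<alpha> (restrict_flow (b k) {e. weight (b k) e < \<tau>})"
      by (intro cost_1_light_edges b \<alpha>) auto
    also have "\<dots> \<le> \<tau> powr (1 - \<alpha>) * C1"
      by (intro mult_left_mono order_trans[OF cost_restrict_le] b) auto
    finally show ?thesis .
  qed
  have R\<eta>: "\<exists>k0. \<forall>k\<in>K. k0 \<le> k \<longrightarrow> transport \<alpha> (R \<tau> k) \<le> \<eta>" if "0 < \<tau>" for \<tau>
    using band[OF that] unfolding R_def by (meson b(1) flow_restrict order_trans transport_bd_le)
  show ?thesis
  \<comment> \<open>Closeness is asked for arbitrarily late indices because the intermediate parts
    are small only from an index that depends on \<open>\<tau>\<close>. The negation makes the heavy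
    parts \<open>\<epsilon> / 16\<close> apart beyond a fixed \<open>k0\<close>.\<close>
  proof (cases "\<forall>k0. \<exists>k\<in>K. \<exists>l\<in>K. k0 \<le> k \<and> k0 \<le> l \<and> k \<noteq> l \<and> transport \<alpha> (H k - H l) < \<epsilon> / 16")
    case True
    show ?thesis
    proof (rule that[of "\<epsilon> / 2"])
      fix \<kappa> :: real assume \<kappa>: "0 < \<kappa>"
      obtain \<tau> where \<tau>: "0 < \<tau>" "\<tau> \<le> \<tau>0" "\<tau> powr (1 - \<alpha>) * (2 * C1) \<le> \<kappa>"
        using exists_small_scale[OF \<alpha>(2) \<kappa> _ \<tau>0, of "2 * C1"] C1 by auto
      obtain k0 where k0: "\<forall>k\<in>K. k0 \<le> k \<longrightarrow> transport \<alpha> (R \<tau> k) \<le> \<eta>" using R\<eta>[OF \<tau>(1)] by blast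
      obtain k l where kl: "k \<in> K" "l \<in> K" "k0 \<le> k" "k0 \<le> l" "k \<noteq> l" "transport \<alpha> (H k - H l) < \<epsilon> / 16"
        using True by blast
      \<comment> \<open>The difference \<open>m k - m l\<close> costs at least
        \<open>\<epsilon>\<close>, and its heavy and intermediate parts at most
        \<open>\<epsilon> / 8\<close>, so the light part keeps at least
        \<open>\<epsilon> / 2\<close>.\<close>
      define v where "v = L \<tau> k - L \<tau> l"
      have v: "v \<in> balanced" by (simp add: v_def balanced_diff LB)
      have mm: "m k - m l = (H k - H l) + (R \<tau> k - R \<tau> l) + v"
        unfolding v_def split[OF \<tau>(2), of k] split[OF \<tau>(2), of l] by simp
      have le1: "transport \<alpha> ((H k - H l) + (R \<tau> k - R \<tau> l)) \<le>
          transport \<alpha> (H k - H l) + transport \<alpha> (R \<tau> k - R \<tau> l)"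
        by (intro transport_add_le balanced_diff HB RB \<alpha> \<alpha>1)
      have le2: "transport \<alpha> (R \<tau> k - R \<tau> l) \<le> transport \<alpha> (R \<tau> k) + transport \<alpha> (R \<tau> l)"
        by (intro transport_diff_le RB \<alpha> \<alpha>1)
      have err: "transport \<alpha> ((m k - m l) - v) \<le> \<epsilon> / 8"
      proof -
        have "transport \<alpha> (R \<tau> k) \<le> \<epsilon> / 100000" "transport \<alpha> (R \<tau> l) \<le> \<epsilon> / 100000"
          using k0 kl unfolding \<eta>_def by blast+
        with le1 le2 kl(6) \<epsilon> show ?thesis
          unfolding mm add_diff_cancel_right' by linarith
      qed
      have "transport \<alpha> (m k - m l) \<le> transport \<alpha> ((m k - m l) - v) + transport \<alpha> v"
        using transport_add_le[of "(m k - m l) - v" v \<alpha>] v m(1) \<alpha> \<alpha>1 by (simp add: balanced_diff)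
      then have big: "\<epsilon> / 2 \<le> transport \<alpha> v" using sep[OF kl(5)] err \<epsilon> by simp
      have "transport 1 v \<le> transport 1 (L \<tau> k) + transport 1 (L \<tau> l)"
        unfolding v_def by (intro transport_diff_le LB) auto
      then have small: "transport 1 v \<le> \<kappa>" using L1[of \<tau> k] L1[of \<tau> l] \<tau>(3) by simp
      define lam :: "nat \<Rightarrow> real" where "lam i = (if i = k then 1 else - 1)" for i
      have comb: "(\<Sum>i\<in>{k, l}. lam i *\<^sub>R m i) = m k - m l" using kl(5) by (simp add: lam_def)
      have norm: "(\<Sum>i\<in>{k, l}. \<bar>lam i\<bar> powr (q * \<alpha>)) \<le> 2" using kl(5) by (simp add: lam_def)
      show "\<exists>S lam v. finite S \<and> (\<Sum>k\<in>S. \<bar>lam k\<bar> powr (q * \<alpha>)) \<le> 2 \<and> v \<in> balanced \<and>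
        transport \<alpha> ((\<Sum>k\<in>S. lam k *\<^sub>R m k) - v) \<le> \<epsilon> / 2 / 4 \<and> \<epsilon> / 2 \<le> transport \<alpha> v \<and> transport 1 v \<le> \<kappa>"
        using v err big small norm comb
        by (intro exI[of _ "{k, l}"] exI[of _ lam] exI[of _ v] conjI) auto
    qed (use \<epsilon> in simp)
  next
    case False
    then obtain k0 where k0: "\<And>k l. k \<in> K \<Longrightarrow> l \<in> K \<Longrightarrow> k0 \<le> k \<Longrightarrow> k0 \<le> l \<Longrightarrow> k \<noteq> l \<Longrightarrow>
        \<epsilon> / 16 \<le> transport \<alpha> (H k - H l)"
      by (auto simp: not_less)
    \<comment> \<open>Markov's inequality bounds the number of heavy edges uniformly in
      \<open>k\<close>, and each edge has two ends. This uniformity is what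
      \<open>escape_sets\<close> requires.\<close>
    define n where "n = 2 * nat \<lfloor>C1 / \<tau>0 powr \<alpha>\<rfloor>"
    define X where "X k = {v. H k v \<noteq> 0}" for k
    have X: "finite (X k) \<and> X k \<subseteq> M \<and> card (X k) \<le> n" for k
    proof -
      let ?Z = "{e. restrict_flow (b k) {e. \<tau>0 \<le> weight (b k) e} e \<noteq> 0}"
      have "real (card ?Z) * \<tau>0 powr \<alpha> \<le> C1"
        using card_heavy_edges[OF b(1) \<tau>0 \<alpha>(1), of k] b(3)[of k] by linarith
      then have "real (card ?Z) \<le> C1 / \<tau>0 powr \<alpha>" using \<tau>0 by (simp add: field_simps)
      then have "card ?Z \<le> nat \<lfloor>C1 / \<tau>0 powr \<alpha>\<rfloor>" by (simp add: le_nat_floor)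
      then have "card (X k) \<le> n"
        using card_bd_support[OF flow_restrict[OF b(1)], of k "{e. \<tau>0 \<le> weight (b k) e}"]
        unfolding X_def H_def n_def by linarith
      then show ?thesis using balanced_support[OF HB] by (auto simp: X_def)
    qed
    define K1 where "K1 = K \<inter> {k0..}"
    have K1: "infinite K1"
    proof -
      have "K \<subseteq> K1 \<union> {..<k0}" by (auto simp: K1_def)
      then show ?thesis using K by (metis finite_Un finite_lessThan finite_subset)
    qed
    obtain A K2 where A: "finite A" "A \<noteq> {}" "A \<subseteq> M" and K2: "K2 \<subseteq> K1" "infinite K2"
      and esc: "\<And>y. y \<in> M \<Longrightarrow> \<exists>l0. \<forall>l\<in>K2. l0 \<le> l \<longrightarrow> (\<forall>a\<in>X l. dist_to A a \<le> 4 * D a y)"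
      using escape_sets[OF complete z K1, of X n] X by metis
    \<comment> \<open>Indices whose heavy part is nearly carried by \<open>A\<close>. If there were
      infinitely many, two of the approximating measures would be close by
      \<open>finite_support_close\<close>, and three errors of at most
      \<open>\<epsilon> / 64\<close> would contradict the separation
      \<open>\<epsilon> / 16\<close>.\<close>
    define F where "F = {k \<in> K2. \<exists>w\<in>balanced. {v. w v \<noteq> 0} \<subseteq> A \<and> transport \<alpha> (H k - w) < \<epsilon> / 64}"
    have "finite F"
    proof (rule ccontr)
      assume F: "infinite F"
      have "\<forall>k\<in>F. \<exists>w. w \<in> balanced \<and> {v. w v \<noteq> 0} \<subseteq> A \<and> transport \<alpha> (H k - w) < \<epsilon> / 64"
        by (auto simp: F_def)
      then obtain w where w: "\<And>k. k \<in> F \<Longrightarrow> w k \<in> balanced \<and> {v. w k v \<noteq> 0} \<subseteq> A \<and> transport \<alpha> (H k - w k) < \<epsilon> / 64"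
        by metis
      have wC: "transport \<alpha> (w k) \<le> C1 + \<epsilon>" if "k \<in> F" for k
      proof -
        have "transport \<alpha> (H k - (H k - w k)) \<le> transport \<alpha> (H k) + transport \<alpha> (H k - w k)"
          using w[OF that] HB by (intro transport_diff_le balanced_diff \<alpha> \<alpha>1) auto
        then show ?thesis using HC[of k] w[OF that] \<epsilon> by simp
      qed
      obtain k l where kl: "k \<in> F" "l \<in> F" "k \<noteq> l" "transport \<alpha> (w k - w l) \<le> \<epsilon> / 64"
        using finite_support_close[OF \<alpha>(1) \<alpha>1 A F, of w "C1 + \<epsilon>" "\<epsilon> / 64"] w wC \<epsilon> by auto
      have wb: "w k \<in> balanced" "w l \<in> balanced" using w kl by blast+
      have le1: "transport \<alpha> (((H k - w k) + (w k - w l)) - (H l - w l)) \<le>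
          transport \<alpha> ((H k - w k) + (w k - w l)) + transport \<alpha> (H l - w l)"
        by (intro transport_diff_le balanced_add balanced_diff HB wb \<alpha> \<alpha>1)
      have le2: "transport \<alpha> ((H k - w k) + (w k - w l)) \<le>
          transport \<alpha> (H k - w k) + transport \<alpha> (w k - w l)"
        by (intro transport_add_le balanced_diff HB wb \<alpha> \<alpha>1)
      have eq: "((H k - w k) + (w k - w l)) - (H l - w l) = H k - H l" by (simp only: algebra_simps)
      have "transport \<alpha> (H k - w k) < \<epsilon> / 64" "transport \<alpha> (H l - w l) < \<epsilon> / 64"
        using w kl by blast+
      then have "transport \<alpha> (H k - H l) < \<epsilon> / 16"
        using le1[unfolded eq] le2 kl(4) \<epsilon> by linarith
      moreover have "k \<in> K1" "l \<in> K1" using kl K2 by (auto simp: F_def)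
      ultimately show False using k0[of k l] kl(3) by (auto simp: K1_def)
    qed
    define K3 where "K3 = K2 - F"
    have K3: "infinite K3" using K2 \<open>finite F\<close> by (simp add: K3_def)
    have low: "\<epsilon> / 64 \<le> transport \<alpha> (H k - w)"
      if "k \<in> K3" "w \<in> balanced" "{v. w v \<noteq> 0} \<subseteq> A" for k w
      using that by (force simp: K3_def F_def not_less)
    have sum_big: "\<exists>S. finite S \<and> card S = s \<and> real s * (\<epsilon> / 10000) \<le> transport \<alpha> (\<Sum>k\<in>S. m k)"
      if s: "0 < s" for s :: nat
    proof -
      have "0 < real s * \<eta>" using s \<eta> by simp
      \<comment> \<open>The admissible error \<open>s * \<eta>\<close> is proportional to the block
        length, as is the gain it is compared with.\<close>
      then obtain \<kappa> where \<kappa>: "0 < \<kappa>" "\<And>u v. u \<in> balanced \<Longrightarrow> v \<in> balanced \<Longrightarrow> card {x. u x \<noteq> 0} \<le> s * n \<Longrightarrow>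
        transport \<alpha> u \<le> s * C1 \<Longrightarrow> transport \<alpha> v \<le> s * C1 \<Longrightarrow> transport 1 v \<le> \<kappa> \<Longrightarrow>
        transport \<alpha> u + transport \<alpha> v \<le> transport \<alpha> (u + v) + s * \<eta>"
        using transport_almost_additive[OF \<alpha>, of "s * \<eta>" "s * n" "s * C1"] by metis
      obtain \<tau> where \<tau>: "0 < \<tau>" "\<tau> \<le> \<tau>0" "\<tau> powr (1 - \<alpha>) * (s * C1) \<le> \<kappa>"
        using exists_small_scale[OF \<alpha>(2) \<kappa>(1) _ \<tau>0, of "s * C1"] C1 by auto
      obtain k1 where k1: "\<forall>k\<in>K. k1 \<le> k \<longrightarrow> transport \<alpha> (R \<tau> k) \<le> \<eta>" using R\<eta>[OF \<tau>(1)] by blast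
      define K4 where "K4 = K3 \<inter> {k1..}"
      have K4: "infinite K4"
      proof -
        have "K3 \<subseteq> K4 \<union> {..<k1}" by (auto simp: K4_def)
        then show ?thesis using K3 by (metis finite_Un finite_lessThan finite_subset)
      qed
      have K4_sub: "K4 \<subseteq> K3" "K4 \<subseteq> K2" "K4 \<subseteq> K" using K2 by (auto simp: K4_def K3_def K1_def)
      have esc4: "\<exists>l0. \<forall>l\<in>K4. l0 \<le> l \<longrightarrow> (\<forall>a\<in>X l. dist_to A a \<le> 4 * D a y)" if "y \<in> M" for y
        using esc[OF that] K4_sub(2) by blast
      obtain S where S: "finite S" "S \<subseteq> K4" "card S = s"
        "\<And>i l a c. i \<in> S \<Longrightarrow> l \<in> S \<Longrightarrow> i \<noteq> l \<Longrightarrow> a \<in> X i \<Longrightarrow> c \<in> X l \<Longrightarrow> dist_to A a \<le> 5 * D a c"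
        using choose_separated[OF K4 A, of X s] X esc4 by metis
      let ?u = "\<Sum>k\<in>S. H k" and ?v = "\<Sum>k\<in>S. L \<tau> k" and ?w = "\<Sum>k\<in>S. R \<tau> k"
      have ub: "?u \<in> balanced" and vb: "?v \<in> balanced" and wb: "?w \<in> balanced"
        by (simp_all add: balanced_sum HB LB RB)
      \<comment> \<open>Here \<open>64 * 81 = 5184\<close> originates.\<close>
      have "\<epsilon> / 64 * card S \<le> 81 * transport \<alpha> ?u"
        by (rule transport_sum_separated[OF \<alpha>(1) \<alpha>1 A S(1) HB])
          (use S(2,4) K4_sub(1) low in \<open>auto simp: X_def\<close>)
      then have u_big: "real s * (\<epsilon> / 5184) \<le> transport \<alpha> ?u"
        by (simp add: S(3) mult.commute)
      have "{x. ?u x \<noteq> 0} \<subseteq> (\<Union>k\<in>S. X k)"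
      proof
        fix x assume "x \<in> {x. ?u x \<noteq> 0}"
        then have "(\<Sum>k\<in>S. H k x) \<noteq> 0"
          by (simp add: sum_fun_apply)
        then obtain k where "k \<in> S" "H k x \<noteq> 0" by (meson sum.neutral)
        then show "x \<in> (\<Union>k\<in>S. X k)" by (auto simp: X_def)
      qed
      then have "card {x. ?u x \<noteq> 0} \<le> card (\<Union>k\<in>S. X k)" using S(1) X by (intro card_mono) auto
      also have "\<dots> \<le> (\<Sum>k\<in>S. card (X k))" by (rule card_UN_le[OF S(1)])
      also have "\<dots> \<le> (\<Sum>k\<in>S. n)" using X by (intro sum_mono) auto
      finally have card_u: "card {x. ?u x \<noteq> 0} \<le> s * n" by (simp add: S(3))
      have sums: "transport \<alpha> ?u \<le> s * C1" "transport \<alpha> ?v \<le> s * C1" "transport \<alpha> ?w \<le> s * \<eta>"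
        "transport 1 ?v \<le> \<kappa>"
      proof -
        have "transport \<alpha> ?u \<le> (\<Sum>k\<in>S. C1)"
          by (intro order_trans[OF transport_sum_le] sum_mono S HB \<alpha> \<alpha>1 HC)
        then show "transport \<alpha> ?u \<le> s * C1" by (simp add: S(3))
        have "transport \<alpha> ?v \<le> (\<Sum>k\<in>S. C1)"
          by (intro order_trans[OF transport_sum_le] sum_mono S LB \<alpha> \<alpha>1 LC)
        then show "transport \<alpha> ?v \<le> s * C1" by (simp add: S(3))
        have "transport \<alpha> ?w \<le> (\<Sum>k\<in>S. transport \<alpha> (R \<tau> k))"
          by (intro transport_sum_le S RB \<alpha> \<alpha>1)
        also have "\<dots> \<le> (\<Sum>k\<in>S. \<eta>)" using k1 S(2) K4_sub(3) by (intro sum_mono) (auto simp: K4_def)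
        finally show "transport \<alpha> ?w \<le> s * \<eta>" by (simp add: S(3))
        have "transport 1 ?v \<le> (\<Sum>k\<in>S. transport 1 (L \<tau> k))" by (intro transport_sum_le S LB) auto
        also have "\<dots> \<le> (\<Sum>k\<in>S. \<tau> powr (1 - \<alpha>) * C1)" by (intro sum_mono L1)
        finally show "transport 1 ?v \<le> \<kappa>" using \<tau>(3) by (simp add: S(3) mult_ac)
      qed
      \<comment> \<open>Almost additivity serves to discard the light parts: they cannot cancel the
        sum of the heavy ones.\<close>
      have "transport \<alpha> ?u \<le> transport \<alpha> (?u + ?v) + s * \<eta>"
        using \<kappa>(2)[OF ub vb card_u sums(1,2,4)] transport_nonneg[OF vb, of \<alpha>] by linarith
      also have "?u + ?v = (\<Sum>k\<in>S. m k) - ?w"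
        by (simp add: split[OF \<tau>(2)] sum.distrib)
      also have "transport \<alpha> ((\<Sum>k\<in>S. m k) - ?w) \<le> transport \<alpha> (\<Sum>k\<in>S. m k) + transport \<alpha> ?w"
        by (intro transport_diff_le wb balanced_sum m \<alpha> \<alpha>1)
      finally have "real s * (\<epsilon> / 5184) \<le> transport \<alpha> (\<Sum>k\<in>S. m k) + 2 * (s * \<eta>)"
        using u_big sums(3) by linarith
      moreover have "real s * (\<epsilon> / 5184) - 2 * (s * \<eta>) = real s * (\<epsilon> * (1 / 5184 - 2 / 100000))"
        by (simp add: \<eta>_def algebra_simps)
      moreover have "real s * (\<epsilon> / 10000) \<le> real s * (\<epsilon> * (1 / 5184 - 2 / 100000))"
        using \<epsilon> by (intro mult_left_mono) auto
      ultimately show ?thesis using S by (intro exI[of _ S]) auto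
    qed
    show ?thesis
    proof (rule that[of "\<epsilon> / 10000"])
      fix \<kappa> :: real assume \<kappa>: "0 < \<kappa>"
      define \<mu> where "\<mu> = C1 powr (1 / \<alpha>)"
      have m1: "transport 1 (m k) \<le> \<mu>" for k
      proof -
        have "transport 1 (m k) \<le> cost 1 (b k)" using transport_bd_le[OF b(1)] b(2) by metis
        also have "\<dots> \<le> cost \<alpha> (b k) powr (1 / \<alpha>)" by (intro cost_1_le_cost b \<alpha>)
        also have "\<dots> \<le> \<mu>" unfolding \<mu>_def using b(3) \<alpha> by (intro powr_mono2) auto
        finally show ?thesis .
      qed
      \<comment> \<open>For exponent 1 the normalised sum of \<open>s\<close> terms costs at most
        \<open>s * s powr (- (1 / \<alpha>)) * \<mu>\<close>, which is
        \<open>s powr (- \<beta>) * \<mu>\<close> and becomes small for long blocks since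
        \<open>\<beta> > 0\<close>.\<close>
      define \<beta> where "\<beta> = 1 / \<alpha> - 1"
      have \<beta>: "0 < \<beta>" using \<alpha> by (simp add: \<beta>_def)
      obtain s :: nat where s: "max 1 ((\<mu> / \<kappa>) powr (1 / \<beta>)) < s" using reals_Archimedean2 by blast
      then have s0: "0 < s" "1 < real s" by auto
      have \<mu>0: "0 \<le> \<mu>" by (simp add: \<mu>_def)
      have "\<mu> / \<kappa> = ((\<mu> / \<kappa>) powr (1 / \<beta>)) powr \<beta>"
        using \<beta> \<mu>0 \<kappa> by (simp add: powr_powr)
      also have "\<dots> \<le> real s powr \<beta>" using s \<beta> by (intro powr_mono2) auto
      finally have s_large: "\<mu> \<le> real s powr \<beta> * \<kappa>" using \<kappa> by (simp add: field_simps)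
      obtain S where S: "finite S" "card S = s" "real s * (\<epsilon> / 10000) \<le> transport \<alpha> (\<Sum>k\<in>S. m k)"
        using sum_big[OF s0(1)] by blast
      \<comment> \<open>Normalisation of the block:
        \<open>s * \<bar>t\<bar> powr (q * \<alpha>) = 1\<close>. The cost for exponent
        \<open>\<alpha>\<close> is thereby divided by \<open>s\<close> and stays at least
        \<open>\<epsilon> / 10000\<close>.\<close>
      define t where "t = real s powr (- (1 / (q * \<alpha>)))"
      have t: "0 < t" "\<bar>t\<bar> powr (q * \<alpha>) = 1 / s" "\<bar>t\<bar> powr (q * 1) = real s powr (- (1 / \<alpha>))"
      proof -
        show "0 < t" using s0 by (simp add: t_def)
        then have abs: "\<bar>t\<bar> powr x = real s powr (- (1 / (q * \<alpha>)) * x)" for x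
          by (simp only: t_def powr_powr abs_of_pos)
        have "- (1 / (q * \<alpha>)) * (q * \<alpha>) = - 1" "- (1 / (q * \<alpha>)) * (q * 1) = - (1 / \<alpha>)"
          using q \<alpha> by simp_all
        then show "\<bar>t\<bar> powr (q * \<alpha>) = 1 / s" "\<bar>t\<bar> powr (q * 1) = real s powr (- (1 / \<alpha>))"
          unfolding abs using s0 by (simp_all only: powr_neg_one)
      qed
      let ?v = "\<Sum>k\<in>S. t *\<^sub>R m k"
      have vb: "?v \<in> balanced" by (intro balanced_sum balanced_scale m)
      have mb: "(\<Sum>k\<in>S. m k) \<in> balanced" by (intro balanced_sum m)
      have v_eq: "?v = t *\<^sub>R (\<Sum>k\<in>S. m k)" by (simp add: scaleR_sum_right)
      have "transport \<alpha> ?v = 1 / s * transport \<alpha> (\<Sum>k\<in>S. m k)"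
        unfolding v_eq transport_scale[OF mb] t ..
      then have "real s * transport \<alpha> ?v = transport \<alpha> (\<Sum>k\<in>S. m k)" using s0 by simp
      then have "real s * (\<epsilon> / 10000) \<le> real s * transport \<alpha> ?v" using S(3) by linarith
      then have big: "\<epsilon> / 10000 \<le> transport \<alpha> ?v"
        by (rule mult_left_le_imp_le) (use s0 in simp)
      have "transport 1 ?v = real s powr (- (1 / \<alpha>)) * transport 1 (\<Sum>k\<in>S. m k)"
        unfolding v_eq transport_scale[OF mb] t ..
      also have "transport 1 (\<Sum>k\<in>S. m k) \<le> (\<Sum>k\<in>S. \<mu>)"
        by (intro order_trans[OF transport_sum_le] sum_mono S m m1) auto
      also have "real s powr (- (1 / \<alpha>)) * (\<Sum>k\<in>S. \<mu>) = real s powr (- \<beta>) * \<mu>"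
      proof -
        have "real s powr (- (1 / \<alpha>)) * real s = real s powr (- \<beta>)"
          using s0 by (simp add: \<beta>_def powr_diff powr_minus_divide)
        then show ?thesis by (simp add: S(2) mult.assoc[symmetric])
      qed
      also have "\<dots> \<le> \<kappa>" using s_large s0 by (simp add: powr_minus_divide field_simps)
      finally have small: "transport 1 ?v \<le> \<kappa>" by (simp add: mult_left_mono)
      have "(\<Sum>k\<in>S. \<bar>t\<bar> powr (q * \<alpha>)) \<le> 2" using t(2) s0 by (simp add: S(2))
      then show "\<exists>S lam v. finite S \<and> (\<Sum>k\<in>S. \<bar>lam k\<bar> powr (q * \<alpha>)) \<le> 2 \<and> v \<in> balanced \<and>
        transport \<alpha> ((\<Sum>k\<in>S. lam k *\<^sub>R m k) - v) \<le> \<epsilon> / 10000 / 4 \<and> \<epsilon> / 10000 \<le> transport \<alpha> v \<and>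
        transport 1 v \<le> \<kappa>"
        using S(1) vb big small \<epsilon>
        by (intro exI[of _ S] exI[of _ "\<lambda>_. t"] exI[of _ ?v] conjI) auto
    qed simp
  qed
qed

end

section \<open>Completion of a \<open>p\<close>-seminormed space\<close>

text \<open>\<open>P\<close> stands for the \<open>p\<close>-th power of a
  \<open>p\<close>-seminorm, which satisfies the triangle inequality without a constant. Nonzero
  vectors with \<open>P x = 0\<close> are allowed; the completion divides them out.\<close>

locale p_gauge =
  fixes p :: real and V :: "'v::real_vector set" and P :: "'v \<Rightarrow> real"
  assumes p: "0 < p" "p \<le> 1" and V: "subspace V"
    and nonneg: "x \<in> V \<Longrightarrow> 0 \<le> P x"
    and scale: "x \<in> V \<Longrightarrow> P (c *\<^sub>R x) = \<bar>c\<bar> powr p * P x"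
    and add_le: "x \<in> V \<Longrightarrow> y \<in> V \<Longrightarrow> P (x + y) \<le> P x + P y"
begin

lemmas V_closed = subspace_0[OF V] subspace_add[OF V] subspace_diff[OF V] subspace_scale[OF V]
  subspace_sum[OF V]

lemma zero [simp]: "P 0 = 0"
  using scale[of 0 0] V_closed(1) by simp

lemma minus: "x \<in> V \<Longrightarrow> P (- x) = P x"
  using scale[of x "-1"] by simp

lemma diff_le: "x \<in> V \<Longrightarrow> y \<in> V \<Longrightarrow> P (x - y) \<le> P x + P y"
  using add_le[of x "- y"] minus[of y] V_closed(4)[of y "-1"] by simp

lemma diff_commute: "x \<in> V \<Longrightarrow> y \<in> V \<Longrightarrow> P (x - y) = P (y - x)"
  using minus[of "x - y"] V_closed(3)[of x y] by simp

lemma diff_triangle: "x \<in> V \<Longrightarrow> y \<in> V \<Longrightarrow> w \<in> V \<Longrightarrow> P (x - w) \<le> P (x - y) + P (y - w)"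
  using add_le[of "x - y" "y - w"] V_closed(3) by simp

lemma abs_diff_le: "x \<in> V \<Longrightarrow> y \<in> V \<Longrightarrow> \<bar>P x - P y\<bar> \<le> P (x - y)"
  using add_le[of "x - y" y] add_le[of "y - x" x] diff_commute[of x y] V_closed(3) by (simp add: abs_le_iff)

lemma sum_le: "finite I \<Longrightarrow> (\<And>i. i \<in> I \<Longrightarrow> f i \<in> V) \<Longrightarrow> P (\<Sum>i\<in>I. f i) \<le> (\<Sum>i\<in>I. P (f i))"
proof (induction I rule: finite_induct)
  case (insert i I)
  then show ?case using add_le[of "f i" "\<Sum>i\<in>I. f i"] V_closed(5)[of I f] by force
qed simp

lemma p_normed_powr:
  assumes "\<And>x. x \<in> V \<Longrightarrow> P x = 0 \<Longrightarrow> x = 0"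
  shows "p_normed p V (\<lambda>x. P x powr (1 / p))"
proof -
  have powr: "(P x powr (1 / p)) powr p = P x" if "x \<in> V" for x
    using p nonneg[OF that] by (simp add: powr_powr)
  \<comment> \<open>The quasi-norm constant comes from
    \<open>P (x + y) \<le> 2 * max (P x) (P y)\<close>.\<close>
  have "P (x + y) powr (1 / p) \<le> 2 powr (1 / p) * (P x powr (1 / p) + P y powr (1 / p))"
    if "x \<in> V" "y \<in> V" for x y
  proof -
    have "P (x + y) \<le> 2 * max (P x) (P y)" using add_le[OF that] by simp
    then have "P (x + y) powr (1 / p) \<le> (2 * max (P x) (P y)) powr (1 / p)"
      using p that nonneg V_closed by (intro powr_mono2) auto
    also have "\<dots> = 2 powr (1 / p) * max (P x) (P y) powr (1 / p)"
      using nonneg that by (simp add: powr_mult)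
    also have "max (P x) (P y) powr (1 / p) \<le> P x powr (1 / p) + P y powr (1 / p)"
      by (simp add: max_def)
    finally show ?thesis by (simp add: mult_left_mono)
  qed
  moreover have "(P (c *\<^sub>R x)) powr (1 / p) = \<bar>c\<bar> * P x powr (1 / p)" if "x \<in> V" for c x
    using that p nonneg by (simp add: scale powr_mult powr_powr)
  moreover have "P x powr (1 / p) = 0 \<longleftrightarrow> x = 0" if "x \<in> V" for x
    using that assms by auto
  ultimately have "quasi_norm_on V (\<lambda>x. P x powr (1 / p))"
    by (auto simp: quasi_norm_on_def)
  moreover have "\<forall>x\<in>V. \<forall>y\<in>V. (P (x + y) powr (1 / p)) powr p
      \<le> (P x powr (1 / p)) powr p + (P y powr (1 / p)) powr p"
    using add_le V_closed(2) by (simp add: powr)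
  ultimately show ?thesis using V by (simp add: p_normed_def)
qed

definition Cau :: "(nat \<Rightarrow> 'v) set" where
  "Cau = {\<sigma>. range \<sigma> \<subseteq> V \<and> (\<forall>e>0. \<exists>N. \<forall>i\<ge>N. \<forall>j\<ge>N. P (\<sigma> i - \<sigma> j) < e)}"

definition Null :: "(nat \<Rightarrow> 'v) set" where
  "Null = {\<sigma>. range \<sigma> \<subseteq> V \<and> (\<lambda>k. P (\<sigma> k)) \<longlonglongrightarrow> 0}"

definition L :: "(nat \<Rightarrow> 'v) \<Rightarrow> real" where "L \<sigma> = lim (\<lambda>k. P (\<sigma> k))"

lemma Cau_V: "\<sigma> \<in> Cau \<Longrightarrow> \<sigma> k \<in> V"
  by (auto simp: Cau_def)

lemma CauD: "\<sigma> \<in> Cau \<Longrightarrow> 0 < e \<Longrightarrow> \<exists>N. \<forall>i\<ge>N. \<forall>j\<ge>N. P (\<sigma> i - \<sigma> j) < e"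
  by (auto simp: Cau_def)

lemma Null_V: "\<sigma> \<in> Null \<Longrightarrow> \<sigma> k \<in> V"
  by (auto simp: Null_def)

lemma tendsto_L: assumes "\<sigma> \<in> Cau" shows "(\<lambda>k. P (\<sigma> k)) \<longlonglongrightarrow> L \<sigma>"
proof -
  have "Cauchy (\<lambda>k. P (\<sigma> k))"
  proof (rule metric_CauchyI)
    fix e :: real assume "e > 0"
    then obtain N where N: "\<forall>i\<ge>N. \<forall>j\<ge>N. P (\<sigma> i - \<sigma> j) < e" using assms by (auto simp: Cau_def)
    have "dist (P (\<sigma> i)) (P (\<sigma> j)) < e" if "i \<ge> N" "j \<ge> N" for i j
    proof -
      have "P (\<sigma> i - \<sigma> j) < e" using N that by blast
      then show ?thesis
        using abs_diff_le[OF Cau_V[OF assms] Cau_V[OF assms], of i j] by (simp add: dist_real_def)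
    qed
    then show "\<exists>N. \<forall>i\<ge>N. \<forall>j\<ge>N. dist (P (\<sigma> i)) (P (\<sigma> j)) < e" by blast
  qed
  then show ?thesis unfolding L_def using Cauchy_convergent convergent_LIMSEQ_iff by blast
qed

lemma const_Cau: "x \<in> V \<Longrightarrow> (\<lambda>_. x) \<in> Cau"
  by (auto simp: Cau_def)

lemma L_const: "x \<in> V \<Longrightarrow> L (\<lambda>_. x) = P x"
  using tendsto_L[OF const_Cau, of x] by (simp add: LIMSEQ_const_iff)

lemma subspace_Cau: "subspace Cau"
proof (rule subspaceI)
  show "0 \<in> Cau" using V_closed by (auto simp: Cau_def)
next
  fix \<sigma> \<tau> assume st: "\<sigma> \<in> Cau" "\<tau> \<in> Cau"
  have "\<exists>N. \<forall>i\<ge>N. \<forall>j\<ge>N. P ((\<sigma> + \<tau>) i - (\<sigma> + \<tau>) j) < e" if e: "e > 0" for e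
  proof -
    obtain M where M: "\<forall>i\<ge>M. \<forall>j\<ge>M. P (\<sigma> i - \<sigma> j) < e / 2"
      using CauD[OF st(1), of "e / 2"] e by auto
    obtain N where N: "\<forall>i\<ge>N. \<forall>j\<ge>N. P (\<tau> i - \<tau> j) < e / 2"
      using CauD[OF st(2), of "e / 2"] e by auto
    have "P ((\<sigma> + \<tau>) i - (\<sigma> + \<tau>) j) < e" if "max M N \<le> i" "max M N \<le> j" for i j
    proof -
      have "(\<sigma> + \<tau>) i - (\<sigma> + \<tau>) j = (\<sigma> i - \<sigma> j) + (\<tau> i - \<tau> j)" by simp
      then have "P ((\<sigma> + \<tau>) i - (\<sigma> + \<tau>) j) \<le> P (\<sigma> i - \<sigma> j) + P (\<tau> i - \<tau> j)"
        using add_le[of "\<sigma> i - \<sigma> j" "\<tau> i - \<tau> j"] st Cau_V V_closed by metis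
      moreover have "P (\<sigma> i - \<sigma> j) < e / 2" "P (\<tau> i - \<tau> j) < e / 2" using M N that by auto
      ultimately show ?thesis by linarith
    qed
    then show ?thesis by blast
  qed
  moreover have "range (\<sigma> + \<tau>) \<subseteq> V" using st Cau_V V_closed by auto
  ultimately show "\<sigma> + \<tau> \<in> Cau" by (auto simp: Cau_def)
next
  fix c \<sigma> assume s: "\<sigma> \<in> Cau"
  have "\<exists>N. \<forall>i\<ge>N. \<forall>j\<ge>N. P ((c *\<^sub>R \<sigma>) i - (c *\<^sub>R \<sigma>) j) < e" if e: "e > 0" for e
  proof -
    have "0 < e / (\<bar>c\<bar> powr p + 1)" using e by (simp add: add_nonneg_pos)
    then obtain N where N: "\<forall>i\<ge>N. \<forall>j\<ge>N. P (\<sigma> i - \<sigma> j) < e / (\<bar>c\<bar> powr p + 1)"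
      using CauD[OF s] by blast
    have "P ((c *\<^sub>R \<sigma>) i - (c *\<^sub>R \<sigma>) j) < e" if "N \<le> i" "N \<le> j" for i j
    proof -
      have in_V: "\<sigma> i - \<sigma> j \<in> V" by (rule V_closed(3)[OF Cau_V[OF s] Cau_V[OF s]])
      have "P ((c *\<^sub>R \<sigma>) i - (c *\<^sub>R \<sigma>) j) = \<bar>c\<bar> powr p * P (\<sigma> i - \<sigma> j)"
        using scale[OF in_V, of c] by (simp add: scaleR_diff_right)
      also have "\<dots> \<le> (\<bar>c\<bar> powr p + 1) * P (\<sigma> i - \<sigma> j)" using nonneg[OF in_V] by (intro mult_right_mono) auto
      also have "\<dots> < (\<bar>c\<bar> powr p + 1) * (e / (\<bar>c\<bar> powr p + 1))"
        using N that by (intro mult_strict_left_mono) (auto simp: add_nonneg_pos)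
      also have "\<dots> = e" by (simp add: add_nonneg_eq_0_iff)
      finally show ?thesis .
    qed
    then show ?thesis by blast
  qed
  moreover have "range (c *\<^sub>R \<sigma>) \<subseteq> V" using s Cau_V V_closed by auto
  ultimately show "c *\<^sub>R \<sigma> \<in> Cau" by (auto simp: Cau_def)
qed

lemmas Cau_closed = subspace_0[OF subspace_Cau] subspace_add[OF subspace_Cau]
  subspace_diff[OF subspace_Cau] subspace_scale[OF subspace_Cau]

lemma L_nonneg: "\<sigma> \<in> Cau \<Longrightarrow> 0 \<le> L \<sigma>"
  by (rule LIMSEQ_le_const[OF tendsto_L]) (use nonneg Cau_V in auto)

lemma L_scale: assumes "\<sigma> \<in> Cau" shows "L (c *\<^sub>R \<sigma>) = \<bar>c\<bar> powr p * L \<sigma>"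
proof -
  have "(\<lambda>k. \<bar>c\<bar> powr p * P (\<sigma> k)) \<longlonglongrightarrow> \<bar>c\<bar> powr p * L \<sigma>"
    by (intro tendsto_mult tendsto_const tendsto_L assms)
  moreover have "(\<lambda>k. \<bar>c\<bar> powr p * P (\<sigma> k)) \<longlonglongrightarrow> L (c *\<^sub>R \<sigma>)"
    using tendsto_L[OF Cau_closed(4)[OF assms, of c]] Cau_V[OF assms] by (simp add: scale)
  ultimately show ?thesis by (rule LIMSEQ_unique[symmetric])
qed

lemma L_add_le: assumes "\<sigma> \<in> Cau" "\<tau> \<in> Cau" shows "L (\<sigma> + \<tau>) \<le> L \<sigma> + L \<tau>"
proof (rule LIMSEQ_le[OF tendsto_L[OF Cau_closed(2)[OF assms]]])
  show "(\<lambda>k. P (\<sigma> k) + P (\<tau> k)) \<longlonglongrightarrow> L \<sigma> + L \<tau>" by (intro tendsto_add tendsto_L assms)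
  show "\<exists>N. \<forall>n\<ge>N. P ((\<sigma> + \<tau>) n) \<le> P (\<sigma> n) + P (\<tau> n)"
    using add_le Cau_V assms by auto
qed

lemma Null_Cau: "Null \<subseteq> Cau"
proof
  fix \<sigma> assume s: "\<sigma> \<in> Null"
  have "\<exists>N. \<forall>i\<ge>N. \<forall>j\<ge>N. P (\<sigma> i - \<sigma> j) < e" if e: "e > 0" for e
  proof -
    have "eventually (\<lambda>k. P (\<sigma> k) < e / 2) sequentially"
      using s e by (intro order_tendstoD(2)[where y = 0]) (auto simp: Null_def)
    then obtain N where N: "\<forall>k\<ge>N. P (\<sigma> k) < e / 2" by (auto simp: eventually_sequentially)
    have "P (\<sigma> i - \<sigma> j) < e" if "N \<le> i" "N \<le> j" for i j
    proof -
      have "P (\<sigma> i) < e / 2" "P (\<sigma> j) < e / 2" using N that by auto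
      then show ?thesis using diff_le[OF Null_V[OF s] Null_V[OF s], of i j] by linarith
    qed
    then show ?thesis by blast
  qed
  then show "\<sigma> \<in> Cau" using s by (auto simp: Cau_def Null_def)
qed

lemma Null_iff: "\<sigma> \<in> Null \<longleftrightarrow> \<sigma> \<in> Cau \<and> L \<sigma> = 0"
proof
  assume s: "\<sigma> \<in> Null"
  then have "\<sigma> \<in> Cau" using Null_Cau by blast
  moreover have "L \<sigma> = 0" using s tendsto_L[OF \<open>\<sigma> \<in> Cau\<close>] LIMSEQ_unique by (auto simp: Null_def)
  ultimately show "\<sigma> \<in> Cau \<and> L \<sigma> = 0" by blast
next
  assume "\<sigma> \<in> Cau \<and> L \<sigma> = 0"
  then show "\<sigma> \<in> Null" using tendsto_L[of \<sigma>] Cau_V[of \<sigma>] by (auto simp: Null_def)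
qed

lemma subspace_Null: "subspace Null"
proof (rule subspaceI)
  show "0 \<in> Null" using V_closed by (auto simp: Null_def)
  show "\<sigma> + \<tau> \<in> Null" if "\<sigma> \<in> Null" "\<tau> \<in> Null" for \<sigma> \<tau>
    using that L_add_le[of \<sigma> \<tau>] L_nonneg[of "\<sigma> + \<tau>"] Cau_closed(2)[of \<sigma> \<tau>] unfolding Null_iff by auto
  show "c *\<^sub>R \<sigma> \<in> Null" if "\<sigma> \<in> Null" for c \<sigma>
    using that L_scale[of \<sigma> c] Cau_closed(4)[of \<sigma> c] unfolding Null_iff by auto
qed

text \<open>The quotient \<^term>\<open>Cau\<close> modulo \<^term>\<open>Null\<close> is realised inside \<^term>\<open>Cau\<close> as the range of a linear
  projection \<^term>\<open>g\<close> with kernel \<^term>\<open>Null\<close>.\<close>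

lemma completion:
  obtains Y :: "(nat \<Rightarrow> 'v) set" and nY \<iota> where "p_banach p Y nY" "linear \<iota>"
    "\<And>x. x \<in> V \<Longrightarrow> \<iota> x \<in> Y" "\<And>x. x \<in> V \<Longrightarrow> nY (\<iota> x) = P x powr (1 / p)"
proof -
  obtain B where B: "B \<subseteq> Null" "independent B" "Null \<subseteq> span B"
    using maximal_independent_subset by blast
  \<comment> \<open>A basis of \<open>Null\<close> is extended to one of \<open>Cau\<close>. Killing
    the former and fixing the rest defines a projection that changes a sequence only by a null
    sequence and so preserves \<open>L\<close>.\<close>
  obtain B' where B': "B \<subseteq> B'" "B' \<subseteq> Cau" "independent B'" "Cau \<subseteq> span B'"
    using maximal_independent_subset_extend[of B Cau] B Null_Cau by (metis subset_trans)
  obtain g :: "(nat \<Rightarrow> 'v) \<Rightarrow> nat \<Rightarrow> 'v" where g: "linear g" "\<forall>b\<in>B'. g b = (if b \<in> B then 0 else b)"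
    using linear_independent_extend[OF B'(3), of "\<lambda>b. if b \<in> B then 0 else b"] by blast
  have sub1: "subspace {\<sigma>. \<sigma> - g \<sigma> \<in> Null}"
  proof (rule subspaceI)
    show "0 \<in> {\<sigma>. \<sigma> - g \<sigma> \<in> Null}" using subspace_Null by (simp add: linear_0[OF g(1)] subspace_0)
    show "x + y \<in> {\<sigma>. \<sigma> - g \<sigma> \<in> Null}" if "x \<in> {\<sigma>. \<sigma> - g \<sigma> \<in> Null}" "y \<in> {\<sigma>. \<sigma> - g \<sigma> \<in> Null}" for x y
      using subspace_add[OF subspace_Null, of "x - g x" "y - g y"] that
      by (simp add: linear_add[OF g(1)] add_diff_add)
    show "c *\<^sub>R x \<in> {\<sigma>. \<sigma> - g \<sigma> \<in> Null}" if "x \<in> {\<sigma>. \<sigma> - g \<sigma> \<in> Null}" for c x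
      using subspace_scale[OF subspace_Null, of "x - g x" c] that
      by (simp add: linear_scale[OF g(1)] scaleR_diff_right)
  qed
  have "B' \<subseteq> {\<sigma>. \<sigma> - g \<sigma> \<in> Null}"
    using g(2) B subspace_0[OF subspace_Null] by auto
  then have diff: "\<sigma> - g \<sigma> \<in> Null" if "\<sigma> \<in> Cau" for \<sigma>
    using span_minimal[OF _ sub1] B'(4) that by blast
  have "subspace {\<sigma>. g \<sigma> = 0}"
    by (rule subspaceI) (auto simp: linear_0[OF g(1)] linear_add[OF g(1)] linear_scale[OF g(1)])
  moreover have "B \<subseteq> {\<sigma>. g \<sigma> = 0}" using g(2) B'(1) by auto
  ultimately have ker: "g \<sigma> = 0" if "\<sigma> \<in> Null" for \<sigma> using span_minimal[of B] B(3) that by blast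
  have gC: "g \<sigma> \<in> Cau" if "\<sigma> \<in> Cau" for \<sigma>
    using Cau_closed(3)[OF that subsetD[OF Null_Cau diff[OF that]]] by simp
  have gg: "g (g \<sigma>) = g \<sigma>" if "\<sigma> \<in> Cau" for \<sigma>
    using ker[OF diff[OF that]] by (simp add: linear_diff[OF g(1)])
  have Lg: "L (g \<sigma>) = L \<sigma>" if "\<sigma> \<in> Cau" for \<sigma>
  proof -
    have "L \<sigma> \<le> L (g \<sigma>) + L (\<sigma> - g \<sigma>)"
      using L_add_le[OF gC[OF that] subsetD[OF Null_Cau diff[OF that]]] by simp
    moreover have "L (g \<sigma>) \<le> L \<sigma> + L (- 1 *\<^sub>R (\<sigma> - g \<sigma>))"
      using L_add_le[OF that Cau_closed(4)[OF subsetD[OF Null_Cau diff[OF that]], of "-1"]] by simp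
    moreover have "L (- 1 *\<^sub>R (\<sigma> - g \<sigma>)) = L (\<sigma> - g \<sigma>)"
      using L_scale[OF subsetD[OF Null_Cau diff[OF that]], of "-1"] by simp
    moreover have "L (\<sigma> - g \<sigma>) = 0" using diff[OF that] by (simp add: Null_iff)
    ultimately show ?thesis by simp
  qed
  define W where "W = g ` Cau"
  have WC: "w \<in> Cau" "g w = w" if "w \<in> W" for w using that gC gg by (auto simp: W_def)
  have W: "subspace W" unfolding W_def by (rule linear_subspace_image[OF g(1) subspace_Cau])
  interpret W: p_gauge p W L
    by standard (use p W WC L_nonneg L_scale L_add_le in auto)
  have norm: "p_normed p W (\<lambda>w. L w powr (1 / p))"
  proof (rule W.p_normed_powr)
    fix w assume w: "w \<in> W" "L w = 0"
    then have "g w = 0" using ker WC by (simp add: Null_iff)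
    then show "w = 0" using WC(2)[OF w(1)] by simp
  qed
  have "qnorm_complete W (\<lambda>w. L w powr (1 / p))"
    unfolding qnorm_complete_def
  proof (intro allI impI)
    fix w :: "nat \<Rightarrow> nat \<Rightarrow> 'v"
    assume "range w \<subseteq> W \<and> (\<forall>e>0. \<exists>N. \<forall>i\<ge>N. \<forall>j\<ge>N. L (w i - w j) powr (1 / p) < e)"
    then have wW: "\<And>n. w n \<in> W" and cau: "\<And>e. e > 0 \<Longrightarrow> \<exists>N. \<forall>i\<ge>N. \<forall>j\<ge>N. L (w i - w j) powr (1 / p) < e"
      by auto
    have wC: "w n \<in> Cau" for n using WC wW by blast
    have Lpowr: "L x < e" if "L x powr (1 / p) < e powr (1 / p)" "0 < e" for x e
      using that p by (meson not_less powr_mono2 less_imp_le zero_le_divide_1_iff)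
    have Lcau: "\<exists>N. \<forall>i\<ge>N. \<forall>j\<ge>N. L (w i - w j) < e" if "e > 0" for e
      using cau[of "e powr (1 / p)"] Lpowr that by (metis powr_gt_zero less_irrefl)
    \<comment> \<open>Diagonal argument: each \<open>w n\<close> is within \<open>1 / Suc n\<close>
      of one of its own entries, read as a constant sequence. The chosen entries form a Cauchy
      sequence \<open>x\<close> in \<open>V\<close>, and \<open>g x\<close> is the limit of
      \<open>w\<close>.\<close>
    have "\<exists>k. L (w n - (\<lambda>_. w n k)) \<le> 1 / Suc n" for n
    proof -
      have "\<exists>N. \<forall>i\<ge>N. \<forall>j\<ge>N. P (w n i - w n j) < 1 / Suc n"
        by (rule CauD[OF wC]) simp
      then obtain N where N: "\<forall>i\<ge>N. \<forall>j\<ge>N. P (w n i - w n j) < 1 / Suc n" by blast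
      have "w n - (\<lambda>_. w n N) \<in> Cau" 
        by (rule Cau_closed(3)[OF wC const_Cau[OF Cau_V[OF wC]]])
      from tendsto_L[OF this] have "L (w n - (\<lambda>_. w n N)) \<le> 1 / Suc n"
        by (rule LIMSEQ_le_const2) (use N in \<open>auto intro!: exI[of _ N] less_imp_le\<close>)
      then show ?thesis by blast
    qed
    then obtain k where k: "\<And>n. L (w n - (\<lambda>_. w n (k n))) \<le> 1 / Suc n" by metis
    define x where "x n = w n (k n)" for n
    have xV: "x n \<in> V" for n using wC Cau_V by (simp add: x_def)
    have cx: "(\<lambda>_. x n) \<in> Cau" for n using const_Cau xV by simp
    interpret C: p_gauge p Cau L
      by standard (use p subspace_Cau L_nonneg L_scale L_add_le in auto)
    have close: "L (w n - (\<lambda>_. x n)) \<le> 1 / Suc n" for n using k[of n] by (simp add: x_def)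
    have xdiff: "P (x n - x m) \<le> 1 / Suc n + L (w n - w m) + 1 / Suc m" for n m
    proof -
      have "P (x n - x m) = L ((\<lambda>_. x n) - (\<lambda>_. x m))"
        using L_const[OF V_closed(3)[OF xV xV], of n m] by (simp add: fun_diff_def)
      also have "\<dots> \<le> L ((\<lambda>_. x n) - w n) + L (w n - (\<lambda>_. x m))" by (intro C.diff_triangle cx wC)
      also have "L (w n - (\<lambda>_. x m)) \<le> L (w n - w m) + L (w m - (\<lambda>_. x m))" by (intro C.diff_triangle cx wC)
      also have "L ((\<lambda>_. x n) - w n) = L (w n - (\<lambda>_. x n))" by (intro C.diff_commute cx wC)
      finally show ?thesis using close[of n] close[of m] by linarith
    qed
    have xCau: "\<exists>N. \<forall>n\<ge>N. \<forall>m\<ge>N. P (x n - x m) < e" if e: "e > 0" for e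
    proof -
      obtain N1 where N1: "\<forall>i\<ge>N1. \<forall>j\<ge>N1. L (w i - w j) < e / 3" using Lcau[of "e / 3"] e by auto
      obtain N2 where N2: "1 / Suc N2 < e / 3" using e nat_approx_posE[of "e / 3"] by auto
      have "P (x n - x m) < e" if nm: "n \<ge> max N1 N2" "m \<ge> max N1 N2" for n m
      proof -
        have "1 / Suc n \<le> 1 / Suc N2" "1 / Suc m \<le> 1 / Suc N2" using nm by (auto intro!: divide_left_mono)
        moreover have "L (w n - w m) < e / 3" using N1 nm by auto
        ultimately show ?thesis using xdiff[of n m] N2 by linarith
      qed
      then show ?thesis by blast
    qed
    then have xC: "x \<in> Cau" using xV by (auto simp: Cau_def)
    have lim: "\<exists>N. \<forall>n\<ge>N. L (w n - g x) < e" if e: "e > 0" for e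
    proof -
      obtain N1 where N1: "\<forall>i\<ge>N1. \<forall>j\<ge>N1. P (x i - x j) < e / 3" using xCau[of "e / 3"] e by auto
      obtain N2 where N2: "1 / Suc N2 < e / 3" using e nat_approx_posE[of "e / 3"] by auto
      have "L (w n - g x) < e" if n: "n \<ge> max N1 N2" for n
      proof -
        have "w n - g x = g (w n - x)" using WC(2)[OF wW] by (simp add: linear_diff[OF g(1)])
        then have "L (w n - g x) = L (w n - x)" using Lg[of "w n - x"] Cau_closed(3)[OF wC xC] by simp
        also have "\<dots> \<le> L (w n - (\<lambda>_. x n)) + L ((\<lambda>_. x n) - x)" by (intro C.diff_triangle cx wC xC)
        also have "L ((\<lambda>_. x n) - x) \<le> e / 3"
          by (rule LIMSEQ_le_const2[OF tendsto_L[OF Cau_closed(3)[OF cx xC]]])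
            (use N1 n in \<open>auto intro!: exI[of _ N1] less_imp_le\<close>)
        also have "1 / Suc n \<le> 1 / Suc N2" using n by (auto intro!: divide_left_mono)
        then have "L (w n - (\<lambda>_. x n)) \<le> e / 3" using close[of n] N2 by linarith
        finally show ?thesis using e by simp
      qed
      then show ?thesis by blast
    qed
    have gW: "g x \<in> W" using xC by (simp add: W_def)
    have "limitin (qnorm_topology W (\<lambda>w. L w powr (1 / p))) w (g x) sequentially"
    proof (subst limitin_qnorm_topology[OF norm p(1)])
      show "range w \<subseteq> W" using wW by auto
      show "g x \<in> W \<and> (\<forall>e>0. \<forall>\<^sub>F k in sequentially. L (w k - g x) powr (1 / p) < e)"
      proof (intro conjI allI impI gW)
        fix e :: real assume e: "e > 0"
        then obtain N where N: "\<forall>n\<ge>N. L (w n - g x) < e powr p" using lim[of "e powr p"] by auto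
        have "L (w n - g x) powr (1 / p) < e" if "n \<ge> N" for n
        proof -
          have "0 \<le> L (w n - g x)" using L_nonneg Cau_closed(3)[OF wC gC[OF xC]] by blast
          then have "L (w n - g x) powr (1 / p) < (e powr p) powr (1 / p)"
            using N that p by (intro powr_less_mono2) auto
          then show ?thesis using p e by (simp add: powr_powr)
        qed
        then show "\<forall>\<^sub>F k in sequentially. L (w k - g x) powr (1 / p) < e"
          by (auto simp: eventually_sequentially)
      qed
    qed
    then show "\<exists>y. limitin (qnorm_topology W (\<lambda>w. L w powr (1 / p))) w y sequentially" by blast
  qed
  then have "p_banach p W (\<lambda>w. L w powr (1 / p))" using norm by (simp add: p_banach_def)
  moreover have "linear (\<lambda>x. g (\<lambda>_. x))"
    using linear_compose[OF _ g(1), of "\<lambda>x _. x"]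
    by (simp add: comp_def linear_iff fun_eq_iff)
  moreover have "g (\<lambda>_. x) \<in> W" if "x \<in> V" for x using const_Cau[OF that] by (simp add: W_def)
  moreover have "L (g (\<lambda>_. x)) powr (1 / p) = P x powr (1 / p)" if "x \<in> V" for x
    using Lg[OF const_Cau[OF that]] L_const[OF that] by simp
  ultimately show ?thesis using that by blast
qed

end

section \<open>Copies of lp\<close>

lemma p_normed_gauge:
  assumes "p_normed p X n" "0 < p" "p \<le> 1" shows "p_gauge p X (\<lambda>x. n x powr p)"
proof
  fix x c assume x: "x \<in> X"
  show "n (c *\<^sub>R x) powr p = \<bar>c\<bar> powr p * n x powr p"
    using p_normedD(2,4)[OF assms(1) x] by (simp add: powr_mult)
qed (use assms p_normedD(1,5)[OF assms(1)] in auto)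

lemma p_normed_powr_eq_0: "p_normed p X n \<Longrightarrow> 0 < p \<Longrightarrow> x \<in> X \<Longrightarrow> n x powr p = 0 \<longleftrightarrow> x = 0"
  using p_normedD(3)[of p X n x] by simp

lemma powr_root_le:
  fixes x y B p :: real
  assumes "0 < p" "0 \<le> x" "0 \<le> y" "0 \<le> B" "x powr p \<le> B * y powr p"
  shows "x \<le> B powr (1 / p) * y"
proof -
  have "x = (x powr p) powr (1 / p)" using assms by (simp add: powr_powr)
  also have "\<dots> \<le> (B * y powr p) powr (1 / p)" using assms by (intro powr_mono2) auto
  also have "\<dots> = B powr (1 / p) * y" using assms by (simp add: powr_mult powr_powr)
  finally show ?thesis .
qed

lemma lp_gauge:
  assumes p: "0 < p" "p \<le> 1"
  shows "p_gauge p (lp_space p) (\<lambda>x. \<Sum>i. \<bar>x i\<bar> powr p)"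
proof -
  have add: "\<bar>a + b\<bar> powr p \<le> \<bar>a\<bar> powr p + \<bar>b\<bar> powr p" for a b :: real
  proof -
    have "\<bar>a + b\<bar> powr p \<le> (\<bar>a\<bar> + \<bar>b\<bar>) powr p" using p by (intro powr_mono2) auto
    also have "\<dots> \<le> \<bar>a\<bar> powr p + \<bar>b\<bar> powr p" using p by (intro powr_subadditive) auto
    finally show ?thesis .
  qed
  have sum_add: "summable (\<lambda>i. \<bar>(x + y) i\<bar> powr p)" if "x \<in> lp_space p" "y \<in> lp_space p" for x y
  proof (rule summable_comparison_test)
    show "\<exists>N. \<forall>n\<ge>N. norm (\<bar>(x + y) n\<bar> powr p) \<le> \<bar>x n\<bar> powr p + \<bar>y n\<bar> powr p" using add by simp
    show "summable (\<lambda>n. \<bar>x n\<bar> powr p + \<bar>y n\<bar> powr p)"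
      using that by (intro summable_add) (auto simp: lp_space_def)
  qed
  show ?thesis
  proof
    show "subspace (lp_space p)"
    proof (rule subspaceI)
      show "x + y \<in> lp_space p" if "x \<in> lp_space p" "y \<in> lp_space p" for x y
        using sum_add[OF that] by (simp add: lp_space_def)
      show "c *\<^sub>R x \<in> lp_space p" if "x \<in> lp_space p" for c x
        using that by (auto simp: lp_space_def abs_mult powr_mult intro: summable_mult)
    qed (simp add: lp_space_def)
    fix x y c assume x: "x \<in> lp_space p"
    show "0 \<le> (\<Sum>i. \<bar>x i\<bar> powr p)" using x by (intro suminf_nonneg) (auto simp: lp_space_def)
    show "(\<Sum>i. \<bar>(c *\<^sub>R x) i\<bar> powr p) = \<bar>c\<bar> powr p * (\<Sum>i. \<bar>x i\<bar> powr p)"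
      using x by (simp add: abs_mult powr_mult lp_space_def suminf_mult)
    assume y: "y \<in> lp_space p"
    have "(\<Sum>i. \<bar>(x + y) i\<bar> powr p) \<le> (\<Sum>i. \<bar>x i\<bar> powr p + \<bar>y i\<bar> powr p)"
      using add sum_add[OF x y] x y
      by (intro suminf_le summable_add) (auto simp: lp_space_def)
    also have "\<dots> = (\<Sum>i. \<bar>x i\<bar> powr p) + (\<Sum>i. \<bar>y i\<bar> powr p)"
      using x y by (intro suminf_add[symmetric]) (auto simp: lp_space_def)
    finally show "(\<Sum>i. \<bar>(x + y) i\<bar> powr p) \<le> (\<Sum>i. \<bar>x i\<bar> powr p) + (\<Sum>i. \<bar>y i\<bar> powr p)" .
  qed (use p in auto)
qed

lemma lp_norm_powr:
  assumes "0 < p" "x \<in> lp_space p" shows "lp_norm p x powr p = (\<Sum>i. \<bar>x i\<bar> powr p)"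
proof -
  have "0 \<le> (\<Sum>i. \<bar>x i\<bar> powr p)" using assms by (intro suminf_nonneg) (auto simp: lp_space_def)
  then show ?thesis using assms by (simp add: lp_norm_def powr_powr)
qed

text \<open>The limit is taken coordinatewise, and the Cauchy bound passes to it through partial
  sums, as in Fatou's lemma.\<close>

lemma lp_complete:
  assumes p: "0 < p" "p \<le> 1" and a: "\<And>k::nat. a k \<in> lp_space p"
    and cau: "\<And>e. 0 < e \<Longrightarrow> \<exists>N. \<forall>k\<ge>N. \<forall>l\<ge>N. (\<Sum>i. \<bar>(a k - a l) i\<bar> powr p) < e"
  obtains b where "b \<in> lp_space p" "(\<lambda>k. \<Sum>i. \<bar>(a k - b) i\<bar> powr p) \<longlonglongrightarrow> 0"
proof -
  interpret lp: p_gauge p "lp_space p" "\<lambda>x. \<Sum>i. \<bar>x i\<bar> powr p" by (rule lp_gauge[OF p])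
  have diff: "summable (\<lambda>i. \<bar>(a k - a l) i\<bar> powr p)" for k l
    using lp.V_closed(3)[OF a a, of k l] by (simp add: lp_space_def)
  have "Cauchy (\<lambda>k. a k i)" for i
  proof (rule metric_CauchyI)
    fix e :: real assume e: "e > 0"
    then obtain N where N: "\<forall>k\<ge>N. \<forall>l\<ge>N. (\<Sum>i. \<bar>(a k - a l) i\<bar> powr p) < e powr p"
      using cau[of "e powr p"] by auto
    have "dist (a k i) (a l i) < e" if "k \<ge> N" "l \<ge> N" for k l
    proof -
      have "\<bar>(a k - a l) i\<bar> powr p \<le> (\<Sum>i. \<bar>(a k - a l) i\<bar> powr p)"
        using sum_le_suminf[OF diff, of "{i}" k l] by simp
      also have "\<dots> < e powr p" using N that by blast
      finally have "\<bar>(a k - a l) i\<bar> < e" using p e by (meson not_less powr_mono2 less_imp_le)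
      then show ?thesis by (simp add: dist_real_def)
    qed
    then show "\<exists>M. \<forall>m\<ge>M. \<forall>n\<ge>M. dist (a m i) (a n i) < e" by blast
  qed
  then have "\<exists>x. (\<lambda>k. a k i) \<longlonglongrightarrow> x" for i using Cauchy_convergent_iff convergent_def by blast
  then obtain b where b: "\<And>i. (\<lambda>k. a k i) \<longlonglongrightarrow> b i" by metis
  have bound: "summable (\<lambda>i. \<bar>(a k - b) i\<bar> powr p) \<and> (\<Sum>i. \<bar>(a k - b) i\<bar> powr p) \<le> e"
    if N: "\<forall>k\<ge>N. \<forall>l\<ge>N. (\<Sum>i. \<bar>(a k - a l) i\<bar> powr p) < e" and k: "k \<ge> N" for N e k
  proof -
    have part: "(\<Sum>i<n. \<bar>(a k - b) i\<bar> powr p) \<le> e" for n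
    proof (rule LIMSEQ_le_const2)
      show "(\<lambda>l. \<Sum>i<n. \<bar>(a k - a l) i\<bar> powr p) \<longlonglongrightarrow> (\<Sum>i<n. \<bar>(a k - b) i\<bar> powr p)"
        unfolding minus_apply using p by (intro tendsto_sum tendsto_powr2 tendsto_rabs tendsto_diff tendsto_const b) auto
      have "(\<Sum>i<n. \<bar>(a k - a l) i\<bar> powr p) \<le> e" if "l \<ge> N" for l
      proof -
        have "(\<Sum>i<n. \<bar>(a k - a l) i\<bar> powr p) \<le> (\<Sum>i. \<bar>(a k - a l) i\<bar> powr p)"
          by (rule sum_le_suminf[OF diff]) auto
        then show ?thesis using N k that by (meson less_imp_le order_trans)
      qed
      then show "\<exists>N. \<forall>l\<ge>N. (\<Sum>i<n. \<bar>(a k - a l) i\<bar> powr p) \<le> e" by blast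
    qed
    have s: "summable (\<lambda>i. \<bar>(a k - b) i\<bar> powr p)"
      by (rule bounded_imp_summable[where B = e]) (use part[of "Suc _"] in \<open>auto simp: lessThan_Suc_atMost\<close>)
    then show ?thesis using part by (auto intro: suminf_le_const)
  qed
  obtain N1 where N1: "\<forall>k\<ge>N1. \<forall>l\<ge>N1. (\<Sum>i. \<bar>(a k - a l) i\<bar> powr p) < 1" using cau[of 1] by auto
  have "a N1 - b \<in> lp_space p" using bound[OF N1, of N1] by (simp add: lp_space_def)
  then have bl: "b \<in> lp_space p" using lp.V_closed(3)[OF a, of "a N1 - b" N1] by simp
  moreover have "(\<lambda>k. \<Sum>i. \<bar>(a k - b) i\<bar> powr p) \<longlonglongrightarrow> 0"
  proof (rule metric_LIMSEQ_I)
    fix e :: real assume e: "e > 0"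
    then obtain N where N: "\<forall>k\<ge>N. \<forall>l\<ge>N. (\<Sum>i. \<bar>(a k - a l) i\<bar> powr p) < e / 2"
      using cau[of "e / 2"] by auto
    have "dist (\<Sum>i. \<bar>(a k - b) i\<bar> powr p) 0 < e" if "k \<ge> N" for k
      using bound[OF N that] lp.nonneg[OF lp.V_closed(3)[OF a bl], of k] e by (simp add: dist_real_def)
    then show "\<exists>N. \<forall>k\<ge>N. dist (\<Sum>i. \<bar>(a k - b) i\<bar> powr p) 0 < e" by blast
  qed
  ultimately show ?thesis by (rule that)
qed

lemma linear_map_on_diff:
  assumes "linear_map_on X T" "subspace X" "x \<in> X" "y \<in> X" shows "T (x - y) = T x - T y"
proof -
  have "T (x - y + y) = T (x - y) + T y"
    using assms unfolding linear_map_on_def by (blast intro: subspace_diff)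
  then show ?thesis by simp
qed

lemma isomorphism_onI:
  assumes X: "subspace X" and T: "linear_map_on X T" and Y: "T ` X = Y" and inj: "inj_on T X"
    and upper: "\<And>x. x \<in> X \<Longrightarrow> nY (T x) \<le> C * nX x" and lower: "\<And>x. x \<in> X \<Longrightarrow> nX x \<le> C' * nY (T x)"
  shows "isomorphism_on X nX Y nY T"
proof -
  have inv: "inv_into X T (T x) = x" if "x \<in> X" for x using inj that by simp
  have "linear_map_on Y (inv_into X T)"
    unfolding linear_map_on_def Y[symmetric]
  proof (intro conjI allI ballI; clarify)
    fix x y assume xy: "x \<in> X" "y \<in> X"
    have "T x + T y = T (x + y)" using T xy by (simp add: linear_map_on_def)
    then show "inv_into X T (T x + T y) = inv_into X T (T x) + inv_into X T (T y)"
      using inv xy subspace_add[OF X xy] by simp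
  next
    fix c x assume x: "x \<in> X"
    have "c *\<^sub>R T x = T (c *\<^sub>R x)" using T x by (simp add: linear_map_on_def)
    then show "inv_into X T (c *\<^sub>R T x) = c *\<^sub>R inv_into X T (T x)"
      using inv x subspace_scale[OF X x, of c] by simp
  qed
  moreover have "\<forall>y\<in>Y. nX (inv_into X T y) \<le> C' * nY y" using lower inv Y by auto
  moreover have "inv_into X T \<in> Y \<rightarrow> X" using Y by (auto simp: inv)
  ultimately show ?thesis
    using T Y inj upper by (auto simp: isomorphism_on_def bij_betw_def bounded_operator_def)
qed

text \<open>The map \<open>J\<close> sending \<open>a\<close> to the series of
  \<open>a k *\<^sub>R w k\<close> is bounded by the \<open>p\<close>-triangle inequality, and a
  lower bound for \<open>T\<close> after \<open>J\<close> bounds both \<open>J\<close> and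
  \<open>T\<close> on the range of \<open>J\<close> from below. The hypothesis \<open>low\<close>
  concerns finite sums only; the estimates pass to the limit.\<close>

lemma fixes_copy_of_lpI:
  fixes w :: "nat \<Rightarrow> 'e::real_vector" and T :: "'e \<Rightarrow> 'f::real_vector"
  assumes p: "0 < p" "p \<le> 1" and Eb: "p_banach p E nE" and Fn: "p_normed p F nF"
    and T: "bounded_operator E nE F nF T"
    and w: "\<And>k. w k \<in> E" "\<And>k. nE (w k) powr p \<le> B" and c: "0 < c"
    and low: "\<And>n a. c * (\<Sum>k<n. \<bar>a k\<bar> powr p) \<le> nF (T (\<Sum>k<n. a k *\<^sub>R w k)) powr p"
  shows "fixes_copy_of_lp p E nE nF T"
proof -
  have En: "p_normed p E nE" and Ec: "qnorm_complete E nE" using Eb by (auto simp: p_banach_def)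
  define PE where "PE x = nE x powr p" for x
  define PF where "PF x = nF x powr p" for x
  define A where "A x = (\<Sum>i. \<bar>x i\<bar> powr p)" for x :: "nat \<Rightarrow> real"
  let ?l = "lp_space p"
  interpret E: p_gauge p E PE using p_normed_gauge[OF En p] by (simp add: PE_def[abs_def])
  interpret F: p_gauge p F PF using p_normed_gauge[OF Fn p] by (simp add: PF_def[abs_def])
  interpret l: p_gauge p ?l A using lp_gauge[OF p] by (simp add: A_def[abs_def])
  have PE0: "x = 0" if "PE x = 0" "x \<in> E" for x
    using p_normed_powr_eq_0[OF En p(1)] that by (simp add: PE_def)
  have lin: "linear_map_on E T" and TF: "\<And>x. x \<in> E \<Longrightarrow> T x \<in> F" using T by (auto simp: bounded_operator_def)
  obtain K0 where K0: "\<forall>x\<in>E. nF (T x) \<le> K0 * nE x" using T by (auto simp: bounded_operator_def)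
  define K where "K = \<bar>K0\<bar> powr p"
  have K: "0 \<le> K" "\<And>x. x \<in> E \<Longrightarrow> PF (T x) \<le> K * PE x"
  proof -
    fix x assume x: "x \<in> E"
    have "nF (T x) \<le> \<bar>K0\<bar> * nE x"
      using K0 x p_normedD(2)[OF En x] by (meson abs_ge_self mult_right_mono order_trans)
    then have "PF (T x) \<le> (\<bar>K0\<bar> * nE x) powr p"
      unfolding PF_def using p p_normedD(2)[OF Fn TF[OF x]] by (intro powr_mono2) auto
    then show "PF (T x) \<le> K * PE x" using p_normedD(2)[OF En x] by (simp add: powr_mult K_def PE_def)
  qed (simp add: K_def)
  have B0: "0 \<le> B" using w(2)[of 0] powr_ge_zero order_trans by blast
  have l_sum: "summable (\<lambda>i. \<bar>a i\<bar> powr p)" if "a \<in> ?l" for a using that by (simp add: lp_space_def)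
  define s where "s a n = (\<Sum>k<n. a k *\<^sub>R w k)" for a :: "nat \<Rightarrow> real" and n
  have sE: "s a n \<in> E" for a n unfolding s_def by (intro E.V_closed w)
  have PE_sum: "PE (\<Sum>k\<in>I. a k *\<^sub>R w k) \<le> B * (\<Sum>k\<in>I. \<bar>a k\<bar> powr p)" if "finite I" for a I
  proof -
    have "PE (\<Sum>k\<in>I. a k *\<^sub>R w k) \<le> (\<Sum>k\<in>I. PE (a k *\<^sub>R w k))" by (intro E.sum_le that E.V_closed w)
    also have "\<dots> \<le> (\<Sum>k\<in>I. B * \<bar>a k\<bar> powr p)"
      using w by (intro sum_mono) (auto simp: E.scale PE_def[symmetric] mult.commute intro!: mult_right_mono)
    finally show ?thesis by (simp add: sum_distrib_left)
  qed
  \<comment> \<open>Convergence of the series is treated as a relation first. Uniqueness of the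
    limit then makes the choice \<open>J\<close> linear.\<close>
  define conv where "conv a v \<longleftrightarrow> v \<in> E \<and> (\<lambda>n. PE (s a n - v)) \<longlonglongrightarrow> 0" for a v
  have conv_ex: "\<exists>v. conv a v" if a: "a \<in> ?l" for a
  proof -
    have small: "\<exists>N. \<forall>i\<ge>N. \<forall>j\<ge>N. PE (s a i - s a j) < e" if e: "e > 0" for e
    proof -
      have "0 < e / (B + 1)" using e B0 by simp
      then obtain N where N: "\<forall>m\<ge>N. \<forall>n. norm (\<Sum>k=m..<n. \<bar>a k\<bar> powr p) < e / (B + 1)"
        using l_sum[OF a] unfolding summable_Cauchy by meson
      have *: "PE (s a j - s a i) < e" if "N \<le> i" "i \<le> j" for i j
      proof -
        have "s a j - s a i = (\<Sum>k=i..<j. a k *\<^sub>R w k)"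
          using sum_diff_nat_ivl[of 0 i j "\<lambda>k. a k *\<^sub>R w k"] that by (simp add: s_def lessThan_atLeast0)
        then have "PE (s a j - s a i) \<le> B * (\<Sum>k=i..<j. \<bar>a k\<bar> powr p)" using PE_sum[of "{i..<j}" a] by simp
        also have "\<dots> \<le> (B + 1) * (\<Sum>k=i..<j. \<bar>a k\<bar> powr p)" by (intro mult_right_mono sum_nonneg) auto
        also have "\<bar>\<Sum>k=i..<j. \<bar>a k\<bar> powr p\<bar> < e / (B + 1)" using N that by simp
        then have "(B + 1) * (\<Sum>k=i..<j. \<bar>a k\<bar> powr p) < (B + 1) * (e / (B + 1))"
          using B0 by (intro mult_strict_left_mono) linarith+
        also have "\<dots> = e" using B0 by simp
        finally show ?thesis .
      qed
      have "PE (s a i - s a j) < e" if "N \<le> i" "N \<le> j" for i j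
        using *[of i j] *[of j i] that E.diff_commute[OF sE sE, of a i a j] by (cases "i \<le> j") auto
      then show ?thesis by blast
    qed
    have "\<exists>N. \<forall>i\<ge>N. \<forall>j\<ge>N. nE (s a i - s a j) < e" if e: "e > 0" for e
    proof -
      obtain N where N: "\<forall>i\<ge>N. \<forall>j\<ge>N. PE (s a i - s a j) < e powr p" using small[of "e powr p"] e by auto
      have "nE (s a i - s a j) < e" if "N \<le> i" "N \<le> j" for i j
        using N that p e unfolding PE_def by (meson not_less powr_mono2 less_imp_le)
      then show ?thesis by blast
    qed
    moreover have sub: "range (s a) \<subseteq> E" using sE by auto
    ultimately obtain v where v: "limitin (qnorm_topology E nE) (s a) v sequentially"
      using qnorm_completeD[OF Ec sub] by metis
    then have vE: "v \<in> E" and ev: "\<And>e. e > 0 \<Longrightarrow> eventually (\<lambda>k. nE (s a k - v) < e) sequentially"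
      by (auto simp: limitin_qnorm_topology[OF En p(1) sub])
    have "(\<lambda>n. PE (s a n - v)) \<longlonglongrightarrow> 0"
    proof (rule tendstoI)
      fix e :: real assume e: "e > 0"
      show "\<forall>\<^sub>F n in sequentially. dist (PE (s a n - v)) 0 < e"
        using ev[of "e powr (1 / p)"] e
      proof (simp, elim eventually_mono)
        fix n assume "nE (s a n - v) < e powr (1 / p)"
        then have "PE (s a n - v) < (e powr (1 / p)) powr p"
          unfolding PE_def using p p_normedD(2)[OF En E.V_closed(3)[OF sE vE]]
          by (intro powr_less_mono2) auto
        then show "\<bar>PE (s a n - v)\<bar> < e"
          using p e E.nonneg[OF E.V_closed(3)[OF sE vE], of a n] by (simp add: powr_powr)
      qed
    qed
    then show ?thesis using vE by (auto simp: conv_def)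
  qed
  have conv_uniq: "v = v'" if v: "conv a v" "conv a v'" for a v v'
  proof -
    have E: "v \<in> E" "v' \<in> E" using v by (auto simp: conv_def)
    have "(\<lambda>n. PE (s a n - v) + PE (s a n - v')) \<longlonglongrightarrow> 0 + 0"
      using v by (intro tendsto_add) (auto simp: conv_def)
    then have "PE (v - v') \<le> 0 + 0"
      by (rule LIMSEQ_le_const)
        (use E.diff_triangle[OF E(1) sE E(2)] E.diff_commute[OF E(1) sE] in auto)
    then have "PE (v - v') = 0" using E.nonneg[OF E.V_closed(3)[OF E]] by simp
    then show ?thesis using PE0[of "v - v'"] E.V_closed(3)[OF E] by simp
  qed
  define J where "J a = (SOME v. conv a v)" for a
  have J: "conv a (J a)" if "a \<in> ?l" for a unfolding J_def using conv_ex[OF that] by (rule someI_ex)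
  have JE: "J a \<in> E" if "a \<in> ?l" for a using J[OF that] by (simp add: conv_def)
  have Jlim: "(\<lambda>n. PE (s a n - J a)) \<longlonglongrightarrow> 0" if "a \<in> ?l" for a using J[OF that] by (simp add: conv_def)
  have J_add: "J (a + b) = J a + J b" if ab: "a \<in> ?l" "b \<in> ?l" for a b
  proof (rule conv_uniq[OF J[OF l.V_closed(2)[OF ab]]])
    have lim: "(\<lambda>n. PE (s a n - J a) + PE (s b n - J b)) \<longlonglongrightarrow> 0 + 0"
      by (intro tendsto_add Jlim ab)
    have le: "PE (s (a + b) n - (J a + J b)) \<le> PE (s a n - J a) + PE (s b n - J b)" for n
    proof -
      have "s (a + b) n - (J a + J b) = (s a n - J a) + (s b n - J b)"
        by (simp add: s_def scaleR_add_left sum.distrib)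
      then show ?thesis
        using E.add_le[OF E.V_closed(3)[OF sE JE[OF ab(1)]] E.V_closed(3)[OF sE JE[OF ab(2)]], of a n b n]
        by (simp only:)
    qed
    have nn: "0 \<le> PE (s (a + b) n - (J a + J b))" for n
      by (rule E.nonneg[OF E.V_closed(3)[OF sE E.V_closed(2)[OF JE[OF ab(1)] JE[OF ab(2)]]]])
    have "(\<lambda>n. PE (s (a + b) n - (J a + J b))) \<longlonglongrightarrow> 0"
    proof (rule Lim_null_comparison)
      show "\<forall>\<^sub>F n in sequentially. norm (PE (s (a + b) n - (J a + J b))) \<le>
          PE (s a n - J a) + PE (s b n - J b)"
        unfolding real_norm_def abs_of_nonneg[OF nn] by (intro always_eventually allI le)
      show "(\<lambda>n. PE (s a n - J a) + PE (s b n - J b)) \<longlonglongrightarrow> 0" using lim by simp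
    qed
    then show "conv (a + b) (J a + J b)" using E.V_closed(2) JE ab by (simp add: conv_def)
  qed
  have J_scale: "J (r *\<^sub>R a) = r *\<^sub>R J a" if a: "a \<in> ?l" for r a
  proof (rule conv_uniq[OF J[OF l.V_closed(4)[OF a]]])
    have "s (r *\<^sub>R a) n - r *\<^sub>R J a = r *\<^sub>R (s a n - J a)" for n
      by (simp add: s_def scaleR_sum_right scaleR_diff_right)
    then have "PE (s (r *\<^sub>R a) n - r *\<^sub>R J a) = \<bar>r\<bar> powr p * PE (s a n - J a)" for n
      using E.scale[OF E.V_closed(3)[OF sE JE[OF a]], of r a n] by simp
    moreover have "(\<lambda>n. \<bar>r\<bar> powr p * PE (s a n - J a)) \<longlonglongrightarrow> \<bar>r\<bar> powr p * 0"
      by (intro tendsto_mult tendsto_const Jlim a)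
    ultimately have "(\<lambda>n. PE (s (r *\<^sub>R a) n - r *\<^sub>R J a)) \<longlonglongrightarrow> 0" by simp
    then show "conv (r *\<^sub>R a) (r *\<^sub>R J a)" using E.V_closed(4) JE a by (simp add: conv_def)
  qed
  have J_lin: "linear_map_on ?l J" using J_add J_scale by (simp add: linear_map_on_def)
  note J_diff = linear_map_on_diff[OF J_lin l.V]
  have upper: "PE (J a) \<le> B * A a" if a: "a \<in> ?l" for a
  proof -
    have "(\<lambda>n. B * A a + PE (s a n - J a)) \<longlonglongrightarrow> B * A a + 0"
      by (intro tendsto_add tendsto_const Jlim a)
    moreover have "PE (J a) \<le> B * A a + PE (s a n - J a)" for n
    proof -
      have "PE (J a) \<le> PE (s a n) + PE (s a n - J a)"
        using E.diff_le[OF sE E.V_closed(3)[OF sE JE[OF a]], of a n a n] by simp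
      moreover have "PE (s a n) \<le> B * (\<Sum>k<n. \<bar>a k\<bar> powr p)" unfolding s_def by (rule PE_sum) simp
      moreover have "(\<Sum>k<n. \<bar>a k\<bar> powr p) \<le> A a"
        unfolding A_def by (rule sum_le_suminf[OF l_sum[OF a]]) auto
      ultimately show ?thesis using mult_left_mono[OF _ B0] by (smt (verit))
    qed
    ultimately show ?thesis using LIMSEQ_le_const[of _ "B * A a + 0" "PE (J a)"] by auto
  qed
  have lower: "c * A a \<le> PF (T (J a))" if a: "a \<in> ?l" for a
  proof (rule LIMSEQ_le)
    show "(\<lambda>n. c * (\<Sum>k<n. \<bar>a k\<bar> powr p)) \<longlonglongrightarrow> c * A a"
      unfolding A_def using summable_LIMSEQ[OF l_sum[OF a]] by (intro tendsto_mult tendsto_const)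
    have "(\<lambda>n. PF (T (J a)) + K * PE (s a n - J a)) \<longlonglongrightarrow> PF (T (J a)) + K * 0"
      by (intro tendsto_add tendsto_mult tendsto_const Jlim a)
    then show "(\<lambda>n. PF (T (J a)) + K * PE (s a n - J a)) \<longlonglongrightarrow> PF (T (J a))" by simp
    \<comment> \<open>The tail of the series enters through the boundedness of \<open>T\<close> and
      disappears in the limit.\<close>
    have "c * (\<Sum>k<n. \<bar>a k\<bar> powr p) \<le> PF (T (J a)) + K * PE (s a n - J a)" for n
    proof -
      have d: "s a n - J a \<in> E" by (rule E.V_closed(3)[OF sE JE[OF a]])
      have "T (s a n) = T (J a) + T (s a n - J a)"
        using linear_map_on_diff[OF lin E.V sE JE[OF a], of a n] by simp
      then have "PF (T (s a n)) \<le> PF (T (J a)) + PF (T (s a n - J a))"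
        using F.add_le[OF TF[OF JE[OF a]] TF[OF d]] by simp
      moreover have "c * (\<Sum>k<n. \<bar>a k\<bar> powr p) \<le> PF (T (s a n))"
        using low[of a n] by (simp add: PF_def s_def)
      ultimately show ?thesis using K(2)[OF d] by linarith
    qed
    then show "\<exists>N. \<forall>n\<ge>N. c * (\<Sum>k<n. \<bar>a k\<bar> powr p) \<le> PF (T (J a)) + K * PE (s a n - J a)" by blast
  qed
  have A0: "a = 0" if "A a = 0" "a \<in> ?l" for a
  proof
    fix i
    have "\<bar>a i\<bar> powr p \<le> A a" unfolding A_def using sum_le_suminf[OF l_sum[OF that(2)], of "{i}"] by simp
    then have "\<bar>a i\<bar> powr p = 0" using that(1) by (metis antisym powr_ge_zero)
    then show "a i = 0 i" by simp
  qed
  define X0 where "X0 = J ` ?l"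
  have X0E: "X0 \<subseteq> E" using JE by (auto simp: X0_def)
  have T_inj: "a = b" if "a \<in> ?l" "b \<in> ?l" "T (J a) = T (J b)" for a b
  proof -
    have d: "a - b \<in> ?l" using l.V_closed(3) that by blast
    have "T (J (a - b)) = 0"
      using J_diff[OF that(1,2)] linear_map_on_diff[OF lin E.V JE[OF that(1)] JE[OF that(2)]] that(3) by simp
    then have "c * A (a - b) \<le> 0" using lower[OF d] by simp
    then have "A (a - b) = 0" using c l.nonneg[OF d] by (simp add: mult_le_0_iff)
    then show ?thesis using A0[OF _ d] by simp
  qed
  have X0sub: "subspace X0"
  proof (rule subspaceI)
    have "J 0 = 0" using J_scale[OF l.V_closed(1), of 0] by simp
    then show "0 \<in> X0" using l.V_closed(1) by (force simp: X0_def)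
    show "x + y \<in> X0" if "x \<in> X0" "y \<in> X0" for x y
      using that J_add l.V_closed(2) unfolding X0_def by (metis (no_types, lifting) imageE imageI)
    show "r *\<^sub>R x \<in> X0" if "x \<in> X0" for r x
      using that J_scale l.V_closed(4) unfolding X0_def by (metis (no_types, lifting) imageE imageI)
  qed
  have "closedin (qnorm_topology E nE) X0"
    unfolding closedin_def openin_qnorm_topology topspace_qnorm_topology
  proof (intro conjI ballI X0E)
    fix x assume x: "x \<in> E - X0"
    show "\<exists>e>0. \<forall>y\<in>E. nE (y - x) < e \<longrightarrow> y \<in> E - X0"
    proof (rule ccontr)
      assume "\<not> ?thesis"
      \<comment> \<open>If \<open>x\<close> is a limit of vectors \<open>J (a k)\<close>, the lower
        bound makes the coefficient sequences Cauchy in l_p, and their limit \<open>b\<close>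
        satisfies \<open>x = J b\<close>.\<close>
      then have "\<exists>y\<in>X0. nE (y - x) < e" if "e > 0" for e using that X0E by blast
      then have "\<exists>a\<in>?l. nE (J a - x) < (1 / Suc k) powr (1 / p)" for k
        unfolding X0_def by (metis (no_types, lifting) imageE of_nat_0_less_iff powr_gt_zero zero_less_Suc zero_less_divide_1_iff less_irrefl)
      then obtain a where a: "\<And>k. a k \<in> ?l" "\<And>k. nE (J (a k) - x) < (1 / Suc k) powr (1 / p)" by metis
      have JxE: "J (a k) - x \<in> E" for k using E.V_closed(3) JE a(1) x by blast
      have near: "PE (J (a k) - x) \<le> 1 / Suc k" for k
      proof -
        have "PE (J (a k) - x) \<le> ((1 / Suc k) powr (1 / p)) powr p"
          unfolding PE_def using a(2)[of k] p p_normedD(2)[OF En JxE] by (intro powr_mono2) auto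
        then show ?thesis using p by (simp add: powr_powr)
      qed
      have A_le: "A (a k - a l) \<le> K / c * (1 / Suc k + 1 / Suc l)" for k l
      proof -
        have d: "a k - a l \<in> ?l" using l.V_closed(3) a(1) by blast
        have "c * A (a k - a l) \<le> K * PE (J (a k - a l))"
          using lower[OF d] K(2)[OF JE[OF d]] by linarith
        also have "PE (J (a k - a l)) \<le> PE (J (a k) - x) + PE (J (a l) - x)"
          using E.diff_le[OF JxE JxE, of k l] J_diff[OF a(1) a(1), of k l] by simp
        also have "\<dots> \<le> 1 / Suc k + 1 / Suc l" using near add_mono by blast
        finally have "c * A (a k - a l) \<le> K * (1 / Suc k + 1 / Suc l)"
          using K(1) by (simp add: mult_left_mono)
        then have "A (a k - a l) \<le> K * (1 / Suc k + 1 / Suc l) / c"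
          unfolding pos_le_divide_eq[OF c] by (simp only: mult.commute)
        then show ?thesis by (simp only: times_divide_eq_left)
      qed
      have cauA: "\<exists>N. \<forall>k\<ge>N. \<forall>l\<ge>N. A (a k - a l) < e" if e: "e > 0" for e
      proof -
        define h where "h = e / (2 * (K / c + 1))"
        have Kc: "0 \<le> K / c" using K c by simp
        have h: "0 < h" using e Kc by (simp add: h_def)
        obtain N where N: "1 / Suc N < h" using nat_approx_posE[OF h] by auto
        have "A (a k - a l) < e" if "k \<ge> N" "l \<ge> N" for k l
        proof -
          have "1 / Suc k \<le> 1 / Suc N" "1 / Suc l \<le> 1 / Suc N" using that by (auto intro!: divide_left_mono)
          then have "1 / Suc k + 1 / Suc l \<le> 2 * h" using N by linarith
          then have "A (a k - a l) \<le> K / c * (2 * h)" using A_le[of k l] Kc by (meson mult_left_mono order_trans)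
          also have "\<dots> < (K / c + 1) * (2 * h)" using h by (intro mult_strict_right_mono) auto
          also have "\<dots> = e"
          proof -
            have "y * (2 * (e / (2 * y))) = e" if "0 < y" for y using that by simp
            from this[of "K / c + 1"] show ?thesis unfolding h_def using Kc by linarith
          qed
          finally show ?thesis .
        qed
        then show ?thesis by blast
      qed
      obtain b where b: "b \<in> ?l" "(\<lambda>k. A (a k - b)) \<longlonglongrightarrow> 0"
        unfolding A_def by (rule lp_complete[where a = a, OF p a(1) cauA[unfolded A_def]])
      have "(\<lambda>k. 1 / Suc k + B * A (a k - b)) \<longlonglongrightarrow> 0 + B * 0"
        by (intro tendsto_add tendsto_mult tendsto_const b LIMSEQ_Suc[OF lim_1_over_n])
      moreover have "PE (x - J b) \<le> 1 / Suc k + B * A (a k - b)" for k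
      proof -
        have xE: "x \<in> E" using x by simp
        have "PE (x - J b) \<le> PE (x - J (a k)) + PE (J (a k) - J b)"
          by (intro E.diff_triangle xE JE a b)
        also have "PE (x - J (a k)) = PE (J (a k) - x)" by (intro E.diff_commute xE JE a)
        also have "PE (J (a k) - J b) \<le> B * A (a k - b)"
          using upper[OF l.V_closed(3)[OF a(1) b(1)], of k] J_diff[OF a(1) b(1), of k] by simp
        finally show ?thesis using near[of k] by linarith
      qed
      ultimately have "PE (x - J b) \<le> 0 + B * 0" using LIMSEQ_le_const by blast
      moreover have xJ: "x - J b \<in> E" using E.V_closed(3) x JE b by blast
      ultimately have "PE (x - J b) = 0" using E.nonneg[OF xJ] by simp
      then have "x = J b" using PE0[OF _ xJ] by simp
      then show False using x b by (auto simp: X0_def)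
    qed
  qed auto
  moreover have "isomorphism_on ?l (lp_norm p) X0 nE J"
  proof (rule isomorphism_onI[OF l.V J_lin])
    show "J ` ?l = X0" by (simp add: X0_def)
    show "inj_on J ?l" using T_inj by (intro inj_onI) metis
    fix a assume a: "a \<in> ?l"
    have n: "0 \<le> lp_norm p a" "lp_norm p a powr p = A a" "0 \<le> nE (J a)"
      using lp_norm_powr[OF p(1) a] p_normedD(2)[OF En JE[OF a]] by (auto simp: A_def lp_norm_def)
    show "nE (J a) \<le> B powr (1 / p) * lp_norm p a"
      using upper[OF a] n p B0 by (intro powr_root_le) (auto simp: PE_def)
    have "c * A a \<le> K * PE (J a)" using lower[OF a] K(2)[OF JE[OF a]] by linarith
    then have "A a \<le> K / c * PE (J a)" using c by (simp add: field_simps)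
    then show "lp_norm p a \<le> (K / c) powr (1 / p) * nE (J a)"
      using n p K c by (intro powr_root_le) (auto simp: PE_def)
  qed
  moreover have "isomorphism_on X0 nE (T ` X0) nF T"
  proof (rule isomorphism_onI[OF X0sub _ refl])
    show "linear_map_on X0 T" using lin X0E by (auto simp: linear_map_on_def subset_iff)
    show "inj_on T X0" using T_inj unfolding X0_def by (intro inj_onI) blast
    fix x assume x: "x \<in> X0"
    then show "nF (T x) \<le> K0 * nE x" using K0 X0E by blast
    obtain a where a: "a \<in> ?l" "x = J a" using x by (auto simp: X0_def)
    have "c * PE x \<le> c * (B * A a)" using upper[OF a(1)] c a(2) by simp
    also have "\<dots> = B * (c * A a)" by simp
    also have "\<dots> \<le> B * PF (T x)" using lower[OF a(1)] a(2) B0 by (intro mult_left_mono) auto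
    finally have "PE x \<le> B / c * PF (T x)" using c by (simp add: field_simps)
    then show "nE x \<le> (B / c) powr (1 / p) * nF (T x)"
      using p B0 c p_normedD(2)[OF En] p_normedD(2)[OF Fn TF] X0E x
      by (intro powr_root_le) (auto simp: PE_def PF_def)
  qed
  ultimately show ?thesis unfolding fixes_copy_of_lp_def using X0E X0sub by blast
qed

section \<open>Compactness and separated sequences\<close>

text \<open>\<open>nF (x - y) powr p\<close> is a complete metric that induces the topology of
  \<open>F\<close>. For such a metric relative compactness is total boundedness, and where total
  boundedness fails a separated sequence can be chosen greedily.\<close>

lemma compact_operator_iff_no_separated_sequence:
  fixes T :: "'e::real_vector \<Rightarrow> 'f::real_vector"
  assumes p: "0 < p" "p \<le> 1" and Fb: "p_banach p F nF" and T: "T \<in> E \<rightarrow> F"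
  shows "compact_operator E nE F nF T \<longleftrightarrow>
    \<not> (\<exists>\<epsilon>>0. \<exists>e :: nat \<Rightarrow> 'e. (\<forall>k. e k \<in> E \<and> nE (e k) \<le> 1) \<and>
        (\<forall>k l. k \<noteq> l \<longrightarrow> \<epsilon> \<le> nF (T (e k) - T (e l)) powr p))"
proof -
  have Fn: "p_normed p F nF" and Fc: "qnorm_complete F nF" using Fb by (auto simp: p_banach_def)
  interpret P: p_gauge p F "\<lambda>x. nF x powr p" by (rule p_normed_gauge[OF Fn p])
  \<comment> \<open>The value 0 outside \<open>F\<close> serves the axioms of
    \<open>Metric_space\<close> that are not restricted to the carrier.\<close>
  define dF where "dF x y = (if x \<in> F \<and> y \<in> F then nF (x - y) powr p else 0)" for x y
  have dF: "dF x y = nF (x - y) powr p" if "x \<in> F" "y \<in> F" for x y using that by (simp add: dF_def)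
  interpret Metric_space F dF
  proof
    show "dF x y = dF y x" for x y using P.diff_commute[of x y] by (simp add: dF_def)
    show "dF x y = 0 \<longleftrightarrow> x = y" if "x \<in> F" "y \<in> F" for x y
      using that p_normed_powr_eq_0[OF Fn p(1) P.V_closed(3)[OF that]] by (simp add: dF)
    show "dF x w \<le> dF x y + dF y w" if "x \<in> F" "y \<in> F" "w \<in> F" for x y w
      using P.diff_triangle that by (simp add: dF)
  qed (simp add: dF_def)
  have less: "nF (x - y) < e \<longleftrightarrow> dF x y < e powr p" if "x \<in> F" "y \<in> F" "0 < e" for x y e
    using that p p_normedD(2)[OF Fn P.V_closed(3)[OF that(1,2)]]
    by (metis dF not_less powr_less_mono2 powr_mono2 less_imp_le)
  have less': "dF x y < e \<longleftrightarrow> nF (x - y) < e powr (1 / p)" if "x \<in> F" "y \<in> F" "0 < e" for x y e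
    using less[OF that(1,2), of "e powr (1 / p)"] that p by (simp add: powr_powr)
  have top: "mtopology = qnorm_topology F nF"
    unfolding topology_eq openin_mtopology openin_qnorm_topology
  proof (intro allI conj_cong refl)
    fix U assume U: "U \<subseteq> F"
    have "(\<exists>r>0. mball x r \<subseteq> U) \<longleftrightarrow> (\<exists>e>0. \<forall>y\<in>F. nF (y - x) < e \<longrightarrow> y \<in> U)" if x: "x \<in> U" for x
    proof
      assume "\<exists>r>0. mball x r \<subseteq> U"
      then obtain r where r: "0 < r" "mball x r \<subseteq> U" by blast
      then show "\<exists>e>0. \<forall>y\<in>F. nF (y - x) < e \<longrightarrow> y \<in> U"
        using less'[of _ x r] x U by (intro exI[of _ "r powr (1 / p)"]) (force simp: commute)
    next
      assume "\<exists>e>0. \<forall>y\<in>F. nF (y - x) < e \<longrightarrow> y \<in> U"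
      then obtain e where e: "0 < e" "\<forall>y\<in>F. nF (y - x) < e \<longrightarrow> y \<in> U" by blast
      then show "\<exists>r>0. mball x r \<subseteq> U"
        using less[of _ x e] x U by (intro exI[of _ "e powr p"]) (force simp: commute)
    qed
    then show "(\<forall>x. x \<in> U \<longrightarrow> (\<exists>r>0. mball x r \<subseteq> U)) \<longleftrightarrow> (\<forall>x\<in>U. \<exists>e>0. \<forall>y\<in>F. nF (y - x) < e \<longrightarrow> y \<in> U)"
      by blast
  qed
  have mcomplete
    unfolding mcomplete_def
  proof (intro allI impI)
    fix \<sigma> assume \<sigma>: "MCauchy \<sigma>"
    then have sub: "range \<sigma> \<subseteq> F" by (simp add: MCauchy_def)
    have "\<exists>N. \<forall>i\<ge>N. \<forall>j\<ge>N. nF (\<sigma> i - \<sigma> j) < e" if e: "e > 0" for e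
    proof -
      have "0 < e powr p" using e by simp
      then obtain N where "\<forall>i j. N \<le> i \<longrightarrow> N \<le> j \<longrightarrow> dF (\<sigma> i) (\<sigma> j) < e powr p"
        using \<sigma> unfolding MCauchy_def by blast
      then show ?thesis using less[of "\<sigma> _" "\<sigma> _" e] sub e by (intro exI[of _ N]) (auto simp: subset_iff)
    qed
    then show "\<exists>x. limitin mtopology \<sigma> x sequentially"
      unfolding top using qnorm_completeD[OF Fc sub] by metis
  qed
  let ?S = "T ` {x \<in> E. nE x \<le> 1}"
  have S: "?S \<subseteq> F" using T by auto
  have "compact_operator E nE F nF T \<longleftrightarrow> mtotally_bounded ?S"
    unfolding compact_operator_def top[symmetric]
    using mtotally_bounded_eq_compact_closure_of[OF \<open>mcomplete\<close>] S by blast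
  also have "\<dots> \<longleftrightarrow> \<not> (\<exists>\<epsilon>>0. \<exists>e :: nat \<Rightarrow> 'e. (\<forall>k. e k \<in> E \<and> nE (e k) \<le> 1) \<and>
        (\<forall>k l. k \<noteq> l \<longrightarrow> \<epsilon> \<le> nF (T (e k) - T (e l)) powr p))"
  proof
    assume tb: "mtotally_bounded ?S"
    show "\<not> (\<exists>\<epsilon>>0. \<exists>e :: nat \<Rightarrow> 'e. (\<forall>k. e k \<in> E \<and> nE (e k) \<le> 1) \<and>
        (\<forall>k l. k \<noteq> l \<longrightarrow> \<epsilon> \<le> nF (T (e k) - T (e l)) powr p))"
    proof
      assume "\<exists>\<epsilon>>0. \<exists>e :: nat \<Rightarrow> 'e. (\<forall>k. e k \<in> E \<and> nE (e k) \<le> 1) \<and>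
        (\<forall>k l. k \<noteq> l \<longrightarrow> \<epsilon> \<le> nF (T (e k) - T (e l)) powr p)"
      then obtain \<epsilon> and e :: "nat \<Rightarrow> 'e" where \<epsilon>: "0 < \<epsilon>" and e: "\<And>k. e k \<in> E" "\<And>k. nE (e k) \<le> 1"
        and sep: "\<And>k l. k \<noteq> l \<Longrightarrow> \<epsilon> \<le> nF (T (e k) - T (e l)) powr p" by blast
      obtain K where K: "finite K" "K \<subseteq> ?S" "?S \<subseteq> (\<Union>x\<in>K. mball x (\<epsilon> / 2))"
        using tb \<epsilon> unfolding mtotally_bounded_def by (meson half_gt_zero)
      have "\<forall>k. \<exists>x\<in>K. T (e k) \<in> mball x (\<epsilon> / 2)" using K(3) e by blast
      then obtain c where c: "\<And>k. c k \<in> K" "\<And>k. T (e k) \<in> mball (c k) (\<epsilon> / 2)" by metis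
      have "finite (range c)" using K(1) c(1) by (meson finite_subset image_subsetI)
      then have "\<not> inj c" using finite_imageD infinite_UNIV_nat by blast
      then obtain k l where kl: "k \<noteq> l" "c k = c l" by (auto simp: inj_def)
      have "dF (T (e k)) (T (e l)) \<le> dF (T (e k)) (c k) + dF (c k) (T (e l))"
        using c(2)[of k] c(2)[of l] by (intro triangle) auto
      also have "\<dots> < \<epsilon>" using c(2)[of k] c(2)[of l] kl(2) by (simp add: commute)
      finally show False using sep[OF kl(1)] c(2)[of k] c(2)[of l] by (simp add: dF)
    qed
  next
    assume no: "\<not> (\<exists>\<epsilon>>0. \<exists>e :: nat \<Rightarrow> 'e. (\<forall>k. e k \<in> E \<and> nE (e k) \<le> 1) \<and>
        (\<forall>k l. k \<noteq> l \<longrightarrow> \<epsilon> \<le> nF (T (e k) - T (e l)) powr p))"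
    show "mtotally_bounded ?S"
      unfolding mtotally_bounded_def
    proof (intro allI impI, rule ccontr)
      fix \<epsilon> :: real
      assume \<epsilon>: "0 < \<epsilon>" and nK: "\<not> (\<exists>K. finite K \<and> K \<subseteq> ?S \<and> ?S \<subseteq> (\<Union>x\<in>K. mball x \<epsilon>))"
      have "\<exists>e. \<forall>k::nat. (e k \<in> E \<and> nE (e k) \<le> 1) \<and> (\<forall>l<k. \<epsilon> \<le> dF (T (e l)) (T (e k)))"
      proof (rule dependent_wellorder_choice)
        fix r and k :: nat and f :: "nat \<Rightarrow> 'e"
        assume f: "\<And>y. y < k \<Longrightarrow> (f y \<in> E \<and> nE (f y) \<le> 1) \<and> (\<forall>l<y. \<epsilon> \<le> dF (T (f l)) (T (f y)))"
        have "finite ((\<lambda>y. T (f y)) ` {..<k}) \<and> (\<lambda>y. T (f y)) ` {..<k} \<subseteq> ?S" using f by auto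
        then have "\<not> ?S \<subseteq> (\<Union>x\<in>(\<lambda>y. T (f y)) ` {..<k}. mball x \<epsilon>)" using nK by blast
        then obtain r where r: "r \<in> E" "nE r \<le> 1" "T r \<notin> (\<Union>x\<in>(\<lambda>y. T (f y)) ` {..<k}. mball x \<epsilon>)" by blast
        have "\<epsilon> \<le> dF (T (f l)) (T r)" if "l < k" for l
        proof -
          have "T r \<notin> mball (T (f l)) \<epsilon>" "T r \<in> F" "T (f l) \<in> F" using r f[OF that] that T by auto
          then show ?thesis by simp
        qed
        then show "\<exists>r. (r \<in> E \<and> nE r \<le> 1) \<and> (\<forall>l<k. \<epsilon> \<le> dF (T (f l)) (T r))" using r by blast
      qed simp
      then obtain e :: "nat \<Rightarrow> 'e" where e: "\<And>k. e k \<in> E \<and> nE (e k) \<le> 1"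
        "\<And>k l. l < k \<Longrightarrow> \<epsilon> \<le> dF (T (e l)) (T (e k))" by blast
      have TF: "T (e k) \<in> F" for k using e(1) T by blast
      have "\<epsilon> \<le> nF (T (e k) - T (e l)) powr p" if "k \<noteq> l" for k l
        using e(2)[of k l] e(2)[of l k] that dF[OF TF TF, of k l] commute[of "T (e k)" "T (e l)"]
        by (cases "k < l") auto
      then show False using no \<epsilon> e(1) by blast
    qed
  qed
  finally show ?thesis .
qed

text \<open>Distinct unit vectors of l_p have distance at least 1. Up to constants this survives
  both isomorphisms and the rescaling into the unit ball.\<close>

lemma fixes_copy_of_lp_imp_not_compact:
  fixes T :: "'e::real_vector \<Rightarrow> 'f::real_vector"
  assumes p: "0 < p" "p \<le> 1" and En: "p_normed p E nE" and Fb: "p_banach p F nF"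
    and T: "bounded_operator E nE F nF T" and copy: "fixes_copy_of_lp p E nE nF T"
  shows "\<not> compact_operator E nE F nF T"
proof -
  have Fn: "p_normed p F nF" using Fb by (simp add: p_banach_def)
  obtain X0 J where X0: "X0 \<subseteq> E" "subspace X0" and J: "isomorphism_on (lp_space p) (lp_norm p) X0 nE J"
    and TX: "isomorphism_on X0 nE (T ` X0) nF T"
    using copy unfolding fixes_copy_of_lp_def by blast
  have lin: "linear_map_on E T" and TF: "T \<in> E \<rightarrow> F" using T by (auto simp: bounded_operator_def)
  interpret l: p_gauge p "lp_space p" "\<lambda>x. \<Sum>i. \<bar>x i\<bar> powr p" by (rule lp_gauge[OF p])
  have Jb: "bij_betw J (lp_space p) X0" and Jlin: "linear_map_on (lp_space p) J"
    and JX: "J \<in> lp_space p \<rightarrow> X0"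
    using J by (auto simp: isomorphism_on_def bounded_operator_def)
  obtain C where C: "\<forall>x\<in>lp_space p. nE (J x) \<le> C * lp_norm p x"
    using J by (auto simp: isomorphism_on_def bounded_operator_def)
  obtain C1 where C1: "\<forall>y\<in>X0. lp_norm p (inv_into (lp_space p) J y) \<le> C1 * nE y"
    using J by (auto simp: isomorphism_on_def bounded_operator_def)
  obtain C2 where C2: "\<forall>y\<in>T ` X0. nE (inv_into X0 T y) \<le> C2 * nF y"
    using TX by (auto simp: isomorphism_on_def bounded_operator_def)
  have Tinj: "inj_on T X0" using TX by (auto simp: isomorphism_on_def bij_betw_def)
  define u where "u k = (\<lambda>i::nat. of_bool (i = k) :: real)" for k
  have ul: "u k \<in> lp_space p" for k
  proof -
    have "(\<lambda>i. \<bar>u k i\<bar> powr p) sums (\<Sum>i\<in>{k}. \<bar>u k i\<bar> powr p)"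
      by (rule sums_finite) (auto simp: u_def)
    then show ?thesis by (simp add: lp_space_def sums_iff)
  qed
  have sum_u: "(\<Sum>i. \<bar>u k i\<bar> powr p) = 1" for k
    using suminf_finite[of "{k}" "\<lambda>i. \<bar>u k i\<bar> powr p"] by (simp add: u_def)
  have norm_u: "lp_norm p (u k) = 1" for k by (simp add: lp_norm_def sum_u)
  have norm_diff: "1 \<le> lp_norm p (u k - u l)" if "k \<noteq> l" for k l
  proof -
    have d: "u k - u l \<in> lp_space p" by (rule l.V_closed(3)[OF ul ul])
    have "\<bar>(u k - u l) k\<bar> powr p \<le> (\<Sum>i. \<bar>(u k - u l) i\<bar> powr p)"
      using sum_le_suminf[of "\<lambda>i. \<bar>(u k - u l) i\<bar> powr p" "{k}"] d by (simp add: lp_space_def)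
    then have "1 \<le> (\<Sum>i. \<bar>(u k - u l) i\<bar> powr p)" using that by (simp add: u_def)
    then have "1 powr (1 / p) \<le> lp_norm p (u k - u l)"
      unfolding lp_norm_def using p by (intro powr_mono2) auto
    then show ?thesis by simp
  qed
  have lower: "1 \<le> \<bar>C1\<bar> * \<bar>C2\<bar> * nF (T (J (u k)) - T (J (u l)))" if kl: "k \<noteq> l" for k l
  proof -
    have d: "u k - u l \<in> lp_space p" by (rule l.V_closed(3)[OF ul ul])
    have JX': "J a \<in> X0" "J a \<in> E" if "a \<in> lp_space p" for a using JX X0 that by auto
    have eq: "T (J (u k - u l)) = T (J (u k)) - T (J (u l))"
      using linear_map_on_diff[OF Jlin l.V ul ul, of k l]
        linear_map_on_diff[OF lin p_normedD(1)[OF En] JX'(2)[OF ul] JX'(2)[OF ul], of k l] by simp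
    let ?v = "J (u k - u l)"
    have v: "?v \<in> X0" "?v \<in> E" using JX' d by auto
    have "lp_norm p (u k - u l) \<le> C1 * nE ?v"
      using C1 v(1) bij_betw_inv_into_left[OF Jb d] by metis
    also have "\<dots> \<le> \<bar>C1\<bar> * nE ?v" using p_normedD(2)[OF En v(2)] by (intro mult_right_mono) auto
    also have "nE ?v \<le> C2 * nF (T ?v)" using C2 v(1) inv_into_f_f[OF Tinj v(1)] by (metis imageI)
    also have "C2 * nF (T ?v) \<le> \<bar>C2\<bar> * nF (T ?v)"
      using p_normedD(2)[OF Fn, of "T ?v"] TF v(2) by (intro mult_right_mono) auto
    finally have "lp_norm p (u k - u l) \<le> \<bar>C1\<bar> * (\<bar>C2\<bar> * nF (T ?v))" by (simp add: mult_left_mono)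
    then show ?thesis using norm_diff[OF kl] eq by (simp add: mult.assoc)
  qed
  \<comment> \<open>Dividing by \<open>R\<close> puts the images of the unit vectors into the unit
    ball of \<open>E\<close>; the maximum with 1 keeps \<open>R\<close> positive whatever
    \<open>C\<close> is.\<close>
  define R where "R = max 1 C"
  have R: "1 \<le> R" "C \<le> R" by (auto simp: R_def)
  define e where "e k = (1 / R) *\<^sub>R J (u k)" for k
  have JE: "J (u k) \<in> E" for k using JX X0 ul by auto
  have eE: "e k \<in> E" "nE (e k) \<le> 1" for k
  proof -
    show "e k \<in> E" unfolding e_def using JE p_normedD(1)[OF En] by (simp add: subspace_scale)
    have "nE (e k) = 1 / R * nE (J (u k))" using p_normedD(4)[OF En JE, of "1 / R" k] R by (simp add: e_def)
    also have "nE (J (u k)) \<le> C" using C ul[of k] norm_u[of k] by fastforce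
    then have "1 / R * nE (J (u k)) \<le> 1 / R * C" using R by (intro mult_left_mono) auto
    also have "\<dots> \<le> 1" using R by (simp add: divide_le_eq)
    finally show "nE (e k) \<le> 1" .
  qed
  define Q where "Q = \<bar>C1\<bar> * \<bar>C2\<bar> + 1"
  have Q: "0 < Q" by (simp add: Q_def add_nonneg_pos)
  have "(1 / (R * Q)) powr p \<le> nF (T (e k) - T (e l)) powr p" if kl: "k \<noteq> l" for k l
  proof -
    let ?y = "T (J (u k)) - T (J (u l))"
    have y: "?y \<in> F" using TF JE p_normedD(1)[OF Fn] by (auto intro: subspace_diff)
    have "T (e k) - T (e l) = (1 / R) *\<^sub>R ?y"
      using lin JE by (simp add: linear_map_on_def e_def scaleR_diff_right)
    then have eq: "nF (T (e k) - T (e l)) = 1 / R * nF ?y"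
      using p_normedD(4)[OF Fn y, of "1 / R"] R by simp
    have "1 \<le> Q * nF ?y" using lower[OF kl] p_normedD(2)[OF Fn y] by (simp add: Q_def distrib_right)
    then have "1 / Q \<le> nF ?y" using Q by (simp add: divide_le_eq mult.commute)
    then have "1 / R * (1 / Q) \<le> nF (T (e k) - T (e l))" unfolding eq using R by (intro mult_left_mono) auto
    then show ?thesis using p R Q by (intro powr_mono2) auto
  qed
  moreover have "0 < (1 / (R * Q)) powr p" using R Q by simp
  ultimately show ?thesis
    unfolding compact_operator_iff_no_separated_sequence[OF p Fb TF] using eE by blast
qed

section \<open>Sequences with almost additive costs\<close>

context flow_space
begin

text \<open>Almost additivity is uniform over all measures with at most \<open>N\<close> atoms and
  cost at most \<open>C\<close>. So the next \<open>v\<close> can be chosen almost disjoint from all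
  normalised combinations of the earlier ones at once. The relation \<open>R\<close> carries along a
  companion \<open>w\<close> of each \<open>v\<close>.\<close>

lemma almost_disjoint_sequence:
  assumes \<alpha>: "0 < \<alpha>" "\<alpha> < 1" and c: "0 < c"
    and good: "\<And>\<kappa>. 0 < \<kappa> \<Longrightarrow> \<exists>w v. R w v \<and> v \<in> balanced \<and> c \<le> transport \<alpha> v \<and> transport \<alpha> v \<le> C \<and>
      transport 1 v \<le> \<kappa>"
  obtains w :: "nat \<Rightarrow> 'w" and v where "\<And>k. R (w k) (v k)" "\<And>k. v k \<in> balanced"
    "\<And>n a. 3 / 4 * c * (\<Sum>k<n. \<bar>a k\<bar> powr (q * \<alpha>)) \<le> transport \<alpha> (\<Sum>k<n. a k *\<^sub>R v k)"
proof -
  have \<alpha>1: "\<alpha> \<le> 1" using \<alpha> by simp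
  define r where "r = q * \<alpha>"
  have r: "0 < r" using q \<alpha> by (simp add: r_def)
  \<comment> \<open>The errors add up to at most \<open>c / 4\<close>, which leaves
    \<open>3 / 4 * c\<close>.\<close>
  define \<eta> where "\<eta> k = c / 4 * (1 / 2) ^ Suc k" for k :: nat
  have \<eta>: "0 < \<eta> k" for k using c by (simp add: \<eta>_def)
  have sum_\<eta>: "(\<Sum>k<n. \<eta> k) \<le> c / 4" for n
  proof -
    have "(\<Sum>k<n. \<eta> k) = c / 4 * (1 - (1 / 2) ^ n)"
      by (induction n) (auto simp: \<eta>_def algebra_simps)
    also have "\<dots> \<le> c / 4 * 1" using c by (intro mult_left_mono) auto
    finally show ?thesis by simp
  qed
  \<comment> \<open>The number \<open>N\<close> in the state bounds the atoms of all combinations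
    formed so far. The factor \<open>t\<close> is the coefficient that the new vector will have in a
    normalised combination.\<close>
  define Q where "Q = (\<lambda>k (w::'w, v::'a \<Rightarrow> real, N) (w', v', N'). R w' v' \<and> v' \<in> balanced \<and> c \<le> transport \<alpha> v' \<and>
    transport \<alpha> v' \<le> C \<and> N' = N + card {x. v' x \<noteq> 0} \<and>
    (\<forall>u\<in>balanced. \<forall>t. card {x. u x \<noteq> 0} \<le> N \<longrightarrow> transport \<alpha> u \<le> C \<longrightarrow> \<bar>t\<bar> \<le> 1 \<longrightarrow>
      transport \<alpha> u + transport \<alpha> (t *\<^sub>R v') \<le> transport \<alpha> (u + t *\<^sub>R v') + \<eta> k))"
  have "\<exists>f. \<forall>n::nat. True \<and> Q n (f n) (f (Suc n))"
  proof (rule dependent_nat_choice)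
    fix s :: "'w \<times> ('a \<Rightarrow> real) \<times> nat" and n :: nat
    obtain w v N where s: "s = (w, v, N)" by (cases s)
    obtain \<kappa> where \<kappa>: "0 < \<kappa>"
      "\<And>u v. u \<in> balanced \<Longrightarrow> v \<in> balanced \<Longrightarrow> card {x. u x \<noteq> 0} \<le> N \<Longrightarrow>
        transport \<alpha> u \<le> C \<Longrightarrow> transport \<alpha> v \<le> C \<Longrightarrow> transport 1 v \<le> \<kappa> \<Longrightarrow>
        transport \<alpha> u + transport \<alpha> v \<le> transport \<alpha> (u + v) + \<eta> n"
      using transport_almost_additive[OF \<alpha> \<eta>, of N C n] by metis
    obtain w' v' where v': "R w' v'" "v' \<in> balanced" "c \<le> transport \<alpha> v'" "transport \<alpha> v' \<le> C"
      "transport 1 v' \<le> \<kappa>" using good[OF \<kappa>(1)] by blast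
    have "transport s (t *\<^sub>R v') \<le> transport s v'" if "\<bar>t\<bar> \<le> 1" "0 < s" for t s
    proof -
      have "\<bar>t\<bar> powr (q * s) \<le> 1" using that q by (intro powr_le1) auto
      then show ?thesis
        using transport_nonneg[OF v'(2), of s] by (simp add: transport_scale[OF v'(2)] mult_left_le_one_le)
    qed
    then have "transport \<alpha> (t *\<^sub>R v') \<le> C" "transport 1 (t *\<^sub>R v') \<le> \<kappa>" if "\<bar>t\<bar> \<le> 1" for t
      using that v' \<alpha> by (meson order_trans zero_less_one)+
    then have "Q n s (w', v', N + card {x. v' x \<noteq> 0})"
      using v' \<kappa>(2) balanced_scale[OF v'(2)] by (simp add: Q_def s)
    then show "\<exists>s'. True \<and> Q n s s'" by blast
  qed simp
  then obtain f where f: "\<And>n. Q n (f n) (f (Suc n))" by blast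
  define w where "w k = fst (f (Suc k))" for k
  define v where "v k = fst (snd (f (Suc k)))" for k
  define N where "N k = snd (snd (f k))" for k
  have props: "R (w k) (v k)" "v k \<in> balanced" "c \<le> transport \<alpha> (v k)" "transport \<alpha> (v k) \<le> C"
    "N (Suc k) = N k + card {x. v k x \<noteq> 0}"
    "\<And>u t. u \<in> balanced \<Longrightarrow> card {x. u x \<noteq> 0} \<le> N k \<Longrightarrow> transport \<alpha> u \<le> C \<Longrightarrow> \<bar>t\<bar> \<le> 1 \<Longrightarrow>
      transport \<alpha> u + transport \<alpha> (t *\<^sub>R v k) \<le> transport \<alpha> (u + t *\<^sub>R v k) + \<eta> k" for k
    using f[of k] by (auto simp: Q_def w_def v_def N_def split: prod.splits)
  have comb: "(\<Sum>k<n. a k *\<^sub>R v k) \<in> balanced" for a n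
    by (intro balanced_sum balanced_scale props)
  have card_comb: "card {x. (\<Sum>k<n. a k *\<^sub>R v k) x \<noteq> 0} \<le> N n" for a n
  proof (induction n)
    case (Suc n)
    have "{x. (\<Sum>k<Suc n. a k *\<^sub>R v k) x \<noteq> 0} \<subseteq> {x. (\<Sum>k<n. a k *\<^sub>R v k) x \<noteq> 0} \<union> {x. v n x \<noteq> 0}"
      by auto
    then have "card {x. (\<Sum>k<Suc n. a k *\<^sub>R v k) x \<noteq> 0} \<le>
        card ({x. (\<Sum>k<n. a k *\<^sub>R v k) x \<noteq> 0} \<union> {x. v n x \<noteq> 0})"
      using balanced_support(1)[OF comb[of a n]] balanced_support(1)[OF props(2)[of n]]
      by (intro card_mono) auto
    also have "\<dots> \<le> card {x. (\<Sum>k<n. a k *\<^sub>R v k) x \<noteq> 0} + card {x. v n x \<noteq> 0}" by (rule card_Un_le)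
    finally show ?case using Suc props(5)[of n] by linarith
  qed simp
  have C0: "0 \<le> C" using props(3,4)[of 0] c by linarith
  have comb_le: "transport \<alpha> (\<Sum>k<n. a k *\<^sub>R v k) \<le> (\<Sum>k<n. \<bar>a k\<bar> powr r) * C" for a n
  proof -
    have "transport \<alpha> (\<Sum>k<n. a k *\<^sub>R v k) \<le> (\<Sum>k<n. transport \<alpha> (a k *\<^sub>R v k))"
      by (intro transport_sum_le balanced_scale props \<alpha> \<alpha>1) auto
    also have "\<dots> \<le> (\<Sum>k<n. \<bar>a k\<bar> powr r * C)"
      unfolding transport_scale[OF props(2)] r_def by (intro sum_mono mult_left_mono props) auto
    finally show ?thesis by (simp add: sum_distrib_right)
  qed
  have lower: "(c - (\<Sum>k<n. \<eta> k)) * (\<Sum>k<n. \<bar>a k\<bar> powr r) \<le> transport \<alpha> (\<Sum>k<n. a k *\<^sub>R v k)" for n a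
  proof (induction n arbitrary: a)
    case (Suc n)
    define s where "s = (\<Sum>k<Suc n. \<bar>a k\<bar> powr r)"
    show ?case
    proof (cases "s = 0")
      case True
      then show ?thesis using transport_nonneg[OF comb[of a "Suc n"], of \<alpha>]
        unfolding s_def[symmetric] by (simp only: mult_zero_right)
    next
      case False
      then have s: "0 < s" unfolding s_def using sum_nonneg[of "{..<Suc n}" "\<lambda>k. \<bar>a k\<bar> powr r"]
        by (simp add: less_le)
      \<comment> \<open>Both sides are homogeneous of degree \<open>r\<close>, so the coefficients
        are scaled until their \<open>r\<close>-th powers sum to 1. Then the partial combination
        costs at most \<open>C\<close> and the last coefficient has modulus at most 1, as the choice
        of \<open>v n\<close> requires.\<close>
      define h where "h = s powr (- (1 / r))"
      have h: "\<bar>h\<bar> powr r = 1 / s" "0 < h"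
      proof -
        show h0: "0 < h" using s by (simp add: h_def)
        have "\<bar>h\<bar> powr r = s powr (- (1 / r) * r)"
          using h0 by (simp only: h_def powr_powr abs_of_pos)
        also have "- (1 / r) * r = - 1" using r by simp
        finally show "\<bar>h\<bar> powr r = 1 / s" using s by (simp only: powr_neg_one)
      qed
      let ?b = "\<lambda>k. h * a k"
      have b_powr: "\<bar>?b k\<bar> powr r = \<bar>a k\<bar> powr r / s" for k
        using h by (simp add: abs_mult powr_mult)
      have sum_b: "(\<Sum>k<n. \<bar>?b k\<bar> powr r) + \<bar>?b n\<bar> powr r = 1"
        using s unfolding b_powr sum_divide_distrib[symmetric] add_divide_distrib[symmetric]
        by (simp add: s_def)
      have part: "(\<Sum>k<n. \<bar>?b k\<bar> powr r) \<le> 1" "\<bar>?b n\<bar> powr r \<le> 1"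
        using sum_b sum_nonneg[of "{..<n}" "\<lambda>k. \<bar>?b k\<bar> powr r", OF powr_ge_zero]
          powr_ge_zero[of "\<bar>?b n\<bar>" r] by linarith+
      have bn: "\<bar>?b n\<bar> \<le> 1"
      proof (rule ccontr)
        assume "\<not> ?thesis"
        then have "1 powr r < \<bar>?b n\<bar> powr r" using r by (intro powr_less_mono2) auto
        then show False using part(2) by simp
      qed
      let ?u = "\<Sum>k<n. ?b k *\<^sub>R v k"
      have "transport \<alpha> ?u \<le> C" using comb_le[of ?b n] mult_right_mono[OF part(1) C0] by simp
      then have "transport \<alpha> ?u + transport \<alpha> (?b n *\<^sub>R v n) \<le> transport \<alpha> (?u + ?b n *\<^sub>R v n) + \<eta> n"
        by (rule props(6)[OF comb card_comb _ bn])
      moreover have "c * \<bar>?b n\<bar> powr r \<le> transport \<alpha> (?b n *\<^sub>R v n)"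
        using mult_left_mono[OF props(3)[of n], of "\<bar>?b n\<bar> powr r"]
        by (simp add: transport_scale[OF props(2)] r_def mult.commute)
      moreover have "(c - (\<Sum>k<n. \<eta> k)) * (\<Sum>k<n. \<bar>?b k\<bar> powr r) \<le> transport \<alpha> ?u" by (rule Suc.IH)
      moreover have "(c - (\<Sum>k<Suc n. \<eta> k)) * 1 \<le>
          (c - (\<Sum>k<n. \<eta> k)) * (\<Sum>k<n. \<bar>?b k\<bar> powr r) + c * \<bar>?b n\<bar> powr r - \<eta> n"
      proof -
        have "(c - (\<Sum>k<n. \<eta> k)) * 1 = (c - (\<Sum>k<n. \<eta> k)) * (\<Sum>k<n. \<bar>?b k\<bar> powr r)
            + (c - (\<Sum>k<n. \<eta> k)) * \<bar>?b n\<bar> powr r"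
          by (simp only: sum_b[symmetric] distrib_left)
        also have "(c - (\<Sum>k<n. \<eta> k)) * \<bar>?b n\<bar> powr r \<le> c * \<bar>?b n\<bar> powr r"
          using sum_nonneg[of "{..<n}" \<eta>, OF less_imp_le[OF \<eta>]] by (intro mult_right_mono) auto
        finally show ?thesis by simp
      qed
      moreover have "x1 + x2 \<le> x + e \<Longrightarrow> y2 \<le> x2 \<Longrightarrow> y1 \<le> x1 \<Longrightarrow> y * 1 \<le> y1 + y2 - e \<Longrightarrow> y \<le> x"
        for x x1 x2 y y1 y2 e :: real by linarith
      ultimately have "c - (\<Sum>k<Suc n. \<eta> k) \<le> transport \<alpha> (?u + ?b n *\<^sub>R v n)" by blast
      also have "?u + ?b n *\<^sub>R v n = h *\<^sub>R (\<Sum>k<Suc n. a k *\<^sub>R v k)"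
        by (simp only: sum.lessThan_Suc scaleR_sum_right scaleR_add_right scaleR_scaleR)
      also have "transport \<alpha> \<dots> = 1 / s * transport \<alpha> (\<Sum>k<Suc n. a k *\<^sub>R v k)"
        unfolding transport_scale[OF comb] r_def[symmetric] h(1) ..
      finally show ?thesis
        unfolding s_def[symmetric] using s by (simp only: pos_le_divide_eq mult_1 times_divide_eq_left)
    qed
  qed (simp add: transport_nonneg[OF balanced_0])
  have "3 / 4 * c * (\<Sum>k<n. \<bar>a k\<bar> powr (q * \<alpha>)) \<le> transport \<alpha> (\<Sum>k<n. a k *\<^sub>R v k)" for n a
  proof -
    have "3 / 4 * c * (\<Sum>k<n. \<bar>a k\<bar> powr r) \<le> (c - (\<Sum>k<n. \<eta> k)) * (\<Sum>k<n. \<bar>a k\<bar> powr r)"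
      using sum_\<eta>[of n] by (intro mult_right_mono sum_nonneg) auto
    then show ?thesis using lower[of n a] by (simp add: r_def)
  qed
  then show ?thesis using that props(1,2) by blast
qed

end

section \<open>Lipschitz-free spaces\<close>

lemma linear_map_on_comb:
  assumes T: "linear_map_on X T" and X: "subspace X" and x: "\<And>k. k \<in> S \<Longrightarrow> x k \<in> X" and S: "finite S"
  shows "T (\<Sum>k\<in>S. a k *\<^sub>R x k) = (\<Sum>k\<in>S. a k *\<^sub>R T (x k))"
  using S x
proof (induction S rule: finite_induct)
  case empty
  have "T (0 *\<^sub>R 0) = 0 *\<^sub>R T 0" using T subspace_0[OF X] unfolding linear_map_on_def by blast
  then show ?case by simp
next
  case (insert k S)
  have "T (a k *\<^sub>R x k + (\<Sum>k\<in>S. a k *\<^sub>R x k)) = T (a k *\<^sub>R x k) + T (\<Sum>k\<in>S. a k *\<^sub>R x k)"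
    using T insert.prems X unfolding linear_map_on_def
    by (blast intro: subspace_scale subspace_sum)
  also have "T (a k *\<^sub>R x k) = a k *\<^sub>R T (x k)"
    using T insert.prems unfolding linear_map_on_def by blast
  finally show ?case using insert by simp
qed

lemma bounded_operator_powr:
  assumes p: "0 < p" and En: "p_normed p E nE" and Fn: "p_normed p F nF" and T: "bounded_operator E nE F nF T"
  obtains K where "0 \<le> K" "\<And>x. x \<in> E \<Longrightarrow> nF (T x) powr p \<le> K * nE x powr p"
proof -
  obtain K where K: "\<forall>x\<in>E. nF (T x) \<le> K * nE x" and TF: "T \<in> E \<rightarrow> F"
    using T by (auto simp: bounded_operator_def)
  show ?thesis
  proof (rule that[of "\<bar>K\<bar> powr p"])
    fix x assume x: "x \<in> E"
    have n: "0 \<le> nE x" "0 \<le> nF (T x)" using p_normedD(2)[OF En x] p_normedD(2)[OF Fn] TF x by auto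
    have "nF (T x) \<le> \<bar>K\<bar> * nE x" using K x n by (meson abs_ge_self mult_right_mono order_trans)
    then have "nF (T x) powr p \<le> (\<bar>K\<bar> * nE x) powr p" using p n by (intro powr_mono2) auto
    then show "nF (T x) powr p \<le> \<bar>K\<bar> powr p * nE x powr p" using n by (simp add: powr_mult)
  qed simp
qed

locale lipschitz_free =
  fixes p q :: real and M :: "'m set" and d and z :: 'm and F :: "'f::real_vector set"
    and nF :: "'f \<Rightarrow> real" and \<delta> :: "'m \<Rightarrow> 'f"
  assumes p: "0 < p" "p < q" and q_le_1: "q \<le> 1" and d: "s_metric q M d" and z: "z \<in> M"
    and free: "lipschitz_free_space p M d z F nF \<delta>"
begin

section \<open>The closure of M in F as a metric space\<close>

definition PF :: "'f \<Rightarrow> real" where "PF x = nF x powr p"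

text \<open>The completion of \<^term>\<open>M\<close> is the closure of the image of \<^term>\<open>\<delta>\<close> in \<^term>\<open>F\<close>.\<close>

definition pts :: "'f set" where "pts = {y \<in> F. \<forall>e>0. \<exists>x\<in>M. PF (\<delta> x - y) < e}"

text \<open>In terms of the norm this is \<open>nF (x - y) powr q\<close>, so it extends the
  \<open>q\<close>-th power of \<open>d\<close> along \<open>\<delta>\<close>. On all of
  \<open>F\<close> a triangle inequality is given for exponent \<open>p\<close> only; the one for
  \<open>q\<close> reaches \<open>pts\<close> as a limit of that on \<open>M\<close>.\<close>

definition D :: "'f \<Rightarrow> 'f \<Rightarrow> real" where
  "D x y = (if x \<in> F \<and> y \<in> F then PF (x - y) powr (q / p) else 0)"

abbreviation (input) \<alpha> where "\<alpha> \<equiv> p / q"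

lemma p_le_1: "p \<le> 1" and q_pos: "0 < q" and \<alpha>: "0 < \<alpha>" "\<alpha> < 1" "\<alpha> \<le> 1" and q_\<alpha>: "q * \<alpha> = p"
  using p q_le_1 by auto

lemma Fb: "p_banach p F nF" and Fn: "p_normed p F nF" and \<delta>F: "\<delta> \<in> M \<rightarrow> F" and \<delta>z: "\<delta> z = 0"
  and \<delta>d: "x \<in> M \<Longrightarrow> y \<in> M \<Longrightarrow> nF (\<delta> x - \<delta> y) = d x y"
  using free by (auto simp: lipschitz_free_space_def p_banach_def)

sublocale F: p_gauge p F PF
  using p_normed_gauge[OF Fn p(1) p_le_1] by (simp add: PF_def[abs_def])

lemma PF_eq_0: "x \<in> F \<Longrightarrow> PF x = 0 \<Longrightarrow> x = 0"
  using p_normed_powr_eq_0[OF Fn p(1)] by (simp add: PF_def)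

lemma pts_F: "x \<in> pts \<Longrightarrow> x \<in> F"
  by (simp add: pts_def)

lemma \<delta>_pts: "x \<in> M \<Longrightarrow> \<delta> x \<in> pts"
  using \<delta>F by (auto simp: pts_def intro!: bexI[of _ x])

lemma D_eq: "x \<in> F \<Longrightarrow> y \<in> F \<Longrightarrow> D x y = PF (x - y) powr (q / p)"
  by (simp add: D_def)

lemma D_powr: "x \<in> F \<Longrightarrow> y \<in> F \<Longrightarrow> D x y powr \<alpha> = PF (x - y)"
  using p q_pos F.nonneg[of "x - y"] F.V_closed(3)[of x y] by (simp add: D_eq powr_powr)

lemma D_\<delta>: assumes "x \<in> M" "y \<in> M" shows "D (\<delta> x) (\<delta> y) = d x y powr q"
proof -
  have F: "\<delta> x \<in> F" "\<delta> y \<in> F" using \<delta>F assms by auto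
  have "D (\<delta> x) (\<delta> y) = (nF (\<delta> x - \<delta> y) powr p) powr (q / p)" using F by (simp add: D_eq PF_def)
  also have "\<dots> = nF (\<delta> x - \<delta> y) powr q" using p by (simp add: powr_powr)
  finally show ?thesis using \<delta>d[OF assms] by simp
qed

text \<open>Serves to carry the triangle inequality from \<open>M\<close> to its closure.\<close>

lemma D_tendsto:
  assumes "\<And>n. u n \<in> F" "\<And>n. v n \<in> F" "x \<in> F" "y \<in> F"
    and "(\<lambda>n. PF (u n - x)) \<longlonglongrightarrow> 0" "(\<lambda>n. PF (v n - y)) \<longlonglongrightarrow> 0"
  shows "(\<lambda>n. D (u n) (v n)) \<longlonglongrightarrow> D x y"
proof -
  have "(\<lambda>n. PF (u n - v n) - PF (x - y)) \<longlonglongrightarrow> 0"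
  proof (rule Lim_null_comparison)
    show "\<forall>\<^sub>F n in sequentially. norm (PF (u n - v n) - PF (x - y)) \<le> PF (u n - x) + PF (v n - y)"
    proof (intro always_eventually allI)
      fix n
      have "\<bar>PF (u n - v n) - PF (x - y)\<bar> \<le> PF ((u n - v n) - (x - y))"
        using assms by (intro F.abs_diff_le F.V_closed)
      also have "(u n - v n) - (x - y) = (u n - x) - (v n - y)" by simp
      also have "PF ((u n - x) - (v n - y)) \<le> PF (u n - x) + PF (v n - y)"
        using assms by (intro F.diff_le F.V_closed)
      finally show "norm (PF (u n - v n) - PF (x - y)) \<le> PF (u n - x) + PF (v n - y)" by simp
    qed
    show "(\<lambda>n. PF (u n - x) + PF (v n - y)) \<longlonglongrightarrow> 0" using tendsto_add[OF assms(5,6)] by simp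
  qed
  then have "(\<lambda>n. PF (u n - v n)) \<longlonglongrightarrow> PF (x - y)" by (simp add: LIM_zero_iff)
  then have "(\<lambda>n. PF (u n - v n) powr (q / p)) \<longlonglongrightarrow> PF (x - y) powr (q / p)"
    using p q_pos F.nonneg F.V_closed(3) assms by (intro tendsto_powr2) auto
  then show ?thesis using assms by (simp add: D_eq)
qed

lemma pts_sequence:
  assumes "x \<in> pts" obtains X where "\<And>n::nat. X n \<in> M" "(\<lambda>n. PF (\<delta> (X n) - x)) \<longlonglongrightarrow> 0"
proof -
  have "\<exists>a. a \<in> M \<and> PF (\<delta> a - x) < 1 / Suc n" for n
    using assms unfolding pts_def by (auto dest!: spec[of _ "1 / Suc n"])
  then obtain X where X: "\<And>n. X n \<in> M" "\<And>n. PF (\<delta> (X n) - x) < 1 / Suc n" by metis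
  have "(\<lambda>n. PF (\<delta> (X n) - x)) \<longlonglongrightarrow> 0"
  proof (rule Lim_null_comparison)
    have "0 \<le> PF (\<delta> (X n) - x)" for n using X(1) \<delta>F assms pts_F by (intro F.nonneg F.V_closed) auto
    then show "\<forall>\<^sub>F n in sequentially. norm (PF (\<delta> (X n) - x)) \<le> 1 / Suc n"
      using X(2) by (intro always_eventually allI) (simp add: less_imp_le)
    show "(\<lambda>n. 1 / real (Suc n)) \<longlonglongrightarrow> 0" by (rule LIMSEQ_Suc[OF lim_1_over_n])
  qed
  then show ?thesis using that X(1) by blast
qed

sublocale S: flow_space pts D q
proof
  show "0 \<le> D x y" for x y by (simp add: D_def)
  show "D x y = D y x" for x y using F.diff_commute[of x y] by (simp add: D_def)
  show "D x y = 0 \<longleftrightarrow> x = y" if "x \<in> pts" "y \<in> pts" for x y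
    using that PF_eq_0[OF F.V_closed(3)] pts_F by (auto simp: D_eq)
  show "D x w \<le> D x y + D y w" if xyw: "x \<in> pts" "y \<in> pts" "w \<in> pts" for x y w
  proof -
    obtain X where X: "\<And>n::nat. X n \<in> M" "(\<lambda>n. PF (\<delta> (X n) - x)) \<longlonglongrightarrow> 0"
      using pts_sequence[OF xyw(1)] by metis
    obtain Y where Y: "\<And>n::nat. Y n \<in> M" "(\<lambda>n. PF (\<delta> (Y n) - y)) \<longlonglongrightarrow> 0"
      using pts_sequence[OF xyw(2)] by metis
    obtain W where W: "\<And>n::nat. W n \<in> M" "(\<lambda>n. PF (\<delta> (W n) - w)) \<longlonglongrightarrow> 0"
      using pts_sequence[OF xyw(3)] by metis
    have F: "\<delta> (X n) \<in> F" "\<delta> (Y n) \<in> F" "\<delta> (W n) \<in> F" for n using X Y W \<delta>F by auto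
    note lim = D_tendsto[OF F(1) F(3) pts_F[OF xyw(1)] pts_F[OF xyw(3)] X(2) W(2)]
      tendsto_add[OF D_tendsto[OF F(1) F(2) pts_F[OF xyw(1)] pts_F[OF xyw(2)] X(2) Y(2)]
        D_tendsto[OF F(2) F(3) pts_F[OF xyw(2)] pts_F[OF xyw(3)] Y(2) W(2)]]
    have "d (X n) (W n) powr q \<le> d (X n) (Y n) powr q + d (Y n) (W n) powr q" for n
      using Metric_space.triangle[of M "\<lambda>x y. d x y powr q"] d X Y W by (simp add: s_metric_def)
    then have "D (\<delta> (X n)) (\<delta> (W n)) \<le> D (\<delta> (X n)) (\<delta> (Y n)) + D (\<delta> (Y n)) (\<delta> (W n))" for n
      using X Y W by (simp add: D_\<delta>)
    then show ?thesis by (intro LIMSEQ_le[OF lim]) auto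
  qed
qed (use q_pos q_le_1 in auto)

lemma D_less_iff: "x \<in> F \<Longrightarrow> y \<in> F \<Longrightarrow> 0 < e \<Longrightarrow> D x y < e \<longleftrightarrow> PF (x - y) < e powr \<alpha>"
  using D_powr[of x y] S.nonneg[of x y] \<alpha>
  by (metis not_less powr_less_mono2 powr_mono2 less_imp_le)

text \<open>\<open>pts\<close> is closed in the complete space \<open>F\<close>. This is the
  completeness that \<open>escape_point\<close> needs and that \<open>M\<close> itself may
  lack.\<close>

lemma mcomplete_pts: "S.mcomplete"
  unfolding S.mcomplete_def
proof (intro allI impI)
  fix \<sigma> assume \<sigma>: "S.MCauchy \<sigma>"
  then have pts: "\<And>n. \<sigma> n \<in> pts" by (auto simp: S.MCauchy_def)
  then have \<sigma>F: "\<And>n. \<sigma> n \<in> F" using pts_F by blast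
  have cau: "\<exists>N. \<forall>i\<ge>N. \<forall>j\<ge>N. PF (\<sigma> i - \<sigma> j) < e" if e: "e > 0" for e
  proof -
    have "0 < e powr (q / p)" using e by simp
    then obtain N where N: "\<forall>i j. N \<le> i \<longrightarrow> N \<le> j \<longrightarrow> D (\<sigma> i) (\<sigma> j) < e powr (q / p)"
      using \<sigma> unfolding S.MCauchy_def by blast
    have "PF (\<sigma> i - \<sigma> j) < e" if "N \<le> i" "N \<le> j" for i j
      using N that D_less_iff[OF \<sigma>F \<sigma>F, of "e powr (q / p)" i j] e p q_pos by (simp add: powr_powr)
    then show ?thesis by blast
  qed
  have "\<exists>N. \<forall>i\<ge>N. \<forall>j\<ge>N. nF (\<sigma> i - \<sigma> j) < e" if e: "e > 0" for e
  proof -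
    obtain N where N: "\<forall>i\<ge>N. \<forall>j\<ge>N. PF (\<sigma> i - \<sigma> j) < e powr p" using cau[of "e powr p"] e by auto
    have "nF (\<sigma> i - \<sigma> j) < e" if "N \<le> i" "N \<le> j" for i j
      using N that p e unfolding PF_def by (meson not_less powr_mono2 less_imp_le)
    then show ?thesis by blast
  qed
  moreover have sub: "range \<sigma> \<subseteq> F" using \<sigma>F by auto
  moreover have "qnorm_complete F nF" using Fb by (simp add: p_banach_def)
  ultimately obtain x where "limitin (qnorm_topology F nF) \<sigma> x sequentially"
    using qnorm_completeD[of F nF \<sigma>] by metis
  then have x: "x \<in> F" "\<And>e. e > 0 \<Longrightarrow> eventually (\<lambda>k. nF (\<sigma> k - x) < e) sequentially"
    by (auto simp: limitin_qnorm_topology[OF Fn p(1) sub])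
  have lim: "\<exists>N. \<forall>k\<ge>N. PF (\<sigma> k - x) < e" if e: "e > 0" for e
  proof -
    obtain N where N: "\<forall>k\<ge>N. nF (\<sigma> k - x) < e powr (1 / p)"
      using x(2)[of "e powr (1 / p)"] e by (auto simp: eventually_sequentially)
    have "PF (\<sigma> k - x) < e" if "k \<ge> N" for k
    proof -
      have "PF (\<sigma> k - x) < (e powr (1 / p)) powr p"
        unfolding PF_def using N that p p_normedD(2)[OF Fn F.V_closed(3)[OF \<sigma>F x(1)]]
        by (intro powr_less_mono2) auto
      then show ?thesis using p e by (simp add: powr_powr)
    qed
    then show ?thesis by blast
  qed
  have "\<exists>a\<in>M. PF (\<delta> a - x) < e" if e: "e > 0" for e
  proof -
    obtain N where N: "PF (\<sigma> N - x) < e / 2" using lim[of "e / 2"] e by auto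
    obtain a where a: "a \<in> M" "PF (\<delta> a - \<sigma> N) < e / 2"
      using pts[of N] e unfolding pts_def by (auto dest!: spec[of _ "e / 2"])
    have "PF (\<delta> a - x) \<le> PF (\<delta> a - \<sigma> N) + PF (\<sigma> N - x)"
      using a \<delta>F \<sigma>F x by (intro F.diff_triangle) auto
    then show ?thesis using a N by force
  qed
  then have xp: "x \<in> pts" using x by (simp add: pts_def)
  have "\<exists>N. \<forall>n\<ge>N. D (\<sigma> n) x < e" if e: "e > 0" for e
    using lim[of "e powr \<alpha>"] D_less_iff[OF \<sigma>F x(1) e] e by auto
  then have "limitin S.mtopology \<sigma> x sequentially"
    using xp pts by (auto simp: S.limit_metric_sequentially)
  then show "\<exists>x. limitin S.mtopology \<sigma> x sequentially" by blast
qed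

section \<open>Measures as vectors of F, and equality of norm and transport cost\<close>

definition ev :: "('f \<Rightarrow> real) \<Rightarrow> 'f" where "ev m = (\<Sum>v | m v \<noteq> 0. m v *\<^sub>R v)"

lemma ev_eq_sum:
  assumes "finite A" "{v. m v \<noteq> 0} \<subseteq> A" shows "ev m = (\<Sum>v\<in>A. m v *\<^sub>R v)"
  unfolding ev_def by (rule sum.mono_neutral_left) (use assms in auto)

lemma ev_add:
  assumes "m \<in> S.balanced" "m' \<in> S.balanced" shows "ev (m + m') = ev m + ev m'"
proof -
  let ?A = "{v. m v \<noteq> 0} \<union> {v. m' v \<noteq> 0}"
  have A: "finite ?A" using S.balanced_support(1) assms by blast
  show ?thesis
    by (subst (1 2 3) ev_eq_sum[OF A]) (auto simp: scaleR_add_left sum.distrib)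
qed

lemma ev_scale: assumes "m \<in> S.balanced" shows "ev (c *\<^sub>R m) = c *\<^sub>R ev m"
proof -
  have A: "finite {v. m v \<noteq> 0}" using S.balanced_support(1) assms by blast
  show ?thesis by (subst (1 2) ev_eq_sum[OF A]) (auto simp: scaleR_sum_right)
qed

lemma ev_diff:
  assumes "m \<in> S.balanced" "m' \<in> S.balanced" shows "ev (m - m') = ev m - ev m'"
  using ev_add[OF assms(1) S.balanced_scale[OF assms(2), of "-1"]] ev_scale[OF assms(2), of "-1"] by simp

lemma ev_0 [simp]: "ev 0 = 0"
  by (simp add: ev_def)

lemma ev_comb:
  assumes "finite I" "\<And>k. k \<in> I \<Longrightarrow> m k \<in> S.balanced"
  shows "ev (\<Sum>k\<in>I. a k *\<^sub>R m k) = (\<Sum>k\<in>I. a k *\<^sub>R ev (m k))"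
  using assms
proof (induction I rule: finite_induct)
  case (insert k I)
  have "ev (a k *\<^sub>R m k + (\<Sum>k\<in>I. a k *\<^sub>R m k)) = ev (a k *\<^sub>R m k) + ev (\<Sum>k\<in>I. a k *\<^sub>R m k)"
    using insert by (intro ev_add S.balanced_scale S.balanced_sum) auto
  also have "ev (a k *\<^sub>R m k) = a k *\<^sub>R ev (m k)" using insert by (intro ev_scale) blast
  also have "ev (\<Sum>k\<in>I. a k *\<^sub>R m k) = (\<Sum>k\<in>I. a k *\<^sub>R ev (m k))" using insert by blast
  finally show ?case by (simp only: sum.insert[OF insert(1,2)])
qed simp

lemma ev_dirac_diff: "ev (dirac x - dirac y) = x - y"
proof (cases "x = y")
  case False
  have "ev (dirac x - dirac y) = (\<Sum>v\<in>{x, y}. (dirac x - dirac y) v *\<^sub>R v)"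
    by (rule ev_eq_sum) (auto simp: dirac_def split: if_splits)
  then show ?thesis using False by (simp add: dirac_def)
qed simp

lemma ev_F: assumes "m \<in> S.balanced" shows "ev m \<in> F"
  unfolding ev_def using S.balanced_support(2)[OF assms] pts_F
  by (intro F.V_closed) blast

lemma ev_bd: assumes "S.flow b" shows "ev (bd b) = (\<Sum>e | b e \<noteq> 0. b e *\<^sub>R (fst e - snd e))"
proof -
  let ?P = "{e. b e \<noteq> 0}" and ?V = "fst ` {e. b e \<noteq> 0} \<union> snd ` {e. b e \<noteq> 0}"
  have P: "finite ?P" using assms by (rule S.flow_finite)
  have V: "finite ?V" using P by simp
  have "ev (bd b) = (\<Sum>v\<in>?V. bd b v *\<^sub>R v)" by (rule ev_eq_sum[OF V S.bd_support[OF assms]])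
  also have "\<dots> = (\<Sum>v\<in>?V. \<Sum>e\<in>?P. b e *\<^sub>R ((dirac (fst e) v - dirac (snd e) v) *\<^sub>R v))"
    unfolding bd_def by (simp add: scaleR_sum_left)
  also have "\<dots> = (\<Sum>e\<in>?P. \<Sum>v\<in>?V. b e *\<^sub>R ((dirac (fst e) v - dirac (snd e) v) *\<^sub>R v))"
    by (rule sum.swap)
  also have "\<dots> = (\<Sum>e\<in>?P. b e *\<^sub>R (fst e - snd e))"
  proof (rule sum.cong[OF refl])
    fix e assume e: "e \<in> ?P"
    have one: "(\<Sum>v\<in>?V. dirac x v *\<^sub>R v) = x" if "x \<in> ?V" for x
    proof -
      have "(\<Sum>v\<in>?V. dirac x v *\<^sub>R v) = (\<Sum>v\<in>?V. if v = x then v else 0)"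
        by (rule sum.cong) (auto simp: dirac_def)
      then show ?thesis using that V by simp
    qed
    have "(\<Sum>v\<in>?V. b e *\<^sub>R ((dirac (fst e) v - dirac (snd e) v) *\<^sub>R v))
        = b e *\<^sub>R ((\<Sum>v\<in>?V. dirac (fst e) v *\<^sub>R v) - (\<Sum>v\<in>?V. dirac (snd e) v *\<^sub>R v))"
      by (simp add: scaleR_sum_right sum_subtractf[symmetric] scaleR_diff_left scaleR_diff_right)
    then show "(\<Sum>v\<in>?V. b e *\<^sub>R ((dirac (fst e) v - dirac (snd e) v) *\<^sub>R v)) = b e *\<^sub>R (fst e - snd e)"
      using one[of "fst e"] one[of "snd e"] e by simp
  qed
  finally show ?thesis .
qed

text \<open>The \<open>p\<close>-triangle inequality along a flow: the price of an edge for exponent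
  \<open>\<alpha>\<close> is exactly the \<open>p\<close>-th power of the norm of the vector it
  represents.\<close>

lemma PF_ev_le: assumes "m \<in> S.balanced" shows "PF (ev m) \<le> S.transport \<alpha> m"
proof (rule field_le_epsilon)
  fix e :: real assume "e > 0"
  then obtain b where b: "S.flow b" "bd b = m" "S.cost \<alpha> b < S.transport \<alpha> m + e"
    using S.transport_approx[OF assms, of \<alpha> "S.transport \<alpha> m + e"] by auto
  let ?P = "{e. b e \<noteq> 0}"
  have P: "finite ?P" "\<And>e. e \<in> ?P \<Longrightarrow> fst e \<in> F \<and> snd e \<in> F"
    using b(1) pts_F by (auto simp: S.flow_def)
  have "PF (ev m) = PF (\<Sum>e\<in>?P. b e *\<^sub>R (fst e - snd e))" using ev_bd[OF b(1)] b(2) by simp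
  also have "\<dots> \<le> (\<Sum>e\<in>?P. PF (b e *\<^sub>R (fst e - snd e)))"
    using P by (intro F.sum_le F.V_closed) auto
  also have "\<dots> = (\<Sum>e\<in>?P. S.weight b e powr \<alpha>)"
  proof (rule sum.cong[OF refl])
    fix e assume "e \<in> ?P"
    then have e: "fst e \<in> F" "snd e \<in> F" using P by auto
    show "PF (b e *\<^sub>R (fst e - snd e)) = S.weight b e powr \<alpha>"
      unfolding S.weight_powr D_powr[OF e] q_\<alpha> by (rule F.scale[OF F.V_closed(3)[OF e]])
  qed
  finally show "PF (ev m) \<le> S.transport \<alpha> m + e" using b(3) by (simp add: S.cost_def)
qed

text \<open>The universal property is applied to the completion of the balanced measures under
  \<open>transport\<close>. The map sending \<open>x\<close> to
  \<open>dirac (\<delta> x) - dirac 0\<close> is 1-Lipschitz there, and its extension to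
  \<open>F\<close> has norm at most 1 and sends \<open>ev m\<close> to the copy of \<open>m\<close>.
  Atoms must lie in the image of \<open>\<delta>\<close>, where the extension is prescribed.\<close>

lemma PF_ev_ge_aux:
  assumes m: "m \<in> S.balanced" and supp: "{v. m v \<noteq> 0} \<subseteq> \<delta> ` M"
  shows "S.transport \<alpha> m \<le> PF (ev m)"
proof -
  interpret B: p_gauge p S.balanced "S.transport \<alpha>"
  proof
    show "S.transport \<alpha> (c *\<^sub>R m) = \<bar>c\<bar> powr p * S.transport \<alpha> m" if "m \<in> S.balanced" for c m
      using S.transport_scale[OF that, of \<alpha> c] by (simp only: q_\<alpha>)
    show "S.transport \<alpha> (m + m') \<le> S.transport \<alpha> m + S.transport \<alpha> m'"
      if "m \<in> S.balanced" "m' \<in> S.balanced" for m m'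
      by (rule S.transport_add_le[OF that \<alpha>(1,3)])
  qed (use p(1) p_le_1 S.subspace_balanced S.transport_nonneg in auto)
  obtain Y :: "(nat \<Rightarrow> 'f \<Rightarrow> real) set" and nY \<iota> where Y: "p_banach p Y nY" and \<iota>: "linear \<iota>"
    "\<And>m. m \<in> S.balanced \<Longrightarrow> \<iota> m \<in> Y"
    "\<And>m. m \<in> S.balanced \<Longrightarrow> nY (\<iota> m) = S.transport \<alpha> m powr (1 / p)"
    using B.completion by metis
  have Yn: "p_normed p Y nY" using Y by (simp add: p_banach_def)
  have z0: "0 \<in> pts" using \<delta>_pts[OF z] \<delta>z by simp
  define f where "f x = \<iota> (dirac (\<delta> x) - dirac 0)" for x
  have bal: "dirac (\<delta> x) - dirac 0 \<in> S.balanced" if "x \<in> M" for x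
    using S.balanced_dirac_diff[OF \<delta>_pts[OF that] z0] .
  have lip: "lipschitz_bound M d nY f 1"
    unfolding lipschitz_bound_def
  proof (intro conjI ballI)
    fix x y assume xy: "x \<in> M" "y \<in> M"
    have F: "\<delta> x \<in> F" "\<delta> y \<in> F" using \<delta>F xy by auto
    have eq: "f x - f y = \<iota> (dirac (\<delta> x) - dirac (\<delta> y))"
      unfolding f_def linear_diff[OF \<iota>(1), symmetric] by simp
    have "S.transport \<alpha> (dirac (\<delta> x) - dirac (\<delta> y)) \<le> D (\<delta> x) (\<delta> y) powr \<alpha>"
      using S.transport_dirac_le[OF \<delta>_pts[OF xy(1)] \<delta>_pts[OF xy(2)], of \<alpha> 1] by simp
    also have "\<dots> = nF (\<delta> x - \<delta> y) powr p" using D_powr[OF F] by (simp add: PF_def)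
    finally have "S.transport \<alpha> (dirac (\<delta> x) - dirac (\<delta> y)) powr (1 / p) \<le> (nF (\<delta> x - \<delta> y) powr p) powr (1 / p)"
      using p S.transport_nonneg[OF S.balanced_dirac_diff[OF \<delta>_pts[OF xy(1)] \<delta>_pts[OF xy(2)]]]
      by (intro powr_mono2) auto
    also have "\<dots> = nF (\<delta> x - \<delta> y)" using p p_normedD(2)[OF Fn F.V_closed(3)[OF F]] by (simp add: powr_powr)
    finally show "nY (f x - f y) \<le> 1 * d x y"
      unfolding eq \<iota>(3)[OF S.balanced_dirac_diff[OF \<delta>_pts[OF xy(1)] \<delta>_pts[OF xy(2)]]] \<delta>d[OF xy] by simp
  qed simp
  have "pointed_lipschitz M d z Y nY f"
    unfolding pointed_lipschitz_def using lip \<iota>(2) bal linear_0[OF \<iota>(1)] by (auto simp: f_def \<delta>z)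
  then obtain T where T: "bounded_operator F nF Y nY T" "\<And>x. x \<in> M \<Longrightarrow> T (\<delta> x) = f x"
    "operator_norm F nF nY T = lipschitz_const M d nY f"
    using lipschitz_free_space_universal[OF free p(1) Y] unfolding lipschitz_extension_property_def by metis
  have "lipschitz_const M d nY f \<le> 1"
    unfolding lipschitz_const_def using lip
    by (intro cInf_lower) (auto intro!: bdd_belowI[of _ 0] simp: lipschitz_bound_def)
  then have norm1: "operator_norm F nF nY T \<le> 1" using T(3) by simp
  \<comment> \<open>\<open>operator_norm\<close> is a supremum over the unit ball: it yields an
    estimate only once the set is known to be bounded above, and for \<open>v\<close> only after
    rescaling.\<close>
  have T_le: "nY (T v) \<le> nF v" if v: "v \<in> F" for v
  proof (cases "v = 0")
    case True
    obtain C where "nY (T v) \<le> C * nF v" using T(1) v unfolding bounded_operator_def by blast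
    moreover have "nF v = 0" using True p_normedD(3)[OF Fn v] by simp
    ultimately show ?thesis by simp
  next
    case False
    then have n: "0 < nF v" using p_normedD(2,3)[OF Fn v] by (simp add: less_le)
    obtain C where C: "\<forall>x\<in>F. nY (T x) \<le> C * nF x" and lin: "linear_map_on F T" and TY: "T \<in> F \<rightarrow> Y"
      using T(1) unfolding bounded_operator_def by blast
    let ?u = "(1 / nF v) *\<^sub>R v"
    have u: "?u \<in> F" "nF ?u \<le> 1" using F.V_closed(4)[OF v] p_normedD(4)[OF Fn v, of "1 / nF v"] n by auto
    have "bdd_above ((\<lambda>x. nY (T x)) ` {x \<in> F. nF x \<le> 1})"
    proof (rule bdd_aboveI2)
      fix x assume x: "x \<in> {x \<in> F. nF x \<le> 1}"
      then have "nY (T x) \<le> C * nF x" using C by blast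
      also have "\<dots> \<le> \<bar>C\<bar> * 1" using x p_normedD(2)[OF Fn] by (intro mult_mono) auto
      finally show "nY (T x) \<le> \<bar>C\<bar>" by simp
    qed
    then have "nY (T ?u) \<le> operator_norm F nF nY T"
      unfolding operator_norm_def using u by (intro cSUP_upper) auto
    then have "nY (T ?u) \<le> 1" using norm1 by simp
    moreover have "T ?u = (1 / nF v) *\<^sub>R T v" using lin v unfolding linear_map_on_def by blast
    moreover have "nY ((1 / nF v) *\<^sub>R T v) = 1 / nF v * nY (T v)"
      using p_normedD(4)[OF Yn funcset_mem[OF TY v], of "1 / nF v"] n by simp
    ultimately show ?thesis using n by (simp add: divide_le_eq)
  qed
  let ?A = "{v. m v \<noteq> 0}"
  have A: "finite ?A" using S.balanced_support(1)[OF m] .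
  have AF: "v \<in> F" if "v \<in> ?A" for v using S.balanced_support(2)[OF m] pts_F that by blast
  have "T (ev m) = (\<Sum>v\<in>?A. m v *\<^sub>R T v)"
    unfolding ev_def using T(1) A AF
    by (intro linear_map_on_comb[OF _ F.V]) (auto simp: bounded_operator_def)
  also have "\<dots> = (\<Sum>v\<in>?A. m v *\<^sub>R \<iota> (dirac v - dirac 0))"
  proof (rule sum.cong[OF refl])
    fix v assume "v \<in> ?A"
    then obtain x where "x \<in> M" "v = \<delta> x" using supp by blast
    then show "m v *\<^sub>R T v = m v *\<^sub>R \<iota> (dirac v - dirac 0)" using T(2) by (simp add: f_def)
  qed
  also have "\<dots> = \<iota> (\<Sum>v\<in>?A. m v *\<^sub>R (dirac v - dirac 0))"
    by (simp only: linear_sum[OF \<iota>(1)] linear_scale[OF \<iota>(1)])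
  also have "(\<Sum>v\<in>?A. m v *\<^sub>R (dirac v - dirac 0)) = m"
    using S.balanced_expand[OF m A order_refl] by simp
  finally have "T (ev m) = \<iota> m" .
  then have "S.transport \<alpha> m powr (1 / p) \<le> nF (ev m)" using T_le[OF ev_F[OF m]] \<iota>(3)[OF m] by simp
  then have "(S.transport \<alpha> m powr (1 / p)) powr p \<le> PF (ev m)"
    unfolding PF_def using p by (intro powr_mono2) auto
  then show ?thesis using p S.transport_nonneg[OF m] by (simp add: powr_powr)
qed

text \<open>Both sides change little when atoms are moved slightly, so the atoms in
  \<open>pts\<close> are moved into the image of \<open>\<delta>\<close>, where
  \<open>PF_ev_ge_aux\<close> applies.\<close>

lemma PF_ev: assumes m: "m \<in> S.balanced" shows "PF (ev m) = S.transport \<alpha> m"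
proof (rule antisym[OF PF_ev_le[OF m]], rule field_le_epsilon)
  fix e :: real assume e: "e > 0"
  let ?A = "{v. m v \<noteq> 0}"
  have A: "finite ?A" "?A \<subseteq> pts" using S.balanced_support[OF m] .
  have z0: "0 \<in> pts" using \<delta>_pts[OF z] \<delta>z by simp
  define Q where "Q = (\<Sum>v\<in>?A. \<bar>m v\<bar> powr p)"
  have Q: "0 \<le> Q" by (simp add: Q_def sum_nonneg)
  \<comment> \<open>Moving every atom by less than \<open>h\<close> costs at most
    \<open>Q * h \<le> e / 2\<close>. This error enters twice, once for \<open>transport\<close> and
    once for \<open>PF\<close>.\<close>
  define h where "h = e / 2 / (Q + 1)"
  have h: "0 < h" using e Q by (simp add: h_def)
  have "\<forall>v\<in>?A. \<exists>x\<in>M. PF (\<delta> x - v) < h" using A(2) h by (auto simp: pts_def)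
  then obtain g where g: "\<And>v. v \<in> ?A \<Longrightarrow> g v \<in> M" "\<And>v. v \<in> ?A \<Longrightarrow> PF (\<delta> (g v) - v) < h" by metis
  \<comment> \<open>The base point is the hub: it keeps the moved measure balanced, and
    \<open>0 = \<delta> z\<close> keeps its support in the image of \<open>\<delta>\<close>.\<close>
  let ?m = "\<Sum>v\<in>?A. m v *\<^sub>R (dirac (\<delta> (g v)) - dirac 0)"
  have gp: "\<delta> (g v) \<in> pts" "v \<in> pts" if "v \<in> ?A" for v using g(1)[OF that] \<delta>_pts A(2) that by auto
  have mb: "?m \<in> S.balanced"
    using gp z0 by (intro S.balanced_sum S.balanced_scale S.balanced_dirac_diff) auto
  have supp: "{x. ?m x \<noteq> 0} \<subseteq> \<delta> ` M"
  proof
    fix x assume "x \<in> {x. ?m x \<noteq> 0}"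
    then have "(\<Sum>v\<in>?A. m v * (dirac (\<delta> (g v)) x - dirac 0 x)) \<noteq> 0" by (simp add: sum_fun_apply)
    then obtain v where "v \<in> ?A" "dirac (\<delta> (g v)) x - dirac 0 x \<noteq> 0"
      by (metis (no_types, lifting) mult_zero_right sum.neutral)
    then have "x = \<delta> (g v) \<or> x = \<delta> z" using \<delta>z by (auto simp: dirac_def split: if_splits)
    then show "x \<in> \<delta> ` M" using g(1)[OF \<open>v \<in> ?A\<close>] z by blast
  qed
  have "m - ?m = (\<Sum>v\<in>?A. m v *\<^sub>R (dirac v - dirac 0)) - ?m"
    using S.balanced_expand[OF m A(1) order_refl, of 0] by (rule arg_cong)
  also have "\<dots> = (\<Sum>v\<in>?A. m v *\<^sub>R (dirac v - dirac (\<delta> (g v))))"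
    by (simp add: sum_subtractf[symmetric] scaleR_diff_right[symmetric])
  finally have diff: "m - ?m = (\<Sum>v\<in>?A. m v *\<^sub>R (dirac v - dirac (\<delta> (g v))))" .
  have "S.transport \<alpha> (m - ?m) \<le> (\<Sum>v\<in>?A. S.transport \<alpha> (m v *\<^sub>R (dirac v - dirac (\<delta> (g v)))))"
    unfolding diff using gp \<alpha> A(1)
    by (intro S.transport_sum_le S.balanced_scale S.balanced_dirac_diff) auto
  also have "\<dots> \<le> (\<Sum>v\<in>?A. \<bar>m v\<bar> powr p * h)"
  proof (rule sum_mono)
    fix v assume v: "v \<in> ?A"
    have F: "v \<in> F" "\<delta> (g v) \<in> F" using gp[OF v] pts_F by auto
    have "S.transport \<alpha> (m v *\<^sub>R (dirac v - dirac (\<delta> (g v)))) \<le> \<bar>m v\<bar> powr p * PF (v - \<delta> (g v))"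
      using S.transport_dirac_le[OF gp(2)[OF v] gp(1)[OF v], of \<alpha> "m v"] D_powr[OF F] by (simp only: q_\<alpha>)
    also have "\<dots> \<le> \<bar>m v\<bar> powr p * h"
      using g(2)[OF v] F.diff_commute[OF F] by (intro mult_left_mono) auto
    finally show "S.transport \<alpha> (m v *\<^sub>R (dirac v - dirac (\<delta> (g v)))) \<le> \<bar>m v\<bar> powr p * h" .
  qed
  also have "\<dots> = e / 2 * (Q / (Q + 1))"
    unfolding sum_distrib_right[symmetric] Q_def[symmetric] by (simp add: h_def)
  also have "\<dots> \<le> e / 2 * 1" using e Q by (intro mult_left_mono) auto
  finally have small: "S.transport \<alpha> (m - ?m) \<le> e / 2" by simp
  have "S.transport \<alpha> m \<le> S.transport \<alpha> (m - ?m) + S.transport \<alpha> ?m"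
    using S.transport_add_le[OF S.balanced_diff[OF m mb] mb \<alpha>(1,3)] by simp
  moreover have "S.transport \<alpha> ?m \<le> PF (ev ?m)" by (rule PF_ev_ge_aux[OF mb supp])
  moreover have "PF (ev ?m) \<le> PF (ev m) + PF (ev (m - ?m))"
    using F.diff_le[OF ev_F[OF m] ev_F[OF S.balanced_diff[OF m mb]]] ev_diff[OF m mb] by simp
  moreover have "PF (ev (m - ?m)) \<le> S.transport \<alpha> (m - ?m)" by (rule PF_ev_le[OF S.balanced_diff[OF m mb]])
  ultimately show "S.transport \<alpha> m \<le> PF (ev m) + e" using small by linarith
qed

lemma ev_dense:
  assumes x: "x \<in> F" and e: "0 < e"
  obtains m where "m \<in> S.balanced" "PF (x - ev m) < e"
proof -
  have dense: "qnorm_topology F nF closure_of (span (\<delta> ` M)) = F"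
    using free by (simp add: lipschitz_free_space_def)
  obtain y where y: "y \<in> span (\<delta> ` M)" "y \<in> F" "nF (y - x) < e powr (1 / p)"
    using closure_of_qnorm_topologyD[OF Fn p(1), of x "span (\<delta> ` M)" "e powr (1 / p)"] dense x e by auto
  have "subspace (ev ` S.balanced)"
  proof (rule subspaceI)
    show "0 \<in> ev ` S.balanced" using S.balanced_0 ev_0 by (metis imageI)
    fix a b c assume "a \<in> ev ` S.balanced"
    then obtain m where m: "m \<in> S.balanced" "a = ev m" by blast
    then have "c *\<^sub>R a = ev (c *\<^sub>R m)" by (simp only: ev_scale)
    then show "c *\<^sub>R a \<in> ev ` S.balanced" using S.balanced_scale[OF m(1), of c] by blast
    assume "b \<in> ev ` S.balanced"
    then obtain m' where m': "m' \<in> S.balanced" "b = ev m'" by blast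
    then have "a + b = ev (m + m')" using m by (simp only: ev_add)
    then show "a + b \<in> ev ` S.balanced" using S.balanced_add[OF m(1) m'(1)] by blast
  qed
  moreover have "\<delta> ` M \<subseteq> ev ` S.balanced"
  proof
    fix y assume "y \<in> \<delta> ` M"
    then obtain a where a: "a \<in> M" "y = \<delta> a" by blast
    have "dirac y - dirac (\<delta> z) \<in> S.balanced" using \<delta>_pts a z by (simp add: S.balanced_dirac_diff)
    moreover have "ev (dirac y - dirac (\<delta> z)) = y" by (simp add: ev_dirac_diff \<delta>z)
    ultimately show "y \<in> ev ` S.balanced" by (metis imageI)
  qed
  ultimately have "span (\<delta> ` M) \<subseteq> ev ` S.balanced" by (simp add: span_minimal)
  then obtain m where m: "m \<in> S.balanced" "y = ev m" using y(1) by blast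
  have "PF (y - x) < (e powr (1 / p)) powr p"
    unfolding PF_def using y x p p_normedD(2)[OF Fn F.V_closed(3)[OF y(2) x]] by (intro powr_less_mono2) auto
  then have "PF (x - ev m) < e" using F.diff_commute[OF x y(2)] m(2) p e by (simp add: powr_powr)
  then show ?thesis using that m(1) by blast
qed

text \<open>The separated images are approximated by finitely supported measures. The combinations
  that \<open>diffuse_combination\<close> finds for these are formed with the original vectors of
  \<open>E\<close> as well. Errors stay proportional to \<open>c\<close>, because a perturbation is
  multiplied by the same sum of \<open>p\<close>-th powers of coefficients as the lower
  bound.\<close>

lemma not_compact_imp_fixes_copy:
  fixes E :: "'e::real_vector set"
  assumes Eb: "p_banach p E nE" and T: "bounded_operator E nE F nF T"
    and nc: "\<not> compact_operator E nE F nF T"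
  shows "fixes_copy_of_lp p E nE nF T"
proof -
  have En: "p_normed p E nE" using Eb by (simp add: p_banach_def)
  interpret E: p_gauge p E "\<lambda>x. nE x powr p" by (rule p_normed_gauge[OF En p(1) p_le_1])
  have TF: "T \<in> E \<rightarrow> F" and lin: "linear_map_on E T" using T by (auto simp: bounded_operator_def)
  obtain K where K: "0 \<le> K" "\<And>x. x \<in> E \<Longrightarrow> PF (T x) \<le> K * nE x powr p"
    using bounded_operator_powr[OF p(1) En Fn T] unfolding PF_def by metis
  obtain \<epsilon> and e :: "nat \<Rightarrow> 'e" where \<epsilon>: "0 < \<epsilon>" and e: "\<And>k. e k \<in> E" "\<And>k. nE (e k) \<le> 1"
    and sep: "\<And>k l. k \<noteq> l \<Longrightarrow> \<epsilon> \<le> PF (T (e k) - T (e l))"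
    using nc unfolding compact_operator_iff_no_separated_sequence[OF p(1) p_le_1 Fb TF] PF_def by blast
  have Te: "T (e k) \<in> F" for k using e TF by auto
  have e_powr: "nE (e k) powr p \<le> 1" for k
    using e p_normedD(2)[OF En e(1)] p by (intro powr_le1) auto
  have PTe: "PF (T (e k)) \<le> K" for k
    using K(2)[OF e(1), of k] mult_left_mono[OF e_powr K(1), of k] by linarith
  \<comment> \<open>Coefficients whose \<open>p\<close>-th powers sum to at most 2 produce an error
    of at most \<open>2 * err\<close>, and \<open>c \<ge> \<epsilon> / 20000\<close> makes this at
    most \<open>c / 4\<close>.\<close>
  define err where "err = \<epsilon> / 160000"
  have err: "0 < err" using \<epsilon> by (simp add: err_def)
  have "\<exists>m. m \<in> S.balanced \<and> PF (T (e k) - ev m) < err" for k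
    using ev_dense[OF Te err] by metis
  then obtain m where m: "\<And>k. m k \<in> S.balanced" "\<And>k. PF (T (e k) - ev (m k)) < err" by metis
  have evF: "ev (m k) \<in> F" for k using ev_F[OF m(1)] .
  have sep_m: "\<epsilon> / 2 \<le> S.transport \<alpha> (m k - m l)" if "k \<noteq> l" for k l
  proof -
    have "PF (T (e k) - T (e l)) \<le> PF (T (e k) - ev (m k)) + PF (ev (m k) - T (e l))"
      by (intro F.diff_triangle Te evF)
    moreover have "PF (ev (m k) - T (e l)) \<le> PF (ev (m k) - ev (m l)) + PF (ev (m l) - T (e l))"
      by (intro F.diff_triangle Te evF)
    moreover have "PF (ev (m l) - T (e l)) = PF (T (e l) - ev (m l))" by (intro F.diff_commute Te evF)
    moreover have "PF (ev (m k) - ev (m l)) = S.transport \<alpha> (m k - m l)"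
      using PF_ev[OF S.balanced_diff[OF m(1) m(1)]] ev_diff[OF m(1) m(1)] by simp
    ultimately show ?thesis using sep[OF that] m(2)[of k] m(2)[of l] \<epsilon> unfolding err_def by linarith
  qed
  have bound_m: "S.transport \<alpha> (m k) \<le> K + err" for k
  proof -
    have "PF (T (e k) - (T (e k) - ev (m k))) \<le> PF (T (e k)) + PF (T (e k) - ev (m k))"
      by (intro F.diff_le F.V_closed Te evF)
    then show ?thesis using PTe[of k] m(2)[of k] PF_ev[OF m(1), of k] by simp
  qed
  have \<epsilon>2: "0 < \<epsilon> / 2" using \<epsilon> by simp
  obtain c where c: "\<epsilon> / 2 / 10000 \<le> c"
    and diffuse: "\<And>\<kappa>. 0 < \<kappa> \<Longrightarrow> \<exists>S lam v. finite S \<and> (\<Sum>k\<in>S. \<bar>lam k\<bar> powr (q * \<alpha>)) \<le> 2 \<and> v \<in> S.balanced \<and>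
      S.transport \<alpha> ((\<Sum>k\<in>S. lam k *\<^sub>R m k) - v) \<le> c / 4 \<and> c \<le> S.transport \<alpha> v \<and> S.transport 1 v \<le> \<kappa>"
    using S.diffuse_combination[where m = m, OF \<alpha>(1,2) mcomplete_pts \<delta>_pts[OF z] m(1) bound_m \<epsilon>2 sep_m] by blast
  have c0: "0 < c" and err_c: "2 * err \<le> c / 4" using c \<epsilon> by (auto simp: err_def)
  \<comment> \<open>The cost bound \<open>2 * K + c / 2\<close> does not depend on
    \<open>\<kappa>\<close>, as \<open>almost_disjoint_sequence\<close> requires. The distance
    \<open>c / 2\<close> is made up of \<open>c / 4\<close> from the approximation by measures and
    \<open>c / 4\<close> from \<open>diffuse_combination\<close>.\<close>
  have good: "\<exists>w v. (w \<in> E \<and> nE w powr p \<le> 2 \<and> PF (T w - ev v) \<le> c / 2) \<and> v \<in> S.balanced \<and>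
    c \<le> S.transport \<alpha> v \<and> S.transport \<alpha> v \<le> 2 * K + c / 2 \<and> S.transport 1 v \<le> \<kappa>" if \<kappa>: "0 < \<kappa>" for \<kappa>
  proof -
    obtain I lam v where I: "finite I" and lam: "(\<Sum>k\<in>I. \<bar>lam k\<bar> powr p) \<le> 2" and v: "v \<in> S.balanced"
      "S.transport \<alpha> ((\<Sum>k\<in>I. lam k *\<^sub>R m k) - v) \<le> c / 4" "c \<le> S.transport \<alpha> v" "S.transport 1 v \<le> \<kappa>"
      using diffuse[OF \<kappa>] unfolding q_\<alpha> by blast
    let ?w = "\<Sum>k\<in>I. lam k *\<^sub>R e k" and ?m = "\<Sum>k\<in>I. lam k *\<^sub>R m k"
    have w: "?w \<in> E" by (intro E.V_closed e)
    have mb: "?m \<in> S.balanced" by (intro S.balanced_sum S.balanced_scale m)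
    have "nE ?w powr p \<le> (\<Sum>k\<in>I. nE (lam k *\<^sub>R e k) powr p)" by (intro E.sum_le I E.V_closed e)
    also have "\<dots> \<le> (\<Sum>k\<in>I. \<bar>lam k\<bar> powr p * 1)"
      unfolding E.scale[OF e(1)] by (intro sum_mono mult_left_mono e_powr) auto
    finally have w2: "nE ?w powr p \<le> 2" using lam by simp
    have "T ?w - ev ?m = (\<Sum>k\<in>I. lam k *\<^sub>R (T (e k) - ev (m k)))"
      using linear_map_on_comb[OF lin E.V e(1) I] ev_comb[OF I m(1)]
      by (simp add: scaleR_diff_right sum_subtractf)
    then have "PF (T ?w - ev ?m) \<le> (\<Sum>k\<in>I. PF (lam k *\<^sub>R (T (e k) - ev (m k))))"
      using F.sum_le[OF I, of "\<lambda>k. lam k *\<^sub>R (T (e k) - ev (m k))"] F.V_closed(3,4) Te evF by simp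
    also have "\<dots> \<le> (\<Sum>k\<in>I. \<bar>lam k\<bar> powr p * err)"
      unfolding F.scale[OF F.V_closed(3)[OF Te evF]] using m(2)
      by (intro sum_mono mult_left_mono) (auto intro: less_imp_le)
    also have "\<dots> \<le> 2 * err" unfolding sum_distrib_right[symmetric]
      using lam err by (intro mult_right_mono) auto
    finally have 1: "PF (T ?w - ev ?m) \<le> c / 4" using err_c by linarith
    have TwF: "T ?w \<in> F" using TF w by blast
    have 2: "PF (ev ?m - ev v) \<le> c / 4"
      using v(2) PF_ev[OF S.balanced_diff[OF mb v(1)]] ev_diff[OF mb v(1)] by simp
    have 3: "PF (T ?w - ev v) \<le> c / 2"
      using F.diff_triangle[OF TwF ev_F[OF mb] ev_F[OF v(1)]] 1 2 by linarith
    have "PF (T ?w - (T ?w - ev v)) \<le> PF (T ?w) + PF (T ?w - ev v)"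
      by (intro F.diff_le F.V_closed TwF ev_F v)
    moreover have "PF (T ?w) \<le> 2 * K"
      using K(2)[OF w] mult_left_mono[OF w2 K(1)] by linarith
    ultimately have "S.transport \<alpha> v \<le> 2 * K + c / 2" using 3 PF_ev[OF v(1)] by simp
    then show ?thesis using w w2 3 v by blast
  qed
  obtain w :: "nat \<Rightarrow> 'e" and v where
    w: "\<And>k. w k \<in> E \<and> nE (w k) powr p \<le> 2 \<and> PF (T (w k) - ev (v k)) \<le> c / 2" and v: "\<And>k. v k \<in> S.balanced"
    and low: "\<And>n a. 3 / 4 * c * (\<Sum>k<n. \<bar>a k\<bar> powr (q * \<alpha>)) \<le> S.transport \<alpha> (\<Sum>k<n. a k *\<^sub>R v k)"
    by (rule S.almost_disjoint_sequence[where R = "\<lambda>w v. w \<in> E \<and> nE w powr p \<le> 2 \<and>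
          PF (T w - ev v) \<le> c / 2", OF \<alpha>(1,2) c0 good]) blast+
  \<comment> \<open>The constant \<open>c / 4\<close> is \<open>3 / 4 * c\<close> for the measures
    less \<open>c / 2\<close> for passing from \<open>ev (v k)\<close> to
    \<open>T (w k)\<close>.\<close>
  show ?thesis
  proof (rule fixes_copy_of_lpI[OF p(1) p_le_1 Eb Fn T, of w 2 "c / 4"])
    show "w k \<in> E" "nE (w k) powr p \<le> 2" for k using w by auto
    show "0 < c / 4" using c0 by simp
    fix n and a :: "nat \<Rightarrow> real"
    let ?w = "\<Sum>k<n. a k *\<^sub>R w k" and ?v = "\<Sum>k<n. a k *\<^sub>R v k"
    have wE: "?w \<in> E" using w by (intro E.V_closed) auto
    have TwF: "T ?w \<in> F" "T (w k) \<in> F" for k using TF wE w by auto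
    have vb: "?v \<in> S.balanced" by (intro S.balanced_sum S.balanced_scale v)
    have "T ?w - ev ?v = (\<Sum>k<n. a k *\<^sub>R (T (w k) - ev (v k)))"
      using linear_map_on_comb[OF lin E.V, of "{..<n}" w a] ev_comb[of "{..<n}" v a] w v
      by (simp add: scaleR_diff_right sum_subtractf)
    then have "PF (T ?w - ev ?v) \<le> (\<Sum>k<n. PF (a k *\<^sub>R (T (w k) - ev (v k))))"
      using F.sum_le[of "{..<n}" "\<lambda>k. a k *\<^sub>R (T (w k) - ev (v k))"] F.V_closed(3,4) TwF(2) ev_F[OF v] by simp
    also have "\<dots> \<le> (\<Sum>k<n. \<bar>a k\<bar> powr p * (c / 2))"
      unfolding F.scale[OF F.V_closed(3)[OF TwF(2) ev_F[OF v]]] using w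
      by (intro sum_mono mult_left_mono) auto
    finally have d: "PF (T ?w - ev ?v) \<le> (\<Sum>k<n. \<bar>a k\<bar> powr p) * (c / 2)" by (simp only: sum_distrib_right)
    have "PF (T ?w - (T ?w - ev ?v)) \<le> PF (T ?w) + PF (T ?w - ev ?v)"
      by (intro F.diff_le F.V_closed TwF ev_F vb)
    then have "PF (ev ?v) \<le> PF (T ?w) + PF (T ?w - ev ?v)" by simp
    moreover have "3 / 4 * c * (\<Sum>k<n. \<bar>a k\<bar> powr p) \<le> PF (ev ?v)"
      using low[of a n] PF_ev[OF vb] by (simp only: q_\<alpha>)
    ultimately have "3 / 4 * c * (\<Sum>k<n. \<bar>a k\<bar> powr p) - (\<Sum>k<n. \<bar>a k\<bar> powr p) * (c / 2) \<le> PF (T ?w)"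
      using d by linarith
    then show "c / 4 * (\<Sum>k<n. \<bar>a k\<bar> powr p) \<le> nF (T ?w) powr p"
      unfolding PF_def by (simp add: algebra_simps)
  qed
qed

end

theorem proposition7p6:
  fixes p q0 :: real
    and E :: "'e::real_vector set" and nE :: "'e \<Rightarrow> real"
    and M :: "'m set" and d :: "'m \<Rightarrow> 'm \<Rightarrow> real" and z :: 'm
    and F :: "'f::real_vector set" and nF :: "'f \<Rightarrow> real" and \<delta> :: "'m \<Rightarrow> 'f"
    and T :: "'e \<Rightarrow> 'f"
  assumes "0 < p" and "p < q0" and "q0 \<le> 1"
    and "p_banach p E nE"
    and "s_metric q0 M d" and "z \<in> M"
    and "lipschitz_free_space p M d z F nF \<delta>"
    and "bounded_operator E nE F nF T"
  shows "(compact_operator E nE F nF T \<and> \<not> fixes_copy_of_lp p E nE nF T) \<or>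
         (\<not> compact_operator E nE F nF T \<and> fixes_copy_of_lp p E nE nF T)"
proof -
  interpret lipschitz_free p q0 M d z F nF \<delta>
    using assms by unfold_locales
  have "p_normed p E nE" using assms(4) by (simp add: p_banach_def)
  then show ?thesis
    using not_compact_imp_fixes_copy[OF assms(4,8)]
      fixes_copy_of_lp_imp_not_compact[OF p(1) p_le_1 _ Fb assms(8)] by blast
qed

end
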